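(* Let $W\subset\mathrm{GL}(V)$ be a complex reflection group with braid group $B$ and canonical morphism $p:B\to W$, and let $C$ be a subgroup of $W$ generated by reflections. Then $p^{-1}(C)^{\mathrm{ab}}$ is the free abelian group over $\mathscr{H}/C$, the set of $C$-classes of hyperplanes of $W$. More precisely, $p^{-1}(C)=\langle s_{H,\gamma}^{a_H},\ (H,\gamma)\rangle$, where $(H,\gamma)$ runs over all $H\in\mathscr{H}$ and all generators of the monodromy $s_{H,\gamma}$ around $H$. For $\mathcal{C}\in\mathscr{H}/C$, the elements $s_{H,\gamma}^{a_H}$ with $H\in\mathcal{C}$ have a common value in $p^{-1}(C)^{\mathrm{ab}}$, denoted $(s_{\mathcal{C}}^{a_{\mathcal{C}}})^{\mathrm{ab}}$, and $$p^{-1}(C)^{\mathrm{ab}}=\langle (s_{\mathcal{C}}^{a_{\mathcal{C}}})^{\mathrm{ab}},\ \mathcal{C}\in\mathscr{H}/C\rangle .$$ Moreover, for each $\mathcal{C}\in\mathscr{H}/C$ there exists a group homomorphism $\varphi_{\mathcal{C}}:p^{-1}(C)\to\mathbb{Z}$ such that (for the induced map on $p^{-1}(C)^{\mathrm{ab}}$) $\varphi_{\mathcal{C}}((s_{\mathcal{C}}^{a_{\mathcal{C}}})^{\mathrm{ab}})=1$ and $\varphi_{\mathcal{C}}((s_{\mathcal{C}'}^{a_{\mathcal{C}'}})^{\mathrm{ab}})=0$ for every $\mathcal{C}'\in\mathscr{H}/C$ with $\mathcal{C}'\neq\mathcal{C}$.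
   Context: $V$ is a finite-dimensional complex vector space. A reflection is a nontrivial finite-order element of $\mathrm{GL}(V)$ fixing a hyperplane pointwise; a (complex) reflection group $W\subset\mathrm{GL}(V)$ is a finite group generated by reflections; $\mathscr{H}$ is the set of hyperplanes of the reflections of $W$. $V^{\mathrm{reg}}=V\setminus\bigcup_{H\in\mathscr{H}}H$, on which $W$ acts freely. Fix $x_0\in V^{\mathrm{reg}}$; $P=\pi_1(V^{\mathrm{reg}},x_0)$ and $B=\pi_1(V^{\mathrm{reg}}/W,\overline{x_0})$, with exact sequence $1\to P\to B\stackrel{p}{\to}W\to1$ (a loop lifted to a path starting at $x_0$ ends at $p(b)x_0$; in a product of paths the first factor is travelled first). $G^{\mathrm{ab}}=G/[G,G]$. Fix a $W$-invariant hermitian product on $V$. For $H\in\mathscr{H}$, $W_H$ is the pointwise fixator of $H$ in $W$, cyclic of order $e_H$, and $s_H$ is its generator of determinant $\exp(2i\pi/e_H)$. Integers $a_H$: if $H$ is the hyperplane of some reflection of $C$, then $a_H$ is the divisor of $e_H$ such that $\{c\in C:\forall x\in H,\ cx=x\}=\langle s_H^{a_H}\rangle$; otherwise $a_H=e_H$. It is constant on $C$-orbits; its value on $\mathcal{C}\in\mathscr{H}/C$ is $a_{\mathcal{C}}$. Generator of the monodromy around $H$: $s_{H,\gamma}\in B$ is the class of the image of the path in $V^{\mathrm{reg}}$ from $x_0$ to $s_H(x_0)$ composed of: a path $\gamma$ in $V^{\mathrm{reg}}$ from $x_0$ to a point $x_H=h+d$ near $H$ and far from the other hyperplanes ($h\in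 H$ on no other hyperplane of $\mathscr{H}$, $d\in H^\perp\setminus\{0\}$ small enough that $h+zd$ lies on no other hyperplane for $|z|\le1$); then $t\in[0,1]\mapsto h+\exp(2i\pi t/e_H)d$, from $x_H$ to $s_H(x_H)$; then $s_H(\gamma^{-1})$, from $s_H(x_H)$ to $s_H(x_0)$. *)

theory Defs
  imports "HOL-Analysis.Analysis" "HOL-Algebra.Free_Abelian_Groups"
    "HOL-Algebra.Generated_Groups" "HOL-Algebra.Group_Action"
begin

text \<open>
  All norms on a finite-dimensional complex vector space are equivalent, so the norm below only
  serves to provide its canonical topology. Dimension zero is allowed.
\<close>

class complex_fd_space = real_normed_vector +
  fixes scaleC :: "complex \<Rightarrow> 'a \<Rightarrow> 'a" (infixr "*\<^sub>C" 75)
  assumes scaleC_add_right: "c *\<^sub>C (x + y) = c *\<^sub>C x + c *\<^sub>C y"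
    and scaleC_add_left: "(c + d) *\<^sub>C x = c *\<^sub>C x + d *\<^sub>C x"
    and scaleC_scaleC: "c *\<^sub>C d *\<^sub>C x = (c * d) *\<^sub>C x"
    and scaleC_of_real: "complex_of_real r *\<^sub>C x = r *\<^sub>R x"
    and norm_scaleC: "norm (c *\<^sub>C x) = cmod c * norm x"
    and finite_spanning: "\<exists>S. finite S \<and> (\<forall>x. \<exists>u. x = (\<Sum>b\<in>S. u b *\<^sub>C b))"

global_interpretation cvec: vector_space "scaleC :: complex \<Rightarrow> 'a \<Rightarrow> 'a::complex_fd_space"
proof
  fix x :: 'a
  show "1 *\<^sub>C x = x"
    using scaleC_of_real[of 1 x] by simp
qed (simp_all add: scaleC_add_right scaleC_add_left scaleC_scaleC)

instantiation complex :: complex_fd_space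
begin

definition scaleC_complex :: "complex \<Rightarrow> complex \<Rightarrow> complex"
  where "scaleC_complex = (*)"

instance
proof
  show "\<exists>S::complex set. finite S \<and> (\<forall>x. \<exists>u. x = (\<Sum>b\<in>S. u b *\<^sub>C b))"
  proof (intro exI[of _ "{1}"] conjI allI)
    fix x :: complex
    show "\<exists>u. x = (\<Sum>b\<in>{1}. u b *\<^sub>C b)"
      by (intro exI[of _ "\<lambda>_. x"]) (simp add: scaleC_complex_def)
  qed simp
qed (simp_all add: scaleC_complex_def algebra_simps norm_mult scaleR_conv_of_real)

end

instantiation vec :: (complex_fd_space, finite) complex_fd_space
begin

definition scaleC_vec :: "complex \<Rightarrow> 'a ^ 'b \<Rightarrow> 'a ^ 'b"
  where "scaleC_vec c x = (\<chi> i. c *\<^sub>C (x $ i))"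

instance
proof
  fix c :: complex and x :: "'a ^ 'b"
  show "norm (c *\<^sub>C x) = cmod c * norm x"
    by (simp add: norm_vec_def scaleC_vec_def norm_scaleC L2_set_right_distrib)
  obtain S :: "'a set" where S: "finite S" "\<And>x. \<exists>u. x = (\<Sum>b\<in>S. u b *\<^sub>C b)"
    using finite_spanning by blast
  define T where "T = (\<lambda>(i, b). axis i b :: 'a ^ 'b) ` (UNIV \<times> (S - {0}))"
  have inj: "inj_on (\<lambda>(i, b). axis i b :: 'a ^ 'b) (UNIV \<times> (S - {0}))"
    by (auto simp: inj_on_def axis_eq_axis)
  show "\<exists>S::('a ^ 'b) set. finite S \<and> (\<forall>x. \<exists>u. x = (\<Sum>b\<in>S. u b *\<^sub>C b))"
  proof (intro exI[of _ T] conjI allI)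
    show "finite T"
      using S(1) by (simp add: T_def)
    fix x :: "'a ^ 'b"
    have "\<forall>i. \<exists>u. x $ i = (\<Sum>b\<in>S. u b *\<^sub>C b)"
      using S(2) by blast
    then obtain u where u: "\<And>i. x $ i = (\<Sum>b\<in>S. u i b *\<^sub>C b)"
      by metis
    define v where "v = (\<lambda>(i, b). u i b) \<circ>
      the_inv_into (UNIV \<times> (S - {0})) (\<lambda>(i, b). axis i b :: 'a ^ 'b)"
    have v: "v (axis i b) = u i b" if "b \<in> S - {0}" for i b
      using the_inv_into_f_f[OF inj, of "(i, b)"] that by (simp add: v_def)
    have "(\<Sum>b\<in>T. v b *\<^sub>C b) = (\<Sum>(i, b)\<in>UNIV \<times> (S - {0}). u i b *\<^sub>C axis i b)"
      unfolding T_def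
      by (subst sum.reindex[OF inj]) (rule sum.cong[OF refl], clarsimp, metis v DiffI singletonD)
    also have "\<dots> = (\<Sum>i\<in>UNIV. \<Sum>b\<in>S - {0}. u i b *\<^sub>C axis i b)"
      by (simp add: sum.cartesian_product)
    also have "\<dots> = x"
    proof (rule vec_eq_iff[THEN iffD2], rule allI)
      fix j
      have "(\<Sum>i\<in>UNIV. \<Sum>b\<in>S - {0}. u i b *\<^sub>C axis i b) $ j
          = (\<Sum>i\<in>UNIV. if i = j then (\<Sum>b\<in>S - {0}. u i b *\<^sub>C b) else 0)"
        unfolding sum_component
        by (rule sum.cong) (auto simp: scaleC_vec_def axis_def intro!: sum.neutral)
      also have "\<dots> = (\<Sum>b\<in>S - {0}. u j b *\<^sub>C b)"
        by simp
      also have "\<dots> = x $ j"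
        unfolding u using S(1) by (intro sum.mono_neutral_left) auto
      finally show "(\<Sum>i\<in>UNIV. \<Sum>b\<in>S - {0}. u i b *\<^sub>C axis i b) $ j = x $ j" .
    qed
    finally show "\<exists>u. x = (\<Sum>b\<in>T. u b *\<^sub>C b)"
      by metis
  qed
qed (simp_all add: scaleC_vec_def vec_eq_iff scaleC_add_right scaleC_add_left scaleC_scaleC
    scaleC_of_real)

end

definition GL :: "('v::complex_fd_space \<Rightarrow> 'v) monoid"
  where "GL = \<lparr>carrier = {f. Vector_Spaces.linear scaleC scaleC f \<and> bij f},
               monoid.mult = (\<circ>), one = id\<rparr>"

text \<open>The determinant of an endomorphism: the Leibniz formula for its matrix in some basis.\<close>

definition complex_basis :: "'v::complex_fd_space set"
  where "complex_basis = (SOME S. cvec.independent S \<and> cvec.span S = UNIV)"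

definition complex_det :: "('v::complex_fd_space \<Rightarrow> 'v) \<Rightarrow> complex"
  where "complex_det f =
    (\<Sum>p | p permutes complex_basis.
       of_int (sign p) * (\<Prod>b\<in>complex_basis. cvec.representation complex_basis (f b) (p b)))"

definition hyperplane :: "'v::complex_fd_space set \<Rightarrow> bool"
  where "hyperplane H \<longleftrightarrow> cvec.subspace H \<and> Suc (cvec.dim H) = cvec.dim (UNIV :: 'v set)"

definition hermitian_product :: "('v::complex_fd_space \<Rightarrow> 'v \<Rightarrow> complex) \<Rightarrow> bool"
  where "hermitian_product herm \<longleftrightarrow>
    (\<forall>x y z. herm (x + y) z = herm x z + herm y z) \<and>
    (\<forall>c x y. herm (c *\<^sub>C x) y = c * herm x y) \<and>
    (\<forall>x y. herm y x = cnj (herm x y)) \<and>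
    (\<forall>x. x \<noteq> 0 \<longrightarrow> 0 < Re (herm x x))"

definition invariant_form ::
    "('v::complex_fd_space \<Rightarrow> 'v) set \<Rightarrow> ('v \<Rightarrow> 'v \<Rightarrow> complex) \<Rightarrow> bool"
  where "invariant_form W herm \<longleftrightarrow> (\<forall>w\<in>W. \<forall>x y. herm (w x) (w y) = herm x y)"

definition reflection_on :: "('v::complex_fd_space \<Rightarrow> 'v) \<Rightarrow> 'v set \<Rightarrow> bool"
  where "reflection_on r H \<longleftrightarrow>
    r \<in> carrier GL \<and> r \<noteq> \<one>\<^bsub>GL\<^esub> \<and> (\<exists>k::nat. k > 0 \<and> r [^]\<^bsub>GL\<^esub> k = \<one>\<^bsub>GL\<^esub>) \<and>
    hyperplane H \<and> (\<forall>x\<in>H. r x = x)"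

definition reflection_group :: "('v::complex_fd_space \<Rightarrow> 'v) set \<Rightarrow> bool"
  where "reflection_group W \<longleftrightarrow>
    finite W \<and> subgroup W GL \<and> generate GL {r \<in> W. \<exists>H. reflection_on r H} = W"

definition reflection_hyperplanes :: "('v::complex_fd_space \<Rightarrow> 'v) set \<Rightarrow> 'v set set"
  where "reflection_hyperplanes W = {H. \<exists>r\<in>W. reflection_on r H}"

definition regular_part :: "('v::complex_fd_space \<Rightarrow> 'v) set \<Rightarrow> 'v set"
  where "regular_part W = UNIV - \<Union>(reflection_hyperplanes W)"

definition fixator :: "('v::complex_fd_space \<Rightarrow> 'v) set \<Rightarrow> 'v set \<Rightarrow> ('v \<Rightarrow> 'v) set"
  where "fixator W H = {w \<in> W. \<forall>x\<in>H. w x = x}"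

definition fixator_order :: "('v::complex_fd_space \<Rightarrow> 'v) set \<Rightarrow> 'v set \<Rightarrow> nat"
  where "fixator_order W H = card (fixator W H)"

text \<open>
  For a hyperplane of a reflection of \<open>W\<close> the fixator is cyclic, so exactly one of its generators
  has the prescribed determinant, and a divisor \<open>a\<close> of its order is determined by the subgroup
  generated by the \<open>a\<close>-th power of that generator. Hence both descriptions below are proper.
\<close>

definition distinguished_reflection ::
    "('v::complex_fd_space \<Rightarrow> 'v) set \<Rightarrow> 'v set \<Rightarrow> ('v \<Rightarrow> 'v)"
  where "distinguished_reflection W H =
    (THE s. s \<in> fixator W H \<and> generate GL {s} = fixator W H \<and>
            complex_det s = exp (2 * \<i> * complex_of_real pi / of_nat (fixator_order W H)))"

definition fixator_index ::
    "('v::complex_fd_space \<Rightarrow> 'v) set \<Rightarrow> ('v \<Rightarrow> 'v) set \<Rightarrow> 'v set \<Rightarrow> nat"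
  where "fixator_index W C H =
    (if H \<in> reflection_hyperplanes C
     then (THE a. a dvd fixator_order W H \<and>
                  fixator C H = generate GL {distinguished_reflection W H [^]\<^bsub>GL\<^esub> a})
     else fixator_order W H)"

definition hyperplane_classes ::
    "('v::complex_fd_space \<Rightarrow> 'v) set \<Rightarrow> ('v \<Rightarrow> 'v) set \<Rightarrow> 'v set set set"
  where "hyperplane_classes W C =
    orbits (GL\<lparr>carrier := C\<rparr>) (reflection_hyperplanes W) (\<lambda>c H. c ` H)"

definition quotient_topology :: "'a topology \<Rightarrow> ('a \<Rightarrow> 'b) \<Rightarrow> 'b topology"
  where "quotient_topology X q =
    topology (\<lambda>U. U \<subseteq> q ` topspace X \<and> openin X {x \<in> topspace X. q x \<in> U})"

lemma openin_quotient_topology: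
  "openin (quotient_topology X q) U \<longleftrightarrow>
     U \<subseteq> q ` topspace X \<and> openin X {x \<in> topspace X. q x \<in> U}"
proof -
  have "istopology (\<lambda>U. U \<subseteq> q ` topspace X \<and> openin X {x \<in> topspace X. q x \<in> U})"
    unfolding istopology_def
  proof (intro conjI allI impI)
    fix S T
    assume "S \<subseteq> q ` topspace X \<and> openin X {x \<in> topspace X. q x \<in> S}"
      and "T \<subseteq> q ` topspace X \<and> openin X {x \<in> topspace X. q x \<in> T}"
    then show "S \<inter> T \<subseteq> q ` topspace X" "openin X {x \<in> topspace X. q x \<in> S \<inter> T}"
      using openin_Int[of X "{x \<in> topspace X. q x \<in> S}" "{x \<in> topspace X. q x \<in> T}"]
      by (auto simp: Int_def conj_ac)
  next
    fix K
    assume K: "\<forall>U\<in>K. U \<subseteq> q ` topspace X \<and> openin X {x \<in> topspace X. q x \<in> U}"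
    then show "\<Union>K \<subseteq> q ` topspace X"
      by blast
    have "{x \<in> topspace X. q x \<in> \<Union>K} = (\<Union>U\<in>K. {x \<in> topspace X. q x \<in> U})"
      by blast
    then show "openin X {x \<in> topspace X. q x \<in> \<Union>K}"
      using K by auto
  qed
  then show ?thesis
    by (simp add: quotient_topology_def topology_inverse')
qed

lemma quotient_map_quotient_topology: "quotient_map X (quotient_topology X q) q"
proof -
  have "topspace (quotient_topology X q) = q ` topspace X"
  proof
    show "topspace (quotient_topology X q) \<subseteq> q ` topspace X"
      using openin_topspace[of "quotient_topology X q"] unfolding openin_quotient_topology by blast
    have "{x \<in> topspace X. q x \<in> q ` topspace X} = topspace X"
      by blast
    then have "openin (quotient_topology X q) (q ` topspace X)"
      by (simp add: openin_quotient_topology)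
    then show "q ` topspace X \<subseteq> topspace (quotient_topology X q)"
      by (rule openin_subset)
  qed
  then show ?thesis
    by (auto simp: quotient_map_def openin_quotient_topology)
qed

text \<open>
  The constants \<^const>\<open>joinpaths\<close> and \<^const>\<open>homotopic_paths\<close> need a topological space type class,
  which the set of orbits does not have; the versions below are for abstract topologies. Only the
  values of a path on the unit interval matter.
\<close>

definition path_join :: "(real \<Rightarrow> 'a) \<Rightarrow> (real \<Rightarrow> 'a) \<Rightarrow> real \<Rightarrow> 'a"
  where "path_join g h t = (if t \<le> 1 / 2 then g (2 * t) else h (2 * t - 1))"

lemma path_join_eq_joinpaths: "path_join = joinpaths"
  by (simp add: fun_eq_iff path_join_def joinpaths_def)

definition path_homotopic :: "'a topology \<Rightarrow> (real \<Rightarrow> 'a) \<Rightarrow> (real \<Rightarrow> 'a) \<Rightarrow> bool"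
  where "path_homotopic X g h \<longleftrightarrow>
    homotopic_with (\<lambda>r. r 0 = g 0 \<and> r 1 = g 1) (top_of_set {0..1}) X g h"

lemma path_homotopic_eq_homotopic_paths: "path_homotopic (top_of_set S) = homotopic_paths S"
  by (simp add: fun_eq_iff path_homotopic_def homotopic_paths_def pathstart_def pathfinish_def)

definition path_class :: "'a topology \<Rightarrow> (real \<Rightarrow> 'a) \<Rightarrow> (real \<Rightarrow> 'a) set"
  where "path_class X g = {h. path_homotopic X g h}"

definition fundamental_group :: "'a topology \<Rightarrow> 'a \<Rightarrow> (real \<Rightarrow> 'a) set monoid"
  where "fundamental_group X x =
    \<lparr>carrier = {path_class X g |g. pathin X g \<and> g 0 = x \<and> g 1 = x},
     monoid.mult = (\<lambda>a b. {k. \<exists>g\<in>a. \<exists>h\<in>b. path_homotopic X (path_join g h) k}),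
     one = path_class X (\<lambda>_. x)\<rparr>"

definition group_orbit :: "('v::complex_fd_space \<Rightarrow> 'v) set \<Rightarrow> 'v \<Rightarrow> 'v set"
  where "group_orbit W = orbit (GL\<lparr>carrier := W\<rparr>) (\<lambda>w. w)"

definition regular_orbit_space :: "('v::complex_fd_space \<Rightarrow> 'v) set \<Rightarrow> 'v set topology"
  where "regular_orbit_space W = quotient_topology (top_of_set (regular_part W)) (group_orbit W)"

definition braid_group ::
    "('v::complex_fd_space \<Rightarrow> 'v) set \<Rightarrow> 'v \<Rightarrow> (real \<Rightarrow> 'v set) set monoid"
  where "braid_group W x0 = fundamental_group (regular_orbit_space W) (group_orbit W x0)"

text \<open>
  The path \<open>g\<close> is a lift, starting at \<open>x0\<close>, of some loop in the class \<open>b\<close>. Its endpoint depends only on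
  \<open>b\<close> by homotopy lifting, and determines \<open>w\<close> because \<open>W\<close> acts freely on the regular part.
\<close>

definition braid_projection ::
    "('v::complex_fd_space \<Rightarrow> 'v) set \<Rightarrow> 'v \<Rightarrow> (real \<Rightarrow> 'v set) set \<Rightarrow> ('v \<Rightarrow> 'v)"
  where "braid_projection W x0 b =
    (THE w. w \<in> W \<and>
       (\<exists>g. path g \<and> path_image g \<subseteq> regular_part W \<and> pathstart g = x0 \<and> pathfinish g = w x0 \<and>
            group_orbit W \<circ> g \<in> b))"

definition braid_preimage ::
    "('v::complex_fd_space \<Rightarrow> 'v) set \<Rightarrow> 'v \<Rightarrow> ('v \<Rightarrow> 'v) set \<Rightarrow> (real \<Rightarrow> 'v set) set monoid"
  where "braid_preimage W x0 C =
    (braid_group W x0)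
      \<lparr>carrier := {b \<in> carrier (braid_group W x0). braid_projection W x0 b \<in> C}\<rparr>"

definition monodromy_path ::
    "('v::complex_fd_space \<Rightarrow> 'v) set \<Rightarrow> 'v set \<Rightarrow> (real \<Rightarrow> 'v) \<Rightarrow> 'v \<Rightarrow> 'v \<Rightarrow> real \<Rightarrow> 'v"
  where "monodromy_path W H g h d =
    g +++ (\<lambda>t. h + exp (2 * \<i> * complex_of_real (pi * t) / of_nat (fixator_order W H)) *\<^sub>C d)
      +++ (distinguished_reflection W H \<circ> reversepath g)"

definition monodromy_generators ::
    "('v::complex_fd_space \<Rightarrow> 'v \<Rightarrow> complex) \<Rightarrow> ('v \<Rightarrow> 'v) set \<Rightarrow> 'v \<Rightarrow> 'v set
       \<Rightarrow> (real \<Rightarrow> 'v set) set set"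
  where "monodromy_generators herm W x0 H =
    {path_class (regular_orbit_space W) (group_orbit W \<circ> monodromy_path W H g h d) |g h d.
       h \<in> H \<and> (\<forall>H'\<in>reflection_hyperplanes W. H' \<noteq> H \<longrightarrow> h \<notin> H') \<and>
       d \<noteq> 0 \<and> (\<forall>x\<in>H. herm x d = 0) \<and>
       (\<forall>z. cmod z \<le> 1 \<longrightarrow> (\<forall>H'\<in>reflection_hyperplanes W. H' \<noteq> H \<longrightarrow> h + z *\<^sub>C d \<notin> H')) \<and>
       path g \<and> path_image g \<subseteq> regular_part W \<and> pathstart g = x0 \<and> pathfinish g = h + d}"

definition abelianization :: "('a, 'b) monoid_scheme \<Rightarrow> 'a set monoid"
  where "abelianization G = G Mod (derived G (carrier G))"

definition ab_class :: "('a, 'b) monoid_scheme \<Rightarrow> 'a \<Rightarrow> 'a set"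
  where "ab_class G x = derived G (carrier G) #>\<^bsub>G\<^esub> x"

definition monodromy_power_classes ::
    "('v::complex_fd_space \<Rightarrow> 'v \<Rightarrow> complex) \<Rightarrow> ('v \<Rightarrow> 'v) set \<Rightarrow> 'v \<Rightarrow> ('v \<Rightarrow> 'v) set
       \<Rightarrow> 'v set set \<Rightarrow> (real \<Rightarrow> 'v set) set set set"
  where "monodromy_power_classes herm W x0 C K =
    {ab_class (braid_preimage W x0 C) (s [^]\<^bsub>braid_group W x0\<^esub> fixator_index W C H) |H s.
       H \<in> K \<and> s \<in> monodromy_generators herm W x0 H}"

text \<open>Meaningful only when the set of classes above is a singleton.\<close>

definition common_class ::
    "('v::complex_fd_space \<Rightarrow> 'v \<Rightarrow> complex) \<Rightarrow> ('v \<Rightarrow> 'v) set \<Rightarrow> 'v \<Rightarrow> ('v \<Rightarrow> 'v) set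
       \<Rightarrow> 'v set set \<Rightarrow> (real \<Rightarrow> 'v set) set set"
  where "common_class herm W x0 C K = (THE v. v \<in> monodromy_power_classes herm W x0 C K)"

end

theory Submission
  imports Defs "HOL-Complex_Analysis.Complex_Analysis" "Jordan_Normal_Form.Determinant"
begin

text \<open>
  By Steinberg's theorem \<open>W\<close> acts freely on the regular part, which therefore covers its quotient, and
  \<open>B\<close> becomes the group of homotopy classes of regular paths from \<open>x0\<close> to the points \<open>w x0\<close>.
  A regular loop can be coned off from a generic apex into triangles, and a triangle can be cut into
  pieces meeting at most one hyperplane; hence the kernel of \<open>p\<close> is generated by full turns around the
  hyperplanes, that is, by the powers of the generators of the monodromy with exponent \<open>e_H\<close>. These are
  powers of the elements with exponent \<open>a_H\<close>, which in turn map onto generators of \<open>C\<close>; so the latter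
  generate \<open>p^-1(C)\<close>. Two of them whose hyperplanes are conjugate under \<open>C\<close> are conjugate in \<open>p^-1(C)\<close>.
  The sum, over the hyperplanes of a \<open>C\<close>-class, of the winding numbers of the linear forms along a
  lifted path is a homomorphism on \<open>p^-1(C)\<close>, a multiple of which takes the value 1 on the generators
  of this class and 0 on those of the other classes.
\<close>

text \<open>Freeness is the analytic obstacle: a nontrivial element fixing a regular point would
  have a fixed space of codimension at least two. To exclude this, the non-free locus is exhibited
  as the zero set of a single polynomial function: the coinvariants have a homogeneous basis of
  \<open>card W\<close> elements, its evaluations on an orbit form a square matrix, and this matrix
  is singular exactly on the non-free orbits. One equation in two complex variables has no isolated
  zero. No presentation of the pure braid group is computed. Instead, every assignment of group
  elements to regular paths that respects concatenation and homotopy and kills small meridians is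
  shown to kill all loops; the target used is \<open>B\<close> modulo the subgroup generated by the
  full turns, which is normal because conjugation permutes them. The normalising multiple comes from
  \<open>idx H * card (fixator C H) = ord H\<close>: a generator with exponent a_H is a root of
  order \<open>card (fixator C H)\<close> of a full turn, so its total turn is the inverse of that
  order. Lifted paths are not closed, hence turns are complex numbers and integrality is checked
  only on generators.\<close>

hide_type (open) Matrix.vec
hide_const (open) Matrix.vec Determinant.det
no_notation Matrix.vec_index (infixl "$" 100)

section \<open>Determinants, roots of unity, and norms in finite dimension\<close>

text \<open>The sum is also the determinant of the transpose \<open>?A\<close> of \<open>M\<close>,
  and a kernel vector of \<open>?A\<close> is a linear relation between the rows of
  \<open>M\<close>. The rows will be the evaluations of the coinvariants at the points of an
  orbit.\<close>

lemma leibniz_det_zero_iff: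
  fixes M :: "nat \<Rightarrow> nat \<Rightarrow> complex"
  shows "(\<Sum>p | p permutes {0..<n}. of_int (sign p) * (\<Prod>i = 0..<n. M i (p i))) = 0 \<longleftrightarrow>
    (\<exists>c. (\<exists>i<n. c i \<noteq> 0) \<and> (\<forall>j<n. (\<Sum>i<n. c i * M i j) = 0))"
proof -
  let ?A = "Matrix.mat n n (\<lambda>(j, i). M i j)"
  have A: "?A \<in> carrier_mat n n" by simp
  have D: "Determinant.det ?A = (\<Sum>p | p permutes {0..<n}. of_int (sign p) * (\<Prod>i = 0..<n. M i (p i)))"
  proof -
    have "Determinant.det ?A = Determinant.det (transpose_mat ?A)"
      by (rule det_transpose[OF A, symmetric])
    also have "\<dots> = (\<Sum>p | p permutes {0..<n}. of_int (sign p) * (\<Prod>i = 0..<n. M i (p i)))"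
      unfolding Determinant.det_def by (auto intro!: sum.cong prod.cong simp: permutes_in_image)
    finally show ?thesis .
  qed
  have "Determinant.det ?A = 0 \<longleftrightarrow> (\<exists>v. v \<in> carrier_vec n \<and> v \<noteq> 0\<^sub>v n \<and> ?A *\<^sub>v v = 0\<^sub>v n)"
    by (rule det_0_iff_vec_prod_zero[OF A])
  also have "\<dots> \<longleftrightarrow> (\<exists>c. (\<exists>i<n. c i \<noteq> 0) \<and> (\<forall>j<n. (\<Sum>i<n. c i * M i j) = 0))"
  proof
    assume "\<exists>v. v \<in> carrier_vec n \<and> v \<noteq> 0\<^sub>v n \<and> ?A *\<^sub>v v = 0\<^sub>v n"
    then obtain v where v: "v \<in> carrier_vec n" "v \<noteq> 0\<^sub>v n" "?A *\<^sub>v v = 0\<^sub>v n" by blast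
    have "vec_index (?A *\<^sub>v v) j = (\<Sum>i<n. vec_index v i * M i j)" if "j < n" for j
      using that v(1) by (simp add: scalar_prod_def mult.commute atLeast0LessThan)
    moreover have "\<exists>i<n. vec_index v i \<noteq> 0"
      using v(1,2) by (metis carrier_vecD eq_vecI index_zero_vec(1) index_zero_vec(2))
    ultimately show "\<exists>c. (\<exists>i<n. c i \<noteq> 0) \<and> (\<forall>j<n. (\<Sum>i<n. c i * M i j) = 0)"
      using v(3) by (intro exI[of _ "vec_index v"]) (metis index_zero_vec(1))
  next
    assume "\<exists>c. (\<exists>i<n. c i \<noteq> 0) \<and> (\<forall>j<n. (\<Sum>i<n. c i * M i j) = 0)"
    then obtain c i where c: "i < n" "c i \<noteq> 0" "\<And>j. j < n \<Longrightarrow> (\<Sum>i<n. c i * M i j) = 0" by blast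
    let ?v = "Matrix.vec n c"
    have "?A *\<^sub>v ?v = 0\<^sub>v n"
      using c(3) by (intro eq_vecI) (auto simp: scalar_prod_def mult.commute atLeast0LessThan)
    moreover have "?v \<noteq> 0\<^sub>v n"
      using c(1,2) by (metis index_vec index_zero_vec(1))
    ultimately show "\<exists>v. v \<in> carrier_vec n \<and> v \<noteq> 0\<^sub>v n \<and> ?A *\<^sub>v v = 0\<^sub>v n"
      by (intro exI[of _ ?v]) simp
  qed
  finally show ?thesis by (simp add: D)
qed

text \<open>Composition with the transposition of \<open>a\<close> and \<open>b\<close> reverses
  every sign, so the sum equals its own negative.\<close>

lemma sum_sign_permutes_eq_0:
  assumes "a \<in> A" "b \<in> A" "a \<noteq> b" "finite A"
  shows "(\<Sum>p | p permutes A. of_int (sign p)) = (0::complex)"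
proof -
  let ?t = "Transposition.transpose a b"
  have t: "?t permutes A" using assms by (simp add: permutes_swap_id)
  have "(\<Sum>p | p permutes A. of_int (sign p)) = (\<Sum>p | p permutes A. of_int (sign (p \<circ> ?t)) :: complex)"
    by (rule sum_permutations_compose_right[OF t])
  also have "\<dots> = (\<Sum>p | p permutes A. - of_int (sign p))"
    using assms by (intro sum.cong refl)
      (auto simp: sign_compose sign_swap_id permutes_imp_permutation permutation_swap_id)
  finally show ?thesis by (simp add: sum_negf)
qed

text \<open>The product is expanded over the set \<open>A\<close> of rows where the rank-one term is
  chosen. A surviving permutation is supported in \<open>A\<close>, the remaining factor does not
  depend on it, and the signs cancel as soon as \<open>A\<close> has two elements. It computes the
  determinant of a reflection in an arbitrary basis.\<close>

lemma leibniz_det_id_plus_rank_one: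
  fixes u v :: "'a \<Rightarrow> complex"
  assumes S: "finite S"
  shows "(\<Sum>p | p permutes S. of_int (sign p) * (\<Prod>b\<in>S. u b * v (p b) + (if p b = b then 1 else 0)))
    = 1 + (\<Sum>b\<in>S. u b * v b)"
proof -
  have inner: "(\<Sum>p | p permutes S. of_int (sign p) *
        ((\<Prod>b\<in>A. u b * v (p b)) * (\<Prod>b\<in>S - A. if p b = b then 1 else 0))) =
      (if A = {} then 1 else if \<exists>b. A = {b} then (\<Prod>b\<in>A. u b * v b) else 0)" (is "?L = ?R")
    if A: "A \<subseteq> S" for A
  proof -
    have fA: "finite A" using A S finite_subset by blast
    have "?L = (\<Sum>p | p permutes A. of_int (sign p) *
        ((\<Prod>b\<in>A. u b * v (p b)) * (\<Prod>b\<in>S - A. if p b = b then 1 else 0)))"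
    proof (rule sum.mono_neutral_right)
      show "\<forall>p\<in>{p. p permutes S} - {p. p permutes A}. of_int (sign p) *
        ((\<Prod>b\<in>A. u b * v (p b)) * (\<Prod>b\<in>S - A. if p b = b then 1 else 0)) = 0"
      proof
        fix p assume p: "p \<in> {p. p permutes S} - {p. p permutes A}"
        then have "\<not> (\<forall>b\<in>S - A. p b = b)"
          using permutes_superset[of p S A] by blast
        then obtain b where "b \<in> S - A" "p b \<noteq> b"
          by blast
        then have "(\<Prod>b\<in>S - A. if p b = b then 1 else 0) = (0::complex)"
          using S by auto
        then show "of_int (sign p) *
          ((\<Prod>b\<in>A. u b * v (p b)) * (\<Prod>b\<in>S - A. if p b = b then 1 else 0)) = (0::complex)" by simp
      qed
    qed (use A S permutes_subset finite_permutations in auto)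
    also have "\<dots> = (\<Sum>p | p permutes A. of_int (sign p) * (\<Prod>b\<in>A. u b * v b))"
    proof (rule sum.cong[OF refl])
      fix p assume "p \<in> {p. p permutes A}"
      then have p: "p permutes A" by simp
      have "(\<Prod>b\<in>S - A. if p b = b then 1 else 0) = (1::complex)"
        using p by (intro prod.neutral) (auto simp: permutes_not_in)
      moreover have "(\<Prod>b\<in>A. v (p b)) = (\<Prod>b\<in>A. v b)"
        using prod.permute[OF p, of v] by (simp add: o_def)
      ultimately show "of_int (sign p) * ((\<Prod>b\<in>A. u b * v (p b)) * (\<Prod>b\<in>S - A. if p b = b then 1 else 0))
        = of_int (sign p) * (\<Prod>b\<in>A. u b * v b)" by (simp add: prod.distrib)
    qed
    also have "\<dots> = (\<Sum>p | p permutes A. of_int (sign p)) * (\<Prod>b\<in>A. u b * v b)"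
      by (simp add: sum_distrib_right)
    also have "\<dots> = ?R"
    proof (cases "\<exists>a\<in>A. \<exists>b\<in>A. a \<noteq> b")
      case True
      then show ?thesis using sum_sign_permutes_eq_0[OF _ _ _ fA] by fastforce
    next
      case False
      then have "A = {} \<or> (\<exists>b. A = {b})" by blast
      then show ?thesis by (auto simp: sign_id)
    qed
    finally show ?thesis .
  qed
  have "(\<Sum>p | p permutes S. of_int (sign p) * (\<Prod>b\<in>S. u b * v (p b) + (if p b = b then 1 else 0)))
      = (\<Sum>p | p permutes S. \<Sum>A\<in>Pow S. of_int (sign p) *
        ((\<Prod>b\<in>A. u b * v (p b)) * (\<Prod>b\<in>S - A. if p b = b then 1 else 0)))"
    by (simp add: prod_add[OF S] sum_distrib_left)
  also have "\<dots> = (\<Sum>A\<in>Pow S. \<Sum>p | p permutes S. of_int (sign p) *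
        ((\<Prod>b\<in>A. u b * v (p b)) * (\<Prod>b\<in>S - A. if p b = b then 1 else 0)))"
    by (rule sum.swap)
  also have "\<dots> = (\<Sum>A\<in>Pow S. if A = {} then 1 else if \<exists>b. A = {b} then (\<Prod>b\<in>A. u b * v b) else 0)"
    by (rule sum.cong[OF refl], rule inner) simp
  also have "\<dots> = (\<Sum>A\<in>insert {} ((\<lambda>b. {b}) ` S). if A = {} then 1 else if \<exists>b. A = {b} then (\<Prod>b\<in>A. u b * v b) else 0)"
    using S by (intro sum.mono_neutral_right) (auto split: if_splits)
  also have "\<dots> = 1 + (\<Sum>b\<in>S. u b * v b)"
    using S by (subst sum.insert) (auto simp: sum.reindex)
  finally show ?thesis .
qed

text \<open>Multiplication by \<open>z\<close> permutes \<open>E\<close>; comparing the products of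
  all elements gives one inclusion, and counting roots gives equality.\<close>

lemma finite_mult_closed_eq_roots_of_unity:
  fixes E :: "complex set"
  assumes fin: "finite E" and ne: "E \<noteq> {}" and 0: "0 \<notin> E"
    and mult: "\<And>x y. x \<in> E \<Longrightarrow> y \<in> E \<Longrightarrow> x * y \<in> E"
  shows "E = {z. z ^ card E = 1}"
proof -
  have "z ^ card E = 1" if z: "z \<in> E" for z
  proof -
    have inj: "inj_on ((*) z) E" using 0 z by (auto simp: inj_on_def)
    have "(*) z ` E = E"
      using inj fin mult z by (intro endo_inj_surj) auto
    then have "(\<Prod>y\<in>E. y) = (\<Prod>y\<in>E. z * y)"
      using prod.reindex[OF inj, of "\<lambda>y. y"] by simp
    also have "\<dots> = z ^ card E * (\<Prod>y\<in>E. y)"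
      by (simp add: prod.distrib)
    finally show ?thesis using fin 0 by (auto simp: )
  qed
  then have sub: "E \<subseteq> {z. z ^ card E = 1}" by blast
  have pos: "0 < card E" using fin ne by (simp add: card_gt_0_iff)
  show ?thesis
    by (rule card_subset_eq[OF _ sub]) (use pos card_roots_unity_eq finite_roots_unity in auto)
qed

text \<open>A point \<open>v\<close> avoiding the earlier subspaces but lying in the new one
  \<open>U\<close> is moved along a direction \<open>u\<close> outside \<open>U\<close>. Two
  parameters in the same earlier subspace would put \<open>u\<close>, hence \<open>v\<close>, into
  it, and \<open>U\<close> itself meets the line only at parameter 0; so finitely many parameters
  are excluded.\<close>

lemma finite_union_proper_subspaces:
  fixes \<F> :: "'a::real_vector set set"
  assumes "finite \<F>" "\<And>U. U \<in> \<F> \<Longrightarrow> subspace U \<and> U \<noteq> UNIV"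
  shows "\<exists>v. \<forall>U\<in>\<F>. v \<notin> U"
  using assms
proof (induction \<F> rule: finite_induct)
  case (insert U \<F>)
  then obtain v where v: "\<And>U'. U' \<in> \<F> \<Longrightarrow> v \<notin> U'" by blast
  show ?case
  proof (cases "v \<in> U")
    case True
    obtain u where u: "u \<notin> U" using insert.prems by blast
    have sub: "subspace U'" if "U' \<in> insert U \<F>" for U' using insert.prems that by blast
    have one: "\<exists>s. \<forall>t. v + t *\<^sub>R u \<in> U' \<longrightarrow> t = s" if U': "U' \<in> \<F>" for U'
    proof (cases "\<exists>s. v + s *\<^sub>R u \<in> U'")
      case True
      then obtain s where s: "v + s *\<^sub>R u \<in> U'" by blast
      have "t = s" if t: "v + t *\<^sub>R u \<in> U'" for t
      proof (rule ccontr)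
        assume ne: "t \<noteq> s"
        have "(v + t *\<^sub>R u) - (v + s *\<^sub>R u) \<in> U'"
          using s t sub[of U'] U' subspace_diff by blast
        then have "(t - s) *\<^sub>R u \<in> U'" by (simp add: algebra_simps)
        then have "(1 / (t - s)) *\<^sub>R ((t - s) *\<^sub>R u) \<in> U'"
          using sub[of U'] U' subspace_scale by blast
        then have "u \<in> U'" using ne by simp
        then have "(v + s *\<^sub>R u) - s *\<^sub>R u \<in> U'"
          using s sub[of U'] U' subspace_diff subspace_scale by (metis insertCI)
        then show False using v[OF U'] by simp
      qed
      then show ?thesis by blast
    qed blast
    then obtain s where s: "\<And>U' t. U' \<in> \<F> \<Longrightarrow> v + t *\<^sub>R u \<in> U' \<Longrightarrow> t = s U'" by metis
    obtain t where t: "t \<notin> insert (0::real) (s ` \<F>)"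
      using ex_new_if_finite[OF infinite_UNIV_char_0] insert.hyps(1) by (meson finite.insertI finite_imageI)
    have "v + t *\<^sub>R u \<notin> U"
    proof
      assume "v + t *\<^sub>R u \<in> U"
      then have "(v + t *\<^sub>R u) - v \<in> U" using True sub[of U] subspace_diff by blast
      then have "t *\<^sub>R u \<in> U" by simp
      then have "(1/t) *\<^sub>R t *\<^sub>R u \<in> U" using sub[of U] subspace_scale by blast
      then show False using u t by simp
    qed
    then show ?thesis using s t by blast
  qed (use v in blast)
qed simp

lemma finite_complex_basis:
  "finite (complex_basis :: 'v::complex_fd_space set)"
  "cvec.independent (complex_basis :: 'v set)" "cvec.span (complex_basis :: 'v set) = UNIV"
proof -
  obtain S :: "'v set" where S: "finite S" "\<And>x. \<exists>u. x = (\<Sum>b\<in>S. u b *\<^sub>C b)"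
    using finite_spanning by blast
  have span: "cvec.span S = UNIV"
  proof (intro UNIV_eq_I[symmetric])
    fix x :: 'v
    obtain u where "x = (\<Sum>b\<in>S. u b *\<^sub>C b)" using S(2) by blast
    then show "x \<in> cvec.span S" by (simp add: cvec.span_base cvec.span_scale cvec.span_sum)
  qed
  obtain B where B: "B \<subseteq> S" "cvec.independent B" "S \<subseteq> cvec.span B"
    using cvec.maximal_independent_subset by blast
  then have "cvec.span B = UNIV"
    using span by (metis cvec.span_mono cvec.span_span top.extremum_uniqueI)
  then have ex: "\<exists>B::'v set. cvec.independent B \<and> cvec.span B = UNIV" using B by blast
  show 1: "cvec.independent (complex_basis :: 'v set)" "cvec.span (complex_basis :: 'v set) = UNIV"
    using someI_ex[OF ex] by (simp_all add: complex_basis_def)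
  show "finite (complex_basis :: 'v set)"
    using cvec.independent_span_bound[OF S(1) 1(1)] span by simp
qed

global_interpretation cfin: finite_dimensional_vector_space
  "scaleC :: complex \<Rightarrow> 'v \<Rightarrow> 'v::complex_fd_space" complex_basis
  by unfold_locales (use finite_complex_basis in auto)

lemma scaleR_scaleC: "r *\<^sub>R x = complex_of_real r *\<^sub>C x"
  by (simp add: scaleC_of_real)

lemma bounded_bilinear_scaleC: "bounded_bilinear (scaleC :: complex \<Rightarrow> 'v \<Rightarrow> 'v::complex_fd_space)"
proof
  show "\<exists>K. \<forall>c x. norm (c *\<^sub>C x :: 'v) \<le> norm c * norm x * K"
    by (intro exI[of _ 1]) (simp add: norm_scaleC)
qed (simp_all only: scaleC_add_right scaleC_add_left scaleR_scaleC[where 'a='v] scaleC_scaleC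
  scaleR_conv_of_real mult.commute)

lemmas continuous_on_scaleC [continuous_intros] =
  bounded_bilinear.continuous_on[OF bounded_bilinear_scaleC]
lemmas tendsto_scaleC [tendsto_intros] = bounded_bilinear.tendsto[OF bounded_bilinear_scaleC]

text \<open>The norm of the class is arbitrary, so equivalence of norms is proved here by induction
  on the independent set. The bound for \<open>B\<close> makes coordinates of Cauchy sequences
  Cauchy, so the span of \<open>B\<close> is closed and the new vector \<open>v\<close> has positive
  distance from it; this distance controls the new coordinate.\<close>

lemma coordinates_bounded:
  fixes B :: "'v::complex_fd_space set"
  assumes "finite B" "cvec.independent B"
  shows "\<exists>K\<ge>0. \<forall>u. \<forall>b\<in>B. cmod (u b) \<le> K * norm (\<Sum>b\<in>B. u b *\<^sub>C b)"
  using assms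
proof (induction B rule: finite_induct)
  case (insert v B)
  have ind: "cvec.independent B" and v: "v \<notin> cvec.span B"
    using insert.prems insert.hyps(2) by (auto simp: cvec.independent_insert)
  obtain K where K: "K \<ge> 0" "\<And>u b. b \<in> B \<Longrightarrow> cmod (u b) \<le> K * norm (\<Sum>b\<in>B. u b *\<^sub>C b)"
    using insert.IH[OF ind] by blast
  have closed: "closed (cvec.span B)"
    unfolding closed_sequential_limits
  proof (intro allI impI, elim conjE)
    fix x l assume x: "\<forall>n. x n \<in> cvec.span B" and lim: "x \<longlonglongrightarrow> l"
    have "\<forall>n. \<exists>u. x n = (\<Sum>b\<in>B. u b *\<^sub>C b)"
      using x cvec.span_finite[OF insert.hyps(1)] by blast
    then obtain u where u: "\<And>n. x n = (\<Sum>b\<in>B. u n b *\<^sub>C b)" by metis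
    have cauchy: "Cauchy x" using lim by (rule LIMSEQ_imp_Cauchy)
    have "convergent (\<lambda>n. u n b)" if b: "b \<in> B" for b
    proof -
      have "Cauchy (\<lambda>n. u n b)"
      proof (rule metric_CauchyI)
        fix e :: real assume e: "0 < e"
        obtain M where M: "\<And>m n. m \<ge> M \<Longrightarrow> n \<ge> M \<Longrightarrow> dist (x m) (x n) < e / (K + 1)"
          using metric_CauchyD[OF cauchy, of "e / (K + 1)"] e K(1) by auto
        have "dist (u m b) (u n b) < e" if "m \<ge> M" "n \<ge> M" for m n
        proof -
          have "(\<Sum>b\<in>B. (u m b - u n b) *\<^sub>C b) = x m - x n"
            by (simp add: u cvec.scale_left_diff_distrib sum_subtractf)
          then have "cmod (u m b - u n b) \<le> K * norm (x m - x n)"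
            using K(2)[OF b, of "\<lambda>b. u m b - u n b"] by simp
          also have "\<dots> \<le> (K + 1) * norm (x m - x n)" by (simp add: mult_right_mono)
          also have "\<dots> < e" using M[OF that] K(1) by (simp add: dist_norm field_simps)
          finally show ?thesis by (simp add: dist_norm)
        qed
        then show "\<exists>M. \<forall>m\<ge>M. \<forall>n\<ge>M. dist (u m b) (u n b) < e" by blast
      qed
      then show ?thesis by (rule Cauchy_convergent)
    qed
    then obtain a where a: "\<And>b. b \<in> B \<Longrightarrow> (\<lambda>n. u n b) \<longlonglongrightarrow> a b"
      unfolding convergent_def by metis
    have "x \<longlonglongrightarrow> (\<Sum>b\<in>B. a b *\<^sub>C b)"
      unfolding u[abs_def] by (intro tendsto_sum tendsto_scaleC a tendsto_const)
    then have "l = (\<Sum>b\<in>B. a b *\<^sub>C b)" using lim LIMSEQ_unique by blast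
    then show "l \<in> cvec.span B"
      by (simp add: cvec.span_base cvec.span_scale cvec.span_sum)
  qed
  obtain \<delta> where \<delta>: "\<delta> > 0" "\<And>y. y \<in> cvec.span B \<Longrightarrow> dist v y \<ge> \<delta>"
  proof -
    obtain e where "e > 0" "ball v e \<subseteq> - cvec.span B"
      using closed v open_contains_ball[of "- cvec.span B"] by auto
    then show ?thesis using that[of e] by (force simp: ball_def not_less)
  qed
  \<comment> \<open>The first entry bounds the coordinate of \<open>v\<close>, the second those of
    \<open>B\<close>, after the norm of the component in the span of \<open>B\<close> has been
    bounded by \<open>1 + norm v / \<delta>\<close> times the norm of the whole vector.\<close>
  define K' where "K' = max (1/\<delta>) (K * (1 + norm v / \<delta>))"
  have "K' \<ge> 0" using \<delta>(1) by (simp add: K'_def le_max_iff_disj)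
  moreover have "cmod (u b) \<le> K' * norm (\<Sum>b\<in>insert v B. u b *\<^sub>C b)" if b: "b \<in> insert v B" for u b
  proof -
    define m where "m = (\<Sum>b\<in>B. u b *\<^sub>C b)"
    define x where "x = (\<Sum>b\<in>insert v B. u b *\<^sub>C b)"
    have x: "x = u v *\<^sub>C v + m" using insert.hyps by (simp add: x_def m_def)
    have m: "m \<in> cvec.span B"
      unfolding m_def by (simp add: cvec.span_base cvec.span_scale cvec.span_sum)
    have c: "cmod (u v) * \<delta> \<le> norm x"
    proof (cases "u v = 0")
      case False
      have "\<delta> \<le> dist v ((- inverse (u v)) *\<^sub>C m)"
        by (intro \<delta>(2) cvec.span_scale m)
      moreover have "v - (- inverse (u v)) *\<^sub>C m = inverse (u v) *\<^sub>C x"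
        using False by (simp add: x scaleC_add_right scaleC_scaleC)
      ultimately have "\<delta> \<le> norm x / cmod (u v)"
        by (simp add: dist_norm norm_scaleC norm_inverse divide_inverse mult.commute)
      then show ?thesis using False by (simp add: field_simps)
    qed simp
    then have c': "cmod (u v) \<le> norm x / \<delta>" using \<delta>(1) by (simp add: field_simps)
    have "cmod (u b) \<le> K' * norm x"
    proof (cases "b = v")
      case True
      have "norm x / \<delta> \<le> K' * norm x" 
        unfolding K'_def
          by (metis max.cobounded1 mult.commute mult_left_mono norm_ge_zero times_divide_eq_right mult.right_neutral)
      then show ?thesis using c' True by simp
    next
      case False
      then have "cmod (u b) \<le> K * norm m" using K(2)[of b u] b by (simp add: m_def)
      also have "norm m \<le> norm x + cmod (u v) * norm v"
        using norm_triangle_ineq4[of x "u v *\<^sub>C v"] by (simp add: x norm_scaleC)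
      also have "\<dots> \<le> norm x + norm x / \<delta> * norm v"
        using mult_right_mono[OF c', of "norm v"] by simp
      also have "K * \<dots> = K * (1 + norm v / \<delta>) * norm x" by (simp add: field_simps)
      also have "\<dots> \<le> K' * norm x" by (simp add: K'_def mult_right_mono)
      finally show ?thesis using K(1) by (simp add: mult_left_mono)
    qed
    then show ?thesis by (simp add: x_def)
  qed
  ultimately show ?case by blast
qed auto

definition clinear_form :: "('v::complex_fd_space \<Rightarrow> complex) \<Rightarrow> bool"
  where "clinear_form l \<longleftrightarrow> (\<forall>x y. l (x + y) = l x + l y) \<and> (\<forall>c x. l (c *\<^sub>C x) = c * l x)"

text \<open>Homogeneity is required only for the norms, so that one lemma serves both complex-valued
  forms and endomorphisms, whose codomains carry different complex scalar multiplications.\<close>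

lemma additive_scaleC_bounded_linear:
  fixes f :: "'v::complex_fd_space \<Rightarrow> 'b::real_normed_vector"
  assumes add: "\<And>x y. f (x + y) = f x + f y"
    and scale: "\<And>c x. norm (f (c *\<^sub>C x)) = cmod c * norm (f x)"
    and real: "\<And>r x. f (r *\<^sub>R x) = r *\<^sub>R f x"
  shows "bounded_linear f"
proof -
  let ?B = "complex_basis :: 'v set"
  obtain K where K: "K \<ge> 0" "\<And>u b. b \<in> ?B \<Longrightarrow> cmod (u b) \<le> K * norm (\<Sum>b\<in>?B. u b *\<^sub>C b)"
    using coordinates_bounded[OF finite_complex_basis(1,2)] by blast
  show ?thesis
  proof (rule bounded_linear_intro[of f "K * (\<Sum>b\<in>?B. norm (f b))"])
    fix x :: 'v
    have "x \<in> cvec.span ?B" by (simp add: finite_complex_basis)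
    then obtain u where x: "x = (\<Sum>b\<in>?B. u b *\<^sub>C b)"
      unfolding cvec.span_finite[OF finite_complex_basis(1)] by blast
    have f0: "f 0 = 0" using real[of 0 0] by simp
    have fsum: "f (\<Sum>b\<in>A. g b) = (\<Sum>b\<in>A. f (g b))" if "finite A" for A :: "'v set" and g
      using that by (induction A rule: finite_induct) (auto simp: f0 add)
    have "norm (f x) \<le> (\<Sum>b\<in>?B. norm (f (u b *\<^sub>C b)))"
      unfolding x fsum[OF finite_complex_basis(1)] by (rule norm_sum)
    also have "\<dots> \<le> (\<Sum>b\<in>?B. K * norm x * norm (f b))"
      unfolding scale using K(2)[of _ u] by (intro sum_mono mult_right_mono) (auto simp: x)
    also have "\<dots> = norm x * (K * (\<Sum>b\<in>?B. norm (f b)))"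
      by (simp add: sum_distrib_left mult_ac)
    finally show "norm (f x) \<le> norm x * (K * (\<Sum>b\<in>?B. norm (f b)))" .
  qed (use add real in auto)
qed

lemma clinear_form_bounded_linear: "clinear_form (l :: 'a::complex_fd_space \<Rightarrow> complex) \<Longrightarrow> bounded_linear l"
  by (rule additive_scaleC_bounded_linear)
    (auto simp: clinear_form_def norm_mult scaleR_scaleC[where 'a='a] scaleR_conv_of_real)

lemma linear_scaleC_bounded_linear:
  fixes f :: "'v::complex_fd_space \<Rightarrow> 'v"
  assumes "Vector_Spaces.linear scaleC scaleC f"
  shows "bounded_linear f"
proof -
  interpret Vector_Spaces.linear scaleC scaleC f by fact
  show ?thesis
    by (rule additive_scaleC_bounded_linear) (auto simp: add scale norm_scaleC scaleR_scaleC)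
qed

section \<open>Reflection groups with an invariant hermitian product\<close>

abbreviation finv :: "('a \<Rightarrow> 'b) \<Rightarrow> 'b \<Rightarrow> 'a" where "finv \<equiv> inv_into UNIV"

lemma GL_simps [simp]: "f \<in> carrier GL \<longleftrightarrow> Vector_Spaces.linear scaleC scaleC f \<and> bij f"
  "f \<otimes>\<^bsub>GL\<^esub> g = f \<circ> g" "\<one>\<^bsub>GL\<^esub> = id"
  by (simp_all add: GL_def)

lemma group_GL: "group (GL :: ('v::complex_fd_space \<Rightarrow> 'v) monoid)"
proof (rule groupI)
  fix f g :: "'v \<Rightarrow> 'v" assume "f \<in> carrier GL" "g \<in> carrier GL"
  then show "f \<otimes>\<^bsub>GL\<^esub> g \<in> carrier GL"
    using Vector_Spaces.linear_compose[of scaleC scaleC g scaleC f] bij_comp[of g f] by auto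
next
  show "\<one>\<^bsub>GL\<^esub> \<in> carrier GL" using cvec.linear_id by auto
next
  fix f :: "'v \<Rightarrow> 'v" assume f: "f \<in> carrier GL"
  interpret Vector_Spaces.linear scaleC scaleC f using f by simp
  have ff: "f (finv f x) = x" for x using f by (simp add: bij_is_surj surj_f_inv_f)
  have "Vector_Spaces.linear scaleC scaleC (finv f)"
  proof unfold_locales
    show "finv f (x + y) = finv f x + finv f y" for x y
      using f ff add by (metis GL_simps(1) bij_inv_eq_iff)
    show "finv f (c *\<^sub>C x) = c *\<^sub>C finv f x" for c x
      using f ff scale by (metis GL_simps(1) bij_inv_eq_iff)
  qed
  then show "\<exists>y\<in>carrier GL. y \<otimes>\<^bsub>GL\<^esub> f = \<one>\<^bsub>GL\<^esub>"
    using f by (intro bexI[of _ "finv f"]) (auto simp: bij_imp_bij_inv bij_is_inj)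
qed auto

lemma inv_GL: "f \<in> carrier GL \<Longrightarrow> inv\<^bsub>GL\<^esub> f = finv f"
proof -
  assume f: "f \<in> carrier GL"
  have "inv\<^bsub>GL\<^esub> f \<circ> f = id" "f \<circ> inv\<^bsub>GL\<^esub> f = id"
    using group.l_inv[OF group_GL f] group.r_inv[OF group_GL f] by simp_all
  then show ?thesis by (metis inv_unique_comp)
qed

lemma pow_GL: "f [^]\<^bsub>GL\<^esub> (n::nat) = f ^^ n"
  by (induction n) (simp_all add: fun_eq_iff funpow_swap1)

lemma hyperplane_complement:
  assumes "hyperplane H" "v \<notin> H"
  shows "\<exists>c. x - c *\<^sub>C v \<in> H"
proof -
  have H: "cvec.subspace H" "Suc (cvec.dim H) = cvec.dim (UNIV :: 'a set)"
    using assms(1) by (auto simp: hyperplane_def)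
  have sH: "cvec.span H = H" using H(1) by simp
  have "cvec.dim (insert v H) = Suc (cvec.dim H)"
    using assms(2) cfin.dim_insert[of v H] by (simp add: sH)
  then have "cvec.span (insert v H) = UNIV"
    using H(2) cfin.dim_eq_span[of "insert v H" UNIV] by (simp del: cfin.dim_UNIV)
  then show ?thesis using cvec.span_breakdown_eq[of x v H] sH by auto
qed

lemma hyperplane_subset_eq: "hyperplane H \<Longrightarrow> hyperplane H' \<Longrightarrow> H \<subseteq> H' \<Longrightarrow> H = H'"
  unfolding hyperplane_def by (intro cfin.subspace_dim_equal) auto

lemma hyperplane_subspace_maximal:
  assumes "hyperplane H" "cvec.subspace U" "H \<subseteq> U" "U \<noteq> UNIV"
  shows "U = H"
proof (rule ccontr)
  assume "U \<noteq> H"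
  then obtain v where v: "v \<in> U" "v \<notin> H" using assms(3) by blast
  have "x \<in> U" for x
  proof -
    obtain c where "x - c *\<^sub>C v \<in> U" using hyperplane_complement[OF assms(1) v(2)] assms(3) by blast
    then show ?thesis using v(1) assms(2) cvec.subspace_add cvec.subspace_scale by (metis diff_add_cancel)
  qed
  then show False using assms(4) by blast
qed

locale hermitian_setting =
  fixes herm :: "'v::complex_fd_space \<Rightarrow> 'v \<Rightarrow> complex"
  assumes herm: "hermitian_product herm"
begin

lemma herm_add_left: "herm (x + y) z = herm x z + herm y z"
  and herm_scale_left: "herm (c *\<^sub>C x) z = c * herm x z"
  and herm_sym: "herm y x = cnj (herm x y)"
proof -
  from herm have "\<forall>x y z. herm (x + y) z = herm x z + herm y z"
    "\<forall>c x y. herm (c *\<^sub>C x) y = c * herm x y" "\<forall>x y. herm y x = cnj (herm x y)"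
    unfolding hermitian_product_def by blast+
  then show "herm (x + y) z = herm x z + herm y z" "herm (c *\<^sub>C x) z = c * herm x z"
    "herm y x = cnj (herm x y)" by iprover+
qed

lemma herm_add_right: "herm z (x + y) = herm z x + herm z y"
  by (metis complex_cnj_add herm_add_left herm_sym)

lemma herm_scale_right: "herm z (c *\<^sub>C x) = cnj c * herm z x"
  by (metis complex_cnj_mult herm_scale_left herm_sym)

lemma herm_diff_left: "herm (x - y) z = herm x z - herm y z"
  by (metis add_diff_cancel diff_add_cancel herm_add_left)

lemma herm_diff_right: "herm z (x - y) = herm z x - herm z y"
  by (metis add_diff_cancel diff_add_cancel herm_add_right)

lemma herm_self_eq_0: "herm x x = 0 \<longleftrightarrow> x = 0"
proof
  show "herm x x = 0 \<Longrightarrow> x = 0"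
    using herm unfolding hermitian_product_def by (metis order_less_irrefl zero_complex.simps(1))
  show "x = 0 \<Longrightarrow> herm x x = 0" using herm_diff_left[of x x] by simp
qed

lemma clinear_form_herm: "clinear_form (\<lambda>x. herm x d)"
  by (simp add: clinear_form_def herm_add_left herm_scale_left)

end

locale reflection_setting = hermitian_setting herm
  for herm :: "'v::complex_fd_space \<Rightarrow> 'v \<Rightarrow> complex" +
  fixes W :: "('v \<Rightarrow> 'v) set"
  assumes refl_group: "reflection_group W" and inv_form: "invariant_form W herm"
begin

abbreviation hyps :: "'v set set" where "hyps \<equiv> reflection_hyperplanes W"

lemma finite_W: "finite W" and subgroup_W: "subgroup W GL"
  using refl_group by (auto simp: reflection_group_def)

lemma W_carrier: "w \<in> W \<Longrightarrow> w \<in> carrier GL"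
  by (rule subgroup.mem_carrier[OF subgroup_W])

lemma W_linear: "w \<in> W \<Longrightarrow> Vector_Spaces.linear scaleC scaleC w"
  and W_bij: "w \<in> W \<Longrightarrow> bij w"
  using W_carrier by (simp_all add: GL_def)

lemma W_add: "w \<in> W \<Longrightarrow> w (x + y) = w x + w y"
  and W_scale: "w \<in> W \<Longrightarrow> w (c *\<^sub>C x) = c *\<^sub>C w x"
  and W_diff: "w \<in> W \<Longrightarrow> w (x - y) = w x - w y"
  and W_zero: "w \<in> W \<Longrightarrow> w 0 = 0"
proof -
  assume "w \<in> W"
  then interpret Vector_Spaces.linear scaleC scaleC w by (rule W_linear)
  show "w (x + y) = w x + w y" "w (c *\<^sub>C x) = c *\<^sub>C w x" "w (x - y) = w x - w y" "w 0 = 0"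
    by (simp_all add: add scale diff)
qed

lemma id_W: "id \<in> W" using subgroup.one_closed[OF subgroup_W] by simp

lemma comp_W: "v \<in> W \<Longrightarrow> w \<in> W \<Longrightarrow> v \<circ> w \<in> W"
  using subgroup.m_closed[OF subgroup_W] by fastforce

lemma inv_W: "w \<in> W \<Longrightarrow> finv w \<in> W"
  using subgroup.m_inv_closed[OF subgroup_W] inv_GL[OF W_carrier] by metis

lemma pow_W: "w \<in> W \<Longrightarrow> w ^^ n \<in> W"
  by (induction n) (auto intro: id_W comp_W simp: id_W)

lemma W_inv_apply: "w \<in> W \<Longrightarrow> w (finv w x) = x" "w \<in> W \<Longrightarrow> finv w (w x) = x"
  using W_bij by (auto simp: bij_is_surj surj_f_inv_f bij_is_inj)

lemma W_inj: "w \<in> W \<Longrightarrow> w x = w y \<longleftrightarrow> x = y"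
  using W_bij by (metis W_inv_apply(2))

lemma herm_W: "w \<in> W \<Longrightarrow> herm (w x) (w y) = herm x y"
  using inv_form by (auto simp: invariant_form_def)

lemma continuous_W: "w \<in> W \<Longrightarrow> continuous_on A w"
  by (rule bounded_linear.continuous_on[OF linear_scaleC_bounded_linear[OF W_linear] continuous_on_id])

lemma hyps_hyperplane: "H \<in> hyps \<Longrightarrow> hyperplane H"
  by (auto simp: reflection_hyperplanes_def reflection_on_def)

lemma W_fixed_subspace: "w \<in> W \<Longrightarrow> cvec.subspace {x. w x = x}"
  by (auto simp: cvec.subspace_def W_add W_scale W_zero)

text \<open>The fixed space of a nontrivial element is proper, and hyperplanes are maximal proper
  subspaces. Hence a reflection determines its hyperplane, which makes the set of hyperplanes
  finite.\<close>

lemma reflection_on_fixed: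
  assumes "w \<in> W" "reflection_on w H"
  shows "H = {x. w x = x}"
  using hyperplane_subspace_maximal[of H "{x. w x = x}"] assms W_fixed_subspace[OF assms(1)]
  by (auto simp: reflection_on_def fun_eq_iff)

lemma finite_hyps: "finite hyps"
proof (rule finite_subset)
  show "hyps \<subseteq> (\<lambda>w. {x. w x = x}) ` W"
    using reflection_on_fixed unfolding reflection_hyperplanes_def by blast
qed (simp add: finite_W)

lemma W_finite_order: "w \<in> W \<Longrightarrow> \<exists>k>0. w ^^ k = id"
proof -
  assume w: "w \<in> W"
  have "finite (range (\<lambda>n::nat. w ^^ n))"
    by (rule finite_subset[OF _ finite_W]) (use pow_W[OF w] in auto)
  then have "\<not> inj (\<lambda>n::nat. w ^^ n)" using finite_imageD infinite_UNIV_nat by blast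
  then obtain m n :: nat where mn: "m < n" "w ^^ m = w ^^ n"
    by (metis (no_types, lifting) injI linorder_neqE_nat)
  have "w ^^ m \<circ> w ^^ (n - m) = w ^^ m \<circ> id"
    using mn by (metis comp_id funpow_add le_add_diff_inverse less_imp_le_nat)
  then have "w ^^ (n - m) = id"
    using W_inj[OF pow_W[OF w]] by (auto simp: fun_eq_iff)
  then show ?thesis using mn(1) by (intro exI[of _ "n - m"]) auto
qed

lemma reflection_onI:
  assumes "w \<in> W" "w \<noteq> id" "hyperplane H" "\<And>x. x \<in> H \<Longrightarrow> w x = x"
  shows "reflection_on w H" "H \<in> hyps"
proof -
  show "reflection_on w H"
    using assms W_finite_order[of w] W_linear W_bij by (auto simp: reflection_on_def pow_GL)
  then show "H \<in> hyps" using assms(1) by (auto simp: reflection_hyperplanes_def)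
qed

lemma W_hyps: assumes w: "w \<in> W" and H: "H \<in> hyps" shows "w ` H \<in> hyps"
proof -
  obtain r where r: "r \<in> W" "reflection_on r H" using H by (auto simp: reflection_hyperplanes_def)
  interpret Vector_Spaces.linear scaleC scaleC w by (rule W_linear[OF w])
  interpret cp: finite_dimensional_vector_space_pair "scaleC :: complex \<Rightarrow> 'v \<Rightarrow> 'v" complex_basis
    "scaleC :: complex \<Rightarrow> 'v \<Rightarrow> 'v" complex_basis by unfold_locales
  have inj: "inj_on w (cvec.span H)" using W_inj[OF w] by (auto simp: inj_on_def)
  have "hyperplane (w ` H)"
    using hyps_hyperplane[OF H] cp.dim_image_eq[OF W_linear[OF w] inj] subspace_image
    by (auto simp: hyperplane_def)
  moreover have "w \<circ> r \<circ> finv w \<noteq> id"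
  proof
    assume "w \<circ> r \<circ> finv w = id"
    then have "w (r (finv w (w x))) = w x" for x by (metis comp_apply id_apply)
    then have "r = id" by (auto simp: fun_eq_iff W_inj[OF w] W_inv_apply[OF w])
    then show False using r(2) by (auto simp: reflection_on_def)
  qed
  moreover have "(w \<circ> r \<circ> finv w) x = x" if "x \<in> w ` H" for x
    using that r(2) by (auto simp: reflection_on_def W_inv_apply[OF w])
  ultimately show ?thesis
    using w r(1) by (intro reflection_onI(2)[of "w \<circ> r \<circ> finv w"] comp_W inv_W)
qed

text \<open>For a hyperplane \<open>H\<close> of the arrangement, \<open>nrm H\<close> spans the
  orthogonal line and \<open>lf H\<close> is the linear form with kernel \<open>H\<close> normalised
  to be 1 there. The hermitian product is linear in its first argument, so \<open>lf H\<close> is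
  complex linear.\<close>

definition nrm :: "'v set \<Rightarrow> 'v" where "nrm H = (SOME d. d \<noteq> 0 \<and> (\<forall>x\<in>H. herm x d = 0))"
definition lf :: "'v set \<Rightarrow> 'v \<Rightarrow> complex" where "lf H x = herm x (nrm H) / herm (nrm H) (nrm H)"

text \<open>A normal vector is \<open>x - r x\<close> for any \<open>x\<close> moved by a reflection
  \<open>r\<close> along \<open>H\<close>: invariance of the form and \<open>r h = h\<close> make it
  orthogonal to every \<open>h\<close> in \<open>H\<close>.\<close>

lemma nrm: assumes "H \<in> hyps"
  shows "nrm H \<noteq> 0" "x \<in> H \<Longrightarrow> herm x (nrm H) = 0"
proof -
  obtain r where r: "r \<in> W" "reflection_on r H" using assms by (auto simp: reflection_hyperplanes_def)
  then obtain x where x: "r x \<noteq> x" by (auto simp: reflection_on_def fun_eq_iff)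
  have "herm h (x - r x) = 0" if "h \<in> H" for h
    using r that herm_W[OF r(1), of h x] by (simp add: herm_diff_right reflection_on_def)
  then have ex: "\<exists>d. d \<noteq> 0 \<and> (\<forall>x\<in>H. herm x d = 0)" using x by (intro exI[of _ "x - r x"]) auto
  show "nrm H \<noteq> 0" "x \<in> H \<Longrightarrow> herm x (nrm H) = 0" for x
    using someI_ex[OF ex] by (auto simp: nrm_def)
qed

lemma lf_linear: "clinear_form (lf H)"
  by (simp add: clinear_form_def lf_def herm_add_left herm_scale_left add_divide_distrib)

lemma lf_add: "lf H (x + y) = lf H x + lf H y" and lf_scale: "lf H (c *\<^sub>C x) = c * lf H x"
  using lf_linear by (auto simp: clinear_form_def)

lemma lf_diff: "lf H (x - y) = lf H x - lf H y"
  by (metis add_diff_cancel diff_add_cancel lf_add)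

lemma continuous_lf [continuous_intros]: "continuous_on A f \<Longrightarrow> continuous_on A (\<lambda>x. lf H (f x))"
  by (rule bounded_linear.continuous_on[OF clinear_form_bounded_linear[OF lf_linear]])

lemma lf_nrm: "H \<in> hyps \<Longrightarrow> lf H (nrm H) = 1"
  using nrm(1)[of H] by (simp add: lf_def herm_self_eq_0)

text \<open>Subtracting a multiple of \<open>nrm H\<close> brings \<open>d\<close> into
  \<open>H\<close>, where the difference is orthogonal to itself.\<close>

lemma orthogonal_nrm:
  assumes H: "H \<in> hyps" and d: "\<And>x. x \<in> H \<Longrightarrow> herm x d = 0"
  shows "d = lf H d *\<^sub>C nrm H"
proof -
  have "nrm H \<notin> H" using nrm[OF H] herm_self_eq_0 by blast
  then obtain c where c: "d - c *\<^sub>C nrm H \<in> H"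
    using hyperplane_complement[OF hyps_hyperplane[OF H]] by blast
  then have "herm (d - c *\<^sub>C nrm H) (d - c *\<^sub>C nrm H) = 0"
    using d nrm(2)[OF H] by (simp add: herm_diff_right[of "d - c *\<^sub>C nrm H"] herm_scale_right)
  then have "d = c *\<^sub>C nrm H" by (simp add: herm_self_eq_0)
  then show ?thesis using lf_nrm[OF H] by (metis lf_scale mult.right_neutral)
qed

lemma lf_decomp: "H \<in> hyps \<Longrightarrow> x - lf H x *\<^sub>C nrm H \<in> H"
  and lf_eq_0_iff: "H \<in> hyps \<Longrightarrow> lf H x = 0 \<longleftrightarrow> x \<in> H"
proof -
  assume H: "H \<in> hyps"
  have "nrm H \<notin> H" using nrm[OF H] herm_self_eq_0 by blast
  then obtain c where c: "x - c *\<^sub>C nrm H \<in> H"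
    using hyperplane_complement[OF hyps_hyperplane[OF H]] by blast
  have 0: "lf H y = 0" if "y \<in> H" for y using nrm(2)[OF H that] by (simp add: lf_def)
  have "lf H x = c" using 0[OF c] by (simp add: lf_diff lf_scale lf_nrm[OF H])
  then show d: "x - lf H x *\<^sub>C nrm H \<in> H" using c by simp
  show "lf H x = 0 \<longleftrightarrow> x \<in> H" using 0 d by auto
qed

lemma regular_part_iff: "x \<in> regular_part W \<longleftrightarrow> (\<forall>H\<in>hyps. lf H x \<noteq> 0)"
  using lf_eq_0_iff by (auto simp: regular_part_def)

lemma W_regular: "w \<in> W \<Longrightarrow> x \<in> regular_part W \<Longrightarrow> w x \<in> regular_part W"
proof -
  assume w: "w \<in> W" and x: "x \<in> regular_part W"
  have "w x \<notin> H" if "H \<in> hyps" for H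
  proof
    assume "w x \<in> H"
    then have "x \<in> finv w ` H" using w by (metis W_inv_apply(2) image_eqI)
    then show False using x W_hyps[OF inv_W[OF w] that] by (auto simp: regular_part_def)
  qed
  then show ?thesis by (auto simp: regular_part_def)
qed

text \<open>An element fixing \<open>H\<close> pointwise preserves the orthogonal line. Its
  eigenvalue there determines it completely, which turns the fixator into a group of roots of
  unity.\<close>

lemma fixator_nrm:
  assumes H: "H \<in> hyps" and w: "w \<in> fixator W H"
  shows "w (nrm H) = lf H (w (nrm H)) *\<^sub>C nrm H"
proof (rule orthogonal_nrm[OF H])
  fix x assume "x \<in> H"
  then show "herm x (w (nrm H)) = 0"
    using w herm_W[of w x "nrm H"] nrm(2)[OF H] by (auto simp: fixator_def)
qed

lemma fixator_apply:
  assumes H: "H \<in> hyps" and w: "w \<in> fixator W H"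
  shows "w x = x + ((lf H (w (nrm H)) - 1) * lf H x) *\<^sub>C nrm H"
proof -
  have w': "w \<in> W" "\<And>x. x \<in> H \<Longrightarrow> w x = x" using w by (auto simp: fixator_def)
  have "w x = w (x - lf H x *\<^sub>C nrm H) + lf H x *\<^sub>C w (nrm H)"
    using w'(1) by (simp add: W_diff W_scale)
  also have "w (x - lf H x *\<^sub>C nrm H) = x - lf H x *\<^sub>C nrm H"
    by (rule w'(2)[OF lf_decomp[OF H]])
  also have "w (nrm H) = lf H (w (nrm H)) *\<^sub>C nrm H" by (rule fixator_nrm[OF H w])
  finally show ?thesis by (simp add: scaleC_scaleC cvec.scale_left_diff_distrib algebra_simps)
qed

lemma fixator_comp: "v \<in> fixator W H \<Longrightarrow> w \<in> fixator W H \<Longrightarrow> v \<circ> w \<in> fixator W H"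
  by (auto simp: fixator_def comp_W)

lemma fixator_eigenvalue_mult:
  assumes H: "H \<in> hyps" and "v \<in> fixator W H" "w \<in> fixator W H"
  shows "lf H ((v \<circ> w) (nrm H)) = lf H (v (nrm H)) * lf H (w (nrm H))"
proof -
  have "v (w (nrm H)) = lf H (w (nrm H)) *\<^sub>C v (nrm H)"
    using fixator_nrm[OF H assms(3)] assms(2) by (metis (no_types, lifting) W_scale fixator_def mem_Collect_eq)
  then show ?thesis by (simp add: lf_scale)
qed

lemma inj_on_eigenvalue:
  assumes H: "H \<in> hyps"
  shows "inj_on (\<lambda>w. lf H (w (nrm H))) (fixator W H)"
  using fixator_apply[OF H] by (intro inj_onI ext) metis

text \<open>The eigenvalue is injective and multiplicative on the fixator, so the image of
  \<open>F\<close> is a finite multiplicative set of nonzero numbers. This is the source of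
  cyclicity.\<close>

lemma eigenvalues_subgroup:
  assumes H: "H \<in> hyps" and F: "F \<subseteq> fixator W H" "id \<in> F"
    and comp: "\<And>v w. v \<in> F \<Longrightarrow> w \<in> F \<Longrightarrow> v \<circ> w \<in> F"
  shows "(\<lambda>w. lf H (w (nrm H))) ` F = {z. z ^ card F = 1}"
proof -
  have fin: "finite F" using F(1) finite_W by (auto simp: fixator_def intro: finite_subset)
  have inj: "inj_on (\<lambda>w. lf H (w (nrm H))) F"
    using inj_on_eigenvalue[OF H] F(1) inj_on_subset by blast
  have "(\<lambda>w. lf H (w (nrm H))) ` F = {z. z ^ card ((\<lambda>w. lf H (w (nrm H))) ` F) = 1}"
  proof (rule finite_mult_closed_eq_roots_of_unity)
    show "0 \<notin> (\<lambda>w. lf H (w (nrm H))) ` F"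
    proof
      assume "0 \<in> (\<lambda>w. lf H (w (nrm H))) ` F"
      then obtain w where w: "w \<in> F" "lf H (w (nrm H)) = 0" by auto
      then have "w (nrm H) = 0" using fixator_nrm[OF H, of w] F(1) by auto
      then show False using W_inj[of w "nrm H" 0] W_zero[of w] w(1) F(1) nrm(1)[OF H]
        by (auto simp: fixator_def)
    qed
    show "x * y \<in> (\<lambda>w. lf H (w (nrm H))) ` F"
      if xy: "x \<in> (\<lambda>w. lf H (w (nrm H))) ` F" "y \<in> (\<lambda>w. lf H (w (nrm H))) ` F" for x y
    proof -
      obtain v w where v: "v \<in> F" "w \<in> F" "x = lf H (v (nrm H))" "y = lf H (w (nrm H))" using xy by blast
      then have "x * y = lf H ((v \<circ> w) (nrm H))" using fixator_eigenvalue_mult[OF H, of v w] F(1)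
        by (simp add: subset_iff)
      then show ?thesis using comp[OF v(1,2)] by blast
    qed
  qed (use fin F(2) in auto)
  then show ?thesis by (simp add: card_image[OF inj])
qed

text \<open>In any basis the matrix of \<open>w\<close> is the identity plus a rank-one matrix, so
  the Leibniz sum collapses to 1 plus its trace, whatever basis was chosen in
  \<open>complex_basis\<close>.\<close>

lemma complex_det_fixator:
  assumes H: "H \<in> hyps" and w: "w \<in> fixator W H"
  shows "complex_det w = lf H (w (nrm H))"
proof -
  let ?B = "complex_basis :: 'v set" and ?r = "cvec.representation (complex_basis :: 'v set)"
  let ?z = "lf H (w (nrm H)) - 1"
  have ind: "cvec.independent ?B" and sp: "x \<in> cvec.span ?B" for x
    by (simp_all add: finite_complex_basis)
  have rep: "?r (w b) c = (?z * lf H b) * ?r (nrm H) c + (if c = b then 1 else 0)"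
    if "b \<in> ?B" "c \<in> ?B" for b c
    unfolding fixator_apply[OF H w, of b]
    using cvec.representation_add[OF ind sp sp] cvec.representation_scale[OF ind sp]
      cvec.representation_basis[OF ind that(1)] by auto
  have "complex_det w = (\<Sum>p | p permutes ?B. of_int (sign p) *
      (\<Prod>b\<in>?B. (?z * lf H b) * ?r (nrm H) (p b) + (if p b = b then 1 else 0)))"
    unfolding complex_det_def
    by (intro sum.cong prod.cong refl arg_cong2[where f = "(*)"] rep) (auto simp: permutes_in_image)
  also have "\<dots> = 1 + (\<Sum>b\<in>?B. (?z * lf H b) * ?r (nrm H) b)"
    by (rule leibniz_det_id_plus_rank_one[OF finite_complex_basis(1)])
  also have "(\<Sum>b\<in>?B. (?z * lf H b) * ?r (nrm H) b) = ?z * lf H (\<Sum>b\<in>?B. ?r (nrm H) b *\<^sub>C b)"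
  proof -
    have "lf H (\<Sum>b\<in>A. ?r (nrm H) b *\<^sub>C b) = (\<Sum>b\<in>A. ?r (nrm H) b * lf H b)" if "finite A" for A
      using that by (induction A rule: finite_induct) (use lf_diff[of H 0 0] in \<open>auto simp: lf_add lf_scale\<close>)
    from this[OF finite_complex_basis(1)] show ?thesis by (simp add: sum_distrib_left mult_ac)
  qed
  also have "(\<Sum>b\<in>?B. ?r (nrm H) b *\<^sub>C b) = nrm H"
    by (rule cvec.sum_representation_eq[OF ind sp finite_complex_basis(1)]) simp
  finally show ?thesis by (simp add: lf_nrm[OF H])
qed

definition ord :: "'v set \<Rightarrow> nat" where "ord = fixator_order W"
definition rho :: "'v set \<Rightarrow> complex" where "rho H = exp (2 * \<i> * complex_of_real pi / of_nat (ord H))"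
abbreviation sr :: "'v set \<Rightarrow> 'v \<Rightarrow> 'v" where "sr \<equiv> distinguished_reflection W"

lemma fixator_subgroup: "subgroup (fixator W H) GL"
proof (rule group.subgroupI[OF group_GL])
  show "fixator W H \<subseteq> carrier GL" using W_carrier by (auto simp: fixator_def)
  show "fixator W H \<noteq> {}" using id_W by (auto simp: fixator_def)
  show "v \<otimes>\<^bsub>GL\<^esub> w \<in> fixator W H" if "v \<in> fixator W H" "w \<in> fixator W H" for v w
    using that by (simp add: fixator_comp)
  show "inv\<^bsub>GL\<^esub> w \<in> fixator W H" if "w \<in> fixator W H" for w
  proof -
    have w: "w \<in> W" "\<And>x. x \<in> H \<Longrightarrow> w x = x" using that by (auto simp: fixator_def)
    have "finv w x = x" if "x \<in> H" for x
      using W_inv_apply(2)[OF w(1), of x] w(2)[OF that] by simp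
    then show ?thesis using inv_GL[OF W_carrier[OF w(1)]] inv_W[OF w(1)] by (simp add: fixator_def)
  qed
qed

lemma id_fixator: "id \<in> fixator W H" by (simp add: fixator_def id_W)

lemma finite_fixator: "finite (fixator W H)" by (simp add: fixator_def finite_W)

lemma ord_pos: "0 < ord H"
  using id_fixator finite_fixator by (auto simp: ord_def fixator_order_def card_gt_0_iff)

lemma pow_fixator: "w \<in> fixator W H \<Longrightarrow> w ^^ k \<in> fixator W H"
  by (induction k) (auto intro: fixator_comp id_fixator simp: id_fixator[unfolded id_def] id_def)

lemma eigenvalue_pow:
  assumes "H \<in> hyps" "w \<in> fixator W H"
  shows "lf H ((w ^^ k) (nrm H)) = lf H (w (nrm H)) ^ k"
proof (induction k)
  case 0 then show ?case by (simp add: lf_nrm assms(1))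
next
  case (Suc k)
  then show ?case
    using fixator_eigenvalue_mult[OF assms(1,2) pow_fixator[OF assms(2), of k]] by simp
qed

text \<open>All eigenvalues on \<open>F\<close> are roots of unity of order \<open>card F\<close>,
  hence powers of the primitive one of \<open>s\<close>, and the eigenvalue determines the element.
  The subgroup is arbitrary because the fixators in \<open>W\<close> and in \<open>C\<close> and an
  auxiliary subgroup are all needed.\<close>

lemma primitive_eigenvalue_generates:
  assumes H: "H \<in> hyps" and F: "subgroup F GL" "F \<subseteq> fixator W H"
    and s: "s \<in> F" "lf H (s (nrm H)) = exp (2 * \<i> * complex_of_real pi / of_nat (card F))"
  shows "generate GL {s} = F" "w \<in> F \<Longrightarrow> \<exists>k. w = s ^^ k"
proof -
  have id: "id \<in> F" using subgroup.one_closed[OF F(1)] by simp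
  have comp: "v \<circ> w \<in> F" if "v \<in> F" "w \<in> F" for v w
    using subgroup.m_closed[OF F(1) that] by simp
  have E: "(\<lambda>w. lf H (w (nrm H))) ` F = {z. z ^ card F = 1}"
    by (rule eigenvalues_subgroup[OF H F(2) id comp])
  have "finite F" using F(2) finite_fixator finite_subset by blast
  then have n: "1 \<le> card F" using id by (auto simp: Suc_le_eq card_gt_0_iff)
  show pow: "\<exists>k. w = s ^^ k" if w: "w \<in> F" for w
  proof -
    have "lf H (w (nrm H)) \<in> {z. z ^ card F = 1}" using E w by blast
    then obtain j where j: "lf H (w (nrm H)) = exp (2 * complex_of_real pi * \<i> * (of_nat j / of_nat (card F)))"
      unfolding complex_roots_unity[OF n] by auto
    also have "\<dots> = lf H (s (nrm H)) ^ j"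
      unfolding s(2) exp_of_nat_mult[symmetric] by (simp add: field_simps)
    also have "\<dots> = lf H ((s ^^ j) (nrm H))"
      using eigenvalue_pow[OF H, of s j] s(1) F(2) by auto
    finally have "w = s ^^ j"
      using inj_on_eigenvalue[OF H] w F(2) pow_fixator[of s H j] s(1) unfolding inj_on_def by blast
    then show ?thesis by blast
  qed
  show "generate GL {s} = F"
  proof
    show "generate GL {s} \<subseteq> F"
      using s(1) by (intro group.generate_subgroup_incl[OF group_GL _ F(1)]) auto
    have "s ^^ k \<in> generate GL {s}" for k
    proof (induction k)
      case 0 show ?case using generate.one[of GL "{s}"] by (simp add: id_def)
    next
      case (Suc k)
      then show ?case using generate.eng[OF generate.incl[of s "{s}" GL] Suc] by (simp del: o_apply)
    qed
    then show "F \<subseteq> generate GL {s}" using pow by blast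
  qed
qed

text \<open>This justifies the description operator in \<open>distinguished_reflection\<close>:
  every root of unity of order \<open>ord H\<close> occurs as an eigenvalue, and since the
  determinant is the eigenvalue it singles out one element.\<close>

lemma sr_exists:
  assumes H: "H \<in> hyps"
  shows "sr H \<in> fixator W H" "lf H (sr H (nrm H)) = rho H"
proof -
  have "rho H ^ ord H = 1"
    unfolding rho_def exp_of_nat_mult[symmetric] using ord_pos[of H]
    by (simp add: mult.commute[of _ \<i>] mult.assoc) (metis exp_two_pi_i' mult.commute)
  moreover have "(\<lambda>w. lf H (w (nrm H))) ` fixator W H = {z. z ^ card (fixator W H) = 1}"
    by (rule eigenvalues_subgroup[OF H subset_refl id_fixator fixator_comp])
  ultimately obtain s where s: "s \<in> fixator W H" "rho H = lf H (s (nrm H))"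
    unfolding ord_def fixator_order_def by blast
  have gen: "generate GL {s} = fixator W H"
    by (rule primitive_eigenvalue_generates(1)[OF H fixator_subgroup subset_refl s(1)])
      (simp add: s(2)[symmetric] rho_def ord_def fixator_order_def)
  have "sr H = s" unfolding distinguished_reflection_def
  proof (rule the_equality)
    show "s \<in> fixator W H \<and> generate GL {s} = fixator W H \<and>
      complex_det s = exp (2 * \<i> * complex_of_real pi / of_nat (fixator_order W H))"
      using s gen complex_det_fixator[OF H s(1)] by (simp add: rho_def ord_def)
    show "t = s" if "t \<in> fixator W H \<and> generate GL {t} = fixator W H \<and>
      complex_det t = exp (2 * \<i> * complex_of_real pi / of_nat (fixator_order W H))" for t
      using that s complex_det_fixator[OF H, of t] inj_on_eigenvalue[OF H]
      by (simp add: rho_def ord_def inj_on_def)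
  qed
  then show "sr H \<in> fixator W H" "lf H (sr H (nrm H)) = rho H" using s by simp_all
qed

lemma sr_W: "H \<in> hyps \<Longrightarrow> sr H \<in> W"
  and sr_fixes: "H \<in> hyps \<Longrightarrow> x \<in> H \<Longrightarrow> sr H x = x"
  using sr_exists(1) by (auto simp: fixator_def)

lemma sr_orthogonal:
  assumes H: "H \<in> hyps" and d: "\<And>x. x \<in> H \<Longrightarrow> herm x d = 0"
  shows "sr H d = rho H *\<^sub>C d"
proof -
  have "sr H d = lf H d *\<^sub>C sr H (nrm H)"
    by (subst orthogonal_nrm[OF H d]) (auto simp: W_scale sr_W[OF H])
  also have "sr H (nrm H) = rho H *\<^sub>C nrm H"
    using fixator_nrm[OF H sr_exists(1)[OF H]] sr_exists(2)[OF H] by simp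
  finally show ?thesis
    using orthogonal_nrm[OF H d] by (metis mult.commute scaleC_scaleC)
qed

lemma sr_eqI:
  assumes H: "H \<in> hyps" and w: "w \<in> fixator W H" "w (nrm H) = rho H *\<^sub>C nrm H"
  shows "w = sr H"
  using inj_on_eigenvalue[OF H] w sr_exists[OF H] by (simp add: inj_on_def lf_scale lf_nrm[OF H])

lemma rho_pow_ord: "rho H ^ ord H = 1"
  unfolding rho_def exp_of_nat_mult[symmetric] using ord_pos[of H]
  by (simp add: mult.commute[of _ \<i>] mult.assoc) (metis exp_two_pi_i' mult.commute)

lemma sr_pow_ord: "H \<in> hyps \<Longrightarrow> sr H ^^ ord H = id"
proof -
  assume H: "H \<in> hyps"
  have "lf H ((sr H ^^ ord H) (nrm H)) = lf H (id (nrm H))"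
    using eigenvalue_pow[OF H sr_exists(1)[OF H]] sr_exists(2)[OF H] rho_pow_ord lf_nrm[OF H] by simp
  then show ?thesis
    using inj_onD[OF inj_on_eigenvalue[OF H] _ pow_fixator[OF sr_exists(1)[OF H]] id_fixator] by blast
qed

lemma card_fixator_image:
  assumes w: "w \<in> W"
  shows "card (fixator W (w ` H)) = card (fixator W H)"
proof (rule sym, rule bij_betw_same_card[OF bij_betw_byWitness[where
    f = "\<lambda>v. w \<circ> v \<circ> finv w" and f' = "\<lambda>v. finv w \<circ> v \<circ> w"]])
  show "\<forall>v\<in>fixator W H. finv w \<circ> (w \<circ> v \<circ> finv w) \<circ> w = v"
    by (intro ballI ext) (simp only: comp_apply W_inv_apply[OF w])
  show "\<forall>v\<in>fixator W (w ` H). w \<circ> (finv w \<circ> v \<circ> w) \<circ> finv w = v"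
    by (intro ballI ext) (simp only: comp_apply W_inv_apply[OF w])
  show "(\<lambda>v. w \<circ> v \<circ> finv w) ` fixator W H \<subseteq> fixator W (w ` H)"
  proof (rule image_subsetI)
    fix v assume v: "v \<in> fixator W H"
    then have "w \<circ> v \<circ> finv w \<in> W" by (intro comp_W inv_W w) (simp add: fixator_def)
    moreover have "(w \<circ> v \<circ> finv w) x = x" if "x \<in> w ` H" for x
      using that v by (auto simp: fixator_def W_inv_apply[OF w])
    ultimately show "w \<circ> v \<circ> finv w \<in> fixator W (w ` H)" by (simp add: fixator_def)
  qed
  show "(\<lambda>v. finv w \<circ> v \<circ> w) ` fixator W (w ` H) \<subseteq> fixator W H"
  proof (rule image_subsetI)
    fix v assume v: "v \<in> fixator W (w ` H)"
    then have "finv w \<circ> v \<circ> w \<in> W" by (intro comp_W inv_W w) (simp add: fixator_def)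
    moreover have "(finv w \<circ> v \<circ> w) x = x" if "x \<in> H" for x
      using that v by (simp add: fixator_def W_inv_apply[OF w])
    ultimately show "finv w \<circ> v \<circ> w \<in> fixator W H" by (simp add: fixator_def)
  qed
qed

lemma ord_image: "w \<in> W \<Longrightarrow> ord (w ` H) = ord H"
  by (simp add: ord_def fixator_order_def card_fixator_image)

lemma orthogonal_image:
  assumes "w \<in> W" "\<And>x. x \<in> H \<Longrightarrow> herm x d = 0" "x \<in> w ` H"
  shows "herm x (w d) = 0"
  using assms herm_W by auto

text \<open>The element conjugated back fixes \<open>H\<close> and has eigenvalue
  \<open>rho H\<close> on \<open>nrm H\<close>, because \<open>w\<close> preserves orthogonality and
  the order of the fixator.\<close>

lemma sr_conj:
  assumes w: "w \<in> W" and H: "H \<in> hyps"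
  shows "sr (w ` H) = w \<circ> sr H \<circ> finv w"
proof -
  have H': "w ` H \<in> hyps" by (rule W_hyps[OF w H])
  have o: "sr (w ` H) (w (nrm H)) = rho H *\<^sub>C w (nrm H)"
    using sr_orthogonal[OF H' orthogonal_image[OF w nrm(2)[OF H]]] by (simp only: rho_def ord_image[OF w])
  have "finv w \<circ> sr (w ` H) \<circ> w = sr H"
  proof (rule sr_eqI[OF H])
    have "finv w \<circ> sr (w ` H) \<circ> w \<in> W" by (intro comp_W inv_W w sr_W[OF H'])
    moreover have "(finv w \<circ> sr (w ` H) \<circ> w) x = x" if "x \<in> H" for x
      using that sr_fixes[OF H'] by (simp add: W_inv_apply[OF w])
    ultimately show "finv w \<circ> sr (w ` H) \<circ> w \<in> fixator W H" by (simp add: fixator_def)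
    show "(finv w \<circ> sr (w ` H) \<circ> w) (nrm H) = rho H *\<^sub>C nrm H"
      using inv_W[OF w] by (simp add: o W_scale W_inv_apply[OF w])
  qed
  then have "sr (w ` H) (w (finv w x)) = w (sr H (finv w x))" for x
    by (metis W_inv_apply(1)[OF w] comp_apply)
  then show ?thesis by (intro ext) (simp add: W_inv_apply[OF w])
qed

end

section \<open>Reflection subgroups and the integers a_H\<close>

locale reflection_subgroup = reflection_setting herm W + C: reflection_setting herm C
  for herm :: "'v::complex_fd_space \<Rightarrow> 'v \<Rightarrow> complex" and W C +
  assumes C_subset: "C \<subseteq> W"
begin

abbreviation idx :: "'v set \<Rightarrow> nat" where "idx \<equiv> fixator_index W C"

lemma fixator_C_subset: "fixator C H \<subseteq> fixator W H"
  using C_subset by (auto simp: fixator_def)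

text \<open>The eigenvalues on \<open>fixator C H\<close> are the roots of unity of order
  \<open>m\<close>, among those of order \<open>ord H\<close>, so \<open>m\<close> divides
  \<open>ord H\<close>. With \<open>a\<close> the quotient, the power \<open>sr H ^^ a\<close> has a
  primitive eigenvalue of order \<open>m\<close> and therefore generates \<open>fixator C H\<close>.
  The equation \<open>idx H * card (fixator C H) = ord H\<close> covers both cases of the definition
  and is the only way the index is used later.\<close>

lemma idx_props:
  assumes H: "H \<in> hyps"
  shows "idx H * card (fixator C H) = ord H \<and> sr H ^^ idx H \<in> fixator C H \<and>
    (\<forall>c\<in>fixator C H. \<exists>k. c = (sr H ^^ idx H) ^^ k)"
proof -
  define m where "m = card (fixator C H)"
  have m1: "1 \<le> m" using C.id_fixator C.finite_fixator unfolding m_def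
    by (auto simp: Suc_le_eq card_gt_0_iff)
  have EC: "(\<lambda>w. lf H (w (nrm H))) ` fixator C H = {z. z ^ m = 1}"
    unfolding m_def by (rule eigenvalues_subgroup[OF H fixator_C_subset C.id_fixator C.fixator_comp])
  have EW: "(\<lambda>w. lf H (w (nrm H))) ` fixator W H = {z. z ^ ord H = 1}"
    unfolding ord_def fixator_order_def
    by (rule eigenvalues_subgroup[OF H subset_refl id_fixator fixator_comp])
  define \<zeta> where "\<zeta> = exp (2 * \<i> * complex_of_real pi / of_nat m)"
  have \<zeta>: "\<zeta> ^ m = 1" unfolding \<zeta>_def exp_of_nat_mult[symmetric] using m1
    by (simp add: mult.commute[of _ \<i>] mult.assoc) (metis exp_two_pi_i' mult.commute)
  then have "\<zeta> \<in> {z. z ^ ord H = 1}" using EC EW fixator_C_subset[of H] by blast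
  then have "\<zeta> ^ ord H = 1" by simp
  then have "exp (2 * complex_of_real pi * \<i> * (of_nat (ord H) / of_nat m)) = 1"
    unfolding \<zeta>_def exp_of_nat_mult[symmetric] by (simp add: mult_ac)
  then have "m dvd ord H" using complex_root_unity_eq_1[OF m1, of "ord H"] by simp
  then obtain a where a: "ord H = a * m" by (metis dvd_div_mult_self)
  have pow: "lf H ((sr H ^^ b) (nrm H)) = exp (2 * \<i> * complex_of_real pi / of_nat n)"
    if "ord H = b * n" for b n
  proof -
    have "b \<noteq> 0" using ord_pos[of H] that by (metis mult_is_0 less_irrefl)
    then have "rho H ^ b = exp (2 * \<i> * complex_of_real pi / of_nat n)"
      unfolding rho_def exp_of_nat_mult[symmetric] that by simp
    then show ?thesis using eigenvalue_pow[OF H sr_exists(1)[OF H]] sr_exists(2)[OF H] by simp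
  qed
  have sa: "sr H ^^ a \<in> fixator C H"
  proof -
    have "lf H ((sr H ^^ a) (nrm H)) \<in> (\<lambda>w. lf H (w (nrm H))) ` fixator C H"
      using EC \<zeta> pow[OF a] by (simp add: \<zeta>_def)
    then obtain c where c: "c \<in> fixator C H" "lf H ((sr H ^^ a) (nrm H)) = lf H (c (nrm H))" by blast
    moreover have "c \<in> fixator W H" using c(1) fixator_C_subset by blast
    moreover note pow_fixator[OF sr_exists(1)[OF H], of a]
    ultimately have "sr H ^^ a = c"
      using inj_on_eigenvalue[OF H] unfolding inj_on_def by blast
    then show ?thesis using c(1) by simp
  qed
  have gen: "generate GL {sr H ^^ a} = fixator C H"
    and gen_pow: "\<And>w. w \<in> fixator C H \<Longrightarrow> \<exists>k. w = (sr H ^^ a) ^^ k"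
    using primitive_eigenvalue_generates[OF H C.fixator_subgroup fixator_C_subset sa]
      pow[OF a] m_def by blast+
  have "idx H = a"
  proof (cases "H \<in> C.hyps")
    case True
    have "(THE b. b dvd fixator_order W H \<and> fixator C H = generate GL {sr H [^]\<^bsub>GL\<^esub> b}) = a"
    proof (rule the_equality)
      show "a dvd fixator_order W H \<and> fixator C H = generate GL {sr H [^]\<^bsub>GL\<^esub> a}"
        using a gen by (simp add: pow_GL ord_def)
      fix b assume b: "b dvd fixator_order W H \<and> fixator C H = generate GL {sr H [^]\<^bsub>GL\<^esub> b}"
      then obtain n where n: "ord H = b * n" unfolding ord_def by blast
      \<comment> \<open>For a competing divisor \<open>b\<close> with complementary factor
        \<open>n\<close>, the subgroup generated by \<open>sr H ^^ b\<close> is identified as the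
        elements whose eigenvalue has order dividing \<open>n\<close>. It has \<open>n\<close>
        elements, so comparing with \<open>fixator C H\<close> gives \<open>m = n\<close> and
        \<open>b = a\<close>.\<close>
      define F where "F = {w \<in> fixator W H. lf H (w (nrm H)) ^ n = 1}"
      have n1: "1 \<le> n" using n ord_pos[of H] by (cases n) auto
      have F: "subgroup F GL"
      proof (rule group.subgroupI[OF group_GL])
        show "F \<subseteq> carrier GL" using fixator_subgroup[of H] subgroup.subset by (fastforce simp: F_def)
        show "F \<noteq> {}" using id_fixator[of H] lf_nrm[OF H] by (auto simp: F_def)
        show "v \<otimes>\<^bsub>GL\<^esub> w \<in> F" if "v \<in> F" "w \<in> F" for v w
          using that fixator_comp[of v H w] fixator_eigenvalue_mult[OF H, of v w]
          by (simp add: F_def power_mult_distrib)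
        show "inv\<^bsub>GL\<^esub> w \<in> F" if w: "w \<in> F" for w
        proof -
          have w': "w \<in> fixator W H" "inv\<^bsub>GL\<^esub> w \<in> fixator W H"
            using w subgroup.m_inv_closed[OF fixator_subgroup[of H]] by (auto simp: F_def)
          have "w \<otimes>\<^bsub>GL\<^esub> inv\<^bsub>GL\<^esub> w = \<one>\<^bsub>GL\<^esub>"
            using w'(1) W_carrier by (intro group.r_inv[OF group_GL]) (auto simp: fixator_def)
          then have "w \<circ> inv\<^bsub>GL\<^esub> w = id" by simp
          then have "lf H (w (nrm H)) * lf H ((inv\<^bsub>GL\<^esub> w) (nrm H)) = 1"
            using fixator_eigenvalue_mult[OF H w'] lf_nrm[OF H] by simp
          then have "lf H (w (nrm H)) ^ n * lf H ((inv\<^bsub>GL\<^esub> w) (nrm H)) ^ n = 1"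
            by (metis power_mult_distrib power_one)
          then show ?thesis using w w'(2) by (simp add: F_def)
        qed
      qed
      have inj: "inj_on (\<lambda>w. lf H (w (nrm H))) F"
        by (rule inj_on_subset[OF inj_on_eigenvalue[OF H]]) (auto simp: F_def)
      have "(\<lambda>w. lf H (w (nrm H))) ` F = {z. z ^ n = 1}"
      proof
        show "{z. z ^ n = 1} \<subseteq> (\<lambda>w. lf H (w (nrm H))) ` F"
        proof
          fix z :: complex assume z: "z \<in> {z. z ^ n = 1}"
          then have "z ^ ord H = 1" using n by (simp add: power_mult mult.commute[of b])
          then obtain w where "w \<in> fixator W H" "z = lf H (w (nrm H))" using EW by blast
          then show "z \<in> (\<lambda>w. lf H (w (nrm H))) ` F" using z by (auto simp: F_def)
        qed
      qed (auto simp: F_def)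
      then have cF: "card F = n"
        using card_image[OF inj] card_roots_unity_eq[of n] n1 by simp
      have sF: "sr H ^^ b \<in> F"
      proof -
        have "lf H ((sr H ^^ b) (nrm H)) ^ n = rho H ^ ord H"
          using eigenvalue_pow[OF H sr_exists(1)[OF H], of b] sr_exists(2)[OF H] n by (simp add: power_mult)
        then show ?thesis using pow_fixator[OF sr_exists(1)[OF H]] rho_pow_ord by (simp add: F_def)
      qed
      have "generate GL {sr H ^^ b} = F"
        by (rule primitive_eigenvalue_generates(1)[OF H F _ sF]) (auto simp: F_def[symmetric] cF pow[OF n], auto simp: F_def)
      then have "m = n" using b cF by (simp add: pow_GL m_def)
      then show "b = a" using a n m1 by simp
    qed
    then show ?thesis using True by (simp add: fixator_index_def)
  next
    case False
    \<comment> \<open>A nontrivial element of \<open>C\<close> fixing \<open>H\<close> would be a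
      reflection and put \<open>H\<close> among the hyperplanes of \<open>C\<close>. So
      \<open>m = 1\<close>, in agreement with the default value \<open>ord H\<close> of the
      index.\<close>
    have "c = id" if "c \<in> fixator C H" for c
    proof (rule ccontr)
      assume "c \<noteq> id"
      then have "H \<in> C.hyps"
        using that hyps_hyperplane[OF H] by (intro C.reflection_onI(2)[of c]) (auto simp: fixator_def)
      then show False using False by blast
    qed
    then have "fixator C H = {id}" using C.id_fixator by blast
    then have "m = 1" by (simp add: m_def)
    then show ?thesis using a False by (simp add: fixator_index_def ord_def)
  qed
  then show ?thesis using a sa gen_pow by (simp add: m_def)
qed

text \<open>Both \<open>ord\<close> and the order of the fixator in \<open>C\<close> are invariant
  under conjugation by \<open>c\<close>, and their quotient is the index.\<close>

lemma idx_image: "c \<in> C \<Longrightarrow> H \<in> hyps \<Longrightarrow> idx (c ` H) = idx H"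
proof -
  assume c: "c \<in> C" and H: "H \<in> hyps"
  have cW: "c \<in> W" using c C_subset by blast
  have "idx (c ` H) * card (fixator C (c ` H)) = idx H * card (fixator C H)"
    using idx_props[OF W_hyps[OF cW H]] idx_props[OF H] ord_image[OF cW] by simp
  moreover have "card (fixator C H) \<noteq> 0"
    using C.id_fixator C.finite_fixator by (metis card_eq_0_iff empty_iff)
  ultimately show ?thesis by (simp add: C.card_fixator_image[OF c])
qed

end

section \<open>Polynomial invariants and Steinberg's theorem\<close>

text \<open>Polynomials are treated as functions on the space, generated without coordinates. The
  index is only an upper bound of the degree; it is the induction parameter when dividing by a
  linear form.\<close>

inductive poly_deg :: "nat \<Rightarrow> ('v::complex_fd_space \<Rightarrow> complex) \<Rightarrow> bool" where
  const: "poly_deg n (\<lambda>_. c)"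
| add: "poly_deg n f \<Longrightarrow> poly_deg n g \<Longrightarrow> poly_deg n (\<lambda>x. f x + g x)"
| lin: "clinear_form l \<Longrightarrow> poly_deg n f \<Longrightarrow> poly_deg (Suc n) (\<lambda>x. l x * f x)"

inductive homog_poly :: "nat \<Rightarrow> ('v::complex_fd_space \<Rightarrow> complex) \<Rightarrow> bool" where
  const: "homog_poly 0 (\<lambda>_. c)"
| add: "homog_poly n f \<Longrightarrow> homog_poly n g \<Longrightarrow> homog_poly n (\<lambda>x. f x + g x)"
| lin: "clinear_form l \<Longrightarrow> homog_poly n f \<Longrightarrow> homog_poly (Suc n) (\<lambda>x. l x * f x)"

definition poly_fun :: "('v::complex_fd_space \<Rightarrow> complex) \<Rightarrow> bool"
  where "poly_fun f \<longleftrightarrow> (\<exists>n. poly_deg n f)"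

lemma poly_deg_Suc: "poly_deg n f \<Longrightarrow> poly_deg (Suc n) f"
  by (induction rule: poly_deg.induct) (auto intro: poly_deg.intros)

lemma poly_deg_mono: "poly_deg n f \<Longrightarrow> n \<le> m \<Longrightarrow> poly_deg m f"
  by (rotate_tac, induction m rule: dec_induct) (auto intro: poly_deg_Suc)

lemma poly_deg_scale: "poly_deg n f \<Longrightarrow> poly_deg n (\<lambda>x. c * f x)"
proof (induction rule: poly_deg.induct)
  case (const n d) then show ?case using poly_deg.const[of n "c * d"] by simp
next
  case (add n f g) then show ?case using poly_deg.add[of n "\<lambda>x. c * f x" "\<lambda>x. c * g x"] by (simp add: algebra_simps)
next
  case (lin l n f) then show ?case using poly_deg.lin[of l n "\<lambda>x. c * f x"] by (simp add: mult.left_commute)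
qed

lemma poly_deg_mult: "poly_deg m f \<Longrightarrow> poly_deg n g \<Longrightarrow> poly_deg (m + n) (\<lambda>x. f x * g x)"
proof (induction rule: poly_deg.induct)
  case (const m c)
  then show ?case using poly_deg_mono[OF poly_deg_scale[of n g c], of "m + n"] by simp
next
  case (add m f1 f2)
  then show ?case using poly_deg.add[of "m + n" "\<lambda>x. f1 x * g x" "\<lambda>x. f2 x * g x"] by (simp add: algebra_simps)
next
  case (lin l m f)
  then show ?case using poly_deg.lin[of l "m + n" "\<lambda>x. f x * g x"] by (simp add: mult.assoc)
qed

lemma poly_fun_const [intro]: "poly_fun (\<lambda>_. c)"
  unfolding poly_fun_def using poly_deg.const by blast

lemma poly_fun_add [intro]: "poly_fun f \<Longrightarrow> poly_fun g \<Longrightarrow> poly_fun (\<lambda>x. f x + g x)"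
proof -
  assume "poly_fun f" "poly_fun g"
  then obtain m n where "poly_deg m f" "poly_deg n g" by (auto simp: poly_fun_def)
  then have "poly_deg (m + n) f" "poly_deg (m + n) g" by (auto intro: poly_deg_mono)
  then show ?thesis unfolding poly_fun_def using poly_deg.add by blast
qed

lemma poly_fun_mult [intro]: "poly_fun f \<Longrightarrow> poly_fun g \<Longrightarrow> poly_fun (\<lambda>x. f x * g x)"
  unfolding poly_fun_def using poly_deg_mult by blast

lemma poly_fun_minus [intro]: "poly_fun f \<Longrightarrow> poly_fun (\<lambda>x. - f x)"
  using poly_fun_mult[OF poly_fun_const[of "-1"]] by simp

lemma poly_fun_diff [intro]: "poly_fun f \<Longrightarrow> poly_fun g \<Longrightarrow> poly_fun (\<lambda>x. f x - g x)"
  using poly_fun_add[OF _ poly_fun_minus] by simp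

lemma poly_fun_sum [intro]: "(\<And>i. i \<in> A \<Longrightarrow> poly_fun (f i)) \<Longrightarrow> poly_fun (\<lambda>x. \<Sum>i\<in>A. f i x)"
  by (induction A rule: infinite_finite_induct) auto

lemma poly_fun_prod [intro]: "(\<And>i. i \<in> A \<Longrightarrow> poly_fun (f i)) \<Longrightarrow> poly_fun (\<lambda>x. \<Prod>i\<in>A. f i x)"
  by (induction A rule: infinite_finite_induct) auto

lemma poly_fun_linear [intro]: "clinear_form l \<Longrightarrow> poly_fun l"
  unfolding poly_fun_def using poly_deg.lin[OF _ poly_deg.const[of 0 1]] by force

lemma poly_deg_compose:
  assumes w: "Vector_Spaces.linear scaleC scaleC w"
  shows "poly_deg n f \<Longrightarrow> poly_deg n (\<lambda>x. f (w x))"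
proof (induction rule: poly_deg.induct)
  case (lin l n f)
  interpret Vector_Spaces.linear scaleC scaleC w by fact
  have "clinear_form (\<lambda>x. l (w x))" using lin(1) by (simp add: clinear_form_def add scale)
  then show ?case using poly_deg.lin lin(3) by blast
qed (auto intro: poly_deg.intros)

lemma poly_fun_compose: "Vector_Spaces.linear scaleC scaleC w \<Longrightarrow> poly_fun f \<Longrightarrow> poly_fun (\<lambda>x. f (w x))"
  unfolding poly_fun_def using poly_deg_compose by blast

lemma poly_fun_continuous: "poly_fun f \<Longrightarrow> continuous_on A f"
proof -
  have "poly_deg n f \<Longrightarrow> continuous_on A f" for n
  proof (induction rule: poly_deg.induct)
    case (lin l n f)
    have "continuous_on A l"
      by (rule bounded_linear.continuous_on[OF clinear_form_bounded_linear[OF lin(1)] continuous_on_id])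
    then show ?case by (intro continuous_on_mult lin)
  qed (intro continuous_on_const continuous_on_add; assumption)+
  then show "poly_fun f \<Longrightarrow> continuous_on A f" by (auto simp: poly_fun_def)
qed

text \<open>Restriction to complex lines reduces questions about polynomial functions to univariate
  polynomials, both for zero divisors and for holomorphy.\<close>

lemma poly_fun_line:
  assumes "poly_fun f"
  shows "\<exists>p :: complex poly. \<forall>t. f (x + t *\<^sub>C u) = poly p t"
proof -
  have "poly_deg n f \<Longrightarrow> \<exists>p :: complex poly. \<forall>t. f (x + t *\<^sub>C u) = poly p t" for n
  proof (induction rule: poly_deg.induct)
    case (const n c) then show ?case by (intro exI[of _ "[:c:]"]) simp
  next
    case (add n f g) then show ?case by (metis poly_add)
  next
    case (lin l n f)
    then obtain p where p: "\<And>t. f (x + t *\<^sub>C u) = poly p t" by blast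
    have "l (x + t *\<^sub>C u) = poly [:l x, l u:] t" for t
      using lin(1) by (simp add: clinear_form_def)
    then show ?case using p by (intro exI[of _ "[:l x, l u:] * p"]) (simp del: mult_pCons_left mult_pCons_right)
  qed
  then show ?thesis using assms by (auto simp: poly_fun_def)
qed

text \<open>On the line through \<open>y\<close> and \<open>z\<close> both factors become univariate
  polynomials, the first one nonzero at parameter 0; parameter 1 is the point
  \<open>z\<close>.\<close>

lemma poly_fun_no_zero_divisors:
  assumes f: "poly_fun f" and g: "poly_fun g" and fg: "\<And>x. f x * g x = 0" and y: "f y \<noteq> 0"
  shows "g z = 0"
proof -
  obtain p where p: "\<And>t. f (y + t *\<^sub>C (z - y)) = poly p t" using poly_fun_line[OF f] by blast
  obtain q where q: "\<And>t. g (y + t *\<^sub>C (z - y)) = poly q t" using poly_fun_line[OF g] by blast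
  have "poly (p * q) t = 0" for t using fg by (simp add: p[symmetric] q[symmetric])
  then have "p * q = 0" using poly_all_0_iff_0 by blast
  moreover have "p \<noteq> 0" using y p[of 0] by auto
  ultimately have "q = 0" by simp
  then show ?thesis using q[of 1] by simp
qed

lemma homog_poly_deg: "homog_poly k f \<Longrightarrow> poly_deg k f"
  by (induction rule: homog_poly.induct) (auto intro: poly_deg.intros)

lemma homog_poly_fun: "homog_poly k f \<Longrightarrow> poly_fun f"
  unfolding poly_fun_def using homog_poly_deg by blast

lemma homog_poly_scale: "homog_poly k f \<Longrightarrow> f (c *\<^sub>C x) = c ^ k * f x"
  by (induction rule: homog_poly.induct) (auto simp: clinear_form_def algebra_simps)

lemma homog_poly_zero: "homog_poly k (\<lambda>_. 0)"
proof (induction k)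
  case (Suc k)
  have "clinear_form (\<lambda>_. 0)" by (simp add: clinear_form_def)
  from homog_poly.lin[OF this Suc] show ?case by simp
qed (rule homog_poly.const)

lemma poly_deg_homogeneous_decomposition:
  "poly_deg n f \<Longrightarrow> \<exists>F. (\<forall>k. homog_poly k (F k)) \<and> (\<forall>x. f x = (\<Sum>k\<le>n. F k x))"
proof (induction rule: poly_deg.induct)
  case (const n c)
  define F where "F = (\<lambda>k::nat. if k = 0 then (\<lambda>_. c) else (\<lambda>_::'a. 0))"
  have "homog_poly k (F k)" for k
    by (auto simp: F_def homog_poly_zero homog_poly.const)
  moreover have "(\<Sum>k\<le>n. F k x) = c" for x
    by (simp add: F_def if_distrib[of "\<lambda>f. f x"] cong: if_cong)
  ultimately show ?case by metis
next
  case (add n f g)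
  then obtain F G where "\<And>k. homog_poly k (F k)" "\<And>x. f x = (\<Sum>k\<le>n. F k x)"
    "\<And>k. homog_poly k (G k)" "\<And>x. g x = (\<Sum>k\<le>n. G k x)" by blast
  then show ?case
    by (intro exI[of _ "\<lambda>k x. F k x + G k x"]) (auto simp: sum.distrib intro: homog_poly.add)
next
  case (lin l n f)
  then obtain F where F: "\<And>k. homog_poly k (F k)" "\<And>x. f x = (\<Sum>k\<le>n. F k x)" by blast
  define G where "G = (\<lambda>k. case k of 0 \<Rightarrow> (\<lambda>_. 0) | Suc j \<Rightarrow> (\<lambda>x. l x * F j x))"
  have "homog_poly k (G k)" for k
    by (cases k) (auto simp: G_def homog_poly_zero intro!: homog_poly.lin lin(1) F(1))
  moreover have "l x * f x = (\<Sum>k\<le>Suc n. G k x)" for x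
    by (subst sum.atMost_Suc_shift) (simp add: G_def F(2) sum_distrib_left)
  ultimately show ?case by blast
qed

text \<open>Fraction-free Gaussian elimination over the integral domain of polynomial functions:
  with more unknowns (\<open>A\<close>) than equations (\<open>B\<close>) there is a nontrivial
  polynomial solution.\<close>

lemma poly_fun_elimination:
  assumes "finite B" "finite A" "card B < card A" "\<And>i w. i \<in> A \<Longrightarrow> w \<in> B \<Longrightarrow> poly_fun (v i w)"
  shows "\<exists>c. (\<forall>i\<in>A. poly_fun (c i)) \<and> (\<exists>i\<in>A. \<exists>x. c i x \<noteq> 0) \<and>
    (\<forall>w\<in>B. \<forall>x. (\<Sum>i\<in>A. c i x * v i w x) = (0::complex))"
  using assms
proof (induction B arbitrary: A v rule: finite_induct)
  case empty
  then have "A \<noteq> {}" by auto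
  then show ?case by (intro exI[of _ "\<lambda>_ _. 1"]) auto
next
  case (insert w0 B)
  show ?case
  proof (cases "\<forall>i\<in>A. \<forall>x. v i w0 x = 0")
    case True
    have "card B < card A" using insert.prems(2) insert.hyps by simp
    then obtain c where "\<forall>i\<in>A. poly_fun (c i)" "\<exists>i\<in>A. \<exists>x. c i x \<noteq> 0"
      "\<forall>w\<in>B. \<forall>x. (\<Sum>i\<in>A. c i x * v i w x) = 0"
      using insert.IH[of A v] insert.prems by blast
    then show ?thesis using True by (intro exI[of _ c]) auto
  next
    case False
    then obtain i0 y where i0: "i0 \<in> A" "v i0 w0 y \<noteq> 0" by blast
    define p where "p = v i0 w0"
    define A' where "A' = A - {i0}"
    \<comment> \<open>Cross-multiplication with the pivot \<open>p = v i0 w0\<close> eliminates the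
      unknown \<open>i0\<close> from the equations in \<open>B\<close>.\<close>
    define v' where "v' = (\<lambda>i w x. p x * v i w x - v i w0 x * v i0 w x)"
    have pf: "poly_fun (v i w)" if "i \<in> A" "w \<in> insert w0 B" for i w using insert.prems(3) that by blast
    have A: "finite A'" "A = insert i0 A'" "i0 \<notin> A'" using insert.prems(1) i0(1) by (auto simp: A'_def)
    have "\<exists>c. (\<forall>i\<in>A'. poly_fun (c i)) \<and> (\<exists>i\<in>A'. \<exists>x. c i x \<noteq> 0) \<and>
      (\<forall>w\<in>B. \<forall>x. (\<Sum>i\<in>A'. c i x * v' i w x) = 0)"
    proof (rule insert.IH)
      show "card B < card A'" using insert.prems(1,2) insert.hyps i0(1) by (simp add: A'_def)
      show "poly_fun (v' i w)" if "i \<in> A'" "w \<in> B" for i w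
        using that i0(1) unfolding v'_def p_def
        by (intro poly_fun_diff poly_fun_mult pf) (auto simp: A'_def)
    qed (use A in auto)
    then obtain c where c: "\<And>i. i \<in> A' \<Longrightarrow> poly_fun (c i)" "\<exists>i\<in>A'. \<exists>x. c i x \<noteq> 0"
      "\<And>w x. w \<in> B \<Longrightarrow> (\<Sum>i\<in>A'. c i x * v' i w x) = 0" by blast
    \<comment> \<open>The solution of the reduced system is multiplied by the pivot, and the
      coefficient of \<open>i0\<close> is then the one that solves the equation
      \<open>w0\<close>.\<close>
    define d where "d = (\<lambda>i. if i = i0 then (\<lambda>x. - (\<Sum>j\<in>A'. c j x * v j w0 x)) else (\<lambda>x. p x * c i x))"
    have split: "(\<Sum>i\<in>A. d i x * v i w x) =
        (\<Sum>i\<in>A'. p x * c i x * v i w x) - (\<Sum>j\<in>A'. c j x * v j w0 x) * v i0 w x" for w x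
    proof -
      have "(\<Sum>i\<in>A'. d i x * v i w x) = (\<Sum>i\<in>A'. p x * c i x * v i w x)"
        by (rule sum.cong) (auto simp: d_def A'_def)
      then show ?thesis unfolding A(2) using A(1,3) by (simp add: d_def)
    qed
    show ?thesis
    proof (intro exI[of _ d] conjI ballI allI)
      show "poly_fun (d i)" if "i \<in> A" for i
        using that i0(1) A(2) c(1) pf unfolding d_def p_def
        by (cases "i = i0") (auto intro!: poly_fun_minus poly_fun_sum poly_fun_mult)
      obtain i x where i: "i \<in> A'" "c i x \<noteq> 0" using c(2) by blast
      have "\<exists>x. p x * c i x \<noteq> 0"
      proof (rule ccontr)
        assume "\<nexists>x. p x * c i x \<noteq> 0"
        then have "p x * c i x = 0" for x by blast
        then have "c i x = 0"
          using poly_fun_no_zero_divisors[of p "c i" y x] pf[OF i0(1)] c(1)[OF i(1)] i0(2)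
          by (simp add: p_def)
        then show False using i by simp
      qed
      moreover have "i \<noteq> i0" using i(1) by (auto simp: A'_def)
      ultimately show "\<exists>i\<in>A. \<exists>x. d i x \<noteq> 0"
        using i(1) by (intro bexI[of _ i]) (auto simp: d_def A'_def)
      show "(\<Sum>i\<in>A. d i x * v i w x) = 0" if "w \<in> insert w0 B" for w x
      proof (cases "w = w0")
        case True
        then show ?thesis unfolding split by (simp add: p_def sum_distrib_right sum_distrib_left mult_ac)
      next
        case False
        then have "0 = (\<Sum>i\<in>A'. c i x * v' i w x)" using c(3) that by simp
        also have "\<dots> = (\<Sum>i\<in>A'. p x * c i x * v i w x) - (\<Sum>j\<in>A'. c j x * v j w0 x) * v i0 w x"
          by (simp add: v'_def sum_distrib_left sum_distrib_right sum_subtractf right_diff_distrib mult_ac)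
        finally show ?thesis unfolding split by simp
      qed
    qed
  qed
qed

text \<open>Each factor is the affine function given by the hermitian product with
  \<open>y - z\<close>, scaled to be 1 at \<open>y\<close> and 0 at \<open>z\<close>.\<close>

lemma (in hermitian_setting) poly_fun_interpolation:
  fixes y :: 'v
  assumes "finite Y" "y \<notin> Y"
  shows "\<exists>g. poly_fun g \<and> g y = 1 \<and> (\<forall>z\<in>Y. g z = 0)"
proof -
  define g where "g = (\<lambda>x. \<Prod>z\<in>Y. (herm x (y - z) - herm z (y - z)) * (1 / herm (y - z) (y - z)))"
  have "poly_fun g" unfolding g_def
    by (intro poly_fun_prod poly_fun_mult poly_fun_diff poly_fun_const poly_fun_linear clinear_form_herm)
  moreover have "g y = 1" unfolding g_def
  proof (intro prod.neutral ballI)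
    fix z assume "z \<in> Y"
    then have "herm (y - z) (y - z) \<noteq> 0" using assms(2) herm_self_eq_0 by fastforce
    then show "(herm y (y - z) - herm z (y - z)) * (1 / herm (y - z) (y - z)) = 1"
      by (metis herm_diff_left times_divide_eq_right mult.right_neutral divide_self)
  qed
  moreover have "\<forall>z\<in>Y. g z = 0" unfolding g_def using assms(1) by auto
  ultimately show ?thesis by blast
qed

section \<open>Invariants, coinvariants and freeness over the invariants\<close>

context reflection_setting
begin

definition invariant_poly :: "('v \<Rightarrow> complex) \<Rightarrow> bool"
  where "invariant_poly f \<longleftrightarrow> poly_fun f \<and> (\<forall>w\<in>W. \<forall>x. f (w x) = f x)"

text \<open>This is the Hilbert ideal, generated in the polynomial functions by the invariants
  vanishing at the origin; the quotient by it is the coinvariant algebra.\<close>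

inductive coinv_ideal :: "('v \<Rightarrow> complex) \<Rightarrow> bool" where
  zero: "coinv_ideal (\<lambda>_. 0)"
| add: "coinv_ideal f \<Longrightarrow> invariant_poly b \<Longrightarrow> b 0 = 0 \<Longrightarrow> poly_fun g \<Longrightarrow> coinv_ideal (\<lambda>x. f x + b x * g x)"

lemma coinv_ideal_add: "coinv_ideal g \<Longrightarrow> coinv_ideal f \<Longrightarrow> coinv_ideal (\<lambda>x. f x + g x)"
proof (induction rule: coinv_ideal.induct)
  case (add g b h)
  then show ?case using coinv_ideal.add[of "\<lambda>x. f x + g x" b h] by (simp add: add.assoc)
qed simp

lemma coinv_ideal_mult: "coinv_ideal f \<Longrightarrow> poly_fun h \<Longrightarrow> coinv_ideal (\<lambda>x. h x * f x)"
proof (induction rule: coinv_ideal.induct)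
  case (add f b g)
  then show ?case
    using coinv_ideal.add[of "\<lambda>x. h x * f x" b "\<lambda>x. h x * g x"] by (simp add: poly_fun_mult algebra_simps)
qed (simp add: coinv_ideal.zero)

lemma coinv_ideal_scale: "coinv_ideal f \<Longrightarrow> coinv_ideal (\<lambda>x. c * f x)"
  by (erule coinv_ideal_mult) (rule poly_fun_const)

lemma coinv_ideal_diff: "coinv_ideal f \<Longrightarrow> coinv_ideal g \<Longrightarrow> coinv_ideal (\<lambda>x. f x - g x)"
  using coinv_ideal_add[OF coinv_ideal_scale[of g "-1"], of f] by simp

lemma coinv_ideal_sum: "(\<And>i. i \<in> A \<Longrightarrow> coinv_ideal (f i)) \<Longrightarrow> coinv_ideal (\<lambda>x. \<Sum>i\<in>A. f i x)"
proof (induction A rule: infinite_finite_induct)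
  case (insert a A)
  then show ?case using coinv_ideal_add[of "\<lambda>x. \<Sum>i\<in>A. f i x" "f a"] by simp
qed (simp_all add: coinv_ideal.zero)

lemma coinv_ideal_gen: "invariant_poly b \<Longrightarrow> b 0 = 0 \<Longrightarrow> poly_fun g \<Longrightarrow> coinv_ideal (\<lambda>x. b x * g x)"
  using coinv_ideal.add[OF coinv_ideal.zero] by simp

lemma coinv_ideal_W: "coinv_ideal f \<Longrightarrow> w \<in> W \<Longrightarrow> coinv_ideal (\<lambda>x. f (w x))"
proof (induction rule: coinv_ideal.induct)
  case (add f b g)
  have "b (w x) = b x" for x using add by (auto simp: invariant_poly_def)
  moreover have "poly_fun (\<lambda>x. g (w x))" using poly_fun_compose[OF W_linear] add by blast
  ultimately show ?case using coinv_ideal.add[of "\<lambda>x. f (w x)" b "\<lambda>x. g (w x)"] add by simp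
qed (simp add: coinv_ideal.zero)

lemma invariant_poly_add: "invariant_poly f \<Longrightarrow> invariant_poly g \<Longrightarrow> invariant_poly (\<lambda>x. f x + g x)"
  and invariant_poly_minus: "invariant_poly f \<Longrightarrow> invariant_poly (\<lambda>x. - f x)"
  and invariant_poly_const: "invariant_poly (\<lambda>_. c)"
  unfolding invariant_poly_def by auto

lemma invariant_poly_fun: "invariant_poly f \<Longrightarrow> poly_fun f"
  by (simp add: invariant_poly_def)

definition reynolds :: "('v \<Rightarrow> complex) \<Rightarrow> 'v \<Rightarrow> complex"
  where "reynolds f x = (\<Sum>w\<in>W. f (w x)) / of_nat (card W)"

lemma card_W_pos: "of_nat (card W) \<noteq> (0::complex)"
  using finite_W id_W by auto

lemma reynolds_invariant:
  assumes "poly_fun f" shows "invariant_poly (reynolds f)"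
  unfolding invariant_poly_def
proof (intro conjI ballI allI)
  have "poly_fun (\<lambda>x. (\<Sum>w\<in>W. f (w x)) * (1 / of_nat (card W)))"
    using poly_fun_compose[OF W_linear assms] by (intro poly_fun_mult poly_fun_sum) auto
  then show "poly_fun (reynolds f)" by (simp add: reynolds_def[abs_def])
  fix v x assume v: "v \<in> W"
  have "(\<Sum>w\<in>W. f (w (v x))) = (\<Sum>w\<in>W. f (w x))"
  proof (rule sum.reindex_bij_witness[where i = "\<lambda>w. w \<circ> finv v" and j = "\<lambda>w. w \<circ> v"])
    fix w assume w: "w \<in> W"
    show "(w \<circ> v) \<circ> finv v = w" "(w \<circ> finv v) \<circ> v = w"
      by (simp_all add: fun_eq_iff W_inv_apply[OF v])
    show "w \<circ> v \<in> W" "w \<circ> finv v \<in> W" by (intro comp_W inv_W w v)+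
  qed simp
  then show "reynolds f (v x) = reynolds f x" by (simp add: reynolds_def)
qed

lemma reynolds_mult: "invariant_poly a \<Longrightarrow> reynolds (\<lambda>x. a x * f x) x = a x * reynolds f x"
  by (simp add: reynolds_def invariant_poly_def sum_distrib_left)

text \<open>The difference vanishes on \<open>H\<close> and is therefore divisible by
  \<open>lf H\<close>; the quotient is built by a product rule, the case of a linear form being the
  formula for \<open>r x\<close>. Since \<open>n - 1\<close> is truncated at zero, the last conjunct
  records that constants have divided difference zero.\<close>

lemma divided_difference:
  assumes H: "H \<in> hyps" and r: "r \<in> fixator W H"
  shows "poly_deg n f \<Longrightarrow> \<exists>g. poly_deg (n - 1) g \<and> (\<forall>x. f x - f (r x) = lf H x * g x) \<and> (n = 0 \<longrightarrow> g = (\<lambda>_. 0))"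
proof (induction rule: poly_deg.induct)
  case (const n c)
  then show ?case by (intro exI[of _ "\<lambda>_. 0"]) (auto intro: poly_deg.const)
next
  case (add n f1 f2)
  then obtain g1 g2 where g: "poly_deg (n - 1) g1" "\<And>x. f1 x - f1 (r x) = lf H x * g1 x" "n = 0 \<longrightarrow> g1 = (\<lambda>_. 0)"
    "poly_deg (n - 1) g2" "\<And>x. f2 x - f2 (r x) = lf H x * g2 x" "n = 0 \<longrightarrow> g2 = (\<lambda>_. 0)" by blast
  have "f1 x + f2 x - (f1 (r x) + f2 (r x)) = lf H x * (g1 x + g2 x)" for x
    unfolding distrib_left g(2,5)[symmetric] by simp
  then show ?case using g by (intro exI[of _ "\<lambda>x. g1 x + g2 x"]) (simp add: poly_deg.add)
next
  case (lin l n f)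
  then obtain g where g: "poly_deg (n - 1) g" "\<And>x. f x - f (r x) = lf H x * g x" "n = 0 \<longrightarrow> g = (\<lambda>_. 0)" by blast
  have rW: "Vector_Spaces.linear scaleC scaleC r" using r W_linear by (auto simp: fixator_def)
  define c where "c = (1 - lf H (r (nrm H))) * l (nrm H)"
  have l: "l x - l (r x) = lf H x * c" for x
  proof -
    have "l (x + y) = l x + l y" "l (z *\<^sub>C x) = z * l x" for x y z
      using lin(1) by (simp_all add: clinear_form_def)
    then have "l (r x) = l x + (lf H (r (nrm H)) - 1) * lf H x * l (nrm H)"
      by (simp only: fixator_apply[OF H r, of x])
    then show ?thesis by (simp add: c_def algebra_simps)
  qed
  have "poly_deg n (\<lambda>x. l x * g x)"
  proof (cases n)
    case 0
    then show ?thesis using g(3) poly_deg.const[of 0 0] by simp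
  next
    case (Suc m)
    then show ?thesis using poly_deg.lin[OF lin(1) g(1)] by simp
  qed
  then have "poly_deg n (\<lambda>x. l x * g x + c * f (r x))"
    by (intro poly_deg.add poly_deg_scale poly_deg_compose[OF rW] lin(2))
  moreover have "l x * f x - l (r x) * f (r x) = lf H x * (l x * g x + c * f (r x))" for x
  proof -
    have "l x * f x - l (r x) * f (r x) = l x * (f x - f (r x)) + (l x - l (r x)) * f (r x)"
      by (simp add: algebra_simps)
    then show ?thesis unfolding g(2) l by (simp add: algebra_simps)
  qed
  ultimately show ?case by (intro exI[of _ "\<lambda>x. l x * g x + c * f (r x)"]) simp
qed

text \<open>The differences telescope along a product of reflections, and the ideal is stable under
  \<open>W\<close>. Generation of \<open>W\<close> by reflections enters the invariant theory
  exactly here.\<close>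

lemma coinv_ideal_W_generate:
  assumes "\<And>H r. H \<in> hyps \<Longrightarrow> r \<in> fixator W H \<Longrightarrow> coinv_ideal (\<lambda>x. f x - f (r x))" "w \<in> W"
  shows "coinv_ideal (\<lambda>x. f x - f (w x))"
proof -
  have "w \<in> generate GL {r \<in> W. \<exists>H. reflection_on r H}"
    using assms(2) refl_group by (simp add: reflection_group_def)
  then have "w \<in> W \<and> coinv_ideal (\<lambda>x. f x - f (w x))"
  proof (induction rule: generate.induct)
    case one show ?case using coinv_ideal.zero id_W id_W[unfolded id_def] by simp
  next
    case (incl r)
    then obtain H where H: "reflection_on r H" "r \<in> W" by blast
    then show ?case
      using assms(1)[of H r] by (auto simp: reflection_hyperplanes_def fixator_def reflection_on_def)
  next
    case (inv r)
    then obtain H where H: "reflection_on r H" "r \<in> W" by blast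
    then have "r \<in> fixator W H" "H \<in> hyps"
      by (auto simp: reflection_hyperplanes_def fixator_def reflection_on_def)
    then show ?case
      using assms(1)[of H "inv\<^bsub>GL\<^esub> r"] subgroup.m_inv_closed[OF fixator_subgroup] by (auto simp: fixator_def)
  next
    case (eng v w)
    then have "coinv_ideal (\<lambda>x. (f x - f (w x)) + (f (w x) - f (v (w x))))"
      by (intro coinv_ideal_add[OF coinv_ideal_W]) auto
    then show ?case using eng comp_W[of v w] by (simp add: o_def)
  qed
  then show ?thesis by blast
qed

text \<open>Chevalley's lemma, localised at the origin to avoid homogeneous coefficients.\<close>

lemma chevalley:
  assumes "poly_deg n f0" "finite A" "\<And>i. i \<in> A \<Longrightarrow> invariant_poly (a i)" "\<And>i. i \<in> A \<Longrightarrow> poly_fun (f i)"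
    "invariant_poly a0" "\<And>x. a0 x * f0 x + (\<Sum>i\<in>A. a i x * f i x) = 0"
  shows "coinv_ideal f0 \<or> (\<exists>e b. invariant_poly e \<and> e 0 \<noteq> 0 \<and> (\<forall>i\<in>A. invariant_poly (b i)) \<and>
    (\<forall>x. e x * a0 x = (\<Sum>i\<in>A. b i x * a i x)))"
  using assms
proof (induction n arbitrary: f0 f rule: less_induct)
  case (less n)
  show ?case
  proof (rule disjCI)
    assume no: "\<not> (\<exists>e b. invariant_poly e \<and> e 0 \<noteq> 0 \<and> (\<forall>i\<in>A. invariant_poly (b i)) \<and>
      (\<forall>x. e x * a0 x = (\<Sum>i\<in>A. b i x * a i x)))"
    note f0 = less.prems(1) and finA = less.prems(2) and a = less.prems(3) and f = less.prems(4)
      and a0 = less.prems(5) and rel = less.prems(6)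
    have pf0: "poly_fun f0" using f0 by (auto simp: poly_fun_def)
    \<comment> \<open>Subtracting from the relation its image under \<open>r\<close> and cancelling
      \<open>lf H\<close> gives a relation with the same invariant coefficients and the divided
      difference \<open>g0\<close> in place of \<open>f0\<close>. The excluded alternative speaks of
      the coefficients only, so the induction hypothesis puts \<open>g0\<close> into the
      ideal.\<close>
    have diff: "coinv_ideal (\<lambda>x. f0 x - f0 (r x))" if H: "H \<in> hyps" and r: "r \<in> fixator W H" for H r
    proof -
      have rW: "r \<in> W" using r by (simp add: fixator_def)
      obtain g0 where g0: "poly_deg (n - 1) g0" "\<And>x. f0 x - f0 (r x) = lf H x * g0 x" "n = 0 \<longrightarrow> g0 = (\<lambda>_. 0)"
        using divided_difference[OF H r f0] by blast
      have "\<exists>g. poly_fun g \<and> (\<forall>x. f i x - f i (r x) = lf H x * g x)" if "i \<in> A" for i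
        using f[OF that] divided_difference[OF H r] unfolding poly_fun_def by blast
      then obtain g where g: "\<And>i. i \<in> A \<Longrightarrow> poly_fun (g i)"
        "\<And>i x. i \<in> A \<Longrightarrow> f i x - f i (r x) = lf H x * g i x" by metis
      have relg: "a0 x * g0 x + (\<Sum>i\<in>A. a i x * g i x) = 0" for x
      proof (rule poly_fun_no_zero_divisors[of "lf H"])
        show "poly_fun (lf H)" by (rule poly_fun_linear[OF lf_linear])
        show "poly_fun (\<lambda>x. a0 x * g0 x + (\<Sum>i\<in>A. a i x * g i x))"
          using g(1) a a0 g0(1) by (intro poly_fun_add poly_fun_sum poly_fun_mult)
            (auto simp: invariant_poly_def poly_fun_def)
        show "lf H (nrm H) \<noteq> 0" by (simp add: lf_nrm[OF H])
        fix x
        have "a i (r x) = a i x" if "i \<in> A" for i using a[OF that] rW by (simp add: invariant_poly_def)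
        then have "(\<Sum>i\<in>A. a i x * f i x) - (\<Sum>i\<in>A. a i (r x) * f i (r x)) = (\<Sum>i\<in>A. a i x * (f i x - f i (r x)))"
          by (simp add: sum_subtractf right_diff_distrib)
        also have "\<dots> = lf H x * (\<Sum>i\<in>A. a i x * g i x)"
          by (simp add: g(2) sum_distrib_left mult_ac)
        finally have 1: "(\<Sum>i\<in>A. a i x * f i x) - (\<Sum>i\<in>A. a i (r x) * f i (r x)) = lf H x * (\<Sum>i\<in>A. a i x * g i x)" .
        have "a0 (r x) = a0 x" using a0 rW by (simp add: invariant_poly_def)
        then have 2: "a0 x * f0 x - a0 (r x) * f0 (r x) = lf H x * (a0 x * g0 x)"
          using g0(2)[of x] by (metis mult.left_commute right_diff_distrib)
        show "lf H x * (a0 x * g0 x + (\<Sum>i\<in>A. a i x * g i x)) = 0"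
          unfolding distrib_left 1[symmetric] 2[symmetric]
            eq_neg_iff_add_eq_0[THEN iffD2, OF rel] by simp
      qed
      \<comment> \<open>In degree zero the bound \<open>n - 1\<close> does not decrease, but there
        \<open>g0\<close> is zero.\<close>
      have "coinv_ideal g0"
      proof (cases "n = 0")
        case True then show ?thesis using g0(3) coinv_ideal.zero by simp
      next
        case False
        then have "coinv_ideal g0 \<or> (\<exists>e b. invariant_poly e \<and> e 0 \<noteq> 0 \<and> (\<forall>i\<in>A. invariant_poly (b i)) \<and>
            (\<forall>x. e x * a0 x = (\<Sum>i\<in>A. b i x * a i x)))"
          by (intro less.IH[of "n - 1" g0 g] g0(1) finA a g(1) a0 relg) auto
        then show ?thesis using no by blast
      qed
      then have "coinv_ideal (\<lambda>x. lf H x * g0 x)"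
        using coinv_ideal_mult poly_fun_linear[OF lf_linear] by blast
      then show ?thesis by (simp add: g0(2))
    qed
    \<comment> \<open>Modulo the ideal, \<open>f0\<close> equals its average \<open>e\<close> by
      \<open>diff\<close>. Averaging the relation expresses \<open>e * a0\<close> by the other
      coefficients; if \<open>e\<close> were nonzero at the origin this would be the excluded
      alternative, so \<open>e\<close> is an invariant vanishing at the origin and lies in the
      ideal.\<close>
    define e where "e = reynolds f0"
    have e: "invariant_poly e" unfolding e_def by (rule reynolds_invariant[OF pf0])
    have R1: "e x * a0 x = (\<Sum>i\<in>A. - reynolds (f i) x * a i x)" for x
    proof -
      have "0 = reynolds (\<lambda>x. a0 x * f0 x + (\<Sum>i\<in>A. a i x * f i x)) x"
        by (simp add: reynolds_def rel)
      also have "\<dots> = reynolds (\<lambda>x. a0 x * f0 x) x + (\<Sum>i\<in>A. reynolds (\<lambda>x. a i x * f i x) x)"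
        unfolding reynolds_def sum.distrib sum.swap[of _ A W]
          by (simp add: add_divide_distrib sum_divide_distrib)
      also have "\<dots> = a0 x * reynolds f0 x + (\<Sum>i\<in>A. a i x * reynolds (f i) x)"
        using reynolds_mult[OF a0] reynolds_mult[OF a] by simp
      finally show ?thesis unfolding e_def
        by (simp add: sum_negf mult.commute eq_neg_iff_add_eq_0)
    qed
    have R2: "invariant_poly (\<lambda>x. - reynolds (f i) x)" if "i \<in> A" for i
      by (intro invariant_poly_minus reynolds_invariant f that)
    have e0: "e 0 = 0"
    proof (rule ccontr)
      assume "e 0 \<noteq> 0"
      have no': "\<not> (invariant_poly e \<and> e 0 \<noteq> 0 \<and> (\<forall>i\<in>A. invariant_poly (b i)) \<and>
        (\<forall>x. e x * a0 x = (\<Sum>i\<in>A. b i x * a i x)))" for b using no by blast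
      show False
        by (rule notE[OF no'[of "\<lambda>i x. - reynolds (f i) x"]]) (intro conjI ballI allI e R1 R2 \<open>e 0 \<noteq> 0\<close>)
    qed
    have "coinv_ideal e" using coinv_ideal_gen[OF e e0 poly_fun_const[of 1]] by simp
    moreover have "coinv_ideal (\<lambda>x. 1 / of_nat (card W) * (\<Sum>w\<in>W. f0 x - f0 (w x)))"
      by (intro coinv_ideal_scale coinv_ideal_sum coinv_ideal_W_generate[OF diff])
    ultimately have "coinv_ideal (\<lambda>x. 1 / of_nat (card W) * (\<Sum>w\<in>W. f0 x - f0 (w x)) + e x)"
      by (rule coinv_ideal_add)
    moreover have "1 / of_nat (card W) * (\<Sum>w\<in>W. f0 x - f0 (w x)) + e x = f0 x" for x
    proof -
      have "1 / n * (n * a - b) + b / n = a" if "n \<noteq> 0" for n a b :: complex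
        using that by (simp add: field_simps)
      from this[OF card_W_pos] show ?thesis by (simp add: e_def reynolds_def sum_subtractf)
    qed
    ultimately show "coinv_ideal f0" by simp
  qed
qed

definition coinv_independent :: "'i set \<Rightarrow> ('i \<Rightarrow> 'v \<Rightarrow> complex) \<Rightarrow> bool"
  where "coinv_independent A f \<longleftrightarrow>
    (\<forall>c. coinv_ideal (\<lambda>x. \<Sum>i\<in>A. c i * f i x) \<longrightarrow> (\<forall>i\<in>A. c i = 0))"

text \<open>Independence modulo the ideal lifts to independence over the ring of invariants. Since
  \<open>f j\<close> is not in the ideal, Chevalley's lemma gives \<open>e * a j\<close> as a
  combination of the other coefficients, and substitution leaves a relation between the functions
  \<open>f' i = e * f i + b i * f j\<close>. Modulo the ideal the invariants \<open>e\<close> and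
  \<open>b i\<close> may be replaced by their values at the origin, and \<open>e 0\<close> is
  nonzero, so the family \<open>f'\<close> is again independent.\<close>

lemma coinv_independent_invariant_relation:
  assumes "finite A" "\<And>i. i \<in> A \<Longrightarrow> poly_fun (f i)" "coinv_independent A f"
    "\<And>i. i \<in> A \<Longrightarrow> invariant_poly (a i)" "\<And>x. (\<Sum>i\<in>A. a i x * f i x) = 0"
  shows "\<forall>i\<in>A. \<forall>x. a i x = 0"
  using assms
proof (induction A arbitrary: a f rule: finite_induct)
  case (insert j A)
  note pf = insert.prems(1) and ind = insert.prems(2) and a = insert.prems(3) and rel = insert.prems(4)
  have "\<not> coinv_ideal (f j)"
  proof
    assume "coinv_ideal (f j)"
    then have "coinv_ideal (\<lambda>x. \<Sum>i\<in>insert j A. (if i = j then 1 else 0) * f i x)"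
      using insert.hyps by (simp add: if_distrib[of "\<lambda>c. c * _"] cong: if_cong)
    then show False
      using ind[unfolded coinv_independent_def, rule_format, of "\<lambda>i. if i = j then 1 else 0" j] by simp
  qed
  then obtain e b where e: "invariant_poly e" "e 0 \<noteq> 0" and b: "\<And>i. i \<in> A \<Longrightarrow> invariant_poly (b i)"
    and eb: "\<And>x. e x * a j x = (\<Sum>i\<in>A. b i x * a i x)"
  proof -
    have "coinv_ideal (f j) \<or> (\<exists>e b. invariant_poly e \<and> e 0 \<noteq> 0 \<and> (\<forall>i\<in>A. invariant_poly (b i)) \<and>
        (\<forall>x. e x * a j x = (\<Sum>i\<in>A. b i x * a i x)))" if "poly_deg n (f j)" for n
      using rel insert.hyps pf a by (intro chevalley[OF that, where f = f]) auto
    then show ?thesis using that \<open>\<not> coinv_ideal (f j)\<close> pf[of j] unfolding poly_fun_def by blast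
  qed
  define f' where "f' = (\<lambda>i x. e x * f i x + b i x * f j x)"
  have "\<forall>i\<in>A. \<forall>x. a i x = 0"
  proof (rule insert.IH)
    show "poly_fun (f' i)" if "i \<in> A" for i
      unfolding f'_def using that pf e(1) b
      by (intro poly_fun_add poly_fun_mult) (auto simp: invariant_poly_def)
    show "invariant_poly (a i)" if "i \<in> A" for i using a that by blast
    show "(\<Sum>i\<in>A. a i x * f' i x) = 0" for x
    proof -
      have "(\<Sum>i\<in>A. a i x * f' i x) = e x * (\<Sum>i\<in>A. a i x * f i x) + (\<Sum>i\<in>A. b i x * a i x) * f j x"
        by (simp add: f'_def sum.distrib algebra_simps sum_distrib_left sum_distrib_right)
      also have "\<dots> = e x * (\<Sum>i\<in>insert j A. a i x * f i x)"
        unfolding eb[symmetric] using insert.hyps by (simp add: algebra_simps)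
      finally show ?thesis using rel by simp
    qed
    show "coinv_independent A f'"
      unfolding coinv_independent_def
    proof (intro allI impI)
      fix c assume c: "coinv_ideal (\<lambda>x. \<Sum>i\<in>A. c i * f' i x)"
      have "coinv_ideal (\<lambda>x. c i * ((e x - e 0) * f i x + (b i x - b i 0) * f j x))" if i: "i \<in> A" for i
      proof -
        have "coinv_ideal (\<lambda>x. (e x + - e 0) * f i x)"
          by (intro coinv_ideal_gen invariant_poly_add e invariant_poly_const pf) (use i in auto)
        moreover have "coinv_ideal (\<lambda>x. (b i x + - b i 0) * f j x)"
          by (intro coinv_ideal_gen invariant_poly_add b invariant_poly_const pf i) auto
        ultimately show ?thesis
          using coinv_ideal_scale[OF coinv_ideal_add, of _ _ "c i"] by simp
      qed
      then have "coinv_ideal (\<lambda>x. \<Sum>i\<in>A. c i * ((e x - e 0) * f i x + (b i x - b i 0) * f j x))"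
        by (rule coinv_ideal_sum)
      then have "coinv_ideal (\<lambda>x. (\<Sum>i\<in>A. c i * f' i x) -
          (\<Sum>i\<in>A. c i * ((e x - e 0) * f i x + (b i x - b i 0) * f j x)))"
        by (rule coinv_ideal_diff[OF c])
      moreover have "(\<Sum>i\<in>A. c i * f' i x) -
          (\<Sum>i\<in>A. c i * ((e x - e 0) * f i x + (b i x - b i 0) * f j x)) =
          (\<Sum>i\<in>insert j A. (if i = j then \<Sum>i\<in>A. c i * b i 0 else c i * e 0) * f i x)" for x
      proof -
        have "(\<Sum>i\<in>insert j A. (if i = j then \<Sum>i\<in>A. c i * b i 0 else c i * e 0) * f i x) =
          (\<Sum>i\<in>A. c i * b i 0) * f j x + (\<Sum>i\<in>A. c i * e 0 * f i x)"
          using insert.hyps by (subst sum.insert) (auto intro!: sum.cong)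
        then show ?thesis unfolding sum_subtractf[symmetric]
          by (simp add: f'_def algebra_simps sum.distrib sum_distrib_left)
      qed
      ultimately have "coinv_ideal (\<lambda>x. \<Sum>i\<in>insert j A. (if i = j then \<Sum>i\<in>A. c i * b i 0 else c i * e 0) * f i x)"
        by simp
      then have "\<forall>i\<in>insert j A. (if i = j then \<Sum>i\<in>A. c i * b i 0 else c i * e 0) = 0"
        by (rule ind[unfolded coinv_independent_def, rule_format, THEN ballI])
      then show "\<forall>i\<in>A. c i = 0" using e(2) insert.hyps(2) by (metis insertI2 mult_eq_0_iff)
    qed
  qed
  moreover have "a j x = 0" for x
  proof (rule poly_fun_no_zero_divisors[of e "a j" 0])
    show "e x * a j x = 0" for x using eb[of x] calculation by simp
  qed (use e a in \<open>auto simp: invariant_poly_def\<close>)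
  ultimately show ?case by blast
qed simp

text \<open>A family larger than \<open>W\<close> admits a nontrivial polynomial relation valid
  simultaneously for all translates by elements of \<open>W\<close>. Multiplied by a function
  \<open>g\<close> and averaged it becomes a relation with invariant coefficients, which must
  vanish.\<close>

lemma coinv_independent_card:
  assumes A: "finite A" and pf: "\<And>i. i \<in> A \<Longrightarrow> poly_fun (f i)" and ind: "coinv_independent A f"
  shows "card A \<le> card W"
proof (rule ccontr)
  assume "\<not> card A \<le> card W"
  then have "card W < card A" by simp
  then obtain c where c: "\<And>i. i \<in> A \<Longrightarrow> poly_fun (c i)" "\<exists>i\<in>A. \<exists>x. c i x \<noteq> 0"
    "\<And>w x. w \<in> W \<Longrightarrow> (\<Sum>i\<in>A. c i x * f i (w x)) = 0"
    using poly_fun_elimination[OF finite_W A, of "\<lambda>i w x. f i (w x)"] poly_fun_compose[OF W_linear pf] by blast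
  obtain j y where j: "j \<in> A" "c j y \<noteq> 0" using c(2) by blast
  \<comment> \<open>\<open>g\<close> is 1 at \<open>y\<close> and 0 on the rest of its orbit, so the
    average of \<open>g * c j\<close> at \<open>y\<close> is \<open>c j y\<close> times the order of
    the stabiliser of \<open>y\<close>, up to the factor \<open>card W\<close>. This keeps the
    averaged coefficient from vanishing.\<close>
  obtain g where g: "poly_fun g" "g y = 1" "\<forall>z\<in>(\<lambda>w. w y) ` W - {y}. g z = 0"
    using poly_fun_interpolation[of "(\<lambda>w. w y) ` W - {y}" y] finite_W by auto
  have "\<forall>i\<in>A. \<forall>x. reynolds (\<lambda>x. g x * c i x) x = 0"
  proof (rule coinv_independent_invariant_relation[OF A pf ind])
    show "invariant_poly (reynolds (\<lambda>x. g x * c i x))" if "i \<in> A" for i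
      by (intro reynolds_invariant poly_fun_mult g c that)
    fix x
    have "(\<Sum>i\<in>A. g (w x) * c i (w x) * f i x) = 0" if w: "w \<in> W" for w
    proof -
      have "(\<Sum>i\<in>A. g (w x) * c i (w x) * f i x) = g (w x) * (\<Sum>i\<in>A. c i (w x) * f i (finv w (w x)))"
        by (simp add: sum_distrib_left mult_ac W_inv_apply[OF w])
      then show ?thesis by (simp add: c(3)[OF inv_W[OF w]])
    qed
    then have "(\<Sum>w\<in>W. \<Sum>i\<in>A. g (w x) * c i (w x) * f i x) = 0" by simp
    then have "(\<Sum>i\<in>A. \<Sum>w\<in>W. g (w x) * c i (w x) * f i x) = 0" by (simp only: sum.swap[of _ W A])
    then show "(\<Sum>i\<in>A. reynolds (\<lambda>x. g x * c i x) x * f i x) = 0"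
      by (simp add: reynolds_def sum_distrib_right sum_divide_distrib[symmetric])
  qed
  then have "reynolds (\<lambda>x. g x * c j x) y = 0" using j(1) by blast
  then have "(\<Sum>w\<in>W. g (w y) * c j (w y)) = 0" using card_W_pos by (simp add: reynolds_def)
  moreover have "(\<Sum>w\<in>W. g (w y) * c j (w y)) = (\<Sum>w | w \<in> W \<and> w y = y. c j y)"
  proof (rule sum.mono_neutral_cong_right)
    show "\<forall>w\<in>W - {w. w \<in> W \<and> w y = y}. g (w y) * c j (w y) = 0"
      using g(3) by auto
  qed (use finite_W g(2) in auto)
  moreover have "card {w. w \<in> W \<and> w y = y} \<noteq> 0"
    using finite_W id_W by (auto simp: card_eq_0_iff intro!: exI[of _ id])
  ultimately show False using j(2) by simp
qed

text \<open>A largest independent set of homogeneous functions exists because \<open>card W\<close>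
  bounds its size. By maximality every further homogeneous function is a combination of it modulo
  the ideal.\<close>

lemma exists_homogeneous_coinvariant_basis:
  obtains A where "finite A" "card A \<le> card W" "\<And>f. f \<in> A \<Longrightarrow> \<exists>k. homog_poly k f"
    "\<And>g. \<exists>k. homog_poly k g \<Longrightarrow> \<exists>c. coinv_ideal (\<lambda>x. g x - (\<Sum>f\<in>A. c f * f x))"
proof -
  define \<A> where "\<A> = {A. finite A \<and> (\<forall>f\<in>A. \<exists>k. homog_poly k f) \<and> coinv_independent A (\<lambda>f. f)}"
  have bound: "card A \<le> card W" if "A \<in> \<A>" for A
    using that coinv_independent_card[of A "\<lambda>f. f"] homog_poly_fun unfolding \<A>_def by blast
  have "{} \<in> \<A>" by (simp add: \<A>_def coinv_independent_def)
  then obtain A where A: "A \<in> \<A>" "\<And>B. B \<in> \<A> \<Longrightarrow> card B \<le> card A"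
    using ex_has_greatest_nat[of "\<lambda>A. A \<in> \<A>" "{}" card "Suc (card W)"] bound le_imp_less_Suc by blast
  have fin: "finite A" and ind: "coinv_independent A (\<lambda>f. f)" using A(1) by (auto simp: \<A>_def)
  have "\<exists>c. coinv_ideal (\<lambda>x. g x - (\<Sum>f\<in>A. c f * f x))" if g: "homog_poly k g" for k g
  proof (cases "g \<in> A")
    case True
    have "(\<Sum>f\<in>A. (if f = g then 1 else 0) * f x) = g x" for x
      using True fin by (simp add: if_distrib[of "\<lambda>c. c * _"] cong: if_cong)
    then show ?thesis
      by (intro exI[of _ "\<lambda>f. if f = g then 1 else 0"]) (simp add: coinv_ideal.zero)
  next
    case False
    then have "insert g A \<notin> \<A>" using A(2)[of "insert g A"] fin by auto
    then have "\<not> coinv_independent (insert g A) (\<lambda>f. f)" using A(1) g by (auto simp: \<A>_def)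
    then obtain c h where c: "coinv_ideal (\<lambda>x. \<Sum>f\<in>insert g A. c f * f x)" "h \<in> insert g A" "c h \<noteq> 0"
      unfolding coinv_independent_def by blast
    have sum: "(\<Sum>f\<in>insert g A. c f * f x) = c g * g x + (\<Sum>f\<in>A. c f * f x)" for x
      using False fin by simp
    have cg: "c g \<noteq> 0"
    proof
      assume "c g = 0"
      then have "coinv_ideal (\<lambda>x. \<Sum>f\<in>A. c f * f x)" using c(1) by (simp add: sum)
      then have "\<forall>f\<in>A. c f = 0" using ind unfolding coinv_independent_def by blast
      then show False using c(2,3) \<open>c g = 0\<close> by auto
    qed
    have "coinv_ideal (\<lambda>x. (1 / c g) * (c g * g x + (\<Sum>f\<in>A. c f * f x)))"
      using coinv_ideal_scale[OF c(1), of "1 / c g"] by (simp only: sum)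
    moreover have "(1 / c g) * (c g * g x + (\<Sum>f\<in>A. c f * f x)) = g x - (\<Sum>f\<in>A. - (c f / c g) * f x)" for x
    proof -
      have "(1 / c g) * (c g * g x + (\<Sum>f\<in>A. c f * f x)) = g x + (\<Sum>f\<in>A. c f * f x) / c g"
        using cg by (simp add: add_divide_distrib)
      then show ?thesis by (simp add: sum_negf sum_divide_distrib)
    qed
    ultimately show ?thesis by (intro exI[of _ "\<lambda>f. - (c f / c g)"]) simp
  qed
  then show thesis using that[of A] fin bound[OF A(1)] A(1) unfolding \<A>_def by blast
qed

section \<open>Evaluation on orbits and the discriminant\<close>

definition orbit_functional :: "('v \<Rightarrow> 'v) set \<Rightarrow> (('v \<Rightarrow> 'v) \<Rightarrow> complex) \<Rightarrow> 'v \<Rightarrow> ('v \<Rightarrow> complex) \<Rightarrow> complex"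
  where "orbit_functional G c y f = (\<Sum>w\<in>G. c w * f (w y))"

abbreviation "ofun \<equiv> orbit_functional W"

lemma ofun_add: "ofun c y (\<lambda>x. f x + g x) = ofun c y f + ofun c y g"
  by (simp add: orbit_functional_def distrib_left sum.distrib)

lemma ofun_sum: "ofun c y (\<lambda>x. \<Sum>i\<in>A. f i x) = (\<Sum>i\<in>A. ofun c y (f i))"
  by (simp add: orbit_functional_def sum_distrib_left sum.swap[of _ A])

lemma ofun_mult: "(\<And>w. w \<in> W \<Longrightarrow> b (w y) = z) \<Longrightarrow> ofun c y (\<lambda>x. b x * f x) = z * ofun c y f"
  by (simp add: orbit_functional_def sum_distrib_left mult_ac)

lemma ofun_homog: "homog_poly k f \<Longrightarrow> ofun c (t *\<^sub>C y) f = t ^ k * ofun c y f"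
  by (simp add: orbit_functional_def W_scale homog_poly_scale sum_distrib_left mult_ac)

text \<open>An invariant takes a single value on the orbit of \<open>t *\<^sub>C y\<close>, and this
  value tends to 0 with \<open>t\<close> when the invariant vanishes at the origin; the cofactor
  contributes at least \<open>t ^ k\<close> because the lower homogeneous parts are killed. So the
  functional is of smaller order than \<open>t ^ k\<close> on the ideal.\<close>

lemma ofun_coinv_ideal:
  assumes low: "\<And>j f. j < k \<Longrightarrow> homog_poly j f \<Longrightarrow> ofun c y f = 0"
  shows "coinv_ideal h \<Longrightarrow> \<exists>q. (\<forall>t. ofun c (t *\<^sub>C y) h = t ^ k * q t) \<and> (q \<longlongrightarrow> 0) (at (0::complex))"
proof (induction rule: coinv_ideal.induct)
  case zero
  show ?case by (intro exI[of _ "\<lambda>_. 0"]) (simp add: orbit_functional_def)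
next
  case (add f b g)
  then obtain q where q: "\<And>t. ofun c (t *\<^sub>C y) f = t ^ k * q t" "(q \<longlongrightarrow> 0) (at 0)" by blast
  obtain n where "poly_deg n g" using add(4) by (auto simp: poly_fun_def)
  then obtain F where F: "\<And>j. homog_poly j (F j)" "\<And>x. g x = (\<Sum>j\<le>n. F j x)"
    using poly_deg_homogeneous_decomposition by blast
  define r where "r = (\<lambda>t. \<Sum>j\<in>{k..n}. t ^ (j - k) * ofun c y (F j))"
  have g: "ofun c (t *\<^sub>C y) g = t ^ k * r t" for t
  proof -
    have "ofun c (t *\<^sub>C y) g = (\<Sum>j\<le>n. t ^ j * ofun c y (F j))"
      by (simp add: F(2)[abs_def] ofun_sum ofun_homog[OF F(1)])
    also have "\<dots> = (\<Sum>j\<in>{k..n}. t ^ j * ofun c y (F j))"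
      by (rule sum.mono_neutral_right) (auto simp: low[OF _ F(1)])
    also have "\<dots> = t ^ k * r t"
      unfolding r_def sum_distrib_left
        by (rule sum.cong) (auto simp: power_add[symmetric] mult.assoc[symmetric])
    finally show ?thesis .
  qed
  have b: "b (w (t *\<^sub>C y)) = b (t *\<^sub>C y)" if "w \<in> W" for w t using add(2) that by (simp add: invariant_poly_def)
  have "((\<lambda>t. b (t *\<^sub>C y)) \<longlongrightarrow> b (0 *\<^sub>C y)) (at 0)"
  proof -
    obtain p where p: "\<And>t. b (0 + t *\<^sub>C y) = poly p t"
      using poly_fun_line[OF invariant_poly_fun[OF add(2)]] by blast
    then have "(\<lambda>t. b (t *\<^sub>C y)) = poly p" by auto
    moreover have "isCont (poly p) 0" by (rule poly_isCont)
    moreover have "b 0 = poly p 0" using p[of 0] by simp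
    ultimately show ?thesis by (simp add: isCont_def)
  qed
  then have "((\<lambda>t. b (t *\<^sub>C y)) \<longlongrightarrow> 0) (at 0)" using add(3) by simp
  moreover have "(r \<longlongrightarrow> r 0) (at 0)" unfolding r_def by (intro tendsto_intros)
  ultimately have "((\<lambda>t. q t + b (t *\<^sub>C y) * r t) \<longlongrightarrow> 0 + 0 * r 0) (at 0)"
    by (intro tendsto_add tendsto_mult q(2))
  moreover have "ofun c (t *\<^sub>C y) (\<lambda>x. f x + b x * g x) = t ^ k * (q t + b (t *\<^sub>C y) * r t)" for t
  proof -
    have "ofun c (t *\<^sub>C y) (\<lambda>x. b x * g x) = b (t *\<^sub>C y) * ofun c (t *\<^sub>C y) g"
      by (rule ofun_mult) (rule b)
    then show ?thesis by (simp add: ofun_add q(1) g algebra_simps)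
  qed
  ultimately show ?case by (intro exI[of _ "\<lambda>t. q t + b (t *\<^sub>C y) * r t"]) simp
qed

text \<open>Induction on the degree: modulo the ideal, \<open>g\<close> is a combination of the
  basis, on which the functional vanishes. By homogeneity its value at \<open>t *\<^sub>C y\<close>
  is exactly \<open>t ^ k\<close> times the value at \<open>y\<close>, while
  \<open>ofun_coinv_ideal\<close> makes the quotient tend to 0.\<close>

lemma ofun_determined:
  assumes A: "finite A" "\<And>f. f \<in> A \<Longrightarrow> \<exists>k. homog_poly k f"
    "\<And>g. \<exists>k. homog_poly k g \<Longrightarrow> \<exists>c. coinv_ideal (\<lambda>x. g x - (\<Sum>f\<in>A. c f * f x))"
    and 0: "\<And>f. f \<in> A \<Longrightarrow> ofun c y f = 0"
  shows "homog_poly k g \<Longrightarrow> ofun c y g = 0"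
proof (induction k arbitrary: g rule: less_induct)
  case (less k)
  obtain a where a: "coinv_ideal (\<lambda>x. g x - (\<Sum>f\<in>A. a f * f x))" using A(3)[OF exI, OF less.prems] by blast
  have "\<exists>q. (\<forall>t. ofun c (t *\<^sub>C y) (\<lambda>x. g x - (\<Sum>f\<in>A. a f * f x)) = t ^ k * q t) \<and> (q \<longlongrightarrow> 0) (at 0)"
    by (rule ofun_coinv_ideal[OF _ a]) (rule less.IH)
  then obtain q where q: "\<And>t. ofun c (t *\<^sub>C y) (\<lambda>x. g x - (\<Sum>f\<in>A. a f * f x)) = t ^ k * q t" "(q \<longlongrightarrow> 0) (at 0)"
    by blast
  have "ofun c y g = q t" if t: "t \<noteq> 0" for t
  proof -
    have "ofun c (t *\<^sub>C y) f = 0" if "f \<in> A" for f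
      using A(2)[OF that] ofun_homog 0[OF that] by fastforce
    then have "ofun c (t *\<^sub>C y) (\<lambda>x. \<Sum>f\<in>A. - a f * f x) = 0"
      unfolding ofun_sum by (intro sum.neutral ballI, subst ofun_mult) auto
    moreover have "ofun c (t *\<^sub>C y) (\<lambda>x. g x + (\<Sum>f\<in>A. - a f * f x)) = t ^ k * q t"
      using q(1)[of t] by (simp add: sum_negf)
    ultimately have "t ^ k * ofun c y g = t ^ k * q t"
      using ofun_homog[OF less.prems, of c t y] by (simp add: ofun_add)
    then show ?thesis using t by simp
  qed
  then have "eventually (\<lambda>t. q t = ofun c y g) (at 0)"
    by (auto simp: eventually_at_filter)
  then have "(q \<longlongrightarrow> ofun c y g) (at 0)" by (rule tendsto_eventually)
  then show ?case using q(2) tendsto_unique[OF trivial_limit_at] by blast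
qed

definition free_point :: "'v \<Rightarrow> bool" where "free_point y \<longleftrightarrow> (\<forall>w\<in>W. w y = y \<longrightarrow> w = id)"

text \<open>On a free orbit the points are distinct, so a polynomial separating \<open>v y\<close>
  from the others reads off the weight \<open>c v\<close>. The evaluations of the basis on a free
  orbit are therefore linearly independent.\<close>

lemma free_point_ofun_zero:
  assumes A: "finite A" "\<And>f. f \<in> A \<Longrightarrow> \<exists>k. homog_poly k f"
    "\<And>g. \<exists>k. homog_poly k g \<Longrightarrow> \<exists>c. coinv_ideal (\<lambda>x. g x - (\<Sum>f\<in>A. c f * f x))"
    and y: "free_point y" and 0: "\<And>f. f \<in> A \<Longrightarrow> ofun c y f = 0" and v: "v \<in> W"
  shows "c v = 0"
proof -
  obtain g where g: "poly_fun g" "g (v y) = 1" "\<forall>z\<in>(\<lambda>w. w y) ` (W - {v}) - {v y}. g z = 0"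
    using poly_fun_interpolation[of "(\<lambda>w. w y) ` (W - {v}) - {v y}" "v y"] finite_W by auto
  have "g (w y) = 0" if w: "w \<in> W - {v}" for w
  proof -
    have "w y \<noteq> v y"
    proof
      assume "w y = v y"
      then have "(finv v \<circ> w) y = y" using W_inv_apply(2)[OF v] by simp
      moreover have "finv v \<circ> w \<in> W" using w v by (intro comp_W inv_W) auto
      ultimately have "finv v \<circ> w = id" using y by (simp add: free_point_def)
      then have "finv v (w x) = x" for x by (metis comp_apply id_apply)
      then have "w x = v x" for x using W_inv_apply(1)[OF v] by metis
      then show False using w by auto
    qed
    then show ?thesis using g(3) w by blast
  qed
  then have "ofun c y g = c v"
    unfolding orbit_functional_def using v g(2) finite_W by (subst sum.remove[of _ v]) auto
  moreover have "ofun c y g = 0"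
  proof -
    obtain n where "poly_deg n g" using g(1) by (auto simp: poly_fun_def)
    then obtain F where F: "\<And>j. homog_poly j (F j)" "\<And>x. g x = (\<Sum>j\<le>n. F j x)"
      using poly_deg_homogeneous_decomposition by blast
    then show ?thesis using ofun_determined[OF A 0 F(1)] by (simp add: F(2)[abs_def] ofun_sum)
  qed
  ultimately show ?thesis by simp
qed

lemma exists_free_point: "\<exists>y. free_point y"
proof -
  have "\<exists>y. \<forall>U\<in>(\<lambda>w. {x. w x = x}) ` (W - {id}). y \<notin> U"
  proof (rule finite_union_proper_subspaces)
    fix U assume "U \<in> (\<lambda>w. {x. w x = x}) ` (W - {id})"
    then obtain w where w: "w \<in> W" "w \<noteq> id" "U = {x. w x = x}" by blast
    show "subspace U \<and> U \<noteq> UNIV"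
      using w by (auto simp: subspace_def W_add W_zero scaleR_scaleC W_scale fun_eq_iff)
  qed (simp add: finite_W)
  then show ?thesis by (auto simp: free_point_def)
qed

text \<open>The determinant of the evaluations of a homogeneous basis of the coinvariants on an orbit is
  a polynomial function.  Hence the set of points with nontrivial stabiliser is a hypersurface.\<close>

lemma exists_discriminant:
  obtains D where "poly_fun D" "\<And>y. D y = 0 \<longleftrightarrow> \<not> free_point y"
proof -
  obtain A where A: "finite A" "card A \<le> card W" "\<And>f. f \<in> A \<Longrightarrow> \<exists>k. homog_poly k f"
    "\<And>g. \<exists>k. homog_poly k g \<Longrightarrow> \<exists>c. coinv_ideal (\<lambda>x. g x - (\<Sum>f\<in>A. c f * f x))"
    by (rule exists_homogeneous_coinvariant_basis, rule that)
  define n where "n = card W"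
  have "card W \<le> card A"
  proof (rule ccontr)
    assume "\<not> card W \<le> card A"
    then have lt: "card A < card W" by simp
    obtain y where y: "free_point y" using exists_free_point by blast
    \<comment> \<open>The entries are constants here, so elimination amounts to linear algebra; the
      weights are obtained by evaluating the polynomial coefficients at a point \<open>x\<close>
      where one of them is nonzero.\<close>
    have "\<exists>c. (\<forall>w\<in>W. poly_fun (c w)) \<and> (\<exists>w\<in>W. \<exists>x. c w x \<noteq> 0) \<and>
      (\<forall>f\<in>A. \<forall>x :: 'v. (\<Sum>w\<in>W. c w x * f (w y)) = (0::complex))"
      by (rule poly_fun_elimination[OF A(1) finite_W lt]) (rule poly_fun_const)
    then obtain c v x where c: "v \<in> W" "c v x \<noteq> 0" "\<forall>f\<in>A. \<forall>x :: 'v. (\<Sum>w\<in>W. c w x * f (w y)) = 0"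
      by blast
    have "ofun (\<lambda>w. c w x) y f = 0" if "f \<in> A" for f
      unfolding orbit_functional_def using c(3) that by blast
    from free_point_ofun_zero[OF A(1,3,4) y this c(1)] have "c v x = 0" by simp
    then show False using c by simp
  qed
  then have "card A = n" using A(2) by (simp add: n_def)
  then obtain fl wl where fl: "bij_betw fl {0..<n} A" and wl: "bij_betw wl {0..<n} W"
    using ex_bij_betw_nat_finite[OF A(1)] ex_bij_betw_nat_finite[OF finite_W] by (auto simp: n_def)
  define D where "D = (\<lambda>y. \<Sum>p | p permutes {0..<n}. of_int (sign p) * (\<Prod>i = 0..<n. fl (p i) (wl i y)))"
  have wlW: "wl i \<in> W" if "i < n" for i using wl that by (auto simp: bij_betw_def)
  have flA: "fl i \<in> A" if "i < n" for i using fl that by (auto simp: bij_betw_def)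
  have "poly_fun D" unfolding D_def
  proof (intro poly_fun_sum poly_fun_mult poly_fun_const poly_fun_prod)
    fix p i assume "p \<in> {p. p permutes {0..<n}}" "i \<in> {0..<n}"
    then have "p i < n" "i < n" by (auto simp: permutes_in_image)
    then show "poly_fun (\<lambda>x. fl (p i) (wl i x))"
      using poly_fun_compose[OF W_linear[OF wlW]] A(3)[OF flA] homog_poly_fun by blast
  qed
  moreover have "D y = 0 \<longleftrightarrow> \<not> free_point y" for y
  proof
    assume "D y = 0"
    then obtain c i where c: "i < n" "c i \<noteq> 0" "\<And>j. j < n \<Longrightarrow> (\<Sum>i<n. c i * fl j (wl i y)) = 0"
      unfolding D_def leibniz_det_zero_iff[of "\<lambda>i j. fl j (wl i y)"] by blast
    define d where "d = (\<lambda>w. c (the_inv_into {0..<n} wl w))"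
    have d: "d (wl i) = c i" if "i < n" for i
      using wl that by (simp add: d_def bij_betw_def the_inv_into_f_f)
    have d0: "ofun d y f = 0" if "f \<in> A" for f
    proof -
      obtain j where j: "j < n" "f = fl j" using fl \<open>f \<in> A\<close> by (auto simp: bij_betw_def)
      have "ofun d y f = (\<Sum>i\<in>{0..<n}. d (wl i) * f (wl i y))"
        unfolding orbit_functional_def by (rule sum.reindex_bij_betw[OF wl, symmetric])
      also have "\<dots> = (\<Sum>i<n. c i * fl j (wl i y))"
        by (simp add: d j(2) atLeast0LessThan)
      finally show ?thesis using c(3)[OF j(1)] by simp
    qed
    show "\<not> free_point y"
    proof
      assume y: "free_point y"
      from free_point_ofun_zero[OF A(1,3,4) y d0 wlW[OF c(1)]] have "d (wl i) = 0" .
      then show False using d[OF c(1)] c(2) by simp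
    qed
  next
    assume "\<not> free_point y"
    then obtain w where w: "w \<in> W" "w y = y" "w \<noteq> id" by (auto simp: free_point_def)
    have W_eq: "W = wl ` {0..<n}" using wl by (simp add: bij_betw_def)
    obtain i where i: "i \<in> {0..<n}" "w = wl i" using w(1) unfolding W_eq by (rule imageE)
    obtain j where j: "j \<in> {0..<n}" "id = wl j" using id_W unfolding W_eq by (rule imageE)
    have ij: "i < n" "wl i = w" "j < n" "wl j = id" using i j by simp_all
    have ne: "i \<noteq> j" using ij w(3) by auto
    \<comment> \<open>Since \<open>w\<close> fixes \<open>y\<close>, the rows belonging to
      \<open>w\<close> and to the identity coincide; this is their difference.\<close>
    define c where "c = (\<lambda>k. if k = i then 1 else if k = j then -1 else (0::complex))"
    have "(\<Sum>k<n. c k * fl l (wl k y)) = 0" for l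
    proof -
      have "(\<Sum>k<n. c k * fl l (wl k y)) = (\<Sum>k\<in>{i, j}. c k * fl l (wl k y))"
        using ij by (intro sum.mono_neutral_right) (auto simp: c_def)
      then show ?thesis using ne ij w(2) by (simp add: c_def)
    qed
    then show "D y = 0"
      unfolding D_def leibniz_det_zero_iff[of "\<lambda>i j. fl j (wl i y)"]
      using ij(1) by (intro exI[of _ c] conjI exI[of _ i] allI impI) (simp_all add: c_def)
  qed
  ultimately show thesis using that by blast
qed

text \<open>If a nontrivial element fixing a regular \<open>x\<close> had a hyperplane of fixed
  points, it would be a reflection whose hyperplane contains \<open>x\<close>. So all these fixed
  spaces have codimension at least two, and two generic vectors span a plane meeting each of them
  only in 0.\<close>

lemma nonfree_regular_plane:
  assumes x: "x \<in> regular_part W"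
  obtains u u' where "\<And>w z z'. w \<in> W \<Longrightarrow> w \<noteq> id \<Longrightarrow> w x = x \<Longrightarrow>
    w (z *\<^sub>C u + z' *\<^sub>C u') = z *\<^sub>C u + z' *\<^sub>C u' \<Longrightarrow> z = 0 \<and> z' = 0"
proof -
  define F where "F = (\<lambda>w::'v \<Rightarrow> 'v. {x. w x = x})"
  define N where "N = {w \<in> W. w \<noteq> id \<and> w x = x}"
  have finN: "finite N" using finite_W by (simp add: N_def)
  have sub: "cvec.subspace (F w)" if "w \<in> N" for w
    using that W_fixed_subspace by (auto simp: F_def N_def)
  have real_sub: "subspace U" if "cvec.subspace U" for U :: "'v set"
    using that by (auto simp: subspace_def cvec.subspace_def scaleR_scaleC)
  have "\<exists>u. \<forall>U\<in>F ` N. u \<notin> U"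
  proof (rule finite_union_proper_subspaces)
    fix U assume "U \<in> F ` N"
    then obtain w where w: "w \<in> N" "U = F w" by blast
    then show "subspace U \<and> U \<noteq> UNIV"
      using real_sub[OF sub[OF w(1)]] by (auto simp: F_def N_def fun_eq_iff)
  qed (use finN in simp)
  then obtain u where u: "\<And>w. w \<in> N \<Longrightarrow> w u \<noteq> u" by (auto simp: F_def)
  have "\<exists>u'. \<forall>U\<in>(\<lambda>w. cvec.span (insert u (F w))) ` N. u' \<notin> U"
  proof (rule finite_union_proper_subspaces)
    fix U assume "U \<in> (\<lambda>w. cvec.span (insert u (F w))) ` N"
    then obtain w where w: "w \<in> N" "U = cvec.span (insert u (F w))" by blast
    have "U \<noteq> UNIV"
    proof
      assume "U = UNIV"
      then have "cvec.dim (insert u (F w)) = cvec.dim (UNIV :: 'v set)"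
        using w(2) cvec.dim_span by metis
      moreover have sp: "cvec.span (F w) = F w" using sub[OF w(1)] by simp
      moreover have "u \<notin> cvec.span (F w)" unfolding sp using u[OF w(1)] by (simp add: F_def)
      moreover have "u \<notin> F w" using u[OF w(1)] by (simp add: F_def)
      ultimately have "hyperplane (F w)"
        using sub[OF w(1)] cfin.dim_insert[of u "F w"] by (simp add: hyperplane_def split: if_splits)
      then have "F w \<in> hyps" using w(1) by (intro reflection_onI(2)[of w]) (auto simp: N_def F_def)
      then show False using x w(1) by (auto simp: regular_part_def F_def N_def)
    qed
    then show "subspace U \<and> U \<noteq> UNIV" using real_sub w(2) by simp
  qed (use finN in simp)
  then obtain u' where u': "\<And>w. w \<in> N \<Longrightarrow> u' \<notin> cvec.span (insert u (F w))" by blast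
  show thesis
  proof (rule that[of u u'])
    fix w z z' assume w: "w \<in> W" "w \<noteq> id" "w x = x"
      and fx: "w (z *\<^sub>C u + z' *\<^sub>C u') = z *\<^sub>C u + z' *\<^sub>C u'"
    then have wN: "w \<in> N" by (simp add: N_def)
    have inF: "z *\<^sub>C u + z' *\<^sub>C u' \<in> F w" using fx by (simp add: F_def)
    have z': "z' = 0"
    proof (rule ccontr)
      assume ne: "z' \<noteq> 0"
      have "inverse z' *\<^sub>C ((z *\<^sub>C u + z' *\<^sub>C u') - z *\<^sub>C u) \<in> cvec.span (insert u (F w))"
        by (intro cvec.span_scale cvec.span_diff cvec.span_base) (use inF in auto)
      then show False using u'[OF wN] ne by (simp add: scaleC_scaleC)
    qed
    moreover have "z = 0"
    proof (rule ccontr)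
      assume ne: "z \<noteq> 0"
      have "inverse z *\<^sub>C (z *\<^sub>C u) \<in> F w"
        using inF z' cvec.subspace_scale[OF sub[OF wN], of "z *\<^sub>C u" "inverse z"] by simp
      then show False using u[OF wN] ne by (simp add: F_def scaleC_scaleC)
    qed
    ultimately show "z = 0 \<and> z' = 0" by simp
  qed
qed

text \<open>Steinberg's theorem: a hypersurface has no component of codimension at least two, by the
  maximum principle applied to the reciprocal of its equation on a small bidisc.\<close>

theorem regular_part_free:
  assumes x: "x \<in> regular_part W" and w0: "w0 \<in> W" "w0 x = x"
  shows "w0 = id"
proof (rule ccontr)
  assume "w0 \<noteq> id"
  obtain D where D: "poly_fun D" "\<And>y. D y = 0 \<longleftrightarrow> \<not> free_point y" by (rule exists_discriminant, rule that)
  have Dx: "D x = 0" using D(2) w0 \<open>w0 \<noteq> id\<close> by (auto simp: free_point_def)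
  obtain u u' where uu: "\<And>w z z'. w \<in> W \<Longrightarrow> w \<noteq> id \<Longrightarrow> w x = x \<Longrightarrow>
    w (z *\<^sub>C u + z' *\<^sub>C u') = z *\<^sub>C u + z' *\<^sub>C u' \<Longrightarrow> z = 0 \<and> z' = 0"
    by (rule nonfree_regular_plane[OF x], rule that)
  define E where "E = (\<lambda>z z'. x + z *\<^sub>C u + z' *\<^sub>C u')"
  have contE: "continuous_on A (\<lambda>p. E (fst p) (snd p))" for A
    unfolding E_def by (intro continuous_intros)
  \<comment> \<open>Near \<open>x\<close> no stabiliser contains an element that moves
    \<open>x\<close>.\<close>
  define N where "N = (\<Inter>w\<in>{w \<in> W. w x \<noteq> x}. {y. w y \<noteq> y})"
  have "open N" unfolding N_def
    using finite_W continuous_W by (intro open_INT ballI open_Collect_neq continuous_on_id) auto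
  then have "open ((\<lambda>p. E (fst p) (snd p)) -` N)"
    using contE[of UNIV] by (simp add: open_vimage)
  moreover have "(0, 0) \<in> (\<lambda>p. E (fst p) (snd p)) -` N" by (auto simp: N_def E_def)
  ultimately obtain e where e: "e > 0" "\<And>p. dist p (0, 0) < e \<Longrightarrow> E (fst p) (snd p) \<in> N"
  proof -
    assume "open ((\<lambda>p. E (fst p) (snd p)) -` N)" "(0, 0) \<in> (\<lambda>p. E (fst p) (snd p)) -` N"
    then obtain e where "e > 0" "\<forall>p. dist p (0, 0) < e \<longrightarrow> p \<in> (\<lambda>p. E (fst p) (snd p)) -` N"
      unfolding open_dist by blast
    then show ?thesis using that[of e] by simp
  qed
  define \<rho> where "\<rho> = e / 4"
  have \<rho>: "\<rho> > 0" using e(1) by (simp add: \<rho>_def)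
  \<comment> \<open>On the small bidisc the zero of \<open>D\<close> at the centre is isolated: a
    nontrivial element fixing \<open>E z z'\<close> would fix \<open>x\<close>, hence the vector
    \<open>z *\<^sub>C u + z' *\<^sub>C u'\<close>.\<close>
  have free: "D (E z z') \<noteq> 0" if "cmod z \<le> \<rho>" "cmod z' \<le> \<rho>" "z \<noteq> 0 \<or> z' \<noteq> 0" for z z'
  proof -
    have "dist (z, z') (0, 0) \<le> cmod z + cmod z'"
      using norm_triangle_ineq[of "(z, 0)" "(0, z')"] by (simp add: dist_norm norm_Pair1 norm_Pair2)
    then have "dist (z, z') (0, 0) < e" using that e(1) by (simp add: \<rho>_def)
    then have inN: "E z z' \<in> N" using e(2)[of "(z, z')"] by simp
    have "free_point (E z z')"
      unfolding free_point_def
    proof (intro ballI impI, rule ccontr)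
      fix w assume w: "w \<in> W" "w (E z z') = E z z'" "w \<noteq> id"
      have wx: "w x = x" using inN w by (auto simp: N_def)
      then have "w (z *\<^sub>C u + z' *\<^sub>C u') = z *\<^sub>C u + z' *\<^sub>C u'"
        using w(2) by (simp add: E_def W_add[OF w(1)] add.assoc)
      then show False using uu[OF w(1,3) wx] that(3) by blast
    qed
    then show ?thesis using D(2) by blast
  qed
  have contD: "continuous_on A (\<lambda>p. D (E (fst p) (snd p)))" for A
    by (rule continuous_on_compose2[OF poly_fun_continuous[OF D(1), of UNIV] contE]) simp
  \<comment> \<open>The modulus of \<open>D\<close> has a positive minimum on this part of the
    boundary, uniformly in \<open>z'\<close>, including \<open>z' = 0\<close>.\<close>
  have "compact (sphere 0 \<rho> \<times> cball 0 \<rho> :: (complex \<times> complex) set)" by (intro compact_Times) auto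
  moreover have "sphere 0 \<rho> \<times> cball 0 \<rho> \<noteq> ({} :: (complex \<times> complex) set)"
    using \<rho> by (auto simp: sphere_eq_empty not_less)
  ultimately obtain p where p: "p \<in> sphere 0 \<rho> \<times> cball 0 \<rho>"
    "\<And>q. q \<in> sphere 0 \<rho> \<times> cball 0 \<rho> \<Longrightarrow> cmod (D (E (fst p) (snd p))) \<le> cmod (D (E (fst q) (snd q)))"
    using continuous_attains_inf[OF _ _ continuous_on_norm[OF contD]] by metis
  define m where "m = cmod (D (E (fst p) (snd p)))"
  have m: "m > 0" using p(1) free[of "fst p" "snd p"] \<rho> by (auto simp: m_def)
  \<comment> \<open>For \<open>z'\<close> nonzero the disc in the variable \<open>z\<close> misses
    the zero, so the reciprocal of \<open>D\<close> is holomorphic on it and bounded by its boundary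
    values. Letting \<open>z'\<close> tend to 0 bounds \<open>D x\<close> away from zero.\<close>
  have "m \<le> cmod (D (E 0 z'))" if z': "z' \<noteq> 0" "cmod z' \<le> \<rho>" for z'
  proof -
    obtain P where P: "\<And>z. D ((x + z' *\<^sub>C u') + z *\<^sub>C u) = poly P z" using poly_fun_line[OF D(1)] by blast
    have "E z z' = (x + z' *\<^sub>C u') + z *\<^sub>C u" for z by (simp add: E_def)
    then have P: "D (E z z') = poly P z" for z using P by metis
    have nz: "poly P z \<noteq> 0" if "z \<in> cball 0 \<rho>" for z
      using free[of z z'] that z' by (simp add: P)
    have "cmod (inverse (poly P 0)) \<le> inverse m"
    proof (rule maximum_modulus_frontier[of "\<lambda>z. inverse (poly P z)" "cball 0 \<rho>" "inverse m" 0])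
      show "(\<lambda>z. inverse (poly P z)) holomorphic_on interior (cball 0 \<rho>)"
        using nz interior_subset by (intro holomorphic_on_inverse holomorphic_intros) blast
      show "continuous_on (closure (cball 0 \<rho>)) (\<lambda>z. inverse (poly P z))"
        using nz by (intro continuous_intros) auto
      fix z :: complex assume "z \<in> frontier (cball 0 \<rho>)"
      then have "(z, z') \<in> sphere 0 \<rho> \<times> cball 0 \<rho>" using z' \<rho> by simp
      from p(2)[OF this] have "m \<le> cmod (poly P z)" by (simp add: m_def P)
      then show "cmod (inverse (poly P z)) \<le> inverse m"
        unfolding norm_inverse by (rule le_imp_inverse_le[OF _ m])
    qed (use \<rho> in auto)
    then have "inverse (cmod (poly P 0)) \<le> inverse m" unfolding norm_inverse .
    moreover have "poly P 0 \<noteq> 0" by (rule nz) (use \<rho> in simp)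
    then have "0 < cmod (poly P 0)" by (rule zero_less_norm_iff[THEN iffD2])
    ultimately have "m \<le> cmod (poly P 0)" by (rule inverse_le_imp_le)
    then show ?thesis by (simp only: P)
  qed
  then have "eventually (\<lambda>z'. m \<le> cmod (D (E 0 z'))) (at 0)"
    unfolding eventually_at by (intro exI[of _ \<rho>]) (use \<rho> in \<open>auto simp: dist_norm\<close>)
  moreover have "((\<lambda>z'. cmod (D (E 0 z'))) \<longlongrightarrow> cmod (D (E 0 0))) (at 0)"
  proof -
    obtain P where P: "\<And>z. D (x + z *\<^sub>C u') = poly P z" using poly_fun_line[OF D(1)] by blast
    then have "(\<lambda>z'. cmod (D (E 0 z'))) = (\<lambda>z. cmod (poly P z))" by (simp add: E_def)
    moreover have "cmod (D (E 0 0)) = cmod (poly P 0)" using P[of 0] by (simp add: E_def)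
    moreover have "((\<lambda>z. cmod (poly P z)) \<longlongrightarrow> cmod (poly P 0)) (at 0)"
      by (rule tendsto_norm[OF poly_isCont[unfolded isCont_def]])
    ultimately show ?thesis by simp
  qed
  ultimately have "m \<le> cmod (D (E 0 0))"
    by (intro tendsto_lowerbound[OF _ _ trivial_limit_at])
  then show False using m Dx by (simp add: E_def)
qed

end

section \<open>Loops in the complement of a hyperplane arrangement\<close>

text \<open>The two ways around the unit square are homotopic in the square by convexity, and
  \<open>K\<close> carries the homotopy over.\<close>

lemma homotopic_paths_square:
  fixes K :: "real \<times> real \<Rightarrow> 'a::topological_space"
  assumes K: "continuous_on ({0..1} \<times> {0..1}) K" "K ` ({0..1} \<times> {0..1}) \<subseteq> S"
  shows "homotopic_paths S ((\<lambda>s. K (s, 0)) +++ (\<lambda>t. K (1, t))) ((\<lambda>t. K (0, t)) +++ (\<lambda>s. K (s, 1)))"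
proof -
  let ?Q = "{0..1} \<times> {0..1} :: (real \<times> real) set"
  have "homotopic_paths ?Q (linepath (0,0) (1,0) +++ linepath (1,0) (1,1)) (linepath (0,0) (0,1) +++ linepath (0,1) (1,1))"
  proof (rule homotopic_paths_linear)
    fix t :: real assume t: "t \<in> {0..1}"
    have sub: "path_image (linepath (0,0) (1,0) +++ linepath (1,0) (1,1)) \<subseteq> ?Q"
      "path_image (linepath (0,0) (0,1) +++ linepath (0,1) (1,1)) \<subseteq> ?Q"
      by (auto simp: path_image_join closed_segment_def)
    then have "(linepath (0,0) (1,0) +++ linepath (1,0) (1,1)) t \<in> ?Q"
      "(linepath (0,0) (0,1) +++ linepath (0,1) (1,1)) t \<in> ?Q"
      using t unfolding path_image_def by blast+
    moreover have "convex ?Q" by (intro convex_Times) auto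
    ultimately show "closed_segment ((linepath (0,0) (1,0) +++ linepath (1,0) (1,1)) t)
        ((linepath (0,0) (0,1) +++ linepath (0,1) (1,1)) t) \<subseteq> ?Q"
      by (rule closed_segment_subset)
  qed auto
  then have "homotopic_paths S (K \<circ> (linepath (0,0) (1,0) +++ linepath (1,0) (1,1)))
      (K \<circ> (linepath (0,0) (0,1) +++ linepath (0,1) (1,1)))"
    by (rule homotopic_paths_continuous_image[OF _ K(1)]) (use K(2) in auto)
  then have "homotopic_paths S ((K \<circ> linepath (0,0) (1,0)) +++ (K \<circ> linepath (1,0) (1,1)))
      ((K \<circ> linepath (0,0) (0,1)) +++ (K \<circ> linepath (0,1) (1,1)))"
    by (simp only: path_compose_join)
  moreover have "K \<circ> linepath (0,0) (1,0) = (\<lambda>s. K (s, 0))" "K \<circ> linepath (1,0) (1,1) = (\<lambda>t. K (1, t))"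
    "K \<circ> linepath (0,0) (0,1) = (\<lambda>t. K (0, t))" "K \<circ> linepath (0,1) (1,1) = (\<lambda>s. K (s, 1))"
    by (auto simp: linepath_def fun_eq_iff)
  ultimately show ?thesis by simp
qed

text \<open>Any other continuous logarithm of the same path differs from \<open>q\<close> by a
  continuous function with values in a discrete set, hence by a constant.\<close>

lemma winding_number_exp:
  assumes q: "path q"
  shows "winding_number (\<lambda>t. exp (q t)) 0 = (q 1 - q 0) / (2 * of_real pi * \<i>)"
proof -
  let ?p = "\<lambda>t. exp (q t)"
  have "path ?p" using q unfolding path_def by (intro continuous_intros)
  moreover have "0 \<notin> path_image ?p" by (auto simp: path_image_def)
  ultimately obtain r where r: "path r" "pathfinish r - pathstart r = 2 * of_real pi * \<i> * winding_number ?p 0"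
    "\<And>t. t \<in> {0..1} \<Longrightarrow> ?p t = 0 + exp (r t)"
    by (rule winding_number_as_continuous_log) (rule that)
  have "(\<lambda>t. q t - r t) constant_on {0..1}"
  proof (rule continuous_discrete_range_constant)
    show "continuous_on {0..1} (\<lambda>t. q t - r t)"
      using q r(1) unfolding path_def by (intro continuous_intros)
    fix t :: real assume t: "t \<in> {0..1}"
    show "\<exists>e>0. \<forall>s. s \<in> {0..1} \<and> q s - r s \<noteq> q t - r t \<longrightarrow> e \<le> norm (q s - r s - (q t - r t))"
    proof (intro exI[of _ "2 * pi"] conjI allI impI)
      fix s :: real assume s: "s \<in> {0..1} \<and> q s - r s \<noteq> q t - r t"
      have "exp (q s) = exp (r s)" "exp (q t) = exp (r t)" using r(3) s t by simp_all
      then obtain m n :: int where "q s = r s + (of_int (2 * m) * pi) * \<i>" "q t = r t + (of_int (2 * n) * pi) * \<i>"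
        unfolding exp_eq by blast
      then have eq: "q s - r s - (q t - r t) = of_real (2 * pi * of_int (m - n)) * \<i>"
        by (simp add: algebra_simps)
      moreover have "m \<noteq> n" using s eq by auto
      then have "1 \<le> \<bar>real_of_int (m - n)\<bar>" by linarith
      ultimately show "2 * pi \<le> norm (q s - r s - (q t - r t))"
        by (simp add: norm_mult abs_mult del: of_real_mult)
    qed simp
  qed auto
  then have "q 1 - r 1 = q 0 - r 0"
    unfolding constant_on_def by (metis atLeastAtMost_iff order_refl zero_le_one)
  then have "q 1 - q 0 = 2 * of_real pi * \<i> * winding_number ?p 0"
    using r(2) by (simp add: pathfinish_def pathstart_def algebra_simps)
  then show ?thesis by (simp add: field_simps)
qed

lemma clinear_form_scaleR: "clinear_form l \<Longrightarrow> l (r *\<^sub>R x) = of_real r * l x"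
  by (simp add: clinear_form_def scaleR_scaleC)

text \<open>Scaling one of two nonnegative relations and subtracting the other gives a relation supported
  on an edge, which is excluded.\<close>

lemma positive_relation_unique:
  fixes a b c :: complex
  assumes edge: "\<And>s r. 0 \<le> s \<Longrightarrow> 0 \<le> r \<Longrightarrow> 0 < s + r \<Longrightarrow>
      of_real s * a + of_real r * b \<noteq> 0 \<and> of_real s * b + of_real r * c \<noteq> 0 \<and> of_real s * a + of_real r * c \<noteq> 0"
    and x: "0 \<le> x1" "0 \<le> x2" "0 \<le> x3" "x1 + x2 + x3 = 1" "of_real x1 * a + of_real x2 * b + of_real x3 * c = 0"
    and y: "0 \<le> y1" "0 \<le> y2" "0 \<le> y3" "y1 + y2 + y3 = 1" "of_real y1 * a + of_real y2 * b + of_real y3 * c = 0"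
  shows "x1 = y1" "x2 = y2" "x3 = y3" "0 < x1" "0 < x2" "0 < x3"
proof -
  show pos: "0 < x1" "0 < x2" "0 < x3"
  proof -
    show "0 < x1" using x edge[of x2 x3] by (cases "x1 = 0") auto
    show "0 < x2" using x edge[of x1 x3] by (cases "x2 = 0") auto
    show "0 < x3" using x edge[of x1 x2] by (cases "x3 = 0") auto
  qed
  \<comment> \<open>With the largest ratio, \<open>m * x - y\<close> is nonnegative and has a
    vanishing coordinate, so it is supported on an edge.\<close>
  define m where "m = max (y1 / x1) (max (y2 / x2) (y3 / x3))"
  have "y1 / x1 \<le> m" "y2 / x2 \<le> m" "y3 / x3 \<le> m" by (auto simp: m_def)
  then have ge: "0 \<le> m * x1 - y1" "0 \<le> m * x2 - y2" "0 \<le> m * x3 - y3"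
    using pos by (simp_all add: field_simps)
  have rel: "of_real (m * x1 - y1) * a + of_real (m * x2 - y2) * b + of_real (m * x3 - y3) * c = 0"
  proof -
    have "of_real (m * x1 - y1) * a + of_real (m * x2 - y2) * b + of_real (m * x3 - y3) * c
       = of_real m * (of_real x1 * a + of_real x2 * b + of_real x3 * c)
         - (of_real y1 * a + of_real y2 * b + of_real y3 * c)"
      by (simp add: algebra_simps)
    then show ?thesis using x(5) y(5) by simp
  qed
  have "m = y1 / x1 \<or> m = y2 / x2 \<or> m = y3 / x3" by (auto simp: m_def max_def)
  then have "m * x1 - y1 = 0 \<or> m * x2 - y2 = 0 \<or> m * x3 - y3 = 0" using pos by auto
  then have "m * x1 - y1 = 0 \<and> m * x2 - y2 = 0 \<and> m * x3 - y3 = 0"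
  proof (elim disjE)
    assume 0: "m * x1 - y1 = 0"
    then have "\<not> 0 < (m * x2 - y2) + (m * x3 - y3)"
      using rel edge[of "m * x2 - y2" "m * x3 - y3"] ge by (auto simp del: of_real_diff of_real_mult)
    then show ?thesis using 0 ge by linarith
  next
    assume 0: "m * x2 - y2 = 0"
    then have "\<not> 0 < (m * x1 - y1) + (m * x3 - y3)"
      using rel edge[of "m * x1 - y1" "m * x3 - y3"] ge by (auto simp del: of_real_diff of_real_mult)
    then show ?thesis using 0 ge by linarith
  next
    assume 0: "m * x3 - y3 = 0"
    then have "\<not> 0 < (m * x1 - y1) + (m * x2 - y2)"
      using rel edge[of "m * x1 - y1" "m * x2 - y2"] ge by (auto simp del: of_real_diff of_real_mult)
    then show ?thesis using 0 ge by linarith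
  qed
  then have m: "y1 = m * x1" "y2 = m * x2" "y3 = m * x3" by auto
  then have "m * (x1 + x2 + x3) = 1" using y(4) by (simp add: distrib_left)
  then have "m = 1" using x(4) by simp
  then show "x1 = y1" "x2 = y2" "x3 = y3" using m by auto
qed

text \<open>Only linear forms and transversal vectors are retained, without a group.
  \<open>distinct\<close> encodes that the kernels are pairwise different, in the form needed to
  find generic points.\<close>

locale arrangement =
  fixes I :: "'i set" and l :: "'i \<Rightarrow> 'v::complex_fd_space \<Rightarrow> complex" and d :: "'i \<Rightarrow> 'v"
  assumes finite_I: "finite I" and lin: "i \<in> I \<Longrightarrow> clinear_form (l i)" and ld: "i \<in> I \<Longrightarrow> l i (d i) = 1"
    and distinct: "i \<in> I \<Longrightarrow> j \<in> I \<Longrightarrow> i \<noteq> j \<Longrightarrow> \<exists>x. l i x = 0 \<and> l j x = 1"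
begin

definition compl :: "'v set" where "compl = {x. \<forall>i\<in>I. l i x \<noteq> 0}"

lemma l_add: "i \<in> I \<Longrightarrow> l i (x + y) = l i x + l i y"
  and l_scale: "i \<in> I \<Longrightarrow> l i (c *\<^sub>C x) = c * l i x"
  and l_scaleR: "i \<in> I \<Longrightarrow> l i (r *\<^sub>R x) = of_real r * l i x"
  using lin clinear_form_scaleR[OF lin] by (auto simp: clinear_form_def)

lemma l_diff: "i \<in> I \<Longrightarrow> l i (x - y) = l i x - l i y"
  using l_add[of i "x - y" y] by simp

lemma l_cont: "i \<in> I \<Longrightarrow> continuous_on A f \<Longrightarrow> continuous_on A (\<lambda>x. l i (f x))"
  by (rule bounded_linear.continuous_on[OF clinear_form_bounded_linear[OF lin]])

lemma open_compl: "open compl"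
proof -
  have "compl = (\<Inter>i\<in>I. {x. l i x \<noteq> 0})" by (auto simp: compl_def)
  moreover have "open {x. l i x \<noteq> 0}" if "i \<in> I" for i
    by (intro open_Collect_neq l_cont that continuous_intros)
  ultimately show ?thesis using finite_I by (simp add: open_INT)
qed

end

text \<open>\<open>\<psi>\<close> represents the fundamental groupoid of the complement and kills the small meridians; it is
  used with the quotient of the braid group by the full turns.\<close>

locale arrangement_functor = arrangement I l d + G: group G
  for I :: "'i set" and l :: "'i \<Rightarrow> 'v::complex_fd_space \<Rightarrow> complex" and d :: "'i \<Rightarrow> 'v"
    and G (structure) +
  fixes \<psi> :: "(real \<Rightarrow> 'v) \<Rightarrow> 'g"
  assumes closed [simp, intro]: "path p \<Longrightarrow> path_image p \<subseteq> compl \<Longrightarrow> \<psi> p \<in> carrier G"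
    and join: "\<lbrakk>path p; path_image p \<subseteq> compl; path q; path_image q \<subseteq> compl; pathfinish p = pathstart q\<rbrakk>
      \<Longrightarrow> \<psi> (p +++ q) = \<psi> p \<otimes> \<psi> q"
    and homotopic: "homotopic_paths compl p q \<Longrightarrow> \<psi> p = \<psi> q"
    and meridian: "\<lbrakk>i \<in> I; l i h = 0; c \<noteq> 0;
        \<And>z j. cmod z \<le> 1 \<Longrightarrow> j \<in> I \<Longrightarrow> j \<noteq> i \<Longrightarrow> l j (h + z *\<^sub>C c *\<^sub>C d i) \<noteq> 0\<rbrakk>
      \<Longrightarrow> \<psi> (\<lambda>t. h + exp (2 * \<i> * complex_of_real (pi * t)) *\<^sub>C c *\<^sub>C d i) = \<one>"
begin

lemma const_path: "x \<in> compl \<Longrightarrow> \<psi> (linepath x x) = \<one>"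
proof -
  assume x: "x \<in> compl"
  have "homotopic_paths compl (linepath x x +++ linepath x x) (linepath x x)"
    using x by (intro homotopic_paths_rid') auto
  then have "\<psi> (linepath x x) \<otimes> \<psi> (linepath x x) = \<psi> (linepath x x)"
    using join[of "linepath x x" "linepath x x"] homotopic x by simp
  moreover have "\<psi> (linepath x x) \<in> carrier G" using x by (intro closed) auto
  ultimately show ?thesis by (metis G.r_cancel_one)
qed

lemma reverse:
  assumes "path p" "path_image p \<subseteq> compl"
  shows "\<psi> p \<otimes> \<psi> (reversepath p) = \<one>"
proof -
  have "\<psi> p \<otimes> \<psi> (reversepath p) = \<psi> (p +++ reversepath p)" using assms by (simp add: join)
  also have "\<dots> = \<psi> (linepath (pathstart p) (pathstart p))"
    by (rule homotopic[OF homotopic_paths_rinv[OF assms]])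
  also have "\<dots> = \<one>" using assms by (intro const_path) auto
  finally show ?thesis .
qed

lemma convex_eq:
  assumes "convex T" "T \<subseteq> compl" "path p" "path q" "path_image p \<subseteq> T" "path_image q \<subseteq> T"
    "pathstart p = pathstart q" "pathfinish p = pathfinish q"
  shows "\<psi> p = \<psi> q"
proof (rule homotopic, rule homotopic_paths_linear)
  fix t :: real assume "t \<in> {0..1}"
  then have "p t \<in> T" "q t \<in> T" using assms(5,6) unfolding path_image_def by auto
  then show "closed_segment (p t) (q t) \<subseteq> compl" using assms(1,2) closed_segment_subset by blast
qed (use assms in auto)

lemma line_trans:
  assumes "closed_segment A B \<subseteq> compl" "X \<in> closed_segment A B"
  shows "\<psi> (linepath A B) = \<psi> (linepath A X) \<otimes> \<psi> (linepath X B)"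
proof -
  have sub: "closed_segment A X \<subseteq> closed_segment A B" "closed_segment X B \<subseteq> closed_segment A B"
    using assms(2) by (auto simp: subset_closed_segment)
  have "\<psi> (linepath A X) \<otimes> \<psi> (linepath X B) = \<psi> (linepath A X +++ linepath X B)"
    using sub assms(1) by (intro join[symmetric]) auto
  also have "\<dots> = \<psi> (linepath A B)"
    by (rule convex_eq[OF convex_closed_segment assms(1)]) (use sub in \<open>auto simp: path_image_join\<close>)
  finally show ?thesis by simp
qed

text \<open>The square lemma turns the homotopy into a conjugation by the track of the base point,
  and triviality is invariant under conjugation.\<close>

lemma free_homotopy:
  fixes K :: "real \<times> real \<Rightarrow> 'v"
  assumes K: "continuous_on ({0..1} \<times> {0..1}) K" "K ` ({0..1} \<times> {0..1}) \<subseteq> compl"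
    and loop: "\<And>s. s \<in> {0..1} \<Longrightarrow> K (s, 0) = K (s, 1)" and 1: "\<psi> (\<lambda>t. K (1, t)) = \<one>"
  shows "\<psi> (\<lambda>t. K (0, t)) = \<one>"
proof -
  have h: "continuous_on {0..1} (\<lambda>s. K (s, a))" "continuous_on {0..1} (\<lambda>t. K (a, t))" if "a \<in> {0..1}" for a
    using that by (auto intro!: continuous_on_compose2[OF K(1)] continuous_intros)
  have p: "path (\<lambda>s. K (s, a))" "path (\<lambda>t. K (a, t))" "path_image (\<lambda>s. K (s, a)) \<subseteq> compl"
    "path_image (\<lambda>t. K (a, t)) \<subseteq> compl" if "a \<in> {0..1}" for a
    using h[OF that] K(2) that by (auto simp: path_def path_image_def)
  have eq: "\<psi> (\<lambda>s. K (s, 0)) = \<psi> (\<lambda>s. K (s, 1))"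
    by (intro homotopic homotopic_paths_eq p loop) auto
  have "\<psi> (\<lambda>s. K (s, 0)) \<otimes> \<psi> (\<lambda>t. K (1, t)) = \<psi> ((\<lambda>s. K (s, 0)) +++ (\<lambda>t. K (1, t)))"
    by (intro join[symmetric] p) (auto simp: pathfinish_def pathstart_def)
  also have "\<dots> = \<psi> ((\<lambda>t. K (0, t)) +++ (\<lambda>s. K (s, 1)))"
    by (intro homotopic homotopic_paths_square K)
  also have "\<dots> = \<psi> (\<lambda>t. K (0, t)) \<otimes> \<psi> (\<lambda>s. K (s, 1))"
    by (intro join p) (auto simp: pathfinish_def pathstart_def)
  finally have "\<psi> (\<lambda>s. K (s, 1)) = \<psi> (\<lambda>t. K (0, t)) \<otimes> \<psi> (\<lambda>s. K (s, 1))"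
    using p[of 1] by (simp add: 1 eq)
  moreover have "\<psi> (\<lambda>t. K (0, t)) \<in> carrier G" "\<psi> (\<lambda>s. K (s, 1)) \<in> carrier G"
    by (intro closed p; simp)+
  ultimately show ?thesis using G.r_cancel_one'[of "\<psi> (\<lambda>s. K (s, 1))" "\<psi> (\<lambda>t. K (0, t))"] by blast
qed

text \<open>Inside a disc transversal to the hyperplane \<open>i\<close> and missing the others, a
  loop is classified by its winding number \<open>n\<close>, so it is homotopic to the circle run
  through \<open>n\<close> times, and each turn is a meridian.\<close>

lemma punctured_disc_loop:
  assumes i: "i \<in> I" and q: "l i q = 0"
    and adm: "\<And>z j. cmod z \<le> \<rho> \<Longrightarrow> j \<in> I \<Longrightarrow> j \<noteq> i \<Longrightarrow> l j (q + z *\<^sub>C d i) \<noteq> 0"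
    and z: "path z" "pathfinish z = pathstart z" "\<And>t. t \<in> {0..1} \<Longrightarrow> z t \<noteq> 0 \<and> cmod (z t) \<le> \<rho>"
  shows "\<psi> (\<lambda>t. q + z t *\<^sub>C d i) = \<one>"
proof -
  define b where "b = z 0"
  have b: "b \<noteq> 0" "cmod b \<le> \<rho>" using z(3)[of 0] by (auto simp: b_def)
  have \<rho>: "\<rho> > 0" using b by (metis norm_ge_zero norm_eq_zero order_le_less order.strict_trans1)
  \<comment> \<open>\<open>E x\<close> is reached from the starting value \<open>b\<close> after
    \<open>x\<close> full turns; \<open>F\<close> measures arcs additively, and an arc between
    consecutive integers is a meridian.\<close>
  define E where "E = (\<lambda>x::real. q + (b * exp (2 * \<i> * complex_of_real (pi * x))) *\<^sub>C d i)"
  have E_in: "E x \<in> compl" for x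
    unfolding compl_def
  proof (intro CollectI ballI)
    fix j assume j: "j \<in> I"
    have "cmod (b * exp (2 * \<i> * complex_of_real (pi * x))) \<le> \<rho>"
      using b by (simp add: norm_mult)
    then show "l j (E x) \<noteq> 0"
      using adm[OF _ j] b q i ld[OF i] by (cases "j = i") (auto simp: E_def l_add l_scale)
  qed
  have E_cont: "continuous_on A E" for A
    unfolding E_def by (intro continuous_intros)
  define F where "F = (\<lambda>x y. \<psi> (E \<circ> linepath x y))"
  have Ep: "path (E \<circ> linepath x y)" "path_image (E \<circ> linepath x y) \<subseteq> compl" for x y
    using E_in E_cont by (auto intro!: path_continuous_image simp: path_image_compose)
  have F_closed: "F x y \<in> carrier G" for x y unfolding F_def by (intro closed Ep)
  have F_trans: "F x y \<otimes> F y w = F x w" for x y w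
  proof -
    have "F x y \<otimes> F y w = \<psi> ((E \<circ> linepath x y) +++ (E \<circ> linepath y w))"
      unfolding F_def by (intro join[symmetric] Ep) (simp add: pathfinish_compose pathstart_compose)
    also have "\<dots> = \<psi> (E \<circ> (linepath x y +++ linepath y w))" by (simp add: path_compose_join)
    also have "\<dots> = F x w" unfolding F_def
      by (intro homotopic homotopic_paths_continuous_image[of UNIV, OF homotopic_paths_linear])
        (use E_cont E_in in auto)
    finally show ?thesis .
  qed
  have F_shift: "F (of_int n) (of_int n + 1) = \<one>" for n
  proof -
    have "(E \<circ> linepath (of_int n) (of_int n + 1)) t = q + exp (2 * \<i> * complex_of_real (pi * t)) *\<^sub>C b *\<^sub>C d i" for t
    proof -
      have "2 * \<i> * complex_of_real (pi * (of_int n + t)) =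
          2 * \<i> * complex_of_real (pi * t) + 2 * of_int n * of_real pi * \<i>"
        by (simp add: algebra_simps)
      moreover have "exp (2 * of_int n * of_real pi * \<i>) = 1"
        using exp_integer_2pi[of "of_int n"] by (simp add: mult_ac)
      ultimately have "exp (2 * \<i> * complex_of_real (pi * (of_int n + t))) = exp (2 * \<i> * complex_of_real (pi * t))"
        by (simp only: exp_add mult_1_right)
      moreover have "linepath (of_int n) (of_int n + 1) t = of_int n + t"
        by (simp add: linepath_def algebra_simps)
      ultimately show ?thesis by (simp only: E_def o_apply scaleC_scaleC mult.commute[of b])
    qed
    then have "E \<circ> linepath (of_int n) (of_int n + 1) = (\<lambda>t. q + exp (2 * \<i> * complex_of_real (pi * t)) *\<^sub>C b *\<^sub>C d i)"
      by auto
    moreover have "\<psi> (\<lambda>t. q + exp (2 * \<i> * complex_of_real (pi * t)) *\<^sub>C b *\<^sub>C d i) = \<one>"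
    proof (rule meridian[OF i q b(1)])
      fix w j assume w: "cmod w \<le> 1" and j: "j \<in> I" "j \<noteq> i"
      have "cmod (w * b) \<le> \<rho>" using w b mult_mono[of "cmod w" 1 "cmod b" \<rho>] by (simp add: norm_mult)
      from adm[OF this j] show "l j (q + w *\<^sub>C b *\<^sub>C d i) \<noteq> 0" by (simp add: scaleC_scaleC)
    qed
    ultimately show ?thesis by (simp add: F_def)
  qed
  have F0: "F x x = \<one>" for x
    using F_trans[of x x x] F_closed[of x x] by (metis G.r_cancel_one)
  have F_int: "F 0 (of_int n) = \<one>" for n
  proof (induction n rule: int_induct[where k = 0])
    case base show ?case using F0 by simp
  next
    case (step1 n)
    then show ?case using F_trans[of 0 "of_int n" "of_int n + 1"] F_shift[of n] F_closed by simp
  next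
    case (step2 n)
    then show ?case
      using F_trans[of 0 "of_int (n - 1)" "of_int n"] F_shift[of "n - 1"] F_closed[of 0 "of_int (n - 1)"]
        by simp
  qed
  have pz: "0 \<notin> path_image z" using z(3) by (auto simp: path_image_def)
  then have "winding_number z 0 \<in> \<int>" using z by (intro integer_winding_number) auto
  then obtain n where n: "winding_number z 0 = of_int n" by (auto elim: Ints_cases)
  \<comment> \<open>The standard loop with winding number \<open>n\<close> and the same base point
    \<open>b\<close> as \<open>z\<close>, written with a continuous logarithm.\<close>
  define y where "y = (\<lambda>t::real. exp (Ln b + 2 * \<i> * complex_of_real (pi * (of_int n * t))))"
  have y_eq: "y t = b * exp (2 * \<i> * complex_of_real (pi * (of_int n * t)))" for t
    using b by (simp add: y_def exp_add)
  have py: "path y" unfolding path_def y_def by (intro continuous_intros)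
  have y0: "0 \<notin> path_image y" by (auto simp: path_image_def y_def)
  have "winding_number y 0 = of_int n"
    unfolding y_def by (subst winding_number_exp) (auto simp: path_def intro!: continuous_intros)
  moreover have "y 0 = z 0" "y 1 = z 1"
  proof -
    have "exp (2 * of_int n * of_real pi * \<i>) = 1"
      using exp_integer_2pi[of "of_int n"] by (simp add: mult_ac)
    then have "exp (2 * \<i> * complex_of_real (pi * (of_int n * 1))) = 1"
      by (simp add: mult_ac)
    then show "y 0 = z 0" "y 1 = z 1" using z(2) b_def by (simp_all add: y_eq pathfinish_def pathstart_def)
  qed
  ultimately have hom: "homotopic_paths (- {0}) z y"
    using n z py pz y0
      by (subst winding_number_homotopic_paths_eq[symmetric]) (auto simp: pathfinish_def pathstart_def)
  \<comment> \<open>The library's homotopy lives in the whole punctured plane and may leave the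
    admissible disc; radial truncation at radius \<open>\<rho>\<close> brings it back and leaves
    \<open>z\<close> and \<open>y\<close> unchanged.\<close>
  define g where "g = (\<lambda>w. q + (of_real (min 1 (\<rho> / cmod w)) * w) *\<^sub>C d i)"
  have g_cont: "continuous_on (- {0}) g" unfolding g_def by (intro continuous_intros) auto
  have g_in: "g w \<in> compl" if "w \<noteq> 0" for w
    unfolding compl_def
  proof (intro CollectI ballI)
    fix j assume j: "j \<in> I"
    have "cmod (of_real (min 1 (\<rho> / cmod w)) * w) = min 1 (\<rho> / cmod w) * cmod w"
      using \<rho> by (simp add: norm_mult min_def)
    also have "\<dots> \<le> \<rho> / cmod w * cmod w" by (intro mult_right_mono) auto
    also have "\<dots> = \<rho>" using that by simp
    finally have "cmod (of_real (min 1 (\<rho> / cmod w)) * w) \<le> \<rho>" .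
    moreover have "min 1 (\<rho> / cmod w) \<noteq> 0" using \<rho> that by (auto simp: min_def)
    ultimately show "l j (g w) \<noteq> 0"
      using adm[OF _ j] q i ld[OF i] that by (cases "j = i") (auto simp: g_def l_add l_scale)
  qed
  have g_small: "g w = q + w *\<^sub>C d i" if "w \<noteq> 0" "cmod w \<le> \<rho>" for w
  proof -
    have "1 \<le> \<rho> / cmod w" using that by (simp add: field_simps)
    then show ?thesis by (simp add: g_def min_def)
  qed
  have "homotopic_paths compl (g \<circ> z) (g \<circ> y)"
    by (rule homotopic_paths_continuous_image[OF hom g_cont]) (use g_in in auto)
  then have "\<psi> (g \<circ> z) = \<psi> (g \<circ> y)" by (rule homotopic)
  moreover have "\<psi> (g \<circ> z) = \<psi> (\<lambda>t. q + z t *\<^sub>C d i)"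
  proof (rule homotopic, rule homotopic_paths_eq)
    show "path (g \<circ> z)" using z(1) pz by (intro path_continuous_image continuous_on_subset[OF g_cont]) auto
    show "path_image (g \<circ> z) \<subseteq> compl"
      unfolding path_image_compose using pz by (intro image_subsetI g_in) metis
    show "(g \<circ> z) t = q + z t *\<^sub>C d i" if "t \<in> {0..1}" for t using g_small z(3)[OF that] by simp
  qed
  moreover have "g \<circ> y = E \<circ> linepath 0 (of_int n)"
  proof
    fix t
    have "cmod (y t) \<le> \<rho>" "y t \<noteq> 0" using b by (simp_all add: y_eq norm_mult)
    then have "g (y t) = q + y t *\<^sub>C d i" using g_small by blast
    then show "(g \<circ> y) t = (E \<circ> linepath 0 (of_int n)) t"
      by (simp add: E_def y_eq linepath_def mult_ac)
  qed
  ultimately show ?thesis using F_int[of n] by (simp add: F_def)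
qed

end

lemma finite_positive_lower_bound:
  assumes "finite J" "\<And>j. j \<in> J \<Longrightarrow> 0 < (f j :: real)"
  shows "\<exists>\<mu>>0. \<forall>j\<in>J. \<mu> \<le> f j"
  using assms
proof (induction J rule: finite_induct)
  case empty show ?case by (intro exI[of _ 1]) simp
next
  case (insert a J)
  then obtain \<mu> where "\<mu> > 0" "\<forall>j\<in>J. \<mu> \<le> f j" by blast
  then show ?case using insert.prems[of a] by (intro exI[of _ "min \<mu> (f a)"]) (auto simp: min_le_iff_disj)
qed

lemma finite_continuous_upper_bound:
  fixes f :: "'j \<Rightarrow> real \<Rightarrow> real"
  assumes "finite J" "\<And>j. j \<in> J \<Longrightarrow> continuous_on {0..1} (f j)"
  shows "\<exists>M>0. \<forall>j\<in>J. \<forall>t\<in>{0..1}. f j t \<le> M"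
  using assms
proof (induction J rule: finite_induct)
  case empty show ?case by (intro exI[of _ 1]) simp
next
  case (insert a J)
  then obtain M where M: "M > 0" "\<forall>j\<in>J. \<forall>t\<in>{0..1}. f j t \<le> M" by blast
  obtain x where x: "\<forall>t\<in>{0..1}. f a t \<le> f a x"
    using continuous_attains_sup[of "{0..1::real}" "f a"] insert.prems by fastforce
  show ?case using M x by (intro exI[of _ "max M (f a x)"]) (auto simp: le_max_iff_disj)
qed

context arrangement_functor
begin

text \<open>The boundary is contracted towards the zero \<open>q\<close>, then flattened onto the
  transversal direction \<open>d i\<close>, keeping \<open>l i\<close> nonzero throughout; the
  result is a loop in a punctured disc. The homotopies appear below in reverse order, each reducing
  the previous loop to the next.\<close>

lemma triangle_one_hyperplane:
  assumes i: "i \<in> I" and q: "q \<in> convex hull {A, B, C}" "l i q = 0"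
    and others: "\<And>x j. x \<in> convex hull {A, B, C} \<Longrightarrow> j \<in> I \<Longrightarrow> j \<noteq> i \<Longrightarrow> l j x \<noteq> 0"
    and edges: "closed_segment A B \<subseteq> compl" "closed_segment B C \<subseteq> compl" "closed_segment C A \<subseteq> compl"
  shows "\<psi> (linepath A B) \<otimes> (\<psi> (linepath B C) \<otimes> \<psi> (linepath C A)) = \<one>"
proof -
  let ?T = "convex hull {A, B, C}"
  define p where "p = linepath A B +++ linepath B C +++ linepath C A"
  have p: "path p" "p 0 = p 1" "path_image p = closed_segment A B \<union> closed_segment B C \<union> closed_segment C A"
    by (simp add: p_def, simp add: p_def joinpaths_def linepath_def, simp add: p_def path_image_join Un_assoc)
  have ABC: "A \<in> ?T" "B \<in> ?T" "C \<in> ?T" by (auto intro: hull_inc)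
  have pT: "p t \<in> ?T" "p t \<in> compl" if "t \<in> {0..1}" for t
  proof -
    have "p t \<in> path_image p" using that by (auto simp: path_image_def)
    moreover have "path_image p \<subseteq> ?T"
      unfolding p(3) using ABC closed_segment_subset[OF _ _ convex_convex_hull] by blast
    ultimately show "p t \<in> ?T" "p t \<in> compl" using p(3) edges by blast+
  qed
  have pc: "continuous_on {0..1} p" using p(1) by (simp add: path_def)
  have pc2: "continuous_on ({0..1} \<times> {0..1}) (\<lambda>x. p (snd x))"
    by (rule continuous_on_compose2[OF pc]) (auto intro!: continuous_intros)
  obtain \<mu> where \<mu>: "\<mu> > 0" "\<And>j. j \<in> I - {i} \<Longrightarrow> \<mu> \<le> cmod (l j q)"
    using finite_positive_lower_bound[of "I - {i}" "\<lambda>j. cmod (l j q)"] finite_I others[OF q(1)] by auto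
  obtain M where M: "M > 0" "\<And>j t. j \<in> I \<Longrightarrow> t \<in> {0..1} \<Longrightarrow>
      cmod (l j (p t - q)) + cmod (l i (p t)) * (1 + cmod (l j (d i))) \<le> M"
  proof -
    have "\<exists>M>0. \<forall>j\<in>I. \<forall>t\<in>{0..1}. cmod (l j (p t - q)) + cmod (l i (p t)) * (1 + cmod (l j (d i))) \<le> M"
      by (rule finite_continuous_upper_bound[OF finite_I]) (intro continuous_intros l_cont i pc)
    then show ?thesis using that by blast
  qed
  define N where "N = (\<Sum>j\<in>I. cmod (l j (d i)))"
  have N: "N \<ge> 0" "\<And>j. j \<in> I \<Longrightarrow> cmod (l j (d i)) \<le> N"
    unfolding N_def using finite_I by (auto intro: sum_nonneg member_le_sum)
  \<comment> \<open>\<open>\<mu>\<close> bounds the other forms at \<open>q\<close> from below and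
    \<open>N\<close> bounds their values on \<open>d i\<close>, so the disc of radius
    \<open>\<rho>\<close> in direction \<open>d i\<close> meets no other hyperplane.\<close>
  define \<rho> where "\<rho> = \<mu> / (2 * (N + 1))"
  have \<rho>: "\<rho> > 0" "\<rho> * N < \<mu>" using \<mu>(1) N(1) by (auto simp: \<rho>_def field_simps intro!: add_nonneg_pos)
  \<comment> \<open>The bound by \<open>\<mu> / (2 * M)\<close> keeps the other forms nonzero while
    flattening; the bound by \<open>\<rho> / M\<close> puts the flattened loop into the admissible
    disc.\<close>
  define \<epsilon> where "\<epsilon> = min 1 (min (\<mu> / (2 * M)) (\<rho> / M))"
  have \<epsilon>: "0 < \<epsilon>" "\<epsilon> \<le> 1" "\<epsilon> * M < \<mu>" "\<epsilon> * M \<le> \<rho>"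
  proof -
    show "0 < \<epsilon>" "\<epsilon> \<le> 1" using \<mu> M \<rho> by (auto simp: \<epsilon>_def)
    have "\<epsilon> \<le> \<mu> / (2 * M)" "\<epsilon> \<le> \<rho> / M" by (auto simp: \<epsilon>_def)
    then have "\<epsilon> * M \<le> \<mu> / 2" "\<epsilon> * M \<le> \<rho>" using M(1) by (auto simp: field_simps)
    then show "\<epsilon> * M < \<mu>" "\<epsilon> * M \<le> \<rho>" using \<mu>(1) by auto
  qed
  have far: "l j (q + x) \<noteq> 0" if "j \<in> I" "j \<noteq> i" "cmod (l j x) < \<mu>" for j x
  proof
    assume "l j (q + x) = 0"
    then have "l j q = - l j x" using that(1) by (simp add: l_add eq_neg_iff_add_eq_0)
    then show False using \<mu>(2)[of j] that by simp
  qed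
  have 3: "\<psi> (\<lambda>t. q + (of_real \<epsilon> * l i (p t)) *\<^sub>C d i) = \<one>"
  proof (rule punctured_disc_loop[OF i q(2), of \<rho>])
    fix z j assume z: "cmod z \<le> \<rho>" and j: "j \<in> I" "j \<noteq> i"
    have "cmod (l j (z *\<^sub>C d i)) \<le> \<rho> * N"
      using z N(2)[OF j(1)] N(1) j(1) \<rho>(1) by (simp add: l_scale norm_mult mult_mono)
    then show "l j (q + z *\<^sub>C d i) \<noteq> 0" using far j \<rho>(2) by auto
  next
    show "path (\<lambda>t. of_real \<epsilon> * l i (p t))" unfolding path_def using pc i by (intro continuous_intros l_cont)
    show "pathfinish (\<lambda>t. of_real \<epsilon> * l i (p t)) = pathstart (\<lambda>t. of_real \<epsilon> * l i (p t))"
      using p(2) by (simp add: pathfinish_def pathstart_def)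
    fix t :: real assume t: "t \<in> {0..1}"
    have "cmod (l i (p t)) \<le> cmod (l i (p t)) * (1 + cmod (l i (d i)))" by (simp add: algebra_simps)
    also have "\<dots> \<le> M" using M(2)[OF i t] norm_ge_zero[of "l i (p t - q)"] by linarith
    finally have "\<epsilon> * cmod (l i (p t)) \<le> \<rho>"
      using \<epsilon> mult_left_mono[of "cmod (l i (p t))" M \<epsilon>] by linarith
    moreover have "l i (p t) \<noteq> 0" using pT(2)[OF t] i by (auto simp: compl_def)
    ultimately show "of_real \<epsilon> * l i (p t) \<noteq> 0 \<and> cmod (of_real \<epsilon> * l i (p t)) \<le> \<rho>"
      using \<epsilon>(1) by (simp add: norm_mult)
  qed
  have 2: "\<psi> (\<lambda>t. q + \<epsilon> *\<^sub>R (p t - q)) = \<one>"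
  proof -
    \<comment> \<open>The displacement from \<open>q\<close> is interpolated with its component
      along \<open>d i\<close>; both have the same value under \<open>l i\<close>, which therefore
      stays fixed.\<close>
    define K where "K = (\<lambda>x::real \<times> real. q + \<epsilon> *\<^sub>R ((1 - fst x) *\<^sub>R (p (snd x) - q) +
      (of_real (fst x) * l i (p (snd x))) *\<^sub>C d i))"
    have "\<psi> (\<lambda>t. K (0, t)) = \<one>"
    proof (rule free_homotopy)
      show "continuous_on ({0..1} \<times> {0..1}) K"
        unfolding K_def using i pc2 by (intro continuous_intros l_cont)
      show "K (s, 0) = K (s, 1)" for s by (simp add: K_def p(2))
      show "\<psi> (\<lambda>t. K (1, t)) = \<one>" using 3 by (simp add: K_def scaleR_scaleC scaleC_scaleC)
      show "K ` ({0..1} \<times> {0..1}) \<subseteq> compl"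
      proof (rule image_subsetI)
        fix x :: "real \<times> real" assume x: "x \<in> {0..1} \<times> {0..1}"
        then obtain s t where st: "x = (s, t)" "s \<in> {0..1}" "t \<in> {0..1}" by blast
        show "K x \<in> compl" unfolding compl_def
        proof (intro CollectI ballI)
          fix j assume j: "j \<in> I"
          let ?y = "(1 - s) *\<^sub>R (p t - q) + (of_real s * l i (p t)) *\<^sub>C d i"
          show "l j (K x) \<noteq> 0"
          proof (cases "j = i")
            case True
            have "l i (K x) = of_real \<epsilon> * ((1 - of_real s) * l i (p t) + of_real s * l i (p t))"
              by (simp add: K_def st(1) l_add l_scaleR l_scale l_diff i q(2) ld)
            also have "\<dots> = of_real \<epsilon> * l i (p t)" by (simp add: algebra_simps)
            finally show ?thesis using True \<epsilon>(1) pT(2)[OF st(3)] i by (auto simp: compl_def)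
          next
            case False
            have "l j ?y = of_real (1 - s) * l j (p t - q) + of_real s * (l i (p t) * l j (d i))"
              by (simp only: l_add[OF j] l_scaleR[OF j] l_scale[OF j] mult.assoc)
            then have "cmod (l j ?y) \<le> cmod (of_real (1 - s) * l j (p t - q)) + cmod (of_real s * (l i (p t) * l j (d i)))"
              using norm_triangle_ineq by metis
            also have "cmod (of_real (1 - s) * l j (p t - q)) \<le> 1 * cmod (l j (p t - q))"
              unfolding norm_mult norm_of_real using st(2) by (intro mult_right_mono) auto
            also have "cmod (of_real s * (l i (p t) * l j (d i))) \<le> 1 * cmod (l i (p t) * l j (d i))"
              unfolding norm_mult[of "of_real s"] norm_of_real using st(2) by (intro mult_right_mono) auto
            also have "1 * cmod (l j (p t - q)) + 1 * cmod (l i (p t) * l j (d i)) \<le> M"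
              using M(2)[OF j st(3)] norm_ge_zero[of "l i (p t)"]
              unfolding distrib_left norm_mult mult_1_right mult_1_left by linarith
            finally have "cmod (l j (\<epsilon> *\<^sub>R ?y)) \<le> \<epsilon> * M"
              using \<epsilon>(1)
                by (simp only: l_scaleR[OF j] norm_mult norm_of_real abs_of_pos mult_left_mono less_imp_le)
            then show ?thesis using far[OF j False] \<epsilon>(3) by (simp add: K_def st(1))
          qed
        qed
      qed
    qed
    then show ?thesis by (simp add: K_def)
  qed
  have 1: "\<psi> p = \<one>"
  proof -
    \<comment> \<open>Contraction towards \<open>q\<close> stays in the triangle, where the other
      forms are nonzero, and multiplies \<open>l i\<close> by a positive factor.\<close>
    define K where "K = (\<lambda>x::real \<times> real. q + (1 - fst x + fst x * \<epsilon>) *\<^sub>R (p (snd x) - q))"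
    have "\<psi> (\<lambda>t. K (0, t)) = \<one>"
    proof (rule free_homotopy)
      show "continuous_on ({0..1} \<times> {0..1}) K"
        unfolding K_def using pc2 by (intro continuous_intros)
      show "K (s, 0) = K (s, 1)" for s by (simp add: K_def p(2))
      show "\<psi> (\<lambda>t. K (1, t)) = \<one>" using 2 by (simp add: K_def)
      show "K ` ({0..1} \<times> {0..1}) \<subseteq> compl"
      proof (rule image_subsetI)
        fix x :: "real \<times> real" assume x: "x \<in> {0..1} \<times> {0..1}"
        then obtain s t where st: "x = (s, t)" "s \<in> {0..1}" "t \<in> {0..1}" by blast
        let ?u = "1 - s + s * \<epsilon>"
        have u: "0 < ?u" "?u \<le> 1"
        proof -
          have "0 < (1 - s) + s * \<epsilon>"
            using st(2) \<epsilon>(1) by (cases "s = 1") (auto intro: add_pos_nonneg)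
          then show "0 < ?u" by simp
          have "s * \<epsilon> \<le> s * 1" using st(2) \<epsilon>(2) by (intro mult_left_mono) auto
          then show "?u \<le> 1" by simp
        qed
        have Kx: "K x = (1 - ?u) *\<^sub>R q + ?u *\<^sub>R p t" by (simp add: K_def st(1) algebra_simps)
        then have "K x \<in> ?T"
          using u pT(1)[OF st(3)] q(1) convexD_alt[OF convex_convex_hull, of q _ "p t" ?u] by simp
        moreover have "l i (K x) = of_real ?u * l i (p t)"
          using i q(2) unfolding Kx by (simp add: l_add l_scaleR del: of_real_add of_real_diff of_real_mult)
        then have "l i (K x) \<noteq> 0" using u(1) pT(2)[OF st(3)] i unfolding compl_def
          by (auto simp del: of_real_add of_real_diff of_real_mult)
        ultimately show "K x \<in> compl" using others by (auto simp: compl_def)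
      qed
    qed
    then show ?thesis by (simp add: K_def)
  qed
  show ?thesis using 1 edges unfolding p_def by (simp add: join path_image_join)
qed

lemma cyclic3:
  assumes "a \<in> carrier G" "b \<in> carrier G" "c \<in> carrier G" "a \<otimes> (b \<otimes> c) = \<one>"
  shows "b \<otimes> (c \<otimes> a) = \<one>"
  using assms by (metis G.inv_equality G.m_assoc G.m_closed G.r_inv)

text \<open>Avoidance of the edges is precisely the \<open>edge\<close> hypothesis of
  \<open>positive_relation_unique\<close> for the values of \<open>l i\<close> at the vertices, and
  points of the triangle are given by barycentric coefficients.\<close>

lemma zero_unique_in_triangle:
  assumes i: "i \<in> I"
    and edges: "closed_segment A B \<subseteq> compl" "closed_segment B C \<subseteq> compl" "closed_segment C A \<subseteq> compl"
    and x: "0 \<le> x1" "0 \<le> x2" "0 \<le> x3" "x1 + x2 + x3 = 1" "l i (x1 *\<^sub>R A + x2 *\<^sub>R B + x3 *\<^sub>R C) = 0"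
    and y: "0 \<le> y1" "0 \<le> y2" "0 \<le> y3" "y1 + y2 + y3 = 1" "l i (y1 *\<^sub>R A + y2 *\<^sub>R B + y3 *\<^sub>R C) = 0"
  shows "x1 = y1 \<and> x2 = y2 \<and> x3 = y3 \<and> 0 < x1 \<and> 0 < x2 \<and> 0 < x3"
proof -
  have seg: "of_real s * l i X + of_real r * l i Y \<noteq> 0"
    if XY: "closed_segment X Y \<subseteq> compl" and sr: "0 \<le> s" "0 \<le> r" "0 < s + r" for s r X Y
  proof
    assume 0: "of_real s * l i X + of_real r * l i Y = 0"
    define u where "u = r / (s + r)"
    have u: "0 \<le> u" "u \<le> 1" "1 - u = s / (s + r)" using sr by (auto simp: u_def field_simps)
    have "(1 - u) *\<^sub>R X + u *\<^sub>R Y = (1 / (s + r)) *\<^sub>R (s *\<^sub>R X + r *\<^sub>R Y)"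
      unfolding u(3) by (simp add: u_def scaleR_add_right)
    then have "l i ((1 - u) *\<^sub>R X + u *\<^sub>R Y) = 0"
      using 0 i by (simp add: l_scaleR l_add del: of_real_add)
    moreover have "(1 - u) *\<^sub>R X + u *\<^sub>R Y \<in> compl"
      using XY u by (auto simp: closed_segment_def)
    ultimately show False using i by (auto simp: compl_def)
  qed
  have "closed_segment A C \<subseteq> compl" using edges(3) by (simp add: closed_segment_commute)
  note e = seg[OF edges(1)] seg[OF edges(2)] seg[OF this]
  show ?thesis
    using positive_relation_unique[of "l i A" "l i B" "l i C" x1 x2 x3 y1 y2 y3] e x y i
    by (simp add: l_add l_scaleR)
qed

definition hits :: "'v \<Rightarrow> 'v \<Rightarrow> 'v \<Rightarrow> 'i set"
  where "hits A B C = {i \<in> I. \<exists>x\<in>convex hull {A, B, C}. l i x = 0}"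

text \<open>The hypothesis \<open>lt\<close> says that the rays from \<open>A\<close> through the
  zeros of \<open>l i\<close> and \<open>l j\<close> meet the opposite side at different points, in
  this order. A cut from \<open>A\<close> between them separates the zeros, so each half meets fewer
  hyperplanes.\<close>

lemma triangle_split:
  assumes ij: "i \<in> I" "j \<in> I"
    and edges: "closed_segment A B \<subseteq> compl" "closed_segment B C \<subseteq> compl" "closed_segment C A \<subseteq> compl"
    and x: "0 \<le> x1" "0 \<le> x2" "0 \<le> x3" "x1 + x2 + x3 = 1" "l i (x1 *\<^sub>R A + x2 *\<^sub>R B + x3 *\<^sub>R C) = 0"
    and y: "0 \<le> y1" "0 \<le> y2" "0 \<le> y3" "y1 + y2 + y3 = 1" "l j (y1 *\<^sub>R A + y2 *\<^sub>R B + y3 *\<^sub>R C) = 0"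
    and lt: "x3 * y2 < x2 * y3"
    and IH: "\<And>A' B' C'. card (hits A' B' C') < card (hits A B C) \<Longrightarrow>
      convex hull {A', B', C'} \<subseteq> convex hull {A, B, C} \<Longrightarrow>
      closed_segment A' B' \<subseteq> compl \<Longrightarrow> closed_segment B' C' \<subseteq> compl \<Longrightarrow> closed_segment C' A' \<subseteq> compl \<Longrightarrow>
      \<psi> (linepath A' B') \<otimes> (\<psi> (linepath B' C') \<otimes> \<psi> (linepath C' A')) = \<one>"
  shows "\<psi> (linepath A B) \<otimes> (\<psi> (linepath B C) \<otimes> \<psi> (linepath C A)) = \<one>"
proof -
  let ?T = "convex hull {A, B, C}"
  define m where "m = (\<lambda>t. (1 - t) *\<^sub>R B + t *\<^sub>R C)"
  have T: "u *\<^sub>R A + v *\<^sub>R B + w *\<^sub>R C \<in> ?T" if "0 \<le> u" "0 \<le> v" "0 \<le> w" "u + v + w = 1" for u v w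
    using that unfolding convex_hull_3 by blast
  have mT: "m t \<in> ?T" if "0 \<le> t" "t \<le> 1" for t
    using T[of 0 "1 - t" t] that by (simp add: m_def)
  have xpos: "0 < x1" "0 < x2" "0 < x3" using zero_unique_in_triangle[OF ij(1) edges x x] by auto
  have ypos: "0 < y1" "0 < y2" "0 < y3" using zero_unique_in_triangle[OF ij(2) edges y y] by auto
  \<comment> \<open>The parameters on \<open>B C\<close> where the two rays from \<open>A\<close>
    arrive.\<close>
  define t1 where "t1 = x3 / (x2 + x3)"
  define t2 where "t2 = y3 / (y2 + y3)"
  have t12: "0 < t1" "t1 < t2" "t2 < 1"
    using xpos ypos lt by (auto simp: t1_def t2_def field_simps)
  \<comment> \<open>Parameters for which the cut meets the hyperplane \<open>k\<close>. The zero of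
    \<open>l k\<close> in the triangle is unique and interior, so there is at most one such
    parameter, and finitely many altogether.\<close>
  define bad where "bad = (\<lambda>k. {t. 0 \<le> t \<and> t \<le> 1 \<and> (\<exists>z\<in>closed_segment A (m t). l k z = 0)})"
  have bad_coord: "\<exists>u v w. 0 \<le> u \<and> 0 \<le> v \<and> 0 \<le> w \<and> u + v + w = 1 \<and> l k (u *\<^sub>R A + v *\<^sub>R B + w *\<^sub>R C) = 0 \<and>
      w * (1 - t) = v * t" if "t \<in> bad k" for k t
  proof -
    obtain s where s: "0 \<le> s" "s \<le> 1" "l k ((1 - s) *\<^sub>R A + s *\<^sub>R m t) = 0"
      using \<open>t \<in> bad k\<close> by (auto simp: bad_def closed_segment_def)
    have t: "0 \<le> t" "t \<le> 1" using that by (auto simp: bad_def)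
    have "(1 - s) *\<^sub>R A + s *\<^sub>R m t = (1 - s) *\<^sub>R A + (s * (1 - t)) *\<^sub>R B + (s * t) *\<^sub>R C"
      by (simp add: m_def scaleR_add_right add.assoc)
    then have "l k ((1 - s) *\<^sub>R A + (s * (1 - t)) *\<^sub>R B + (s * t) *\<^sub>R C) = 0"
      using s(3) by (simp add: add.assoc)
    moreover have "0 \<le> 1 - s" "0 \<le> s * (1 - t)" "0 \<le> s * t" using s t by simp_all
    moreover have "(1 - s) + s * (1 - t) + s * t = 1" "s * t * (1 - t) = s * (1 - t) * t"
      by (simp_all add: algebra_simps)
    ultimately show ?thesis by blast
  qed
  have bad_unique: "t = t'" if b: "t \<in> bad k" "t' \<in> bad k" "k \<in> I" for k t t'
  proof -
    obtain u v w where 1: "0 \<le> u" "0 \<le> v" "0 \<le> w" "u + v + w = 1" "l k (u *\<^sub>R A + v *\<^sub>R B + w *\<^sub>R C) = 0"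
      "w * (1 - t) = v * t" using bad_coord[OF b(1)] by blast
    obtain u' v' w' where 2: "0 \<le> u'" "0 \<le> v'" "0 \<le> w'" "u' + v' + w' = 1" "l k (u' *\<^sub>R A + v' *\<^sub>R B + w' *\<^sub>R C) = 0"
      "w' * (1 - t') = v' * t'" using bad_coord[OF b(2)] by blast
    have eq: "v = v'" "w = w'" "0 < v" "0 < w"
      using zero_unique_in_triangle[OF b(3) edges 1(1-5) 2(1-5)] by auto
    have "w = (v + w) * t" "w = (v + w) * t'" using 1(6) 2(6) eq by (simp_all add: algebra_simps)
    then have "(v + w) * t = (v + w) * t'" by simp
    then show ?thesis using eq(3,4) by simp
  qed
  have "finite (bad k)" if "k \<in> I" for k
  proof (cases "bad k = {}")
    case False
    then obtain t where "t \<in> bad k" by blast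
    then have "bad k \<subseteq> {t}" using bad_unique that by blast
    then show ?thesis by (rule finite_subset) simp
  qed simp
  then have "finite (\<Union>k\<in>I. bad k)" using finite_I by blast
  moreover have "infinite {t1<..<t2}" using t12(2) by (simp add: infinite_Ioo)
  ultimately obtain t where t: "t1 < t" "t < t2" "t \<notin> (\<Union>k\<in>I. bad k)"
    by (metis Diff_iff finite_Diff2 finite.emptyI greaterThanLessThan_iff ex_in_conv)
  have t01: "0 \<le> t" "t \<le> 1" using t t12 by auto
  have Am: "closed_segment A (m t) \<subseteq> compl"
    using t(3) t01 unfolding bad_def compl_def by blast
  have mBC: "m t \<in> closed_segment B C" using t01 by (auto simp: m_def closed_segment_def)
  then have Bm: "closed_segment B (m t) \<subseteq> compl" "closed_segment (m t) C \<subseteq> compl"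
    using edges(2) subset_closed_segment
      by (metis ends_in_segment(1) subset_trans, metis ends_in_segment(2) subset_closed_segment subset_trans mBC)
  have ABC: "A \<in> ?T" "B \<in> ?T" "C \<in> ?T" by (auto intro: hull_inc)
  have sub: "convex hull {A, B, m t} \<subseteq> ?T" "convex hull {A, m t, C} \<subseteq> ?T"
    by (rule hull_minimal; use ABC mT[OF t01] in \<open>simp add: convex_convex_hull\<close>)+
  have hits_sub: "hits A B (m t) \<subseteq> hits A B C" "hits A (m t) C \<subseteq> hits A B C"
    using sub by (auto simp: hits_def)
  have fin: "finite (hits A B C)" using finite_I by (simp add: hits_def)
  have "i \<in> hits A B C" "j \<in> hits A B C"
    using T[OF x(1-4)] T[OF y(1-4)] x(5) y(5) ij by (auto simp: hits_def)
  \<comment> \<open>The only zero of \<open>l j\<close> in the triangle lies on the ray with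
    parameter \<open>t2\<close>, beyond the cut. Symmetrically, the zero of \<open>l i\<close> lies
    before it.\<close>
  moreover have "j \<notin> hits A B (m t)"
  proof
    assume "j \<in> hits A B (m t)"
    then obtain u v w where uvw: "0 \<le> u" "0 \<le> v" "0 \<le> w" "u + v + w = 1" "l j (u *\<^sub>R A + v *\<^sub>R B + w *\<^sub>R m t) = 0"
      unfolding hits_def convex_hull_3 by blast
    have eq: "u *\<^sub>R A + v *\<^sub>R B + w *\<^sub>R m t = u *\<^sub>R A + (v + w * (1 - t)) *\<^sub>R B + (w * t) *\<^sub>R C"
      by (simp add: m_def scaleR_add_right scaleR_add_left add_ac)
    have "l j (u *\<^sub>R A + (v + w * (1 - t)) *\<^sub>R B + (w * t) *\<^sub>R C) = 0" using uvw(5) by (simp only: eq)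
    moreover have "u + (v + w * (1 - t)) + w * t = 1" using uvw(4) by (simp add: algebra_simps)
    moreover have "0 \<le> v + w * (1 - t)" "0 \<le> w * t" using uvw t01 by auto
    ultimately have "y2 = v + w * (1 - t) \<and> y3 = w * t"
      using zero_unique_in_triangle[OF ij(2) edges y, of u "v + w * (1 - t)" "w * t"] uvw(1) by blast
    then have yy: "y2 = v + w * (1 - t)" "y3 = w * t" by auto
    have "y2 * t - y3 * (1 - t) = v * t" unfolding yy by (simp add: algebra_simps)
    moreover have "0 \<le> v * t" using uvw(2) t01(1) by simp
    ultimately have "y3 * (1 - t) \<le> y2 * t" by linarith
    moreover have "t * (y2 + y3) < y3" using t(2) ypos by (simp add: t2_def field_simps)
    ultimately show False by (simp add: algebra_simps)
  qed
  moreover have "i \<notin> hits A (m t) C"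
  proof
    assume "i \<in> hits A (m t) C"
    then obtain u v w where uvw: "0 \<le> u" "0 \<le> v" "0 \<le> w" "u + v + w = 1" "l i (u *\<^sub>R A + v *\<^sub>R m t + w *\<^sub>R C) = 0"
      unfolding hits_def convex_hull_3 by blast
    have eq: "u *\<^sub>R A + v *\<^sub>R m t + w *\<^sub>R C = u *\<^sub>R A + (v * (1 - t)) *\<^sub>R B + (w + v * t) *\<^sub>R C"
      by (simp add: m_def scaleR_add_right scaleR_add_left add_ac)
    have "l i (u *\<^sub>R A + (v * (1 - t)) *\<^sub>R B + (w + v * t) *\<^sub>R C) = 0" using uvw(5) by (simp only: eq)
    moreover have "u + v * (1 - t) + (w + v * t) = 1" using uvw(4) by (simp add: algebra_simps)
    moreover have "0 \<le> v * (1 - t)" "0 \<le> w + v * t" using uvw t01 by auto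
    ultimately have "x2 = v * (1 - t) \<and> x3 = w + v * t"
      using zero_unique_in_triangle[OF ij(1) edges x, of u "v * (1 - t)" "w + v * t"] uvw(1) by blast
    then have xx: "x2 = v * (1 - t)" "x3 = w + v * t" by auto
    have "x3 * (1 - t) - x2 * t = w * (1 - t)" unfolding xx by (simp add: algebra_simps)
    moreover have "0 \<le> w * (1 - t)" using uvw(3) t01(2) by simp
    ultimately have "x2 * t \<le> x3 * (1 - t)" by linarith
    moreover have "x3 < t * (x2 + x3)" using t(1) xpos by (simp add: t1_def field_simps)
    ultimately show False by (simp add: algebra_simps)
  qed
  ultimately have card: "card (hits A B (m t)) < card (hits A B C)" "card (hits A (m t) C) < card (hits A B C)"
    using hits_sub fin by (auto intro!: psubset_card_mono)
  let ?P = "\<lambda>X Y. \<psi> (linepath X Y)"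
  have mA: "closed_segment (m t) A \<subseteq> compl" using Am by (simp add: closed_segment_commute)
  have cl: "?P A B \<in> carrier G" "?P B (m t) \<in> carrier G" "?P (m t) A \<in> carrier G" "?P A (m t) \<in> carrier G"
    "?P (m t) C \<in> carrier G" "?P C A \<in> carrier G"
    using edges Bm Am mA by (auto intro!: closed)
  have 1: "?P A B \<otimes> (?P B (m t) \<otimes> ?P (m t) A) = \<one>" by (rule IH[OF card(1) sub(1) edges(1) Bm(1) mA])
  have 2: "?P A (m t) \<otimes> (?P (m t) C \<otimes> ?P C A) = \<one>" by (rule IH[OF card(2) sub(2) Am Bm(2) edges(3)])
  have 3: "?P (m t) A \<otimes> ?P A (m t) = \<one>"
    using reverse[of "linepath (m t) A"] mA by simp
  have "?P A B \<otimes> (?P B C \<otimes> ?P C A) = ?P A B \<otimes> (?P B (m t) \<otimes> (?P (m t) C \<otimes> ?P C A))"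
    using line_trans[OF edges(2) mBC] cl by (simp add: G.m_assoc)
  \<comment> \<open>The cut is inserted together with its reverse, which completes the boundaries of
    the two halves.\<close>
  also have "\<dots> = ?P A B \<otimes> (?P B (m t) \<otimes> ((?P (m t) A \<otimes> ?P A (m t)) \<otimes> (?P (m t) C \<otimes> ?P C A)))"
    using cl by (simp add: 3)
  also have "\<dots> = (?P A B \<otimes> (?P B (m t) \<otimes> ?P (m t) A)) \<otimes> (?P A (m t) \<otimes> (?P (m t) C \<otimes> ?P C A))"
    using cl by (simp add: G.m_assoc)
  finally show ?thesis by (simp add: 1 2)
qed

text \<open>Induction on the number of hyperplanes met by the triangle. As long as there are two,
  their zeros are different points by \<open>codim2\<close>, and from some vertex they are seen in
  different directions; the triangle is rotated so that this vertex comes first, and split.\<close>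

lemma triangle:
  assumes edges: "closed_segment A B \<subseteq> compl" "closed_segment B C \<subseteq> compl" "closed_segment C A \<subseteq> compl"
    and codim2: "\<And>x i j. x \<in> convex hull {A, B, C} \<Longrightarrow> i \<in> I \<Longrightarrow> j \<in> I \<Longrightarrow> l i x = 0 \<Longrightarrow> l j x = 0 \<Longrightarrow> i = j"
  shows "\<psi> (linepath A B) \<otimes> (\<psi> (linepath B C) \<otimes> \<psi> (linepath C A)) = \<one>"
  using assms
proof (induction "card (hits A B C)" arbitrary: A B C rule: less_induct)
  case (less A B C)
  note edges = less.prems(1-3) and codim2 = less.prems(4)
  let ?P = "\<lambda>X Y. \<psi> (linepath X Y)"
  have cl: "?P A B \<in> carrier G" "?P B C \<in> carrier G" "?P C A \<in> carrier G"
    using edges by (auto intro!: closed)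
  have IH: "\<psi> (linepath A' B') \<otimes> (\<psi> (linepath B' C') \<otimes> \<psi> (linepath C' A')) = \<one>"
    if "card (hits A' B' C') < card (hits A B C)" "convex hull {A', B', C'} \<subseteq> convex hull {A, B, C}"
      "closed_segment A' B' \<subseteq> compl" "closed_segment B' C' \<subseteq> compl" "closed_segment C' A' \<subseteq> compl" for A' B' C'
    by (rule less.hyps[OF that(1,3-5)]) (use codim2 that(2) in blast)
  have rot: "{B, C, A} = {A, B, C}" "{C, A, B} = {A, B, C}" by auto
  have hits_rot: "hits B C A = hits A B C" "hits C A B = hits A B C" by (simp_all only: hits_def rot)
  show ?case
  proof (cases "\<exists>i j. i \<in> hits A B C \<and> j \<in> hits A B C \<and> i \<noteq> j")
    case True
    then obtain i j where ij: "i \<in> hits A B C" "j \<in> hits A B C" "i \<noteq> j" by blast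
    then have I: "i \<in> I" "j \<in> I" by (auto simp: hits_def)
    obtain x1 x2 x3 where x: "0 \<le> x1" "0 \<le> x2" "0 \<le> x3" "x1 + x2 + x3 = 1" "l i (x1 *\<^sub>R A + x2 *\<^sub>R B + x3 *\<^sub>R C) = 0"
      using ij(1) unfolding hits_def convex_hull_3 by blast
    obtain y1 y2 y3 where y: "0 \<le> y1" "0 \<le> y2" "0 \<le> y3" "y1 + y2 + y3 = 1" "l j (y1 *\<^sub>R A + y2 *\<^sub>R B + y3 *\<^sub>R C) = 0"
      using ij(2) unfolding hits_def convex_hull_3 by blast
    have split: "\<psi> (linepath A B) \<otimes> (\<psi> (linepath B C) \<otimes> \<psi> (linepath C A)) = \<one>"
      if "i \<in> I" "j \<in> I" "0 \<le> x1" "0 \<le> x2" "0 \<le> x3" "x1 + x2 + x3 = 1" "l i (x1 *\<^sub>R A + x2 *\<^sub>R B + x3 *\<^sub>R C) = 0"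
        "0 \<le> y1" "0 \<le> y2" "0 \<le> y3" "y1 + y2 + y3 = 1" "l j (y1 *\<^sub>R A + y2 *\<^sub>R B + y3 *\<^sub>R C) = 0"
        "x3 * y2 \<noteq> x2 * y3"
        "closed_segment A B \<subseteq> compl" "closed_segment B C \<subseteq> compl" "closed_segment C A \<subseteq> compl"
        "\<And>A' B' C'. card (hits A' B' C') < card (hits A B C) \<Longrightarrow>
          convex hull {A', B', C'} \<subseteq> convex hull {A, B, C} \<Longrightarrow>
          closed_segment A' B' \<subseteq> compl \<Longrightarrow> closed_segment B' C' \<subseteq> compl \<Longrightarrow> closed_segment C' A' \<subseteq> compl \<Longrightarrow>
          \<psi> (linepath A' B') \<otimes> (\<psi> (linepath B' C') \<otimes> \<psi> (linepath C' A')) = \<one>"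
      for A B C x1 x2 x3 y1 y2 y3
    proof (cases "x3 * y2 < x2 * y3")
      case True
      show ?thesis by (rule triangle_split[OF that(1,2,14-16,3-12) True that(17)])
    next
      case False
      then have "y3 * x2 < y2 * x3" using that(13) by (simp add: mult.commute)
      then show ?thesis by (intro triangle_split[OF that(2,1,14-16,8-12,3-7) _ that(17)])
    qed
    \<comment> \<open>If the zeros were aligned with all three vertices, their barycentric
      coordinates would be proportional, hence equal since both sum to 1.\<close>
    have "x3 * y2 \<noteq> x2 * y3 \<or> x1 * y3 \<noteq> x3 * y1 \<or> x2 * y1 \<noteq> x1 * y2"
    proof (rule ccontr)
      assume "\<not> ?thesis"
      then have e: "x3 * y2 = x2 * y3" "x1 * y3 = x3 * y1" "x2 * y1 = x1 * y2" by auto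
      have "x1 * (y1 + y2 + y3) = (x1 + x2 + x3) * y1" "x2 * (y1 + y2 + y3) = (x1 + x2 + x3) * y2"
        "x3 * (y1 + y2 + y3) = (x1 + x2 + x3) * y3"
        using e by (simp_all add: algebra_simps)
      then have "x1 = y1" "x2 = y2" "x3 = y3" using x(4) y(4) by simp_all
      then have "l j (x1 *\<^sub>R A + x2 *\<^sub>R B + x3 *\<^sub>R C) = 0" using y(5) by simp
      moreover have "x1 *\<^sub>R A + x2 *\<^sub>R B + x3 *\<^sub>R C \<in> convex hull {A, B, C}"
        using x unfolding convex_hull_3 by blast
      ultimately show False using codim2 I x(5) ij(3) by blast
    qed
    then show ?thesis
    proof (elim disjE)
      assume "x3 * y2 \<noteq> x2 * y3"
      then show ?thesis by (intro split[OF I x y _ edges IH])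
    next
      assume ne: "x1 * y3 \<noteq> x3 * y1"
      have x': "0 \<le> x2" "0 \<le> x3" "0 \<le> x1" "x2 + x3 + x1 = 1" "l i (x2 *\<^sub>R B + x3 *\<^sub>R C + x1 *\<^sub>R A) = 0"
        using x by (simp_all add: add_ac)
      have y': "0 \<le> y2" "0 \<le> y3" "0 \<le> y1" "y2 + y3 + y1 = 1" "l j (y2 *\<^sub>R B + y3 *\<^sub>R C + y1 *\<^sub>R A) = 0"
        using y by (simp_all add: add_ac)
      have "?P B C \<otimes> (?P C A \<otimes> ?P A B) = \<one>"
        by (rule split[OF I x' y' ne edges(2,3,1)]) (unfold hits_rot rot, rule IH)
      then have "?P C A \<otimes> (?P A B \<otimes> ?P B C) = \<one>" by (rule cyclic3[OF cl(2,3,1)])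
      then show ?thesis by (rule cyclic3[OF cl(3,1,2)])
    next
      assume ne: "x2 * y1 \<noteq> x1 * y2"
      have x': "0 \<le> x3" "0 \<le> x1" "0 \<le> x2" "x3 + x1 + x2 = 1" "l i (x3 *\<^sub>R C + x1 *\<^sub>R A + x2 *\<^sub>R B) = 0"
        using x by (simp_all add: add_ac)
      have y': "0 \<le> y3" "0 \<le> y1" "0 \<le> y2" "y3 + y1 + y2 = 1" "l j (y3 *\<^sub>R C + y1 *\<^sub>R A + y2 *\<^sub>R B) = 0"
        using y by (simp_all add: add_ac)
      have "?P C A \<otimes> (?P A B \<otimes> ?P B C) = \<one>"
        by (rule split[OF I x' y' ne edges(3,1,2)]) (unfold hits_rot rot, rule IH)
      then show ?thesis by (rule cyclic3[OF cl(3,1,2)])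
    qed
  next
    case False
    show ?thesis
    proof (cases "hits A B C = {}")
      case True
      have T: "convex hull {A, B, C} \<subseteq> compl" using True by (auto simp: hits_def compl_def)
      have ABC: "A \<in> convex hull {A, B, C}" "B \<in> convex hull {A, B, C}" "C \<in> convex hull {A, B, C}"
        by (auto intro: hull_inc)
      have "?P A B \<otimes> (?P B C \<otimes> ?P C A) = \<psi> (linepath A B +++ linepath B C +++ linepath C A)"
        using edges by (simp add: join path_image_join)
      also have "\<dots> = \<psi> (linepath A A)"
        by (rule convex_eq[OF convex_convex_hull T])
          (simp_all add: path_image_join ABC closed_segment_subset[OF _ _ convex_convex_hull])
      also have "\<dots> = \<one>" using ABC T by (intro const_path) auto
      finally show ?thesis .
    next
      case ne: False
      then obtain i where i: "i \<in> hits A B C" by blast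
      then have others: "l j x \<noteq> 0" if "x \<in> convex hull {A, B, C}" "j \<in> I" "j \<noteq> i" for x j
        using False that by (auto simp: hits_def)
      obtain q where q: "q \<in> convex hull {A, B, C}" "l i q = 0" and iI: "i \<in> I" using i by (auto simp: hits_def)
      show ?thesis by (rule triangle_one_hyperplane[OF iI q others edges])
    qed
  qed
qed

end

section \<open>Generic apices for coning off a path\<close>

context arrangement
begin

text \<open>The first clause keeps the segments from \<open>A\<close> and \<open>B\<close> to
  \<open>v\<close> off all hyperplanes; the second keeps the triangle spanned by \<open>A\<close>,
  \<open>B\<close>, \<open>v\<close> off their pairwise intersections. Both are stated as avoidance
  of real subspaces.\<close>

definition generic :: "'v \<Rightarrow> 'v \<Rightarrow> 'v \<Rightarrow> bool"
  where "generic A B v \<longleftrightarrow>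
    (\<forall>i\<in>I. \<forall>r. l i v \<noteq> complex_of_real r * l i A \<and> l i v \<noteq> complex_of_real r * l i B) \<and>
    (\<forall>i\<in>I. \<forall>j\<in>I. i \<noteq> j \<longrightarrow> (\<forall>a b. \<not> (l i v = complex_of_real a * l i A + complex_of_real b * l i B \<and>
      l j v = complex_of_real a * l j A + complex_of_real b * l j B)))"

text \<open>The real multiples of a nonzero complex number form a real line, which an imaginary
  multiple leaves.\<close>

lemma real_multiples_proper:
  assumes i: "i \<in> I" and A: "l i A \<noteq> 0"
  shows "subspace {v. \<exists>r. l i v = complex_of_real r * l i A} \<and>
      {v. \<exists>r. l i v = complex_of_real r * l i A} \<noteq> UNIV"
proof
  show "subspace {v. \<exists>r. l i v = complex_of_real r * l i A}"
  proof (rule subspaceI)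
    show "0 \<in> {v. \<exists>r. l i v = complex_of_real r * l i A}"
      using l_scaleR[OF i, of 0 0] by (auto intro: exI[of _ 0])
    show "x + y \<in> {v. \<exists>r. l i v = complex_of_real r * l i A}"
      if xy: "x \<in> {v. \<exists>r. l i v = complex_of_real r * l i A}" "y \<in> {v. \<exists>r. l i v = complex_of_real r * l i A}" for x y
    proof -
      obtain r s where "l i x = complex_of_real r * l i A" "l i y = complex_of_real s * l i A" using xy by blast
      then have "l i (x + y) = complex_of_real (r + s) * l i A" by (simp add: l_add[OF i] distrib_right)
      then show ?thesis by blast
    qed
    show "c *\<^sub>R x \<in> {v. \<exists>r. l i v = complex_of_real r * l i A}"
      if x: "x \<in> {v. \<exists>r. l i v = complex_of_real r * l i A}" for c x
    proof -
      obtain r where "l i x = complex_of_real r * l i A" using x by blast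
      then have "l i (c *\<^sub>R x) = complex_of_real (c * r) * l i A" by (simp add: l_scaleR[OF i])
      then show ?thesis by blast
    qed
  qed
  have "(\<i> * l i A) *\<^sub>C d i \<notin> {v. \<exists>r. l i v = complex_of_real r * l i A}"
  proof
    assume "(\<i> * l i A) *\<^sub>C d i \<in> {v. \<exists>r. l i v = complex_of_real r * l i A}"
    then obtain r where "\<i> * l i A = complex_of_real r * l i A" by (auto simp: l_scale[OF i] ld[OF i])
    then have "\<i> = complex_of_real r" using A by simp
    then show False by (metis Im_complex_of_real imaginary_unit.sel(2) zero_neq_one)
  qed
  then show "{v. \<exists>r. l i v = complex_of_real r * l i A} \<noteq> UNIV" by blast
qed

text \<open>A dimension count made explicit. If \<open>l i B\<close> is a real multiple of
  \<open>l i A\<close>, the first equation alone restricts \<open>l i v\<close> to a real line.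
  Otherwise a vector killed by \<open>l i\<close> but not by \<open>l j\<close> forces both
  coefficients to be zero.\<close>

lemma real_combinations_proper:
  assumes ij: "i \<in> I" "j \<in> I" "i \<noteq> j" and A: "l i A \<noteq> 0"
  shows "subspace {v. \<exists>a b. l i v = complex_of_real a * l i A + complex_of_real b * l i B \<and>
      l j v = complex_of_real a * l j A + complex_of_real b * l j B} \<and>
    {v. \<exists>a b. l i v = complex_of_real a * l i A + complex_of_real b * l i B \<and>
      l j v = complex_of_real a * l j A + complex_of_real b * l j B} \<noteq> UNIV" (is "subspace ?U \<and> _")
proof
  show "subspace ?U"
  proof (rule subspaceI)
    show "0 \<in> ?U"
      using l_scaleR[OF ij(1), of 0 0] l_scaleR[OF ij(2), of 0 0] by (auto intro!: exI[of _ 0])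
    show "x + y \<in> ?U" if xy: "x \<in> ?U" "y \<in> ?U" for x y
    proof -
      obtain a b a' b' where
        "l i x = complex_of_real a * l i A + complex_of_real b * l i B" "l j x = complex_of_real a * l j A + complex_of_real b * l j B"
        "l i y = complex_of_real a' * l i A + complex_of_real b' * l i B" "l j y = complex_of_real a' * l j A + complex_of_real b' * l j B"
        using xy by blast
      then have "l i (x + y) = complex_of_real (a + a') * l i A + complex_of_real (b + b') * l i B"
        "l j (x + y) = complex_of_real (a + a') * l j A + complex_of_real (b + b') * l j B"
        by (simp_all add: l_add ij algebra_simps)
      then show ?thesis by blast
    qed
    show "c *\<^sub>R x \<in> ?U" if x: "x \<in> ?U" for c x
    proof -
      obtain a b where
        "l i x = complex_of_real a * l i A + complex_of_real b * l i B" "l j x = complex_of_real a * l j A + complex_of_real b * l j B"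
        using x by blast
      then have "l i (c *\<^sub>R x) = complex_of_real (c * a) * l i A + complex_of_real (c * b) * l i B"
        "l j (c *\<^sub>R x) = complex_of_real (c * a) * l j A + complex_of_real (c * b) * l j B"
        by (simp_all add: l_scaleR ij algebra_simps)
      then show ?thesis by blast
    qed
  qed
  have "\<exists>v. v \<notin> ?U"
  proof (cases "\<exists>r. l i B = complex_of_real r * l i A")
    case True
    then obtain r where r: "l i B = complex_of_real r * l i A" by blast
    have "?U \<subseteq> {v. \<exists>r. l i v = complex_of_real r * l i A}"
    proof
      fix v assume "v \<in> ?U"
      then obtain a b where "l i v = complex_of_real a * l i A + complex_of_real b * l i B" by blast
      then have "l i v = complex_of_real (a + b * r) * l i A" by (simp add: r algebra_simps)
      then show "v \<in> {v. \<exists>r. l i v = complex_of_real r * l i A}" by blast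
    qed
    then show ?thesis using real_multiples_proper[OF ij(1) A] by blast
  next
    case False
    obtain v where v: "l i v = 0" "l j v = 1" using distinct[OF ij] by blast
    have "v \<notin> ?U"
    proof
      assume "v \<in> ?U"
      then obtain a b where ab: "l i v = complex_of_real a * l i A + complex_of_real b * l i B"
        "l j v = complex_of_real a * l j A + complex_of_real b * l j B" by blast
      have "b = 0"
      proof (rule ccontr)
        assume b: "b \<noteq> 0"
        have "complex_of_real b * l i B = - (complex_of_real a * l i A)"
          using ab(1) v(1) by (simp add: eq_neg_iff_add_eq_0 add.commute)
        then have "l i B = complex_of_real (- a / b) * l i A" using b by (simp add: field_simps)
        then show False using False by blast
      qed
      moreover have "a = 0" using ab(1) v(1) calculation A by simp
      ultimately show False using ab(2) v(2) by simp
    qed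
    then show ?thesis by blast
  qed
  then show "?U \<noteq> UNIV" by blast
qed

text \<open>Genericity is expressed through a finite family of proper real subspaces, because such
  families can be united over finitely many pieces of a path and still be avoided by one common
  apex.\<close>

lemma generic_family:
  assumes "A \<in> compl" "B \<in> compl"
  shows "\<exists>F. finite F \<and> (\<forall>U\<in>F. subspace U \<and> U \<noteq> UNIV) \<and> (\<forall>v. (\<forall>U\<in>F. v \<notin> U) \<longrightarrow> generic A B v)"
proof -
  have nz: "l i A \<noteq> 0" "l i B \<noteq> 0" if "i \<in> I" for i using assms that by (auto simp: compl_def)
  define F1 where "F1 = (\<lambda>X. (\<lambda>i. {v. \<exists>r. l i v = complex_of_real r * l i X}) ` I)"
  define F2 where "F2 = (\<lambda>(i, j). {v. \<exists>a b. l i v = complex_of_real a * l i A + complex_of_real b * l i B \<and>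
      l j v = complex_of_real a * l j A + complex_of_real b * l j B}) ` {(i, j). i \<in> I \<and> j \<in> I \<and> i \<noteq> j}"
  have fin: "finite {(i, j). i \<in> I \<and> j \<in> I \<and> i \<noteq> j}"
    by (rule finite_subset[of _ "I \<times> I"]) (use finite_I in auto)
  show ?thesis
  proof (intro exI[of _ "F1 A \<union> F1 B \<union> F2"] conjI allI impI)
    show "finite (F1 A \<union> F1 B \<union> F2)" using finite_I fin by (simp add: F1_def F2_def)
    show "\<forall>U\<in>F1 A \<union> F1 B \<union> F2. subspace U \<and> U \<noteq> UNIV"
    proof
      fix U assume "U \<in> F1 A \<union> F1 B \<union> F2"
      then consider "U \<in> F1 A" | "U \<in> F1 B" | "U \<in> F2" by blast
      then show "subspace U \<and> U \<noteq> UNIV"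
      proof cases
        case 1 then show ?thesis using real_multiples_proper nz unfolding F1_def by blast
      next
        case 2 then show ?thesis using real_multiples_proper nz unfolding F1_def by blast
      next
        case 3
        then obtain i j where ij: "i \<in> I" "j \<in> I" "i \<noteq> j" "U = {v. \<exists>a b. l i v = complex_of_real a * l i A + complex_of_real b * l i B \<and>
          l j v = complex_of_real a * l j A + complex_of_real b * l j B}" unfolding F2_def by blast
        show ?thesis unfolding ij(4) by (rule real_combinations_proper[OF ij(1-3) nz(1)[OF ij(1)]])
      qed
    qed
    fix v assume v: "\<forall>U\<in>F1 A \<union> F1 B \<union> F2. v \<notin> U"
    have v1: "v \<notin> U" if "U \<in> F1 A" for U by (rule bspec[OF v]) (simp add: that)
    have v2: "v \<notin> U" if "U \<in> F1 B" for U by (rule bspec[OF v]) (simp add: that)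
    have v3: "v \<notin> U" if "U \<in> F2" for U by (rule bspec[OF v]) (simp add: that)
    show "generic A B v" unfolding generic_def
    proof (intro conjI ballI allI impI)
      fix i r assume i: "i \<in> I"
      have "v \<notin> {v. \<exists>r. l i v = complex_of_real r * l i A}"
        by (rule v1) (use i in \<open>simp add: F1_def\<close>)
      then show "l i v \<noteq> complex_of_real r * l i A" by simp
      have "v \<notin> {v. \<exists>r. l i v = complex_of_real r * l i B}"
        by (rule v2) (use i in \<open>simp add: F1_def\<close>)
      then show "l i v \<noteq> complex_of_real r * l i B" by simp
    next
      fix i j a b assume ij: "i \<in> I" "j \<in> I" "i \<noteq> j"
      then have "{v. \<exists>a b. l i v = complex_of_real a * l i A + complex_of_real b * l i B \<and>
          l j v = complex_of_real a * l j A + complex_of_real b * l j B} \<in> F2"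
        unfolding F2_def by (intro image_eqI[of _ _ "(i, j)"]) auto
      then have "v \<notin> {v. \<exists>a b. l i v = complex_of_real a * l i A + complex_of_real b * l i B \<and>
          l j v = complex_of_real a * l j A + complex_of_real b * l j B}" by (rule v3)
      then show "\<not> (l i v = complex_of_real a * l i A + complex_of_real b * l i B \<and>
          l j v = complex_of_real a * l j A + complex_of_real b * l j B)" by blast
    qed
  qed
qed

lemma generic_segment:
  assumes X: "X \<in> compl" and v: "\<And>i r. i \<in> I \<Longrightarrow> l i v \<noteq> complex_of_real r * l i X"
  shows "closed_segment X v \<subseteq> compl"
proof
  fix y assume "y \<in> closed_segment X v"
  then obtain u where u: "0 \<le> u" "u \<le> 1" "y = (1 - u) *\<^sub>R X + u *\<^sub>R v" by (auto simp: closed_segment_def)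
  show "y \<in> compl" unfolding compl_def
  proof (intro CollectI ballI notI)
    fix i assume i: "i \<in> I" and "l i y = 0"
    then have 0: "complex_of_real (1 - u) * l i X + complex_of_real u * l i v = 0"
      by (simp add: u(3) l_add l_scaleR del: of_real_diff)
    have "u \<noteq> 0" using 0 X i by (auto simp: compl_def)
    have "complex_of_real u * l i v = - (complex_of_real (1 - u) * l i X)"
      by (rule eq_neg_iff_add_eq_0[THEN iffD2]) (use 0 in \<open>simp only: add.commute\<close>)
    then have "complex_of_real (1 / u) * (complex_of_real u * l i v) =
        complex_of_real (1 / u) * - (complex_of_real (1 - u) * l i X)" by (simp only:)
    then have "l i v = complex_of_real (- ((1 - u) / u)) * l i X"
      using \<open>u \<noteq> 0\<close> by simp
    then show False using v[OF i] by blast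
  qed
qed

text \<open>A point of the triangle outside the edge \<open>A B\<close> has a positive coefficient
  at \<open>v\<close>; two forms vanishing there would express their values at \<open>v\<close> by
  the same real combination.\<close>

lemma generic_codim2:
  assumes AB: "closed_segment A B \<subseteq> compl" and g: "generic A B v"
    and x: "x \<in> convex hull {A, B, v}" and ij: "i \<in> I" "j \<in> I" and 0: "l i x = 0" "l j x = 0"
  shows "i = j"
proof (rule ccontr)
  assume ne: "i \<noteq> j"
  obtain a b c where abc: "0 \<le> a" "0 \<le> b" "0 \<le> c" "a + b + c = 1" "x = a *\<^sub>R A + b *\<^sub>R B + c *\<^sub>R v"
    using x unfolding convex_hull_3 by blast
  have "c \<noteq> 0"
  proof
    assume "c = 0"
    then have "x = (1 - b) *\<^sub>R A + b *\<^sub>R B" "0 \<le> b" "b \<le> 1" using abc by (auto simp: eq_diff_eq)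
    then have "x \<in> closed_segment A B" unfolding closed_segment_def by blast
    then show False using AB ij 0 by (auto simp: compl_def)
  qed
  have "l k v = complex_of_real (- a / c) * l k A + complex_of_real (- b / c) * l k B"
    if k: "k \<in> I" "l k x = 0" for k
  proof -
    have "complex_of_real a * l k A + complex_of_real b * l k B + complex_of_real c * l k v = 0"
      using k by (simp add: abc(5) l_add l_scaleR)
    then have eq: "complex_of_real c * l k v = - (complex_of_real a * l k A + complex_of_real b * l k B)"
      by (intro eq_neg_iff_add_eq_0[THEN iffD2]) (simp only: add.commute)
    have "l k v = (complex_of_real c * l k v) / complex_of_real c" using \<open>c \<noteq> 0\<close> by simp
    then show ?thesis unfolding eq by (simp add: diff_divide_distrib)
  qed
  then show False using g ij ne 0 unfolding generic_def by blast
qed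

end

context arrangement_functor
begin

text \<open>Triviality of the triangle with apex \<open>v\<close> replaces the edge by two radii;
  radii of neighbouring pieces cancel later.\<close>

lemma generic_cone:
  assumes AB: "closed_segment A B \<subseteq> compl" and g: "generic A B v"
  shows "closed_segment A v \<subseteq> compl" "closed_segment B v \<subseteq> compl"
    "\<psi> (linepath A B) = \<psi> (linepath A v) \<otimes> \<psi> (linepath v B)"
proof -
  have AB': "A \<in> compl" "B \<in> compl" using AB by auto
  show Av: "closed_segment A v \<subseteq> compl" by (rule generic_segment[OF AB'(1)]) (use g in \<open>auto simp: generic_def\<close>)
  show Bv: "closed_segment B v \<subseteq> compl" by (rule generic_segment[OF AB'(2)]) (use g in \<open>auto simp: generic_def\<close>)
  have vA: "closed_segment v A \<subseteq> compl" "closed_segment v B \<subseteq> compl"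
    using Av Bv by (simp_all add: closed_segment_commute)
  let ?P = "\<lambda>X Y. \<psi> (linepath X Y)"
  have cl: "?P A B \<in> carrier G" "?P B v \<in> carrier G" "?P v A \<in> carrier G" "?P A v \<in> carrier G" "?P v B \<in> carrier G"
    using AB Av Bv vA by (auto intro!: closed)
  have t: "?P A B \<otimes> (?P B v \<otimes> ?P v A) = \<one>"
    by (rule triangle[OF AB Bv vA(1)]) (rule generic_codim2[OF AB g])
  have r: "?P v A \<otimes> ?P A v = \<one>" "?P B v \<otimes> ?P v B = \<one>"
    using reverse[of "linepath v A"] reverse[of "linepath B v"] vA Bv by simp_all
  have "?P A B = ?P A B \<otimes> (?P B v \<otimes> ((?P v A \<otimes> ?P A v) \<otimes> ?P v B))" using cl r by simp
  also have "\<dots> = (?P A B \<otimes> (?P B v \<otimes> ?P v A)) \<otimes> (?P A v \<otimes> ?P v B)" using cl by (simp add: G.m_assoc)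
  finally show "?P A B = ?P A v \<otimes> ?P v B" using t cl by simp
qed

text \<open>The path is coned off from a generic apex; by compactness the genericity conditions are finite
  in number.\<close>

theorem loop_trivial:
  assumes g: "path g" "path_image g \<subseteq> compl" "pathfinish g = pathstart g"
  shows "\<psi> g = \<one>"
proof -
  define cone where "cone = (\<lambda>a b v. closed_segment (g a) v \<subseteq> compl \<and> closed_segment (g b) v \<subseteq> compl \<and>
    \<psi> (subpath a b g) = \<psi> (linepath (g a) v) \<otimes> \<psi> (linepath v (g b)))"
  \<comment> \<open>The exceptional family is quantified before the apex: it stays finite under
    union of adjacent intervals, so one \<open>v\<close> can be chosen for the whole path at the
    end.\<close>
  define P where "P = (\<lambda>a b. 0 \<le> a \<and> b \<le> 1 \<longrightarrow>
    (\<exists>F. finite F \<and> (\<forall>U\<in>F. subspace U \<and> U \<noteq> UNIV) \<and> (\<forall>v. (\<forall>U\<in>F. v \<notin> U) \<longrightarrow> cone a b v)))"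
  have "P 0 1"
  proof (rule Bolzano)
    show "(0::real) \<le> 1" by simp
  next
    fix a b c assume P: "P a b" "P b c" and abc: "a \<le> b" "b \<le> c"
    show "P a c" unfolding P_def
    proof
      assume ac: "0 \<le> a \<and> c \<le> 1"
      obtain F where F: "finite F" "\<forall>U\<in>F. subspace U \<and> U \<noteq> UNIV" "\<And>v. (\<forall>U\<in>F. v \<notin> U) \<Longrightarrow> cone a b v"
        using P(1) ac abc unfolding P_def by auto
      obtain F' where F': "finite F'" "\<forall>U\<in>F'. subspace U \<and> U \<noteq> UNIV" "\<And>v. (\<forall>U\<in>F'. v \<notin> U) \<Longrightarrow> cone b c v"
        using P(2) ac abc unfolding P_def by auto
      have "cone a c v" if v: "\<forall>U\<in>F \<union> F'. v \<notin> U" for v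
      proof -
        have c1: "closed_segment (g a) v \<subseteq> compl" "closed_segment (g b) v \<subseteq> compl" "closed_segment (g c) v \<subseteq> compl"
          "\<psi> (subpath a b g) = \<psi> (linepath (g a) v) \<otimes> \<psi> (linepath v (g b))"
          "\<psi> (subpath b c g) = \<psi> (linepath (g b) v) \<otimes> \<psi> (linepath v (g c))"
          using F(3)[of v] F'(3)[of v] v by (auto simp: cone_def)
        have c2: "closed_segment v (g b) \<subseteq> compl" "closed_segment v (g c) \<subseteq> compl"
          using c1 by (simp_all add: closed_segment_commute)
        have sp: "path (subpath x y g)" "path_image (subpath x y g) \<subseteq> compl" if "x \<in> {0..1}" "y \<in> {0..1}" for x y
          using path_subpath[OF g(1) that] subset_trans[OF path_image_subpath_subset[OF that] g(2)] by simp_all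
        have "\<psi> (subpath a c g) = \<psi> (subpath a b g +++ subpath b c g)"
          by (rule homotopic[OF homotopic_paths_sym[OF homotopic_join_subpaths[OF g(1,2)]]]) (use ac abc in auto)
        also have "\<dots> = \<psi> (subpath a b g) \<otimes> \<psi> (subpath b c g)"
          using ac abc by (intro join sp) auto
        also have "\<dots> = \<psi> (linepath (g a) v) \<otimes> ((\<psi> (linepath v (g b)) \<otimes> \<psi> (linepath (g b) v)) \<otimes> \<psi> (linepath v (g c)))"
          using c1 c2 by (simp add: G.m_assoc)
        also have "\<psi> (linepath v (g b)) \<otimes> \<psi> (linepath (g b) v) = \<one>"
          using reverse[of "linepath v (g b)"] c2 by simp
        finally show ?thesis using c1 c2 by (simp add: cone_def)
      qed
      then show "\<exists>F. finite F \<and> (\<forall>U\<in>F. subspace U \<and> U \<noteq> UNIV) \<and> (\<forall>v. (\<forall>U\<in>F. v \<notin> U) \<longrightarrow> cone a c v)"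
        using F(1,2) F'(1,2) by (intro exI[of _ "F \<union> F'"]) auto
    qed
  next
    fix x :: real assume x: "0 \<le> x" "x \<le> 1"
    have gx: "g x \<in> compl" using g(2) x by (auto simp: path_image_def)
    then obtain e where e: "e > 0" "ball (g x) e \<subseteq> compl" by (rule openE[OF open_compl])
    have "continuous_on {0..1} g" using g(1) by (simp add: path_def)
    then obtain \<delta> where \<delta>: "\<delta> > 0" "\<And>t. t \<in> {0..1} \<Longrightarrow> dist t x < \<delta> \<Longrightarrow> dist (g t) (g x) < e"
    proof -
      assume c: "continuous_on {0..1} g"
      have "x \<in> {0..1}" using x by simp
      with c e(1) obtain \<delta> where "\<delta> > 0" "\<forall>t\<in>{0..1}. dist t x < \<delta> \<longrightarrow> dist (g t) (g x) < e"
        unfolding continuous_on_iff by blast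
      then show ?thesis using that[of \<delta>] by blast
    qed
    show "\<exists>d>0. \<forall>a b. a \<le> x \<and> x \<le> b \<and> b - a < d \<longrightarrow> P a b"
    proof (intro exI[of _ \<delta>] conjI allI impI)
      fix a b assume ab: "a \<le> x \<and> x \<le> b \<and> b - a < \<delta>"
      show "P a b" unfolding P_def
      proof
        assume ab': "0 \<le> a \<and> b \<le> 1"
        have near: "g t \<in> ball (g x) e" if "t \<in> {a..b}" for t
          using \<delta>(2)[of t] that ab ab' by (auto simp: dist_commute dist_real_def)
        then have seg: "closed_segment (g a) (g b) \<subseteq> ball (g x) e"
          using ab by (intro closed_segment_subset convex_ball) auto
        \<comment> \<open>A short piece lies in a ball inside the complement and may be replaced by
          its chord.\<close>
        have "\<psi> (subpath a b g) = \<psi> (linepath (g a) (g b))"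
        proof (rule convex_eq[OF convex_ball e(2)])
          show "path (subpath a b g)" using g(1) ab ab' by (intro path_subpath) auto
          show "path_image (subpath a b g) \<subseteq> ball (g x) e"
            using near ab by (auto simp: path_image_subpath)
        qed (use seg in auto)
        note sub = this
        have gab: "g a \<in> compl" "g b \<in> compl" using near[of a] near[of b] ab e(2) by auto
        from generic_family[OF gab] obtain F where F: "finite F" "\<forall>U\<in>F. subspace U \<and> U \<noteq> UNIV"
          "\<forall>v. (\<forall>U\<in>F. v \<notin> U) \<longrightarrow> generic (g a) (g b) v" by (elim exE conjE)
        have AB: "closed_segment (g a) (g b) \<subseteq> compl" using seg e(2) by (rule subset_trans)
        have "cone a b v" if "\<forall>U\<in>F. v \<notin> U" for v
          using generic_cone[OF AB F(3)[THEN spec, THEN mp, OF that]] by (simp add: cone_def sub)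
        then show "\<exists>F. finite F \<and> (\<forall>U\<in>F. subspace U \<and> U \<noteq> UNIV) \<and> (\<forall>v. (\<forall>U\<in>F. v \<notin> U) \<longrightarrow> cone a b v)"
          using F(1,2) by blast
      qed
    qed (rule \<delta>(1))
  qed
  then obtain F where F: "finite F" "\<And>U. U \<in> F \<Longrightarrow> subspace U \<and> U \<noteq> UNIV" "\<And>v. (\<forall>U\<in>F. v \<notin> U) \<Longrightarrow> cone 0 1 v"
    unfolding P_def by auto
  obtain v where "\<forall>U\<in>F. v \<notin> U" using finite_union_proper_subspaces[OF F(1,2)] by blast
  \<comment> \<open>For a closed path the two remaining radii are reverse to each other.\<close>
  then have "cone 0 1 v" by (rule F(3))
  then have "closed_segment (g 0) v \<subseteq> compl" "\<psi> g = \<psi> (linepath (g 0) v) \<otimes> \<psi> (linepath v (g 0))"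
    using g(3) by (auto simp: cone_def pathfinish_def pathstart_def)
  then show ?thesis using reverse[of "linepath (g 0) v"] by simp
qed

end

section \<open>The braid group as a group of lifted paths\<close>

text \<open>Truncated distance functions embed the orbit space into a normed space, so that the results on
  covering spaces of the library apply to it.\<close>

definition dist_embed :: "'v::metric_space set \<Rightarrow> ('v \<Rightarrow>\<^sub>C real)"
  where "dist_embed A = Bcontfun (\<lambda>v. min 1 (infdist v A))"

lemma dist_embed_apply: "apply_bcontfun (dist_embed A) v = min 1 (infdist v A)"
proof -
  have "(\<lambda>v. min 1 (infdist v A)) \<in> bcontfun"
  proof (rule bcontfun_normI)
    show "continuous_on UNIV (\<lambda>v. min 1 (infdist v A))" by (intro continuous_intros)
    show "norm (min 1 (infdist x A)) \<le> 1" for x using infdist_nonneg[of x A] by auto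
  qed
  then show ?thesis by (simp add: dist_embed_def Bcontfun_inverse)
qed

lemma infdist_finite_attained:
  assumes "finite A" "A \<noteq> {}"
  shows "\<exists>a\<in>A. infdist v A = dist v a"
proof -
  obtain a where a: "a \<in> A" "\<And>b. b \<in> A \<Longrightarrow> dist v a \<le> dist v b"
    using ex_min_if_finite[of "dist v ` A"] assms by (auto simp: not_less)
  have "dist v a \<le> infdist v A"
    unfolding infdist_notempty[OF assms(2)] using assms(2) a(2) by (intro cINF_greatest) auto
  then show ?thesis using infdist_le[OF a(1), of v] a(1) by (intro bexI[of _ a]) auto
qed

locale braid_setting = reflection_setting herm W
  for herm :: "'v::complex_fd_space \<Rightarrow> 'v \<Rightarrow> complex" and W +
  fixes x0 :: 'v
  assumes x0: "x0 \<in> regular_part W"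
begin

abbreviation "S \<equiv> regular_part W"
abbreviation "X \<equiv> regular_orbit_space W"
abbreviation "B \<equiv> braid_group W x0"
abbreviation "orb \<equiv> group_orbit W"

definition emb :: "'v \<Rightarrow> ('v \<Rightarrow>\<^sub>C real)" where "emb x = dist_embed (orb x)"
abbreviation "Y \<equiv> emb ` S"

lemma orb_eq: "orb x = (\<lambda>w. w x) ` W"
  by (auto simp: group_orbit_def orbit_def)

lemma finite_orb: "finite (orb x)" and orb_nonempty: "orb x \<noteq> {}" and orb_self: "x \<in> orb x"
proof -
  show "finite (orb x)" by (simp add: orb_eq finite_W)
  have "id x \<in> orb x" unfolding orb_eq using id_W by (rule imageI)
  then show "x \<in> orb x" by simp
  then show "orb x \<noteq> {}" by blast
qed

lemma orb_W: assumes w: "w \<in> W" shows "orb (w x) = orb x"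
proof -
  have "v (w x) \<in> orb x" if "v \<in> W" for v
  proof -
    have "(v \<circ> w) x \<in> orb x" unfolding orb_eq by (rule imageI[OF comp_W[OF that w]])
    then show ?thesis by simp
  qed
  moreover have "v x \<in> orb (w x)" if "v \<in> W" for v
  proof -
    have "(v \<circ> finv w) (w x) \<in> orb (w x)" unfolding orb_eq by (rule imageI[OF comp_W[OF that inv_W[OF w]]])
    then show ?thesis by (simp add: W_inv_apply[OF w])
  qed
  ultimately show ?thesis by (auto simp: orb_eq[of "w x"] orb_eq[of x] image_iff)
qed

lemma orb_eq_iff: "orb x = orb y \<longleftrightarrow> (\<exists>w\<in>W. y = w x)"
proof
  assume "orb x = orb y"
  then have "y \<in> orb x" using orb_self by simp
  then show "\<exists>w\<in>W. y = w x" by (auto simp: orb_eq)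
qed (auto simp: orb_W)

lemma emb_W: "w \<in> W \<Longrightarrow> emb (w x) = emb x"
  by (simp add: emb_def orb_W)

text \<open>Both truncated distance functions are evaluated at \<open>x\<close> itself: that of the
  orbit of \<open>x\<close> is 0 there, so the orbit of \<open>y\<close> has a point close to
  \<open>x\<close>. The minimum with 1 accounts for the truncation.\<close>

lemma emb_near:
  assumes "0 < e"
  shows "\<exists>r>0. \<forall>y. dist (emb y) (emb x) < r \<longrightarrow> (\<exists>w\<in>W. dist (w y) x < e)"
proof (intro exI[of _ "min 1 e"] conjI allI impI)
  fix y assume d: "dist (emb y) (emb x) < min 1 e"
  have "dist (apply_bcontfun (emb y) x) (apply_bcontfun (emb x) x) \<le> dist (emb y) (emb x)"
    by (rule dist_bounded)
  moreover have "apply_bcontfun (emb x) x = 0" using orb_self by (simp add: emb_def dist_embed_apply)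
  ultimately have "min 1 (infdist x (orb y)) < min 1 e"
    using d infdist_nonneg[of x "orb y"] by (simp add: emb_def dist_embed_apply dist_real_def)
  then have "infdist x (orb y) < e" by auto
  then obtain z where "z \<in> orb y" "dist x z < e"
    using infdist_finite_attained[OF finite_orb orb_nonempty, of y x] by auto
  then show "\<exists>w\<in>W. dist (w y) x < e" by (auto simp: orb_eq dist_commute)
qed (use assms in auto)

lemma emb_eq_iff: "emb x = emb y \<longleftrightarrow> orb x = orb y"
proof
  assume eq: "emb x = emb y"
  have "min 1 (infdist x (orb y)) = min 1 (infdist x (orb x))"
    using eq by (metis emb_def dist_embed_apply)
  then have "infdist x (orb y) = 0" using orb_self[of x] by (auto simp: min_def split: if_splits)
  then have "x \<in> orb y"
    using in_closed_iff_infdist_zero[OF finite_imp_closed[OF finite_orb] orb_nonempty] by blast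
  then show "orb x = orb y" using orb_W by (auto simp: orb_eq[of y])
qed (simp add: emb_def)

text \<open>If every \<open>w y\<close> is close to \<open>w x\<close>, the distances of any point
  to the two orbits differ little, uniformly in that point; \<open>W\<close> is finite, so
  continuity of each \<open>w\<close> suffices.\<close>

lemma continuous_emb: "continuous_on A emb"
proof (rule continuous_on_subset[of UNIV])
  show "continuous_on UNIV emb" unfolding continuous_on_iff
  proof (intro ballI allI impI)
    fix x :: 'v and e :: real assume e: "0 < e"
    have "eventually (\<lambda>y. \<forall>w\<in>W. dist (w y) (w x) < e / 2) (at x)"
    proof (intro eventually_ball_finite finite_W ballI)
      fix w assume "w \<in> W"
      then have "isCont w x" using continuous_W[of w UNIV] by (simp add: continuous_on_eq_continuous_at)
      then show "eventually (\<lambda>y. dist (w y) (w x) < e / 2) (at x)"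
        unfolding isCont_def using e by (intro tendstoD) auto
    qed
    then obtain \<delta> where \<delta>: "\<delta> > 0" "\<And>y. y \<noteq> x \<Longrightarrow> dist y x < \<delta> \<Longrightarrow> \<forall>w\<in>W. dist (w y) (w x) < e / 2"
      unfolding eventually_at by auto
    have le: "infdist v (orb y) \<le> infdist v (orb x) + e / 2"
      if "\<forall>w\<in>W. dist (w y) (w x) < e / 2" for v x y
    proof -
      obtain z where z: "z \<in> orb x" "infdist v (orb x) = dist v z"
        using infdist_finite_attained[OF finite_orb orb_nonempty, of x v] by blast
      then obtain w where w: "w \<in> W" "z = w x" by (auto simp: orb_eq)
      have "infdist v (orb y) \<le> dist v (w y)"
        by (rule infdist_le) (use w(1) in \<open>simp add: orb_eq\<close>)
      also have "\<dots> \<le> dist v z + dist (w y) (w x)" unfolding w(2) by (metis dist_commute dist_triangle)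
      also have "\<dots> \<le> infdist v (orb x) + e / 2" using that w(1) z(2) by fastforce
      finally show ?thesis .
    qed
    show "\<exists>\<delta>>0. \<forall>y\<in>UNIV. dist y x < \<delta> \<longrightarrow> dist (emb y) (emb x) < e"
    proof (intro exI[of _ \<delta>] conjI ballI impI \<delta>(1))
      fix y assume y: "dist y x < \<delta>"
      have near: "\<forall>w\<in>W. dist (w y) (w x) < e / 2" using \<delta>(2)[OF _ y] e by (cases "y = x") auto
      then have near': "\<forall>w\<in>W. dist (w x) (w y) < e / 2" by (simp add: dist_commute)
      have "dist (emb y) (emb x) \<le> e / 2"
      proof (rule dist_bound)
        fix v
        show "dist (apply_bcontfun (emb y) v) (apply_bcontfun (emb x) v) \<le> e / 2"
        proof -
          have "\<bar>min 1 a - min 1 b\<bar> \<le> c" if "a \<le> b + c" "b \<le> a + c" "0 \<le> c" for a b c :: real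
            using that by linarith
          from this[OF le[OF near, of v] le[OF near', of v]] show ?thesis
            using e by (simp add: emb_def dist_embed_apply dist_real_def)
        qed
      qed
      then show "dist (emb y) (emb x) < e" using e by simp
    qed
  qed
qed simp

lemma open_S: "open S"
proof -
  have "S = (\<Inter>H\<in>hyps. {x. lf H x \<noteq> 0})" using regular_part_iff by auto
  moreover have "open {x. lf H x \<noteq> 0}" for H
    by (intro open_Collect_neq continuous_lf continuous_intros)
  ultimately show ?thesis using finite_hyps by (simp add: open_INT)
qed

lemma emb_open:
  assumes U: "open U" "U \<subseteq> S"
  shows "openin (top_of_set Y) (emb ` U)"
  unfolding openin_euclidean_subtopology_iff
proof (intro conjI ballI)
  show "emb ` U \<subseteq> Y" using U(2) by blast
  fix z assume "z \<in> emb ` U"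
  then obtain x where x: "x \<in> U" "z = emb x" by blast
  obtain e where e: "e > 0" "ball x e \<subseteq> U" using U(1) x(1) by (rule openE)
  obtain r where r: "r > 0" "\<And>y. dist (emb y) (emb x) < r \<Longrightarrow> \<exists>w\<in>W. dist (w y) x < e"
    using emb_near[OF e(1)] by blast
  show "\<exists>r>0. \<forall>z'\<in>Y. dist z' z < r \<longrightarrow> z' \<in> emb ` U"
  proof (intro exI[of _ r] conjI ballI impI r(1))
    fix z' assume "z' \<in> Y" "dist z' z < r"
    then obtain y w where y: "z' = emb y" "w \<in> W" "dist (w y) x < e" using r(2) x(2) by blast
    then have "w y \<in> U" using e(2) by (auto simp: dist_commute)
    then show "z' \<in> emb ` U" using emb_W[OF y(2)] y(1) by (metis image_eqI)
  qed
qed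

text \<open>Freeness gives a positive lower bound \<open>\<mu>\<close> for the displacement of
  \<open>x\<close> by nontrivial elements. On \<open>U\<close> every element of \<open>W\<close>
  moves a point to within \<open>\<mu> / 2\<close> of the image of \<open>x\<close>, so no two
  translates of \<open>U\<close> by distinct elements meet; they are the sheets.\<close>

lemma covering_emb: "covering_space S emb Y"
proof (rule covering_spaceI[OF continuous_emb refl])
  fix z assume "z \<in> Y"
  then obtain x where x: "x \<in> S" "z = emb x" by blast
  obtain \<mu> where \<mu>: "\<mu> > 0" "\<forall>w\<in>W - {id}. \<mu> \<le> dist (w x) x"
    using finite_positive_lower_bound[of "W - {id}" "\<lambda>w. dist (w x) x"] finite_W regular_part_free[OF x(1)]
      by auto
  define U where "U = S \<inter> ball x (\<mu> / 2) \<inter> (\<Inter>w\<in>W. {y. dist (w y) (w x) < \<mu> / 2})"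
  have oU: "open U" unfolding U_def
    using continuous_W finite_W
      by (intro open_Int open_S open_ball open_INT ballI open_Collect_less continuous_intros) auto
  have xU: "x \<in> U" using x(1) \<mu>(1) by (simp add: U_def)
  have US: "U \<subseteq> S" by (auto simp: U_def)
  have sep: "w = id" if w: "w \<in> W" and y: "y \<in> U" "w y \<in> U" for w y
  proof (rule ccontr)
    assume "w \<noteq> id"
    then have "\<mu> \<le> dist (w x) x" using \<mu>(2) w by blast
    moreover have "dist (w y) (w x) < \<mu> / 2" "dist x (w y) < \<mu> / 2" using w y by (auto simp: U_def)
    moreover have "dist (w x) x \<le> dist (w y) (w x) + dist x (w y)"
      using dist_triangle[of "w x" x "w y"] by (simp add: dist_commute)
    ultimately show False by linarith
  qed
  have wU: "open (w ` U)" "w ` U \<subseteq> S" if w: "w \<in> W" for w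
  proof -
    have "w ` U = finv w -` U" using W_inv_apply[OF w] by (auto simp: image_iff) (metis)
    then show "open (w ` U)" using continuous_W[OF inv_W[OF w]] oU by (simp add: open_vimage)
    show "w ` U \<subseteq> S" using W_regular[OF w] US by blast
  qed
  show "\<exists>T. z \<in> T \<and> openin (top_of_set Y) T \<and> (\<exists>v. \<Union>v = S \<inter> emb -` T \<and>
      (\<forall>u\<in>v. openin (top_of_set S) u) \<and> pairwise disjnt v \<and> (\<forall>u\<in>v. \<exists>q. homeomorphism u T emb q))"
  proof (intro exI[of _ "emb ` U"] conjI exI[of _ "(\<lambda>w. w ` U) ` W"] ballI)
    show "z \<in> emb ` U" using x(2) xU by blast
    show "openin (top_of_set Y) (emb ` U)" by (rule emb_open[OF oU US])
    show "\<Union> ((\<lambda>w. w ` U) ` W) = S \<inter> emb -` (emb ` U)"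
    proof
      show "\<Union> ((\<lambda>w. w ` U) ` W) \<subseteq> S \<inter> emb -` (emb ` U)" using wU(2) emb_W by auto
      show "S \<inter> emb -` (emb ` U) \<subseteq> \<Union> ((\<lambda>w. w ` U) ` W)"
      proof
        fix y assume "y \<in> S \<inter> emb -` (emb ` U)"
        then obtain t where t: "t \<in> U" "emb t = emb y" by auto
        then obtain w where "w \<in> W" "y = w t" using emb_eq_iff orb_eq_iff by blast
        then show "y \<in> \<Union> ((\<lambda>w. w ` U) ` W)" using t(1) by blast
      qed
    qed
    fix u assume "u \<in> (\<lambda>w. w ` U) ` W"
    then obtain w where w: "w \<in> W" "u = w ` U" by blast
    show "openin (top_of_set S) u"
      unfolding w(2) using wU[OF w(1)] by (simp add: open_openin_trans[OF open_S] openin_open_eq[OF open_S])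
    have "inj_on emb u"
    proof (rule inj_onI)
      fix a b assume ab: "a \<in> u" "b \<in> u" "emb a = emb b"
      then obtain y y' where y: "y \<in> U" "a = w y" "y' \<in> U" "b = w y'" using w(2) by blast
      then have "orb y = orb y'" using ab(3) emb_eq_iff emb_W[OF w(1)] by metis
      then obtain v where "v \<in> W" "y' = v y" using orb_eq_iff by blast
      then have "y' = y" using sep[of v y] y by simp
      then show "a = b" using y by simp
    qed
    moreover have "emb ` u = emb ` U" unfolding w(2) image_image using emb_W[OF w(1)] by simp
    moreover have "openin (top_of_set (emb ` U)) (emb ` V)" if V: "openin (top_of_set u) V" for V
    proof -
      have "open V" using V wU(1)[OF w(1)] openin_open_eq w(2) by metis
      moreover have Vu: "V \<subseteq> u" using V openin_imp_subset by blast
      ultimately have "openin (top_of_set Y) (emb ` V)" using wU(2)[OF w(1)] w(2) by (intro emb_open) auto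
      moreover have "emb ` V \<subseteq> emb ` U" using Vu calculation \<open>emb ` u = emb ` U\<close> by blast
      moreover have "emb ` U \<subseteq> Y" using US by blast
      ultimately show ?thesis using openin_subset_trans by blast
    qed
    ultimately show "\<exists>q. homeomorphism u (emb ` U) emb q"
      using homeomorphism_injective_open_map[OF continuous_emb] by metis
  next
    show "pairwise disjnt ((\<lambda>w. w ` U) ` W)"
    proof (rule pairwiseI)
      fix u u' assume "u \<in> (\<lambda>w. w ` U) ` W" "u' \<in> (\<lambda>w. w ` U) ` W" "u \<noteq> u'"
      then obtain w w' where w: "w \<in> W" "u = w ` U" "w' \<in> W" "u' = w' ` U" by blast
      show "disjnt u u'"
      proof (rule ccontr)
        assume "\<not> disjnt u u'"
        then obtain y y' where y: "y \<in> U" "y' \<in> U" "w y = w' y'" using w by (auto simp: disjnt_def)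
        then have "(finv w' \<circ> w) y = y'" using W_inv_apply(2)[OF w(3)] by simp
        then have "finv w' \<circ> w = id" using sep[OF comp_W[OF inv_W[OF w(3)] w(1)], of y] y by simp
        then have "finv w' (w t) = t" for t by (metis comp_apply id_apply)
        then have "w t = w' t" for t using W_inv_apply(1)[OF w(3)] by metis
        then have "w = w'" by blast
        then show False using w \<open>u \<noteq> u'\<close> by simp
      qed
    qed
  qed
qed

lemma topspace_X: "topspace X = orb ` S"
  using quotient_imp_surjective_map[OF quotient_map_quotient_topology[of "top_of_set S" orb]]
  by (simp add: regular_orbit_space_def)

lemma quotient_orb: "quotient_map (top_of_set S) X orb"
  unfolding regular_orbit_space_def by (rule quotient_map_quotient_topology)

text \<open>The orbit map and \<open>emb\<close> are both quotient maps and have the same fibres, so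
  the induced bijection is a homeomorphism.\<close>

lemma homeomorphic_dist_embed: "homeomorphic_map X (top_of_set Y) dist_embed"
proof -
  have q: "quotient_map (top_of_set S) (top_of_set Y) emb"
  proof (rule continuous_open_imp_quotient_map)
    show "continuous_map (top_of_set S) (top_of_set Y) emb" using continuous_emb by auto
    show "open_map (top_of_set S) (top_of_set Y) emb"
      unfolding open_map_def using emb_open openin_open_eq[OF open_S] by auto
  qed simp
  have e: "emb = dist_embed \<circ> orb" by (auto simp: emb_def)
  have "continuous_map X (top_of_set Y) dist_embed"
    using continuous_compose_quotient_map[OF quotient_orb] quotient_imp_continuous_map[OF q] e by metis
  then have "quotient_map X (top_of_set Y) dist_embed"
    using quotient_map_from_composition[OF quotient_imp_continuous_map[OF quotient_orb]] q e by metis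
  moreover have "inj_on dist_embed (topspace X)"
    unfolding topspace_X using emb_eq_iff by (auto simp: inj_on_def emb_def)
  ultimately show ?thesis by (simp add: homeomorphic_map_def)
qed

text \<open>The homeomorphism and its inverse transport homotopies. Its inverse is controlled only
  on the orbit space, hence the hypotheses on the values over the unit interval.\<close>

lemma path_homotopic_iff:
  assumes g: "\<And>t. t \<in> {0..1} \<Longrightarrow> g t \<in> topspace X" and h: "\<And>t. t \<in> {0..1} \<Longrightarrow> h t \<in> topspace X"
  shows "path_homotopic X g h \<longleftrightarrow> homotopic_paths Y (dist_embed \<circ> g) (dist_embed \<circ> h)"
proof -
  obtain f where f: "homeomorphic_maps X (top_of_set Y) dist_embed f"
    using homeomorphic_dist_embed homeomorphic_map_maps by blast
  then have fe: "f (dist_embed a) = a" if "a \<in> topspace X" for a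
    using that by (simp add: homeomorphic_maps_def)
  have cont: "continuous_map X (top_of_set Y) dist_embed" "continuous_map (top_of_set Y) X f"
    using f by (auto simp: homeomorphic_maps_def)
  show ?thesis
  proof
    assume "path_homotopic X g h"
    then show "homotopic_paths Y (dist_embed \<circ> g) (dist_embed \<circ> h)"
      unfolding path_homotopic_def homotopic_paths_def
      by (rule homotopic_with_compose_continuous_map_left[OF _ cont(1)]) (auto simp: pathstart_def pathfinish_def)
  next
    assume "homotopic_paths Y (dist_embed \<circ> g) (dist_embed \<circ> h)"
    then have "homotopic_with (\<lambda>r. r 0 = g 0 \<and> r 1 = g 1) (top_of_set {0..1}) X
      (f \<circ> (dist_embed \<circ> g)) (f \<circ> (dist_embed \<circ> h))"
      unfolding homotopic_paths_def
      by (rule homotopic_with_compose_continuous_map_left[OF _ cont(2)])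
        (use g[of 0] g[of 1] fe in \<open>auto simp: pathstart_def pathfinish_def\<close>)
    then show "path_homotopic X g h" unfolding path_homotopic_def
      by (rule homotopic_with_eq) (use g h fe in auto)
  qed
qed

lemma W_eqI: assumes "v \<in> W" "w \<in> W" "x \<in> S" "v x = w x" shows "v = w"
proof -
  have "(finv w \<circ> v) x = x" using assms(4) W_inv_apply(2)[OF assms(2)] by simp
  then have "finv w \<circ> v = id"
    using regular_part_free[OF assms(3) comp_W[OF inv_W[OF assms(2)] assms(1)]] by blast
  then have "finv w (v t) = t" for t by (metis comp_apply id_apply)
  then have "v t = w t" for t using W_inv_apply(1)[OF assms(2)] by metis
  then show ?thesis by blast
qed

text \<open>Loops in the orbit space are handled through paths upstairs; by freeness the endpoint
  determines \<open>w\<close>, and \<open>cls g\<close> is the class of the projected loop.\<close>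

definition lift :: "('v \<Rightarrow> 'v) \<Rightarrow> (real \<Rightarrow> 'v) \<Rightarrow> bool"
  where "lift w g \<longleftrightarrow> w \<in> W \<and> path g \<and> path_image g \<subseteq> S \<and> pathstart g = x0 \<and> pathfinish g = w x0"

definition cls :: "(real \<Rightarrow> 'v) \<Rightarrow> (real \<Rightarrow> 'v set) set" where "cls g = path_class X (orb \<circ> g)"

lemma emb_o: "dist_embed \<circ> (orb \<circ> g) = emb \<circ> g"
  by (auto simp: emb_def)

lemma path_emb: "path g \<Longrightarrow> path (emb \<circ> g)"
  by (intro path_continuous_image continuous_emb)

lemma orb_in_topspace: "path_image g \<subseteq> S \<Longrightarrow> t \<in> {0..1} \<Longrightarrow> (orb \<circ> g) t \<in> topspace X"
  unfolding topspace_X path_image_def by (simp add: image_subset_iff)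

lemma path_homotopic_imp_topspace:
  assumes "path_homotopic X g h" "t \<in> {0..1}"
  shows "g t \<in> topspace X" "h t \<in> topspace X"
proof -
  have "continuous_map (top_of_set {0..1}) X g \<and> continuous_map (top_of_set {0..1}) X h"
    by (rule homotopic_with_imp_continuous_maps[OF assms(1)[unfolded path_homotopic_def]])
  then show "g t \<in> topspace X" "h t \<in> topspace X"
    using assms(2) by (auto simp: continuous_map_def Pi_iff)
qed

lemma mem_cls:
  assumes "path_image g \<subseteq> S"
  shows "h \<in> cls g \<longleftrightarrow> (\<forall>t\<in>{0..1}. h t \<in> topspace X) \<and> homotopic_paths Y (emb \<circ> g) (dist_embed \<circ> h)"
proof -
  have "h \<in> cls g \<longleftrightarrow> path_homotopic X (orb \<circ> g) h" by (simp add: cls_def path_class_def)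
  also have "\<dots> \<longleftrightarrow> (\<forall>t\<in>{0..1}. h t \<in> topspace X) \<and> homotopic_paths Y (emb \<circ> g) (dist_embed \<circ> h)"
    using path_homotopic_iff[of "orb \<circ> g" h] orb_in_topspace[OF assms] path_homotopic_imp_topspace(2)
    unfolding emb_o by blast
  finally show ?thesis .
qed

text \<open>Homotopies lift along the covering, and the common starting point makes the given paths
  the corresponding lifts.\<close>

lemma homotopic_emb_iff:
  assumes "path g" "path_image g \<subseteq> S" "path g'" "path_image g' \<subseteq> S" "pathstart g = pathstart g'"
  shows "homotopic_paths Y (emb \<circ> g) (emb \<circ> g') \<longleftrightarrow> homotopic_paths S g g'"
proof
  assume h: "homotopic_paths Y (emb \<circ> g) (emb \<circ> g')"
  show "homotopic_paths S g g'"
  proof (rule covering_space_lift_homotopic_paths[OF covering_emb _ _ _ _ h])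
    show "path_image (emb \<circ> g) \<subseteq> Y" "path_image (emb \<circ> g') \<subseteq> Y"
      using assms by (auto simp: path_image_compose)
  qed (use assms path_emb in auto)
next
  assume "homotopic_paths S g g'"
  then show "homotopic_paths Y (emb \<circ> g) (emb \<circ> g')"
    by (rule homotopic_paths_continuous_image[OF _ continuous_emb]) auto
qed

lemma cls_eq_iff:
  assumes "path g" "path_image g \<subseteq> S" "path g'" "path_image g' \<subseteq> S" "pathstart g = pathstart g'"
  shows "cls g = cls g' \<longleftrightarrow> homotopic_paths S g g'"
proof
  assume "cls g = cls g'"
  moreover have "orb \<circ> g' \<in> cls g'"
    unfolding mem_cls[OF assms(4)] emb_o
    using orb_in_topspace[OF assms(4)] assms(3,4) path_emb by (auto simp: path_image_compose)
  ultimately have "orb \<circ> g' \<in> cls g" by simp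
  then show "homotopic_paths S g g'"
    unfolding mem_cls[OF assms(2)] emb_o homotopic_emb_iff[OF assms] by blast
next
  assume "homotopic_paths S g g'"
  then have h: "homotopic_paths Y (emb \<circ> g) (emb \<circ> g')" using homotopic_emb_iff[OF assms] by blast
  show "cls g = cls g'"
    using h homotopic_paths_trans homotopic_paths_sym
    unfolding set_eq_iff mem_cls[OF assms(2)] mem_cls[OF assms(4)] by blast
qed

lemma lift_pathD: "lift w g \<Longrightarrow> path g" "lift w g \<Longrightarrow> path_image g \<subseteq> S" "lift w g \<Longrightarrow> w \<in> W"
  "lift w g \<Longrightarrow> pathstart g = x0" "lift w g \<Longrightarrow> pathfinish g = w x0"
  by (simp_all add: lift_def)

lemma path_W: "w \<in> W \<Longrightarrow> path g \<Longrightarrow> path (w \<circ> g)"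
  by (intro path_continuous_image continuous_W)

lemma path_image_W: "w \<in> W \<Longrightarrow> path_image g \<subseteq> S \<Longrightarrow> path_image (w \<circ> g) \<subseteq> S"
  unfolding path_image_compose using W_regular by blast

lemma lift_join: "lift v g \<Longrightarrow> lift w h \<Longrightarrow> lift (v \<circ> w) (g +++ (v \<circ> h))"
  unfolding lift_def using path_W path_image_W comp_W
  by (simp add: path_image_join pathstart_compose pathfinish_compose)

lemma lift_inverse: "lift w g \<Longrightarrow> lift (finv w) (finv w \<circ> reversepath g)"
  unfolding lift_def using path_W[OF inv_W] path_image_W[OF inv_W] inv_W
  by (simp add: pathstart_compose pathfinish_compose W_inv_apply)

lemma lift_id: "lift id (linepath x0 x0)"
  unfolding lift_def using x0 id_W by simp

lemma cls_eqI: "lift v g \<Longrightarrow> homotopic_paths S g h \<Longrightarrow> cls g = cls h"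
  using cls_eq_iff[of g h] homotopic_paths_imp_path homotopic_paths_imp_subset homotopic_paths_imp_pathstart
    by blast

text \<open>The second lift must be translated by \<open>v\<close> to start where the first one
  ends; its projection is unchanged. The product is defined through all representatives of the two
  classes, so an equality of sets is shown.\<close>

lemma cls_mult:
  assumes g: "lift v g" and h: "lift w h"
  shows "cls g \<otimes>\<^bsub>B\<^esub> cls h = cls (g +++ (v \<circ> h))"
proof -
  note g' = lift_pathD[OF g] and h' = lift_pathD[OF h]
  have emb_eq: "emb \<circ> (g +++ (v \<circ> h)) = (emb \<circ> g) +++ (emb \<circ> h)"
    using emb_W[OF g'(3)] by (auto simp: joinpaths_def)
  have img: "path_image (g +++ (v \<circ> h)) \<subseteq> S" using lift_pathD(2)[OF lift_join[OF g h]] .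
  have end_start: "pathfinish (emb \<circ> g) = pathstart (emb \<circ> h)"
    using g'(5) h'(4) emb_W[OF g'(3)] by (simp add: pathfinish_compose pathstart_compose)
  have "k \<in> cls (g +++ (v \<circ> h)) \<longleftrightarrow> (\<exists>a\<in>cls g. \<exists>b\<in>cls h. path_homotopic X (path_join a b) k)" for k
  proof
    assume k: "k \<in> cls (g +++ (v \<circ> h))"
    have "path_homotopic X (path_join (orb \<circ> g) (orb \<circ> h)) k"
    proof (subst path_homotopic_iff)
      show "path_join (orb \<circ> g) (orb \<circ> h) t \<in> topspace X" if "t \<in> {0..1}" for t
        using that orb_in_topspace[OF g'(2)] orb_in_topspace[OF h'(2)] by (auto simp: path_join_def)
      show "k t \<in> topspace X" if "t \<in> {0..1}" for t using k that unfolding mem_cls[OF img] by blast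
      have "dist_embed \<circ> path_join (orb \<circ> g) (orb \<circ> h) = (emb \<circ> g) +++ (emb \<circ> h)"
        by (auto simp: path_join_def joinpaths_def emb_def)
      then show "homotopic_paths Y (dist_embed \<circ> path_join (orb \<circ> g) (orb \<circ> h)) (dist_embed \<circ> k)"
        using k unfolding mem_cls[OF img] emb_eq by simp
    qed
    moreover have "orb \<circ> g \<in> cls g" "orb \<circ> h \<in> cls h"
      unfolding mem_cls[OF g'(2)] mem_cls[OF h'(2)] emb_o
      using orb_in_topspace[OF g'(2)] orb_in_topspace[OF h'(2)] g' h' path_emb
        by (auto simp: path_image_compose)
    ultimately show "\<exists>a\<in>cls g. \<exists>b\<in>cls h. path_homotopic X (path_join a b) k" by blast
  next
    assume "\<exists>a\<in>cls g. \<exists>b\<in>cls h. path_homotopic X (path_join a b) k"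
    then obtain a b where ab: "a \<in> cls g" "b \<in> cls h" "path_homotopic X (path_join a b) k" by blast
    have "homotopic_paths Y (dist_embed \<circ> path_join a b) (dist_embed \<circ> k)"
      using path_homotopic_iff path_homotopic_imp_topspace[OF ab(3)] ab(3) by blast
    moreover have "dist_embed \<circ> path_join a b = (dist_embed \<circ> a) +++ (dist_embed \<circ> b)"
      by (auto simp: path_join_def joinpaths_def)
    moreover have "homotopic_paths Y ((emb \<circ> g) +++ (emb \<circ> h)) ((dist_embed \<circ> a) +++ (dist_embed \<circ> b))"
      using ab(1,2) end_start unfolding mem_cls[OF g'(2)] mem_cls[OF h'(2)] by (intro homotopic_paths_join) auto
    ultimately show "k \<in> cls (g +++ (v \<circ> h))"
      unfolding mem_cls[OF img] emb_eq
      using homotopic_paths_trans path_homotopic_imp_topspace(2)[OF ab(3)] by auto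
  qed
  then show ?thesis by (auto simp: braid_group_def fundamental_group_def)
qed

text \<open>Path lifting: a loop at the base orbit lifts to a path from \<open>x0\<close>, whose
  endpoint lies in the orbit of \<open>x0\<close>.\<close>

lemma carrier_B: "carrier B = {b. \<exists>w g. lift w g \<and> b = cls g}"
proof
  show "{b. \<exists>w g. lift w g \<and> b = cls g} \<subseteq> carrier B"
  proof clarify
    fix w g assume g: "lift w g"
    have "continuous_map (top_of_set {0..1}) (top_of_set S) g"
      using lift_pathD(1,2)[OF g] by (auto simp: path_def path_image_def)
    then have "pathin X (orb \<circ> g)" unfolding pathin_def
      using continuous_map_compose quotient_imp_continuous_map[OF quotient_orb] by blast
    moreover have "(orb \<circ> g) 0 = orb x0" "(orb \<circ> g) 1 = orb x0"
      using lift_pathD(3-5)[OF g] orb_W by (auto simp: pathstart_def pathfinish_def)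
    ultimately show "cls g \<in> carrier B"
      unfolding braid_group_def fundamental_group_def cls_def by auto
  qed
  show "carrier B \<subseteq> {b. \<exists>w g. lift w g \<and> b = cls g}"
  proof
    fix b assume "b \<in> carrier B"
    then obtain k where k: "b = path_class X k" "pathin X k" "k 0 = orb x0" "k 1 = orb x0"
      unfolding braid_group_def fundamental_group_def by auto
    have top: "k t \<in> topspace X" if "t \<in> {0..1}" for t
      using k(2) that by (auto simp: pathin_def continuous_map_def Pi_iff)
    have "path_homotopic X k k" unfolding path_homotopic_def using k(2)
      by (intro homotopic_with_equal) (auto simp: pathin_def)
    then have hom: "homotopic_paths Y (dist_embed \<circ> k) (dist_embed \<circ> k)" using path_homotopic_iff top by blast
    then have pk: "path (dist_embed \<circ> k)" "path_image (dist_embed \<circ> k) \<subseteq> Y" by auto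
    have "pathstart (dist_embed \<circ> k) = emb x0" by (simp add: pathstart_def k(3) emb_def)
    then obtain g where g: "path g" "path_image g \<subseteq> S" "pathstart g = x0"
      "\<And>t. t \<in> {0..1} \<Longrightarrow> emb (g t) = (dist_embed \<circ> k) t"
      using covering_space_lift_path_strong[OF covering_emb x0 pk] by metis
    have "emb (pathfinish g) = emb x0" using g(4)[of 1] by (simp add: pathfinish_def k(4) emb_def)
    then obtain w where w: "w \<in> W" "pathfinish g = w x0" using emb_eq_iff orb_eq_iff by metis
    have l: "lift w g" using g w by (simp add: lift_def)
    have "homotopic_paths Y (emb \<circ> g) (dist_embed \<circ> k)"
      using g path_emb by (intro homotopic_paths_eq) (auto simp: path_image_compose)
    then have hk: "homotopic_paths Y (dist_embed \<circ> k) h \<longleftrightarrow> homotopic_paths Y (emb \<circ> g) h" for h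
      using homotopic_paths_trans homotopic_paths_sym by blast
    have "b = cls g"
      unfolding set_eq_iff mem_cls[OF g(2)] k(1) path_class_def
      using path_homotopic_iff[of k] top path_homotopic_imp_topspace(2)[of k] hk by auto
    then show "b \<in> {b. \<exists>w g. lift w g \<and> b = cls g}" using l by blast
  qed
qed

lemma cls_carrier: "lift w g \<Longrightarrow> cls g \<in> carrier B"
  unfolding carrier_B by blast

lemma one_B: "\<one>\<^bsub>B\<^esub> = cls (linepath x0 x0)"
proof -
  have "orb \<circ> linepath x0 x0 = (\<lambda>_. orb x0)" by (auto simp: linepath_refl)
  then show ?thesis by (simp add: braid_group_def fundamental_group_def cls_def)
qed

lemma homotopic_W: "w \<in> W \<Longrightarrow> homotopic_paths S g h \<Longrightarrow> homotopic_paths S (w \<circ> g) (w \<circ> h)"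
  by (rule homotopic_paths_continuous_image[OF _ continuous_W]) (auto intro: W_regular)

lemma cls_inverse_mult:
  assumes g: "lift w g"
  shows "cls (finv w \<circ> reversepath g) \<otimes>\<^bsub>B\<^esub> cls g = \<one>\<^bsub>B\<^esub>"
proof -
  note g' = lift_pathD[OF g]
  have h: "path (finv w \<circ> g)" "path_image (finv w \<circ> g) \<subseteq> S"
    using path_W[OF inv_W[OF g'(3)] g'(1)] path_image_W[OF inv_W[OF g'(3)] g'(2)] by auto
  have "cls (finv w \<circ> reversepath g) \<otimes>\<^bsub>B\<^esub> cls g = cls ((finv w \<circ> reversepath g) +++ (finv w \<circ> g))"
    by (rule cls_mult[OF lift_inverse[OF g] g])
  also have "\<dots> = cls (linepath x0 x0)"
  proof (rule cls_eqI[OF lift_join[OF lift_inverse[OF g] g]])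
    have "finv w \<circ> reversepath g = reversepath (finv w \<circ> g)" by (auto simp: reversepath_def)
    moreover have "pathfinish (finv w \<circ> g) = x0" using g' by (simp add: pathfinish_compose W_inv_apply)
    ultimately show "homotopic_paths S ((finv w \<circ> reversepath g) +++ (finv w \<circ> g)) (linepath x0 x0)"
      using homotopic_paths_linv[OF h] by simp
  qed
  finally show ?thesis by (simp add: one_B)
qed

lemma group_B: "group B"
proof (rule groupI)
  fix a b assume "a \<in> carrier B" "b \<in> carrier B"
  then obtain v g w h where "lift v g" "a = cls g" "lift w h" "b = cls h" unfolding carrier_B by blast
  then show "a \<otimes>\<^bsub>B\<^esub> b \<in> carrier B" using cls_mult cls_carrier lift_join by metis
next
  show "\<one>\<^bsub>B\<^esub> \<in> carrier B" unfolding one_B by (rule cls_carrier[OF lift_id])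
next
  fix a b c assume "a \<in> carrier B" "b \<in> carrier B" "c \<in> carrier B"
  then obtain u f v g w h where l: "lift u f" "a = cls f" "lift v g" "b = cls g" "lift w h" "c = cls h"
    unfolding carrier_B by blast
  note f' = lift_pathD[OF l(1)] and g' = lift_pathD[OF l(3)] and h' = lift_pathD[OF l(5)]
  have "a \<otimes>\<^bsub>B\<^esub> b \<otimes>\<^bsub>B\<^esub> c = cls ((f +++ (u \<circ> g)) +++ ((u \<circ> v) \<circ> h))"
    unfolding l(2,4,6) cls_mult[OF l(1,3)] by (rule cls_mult[OF lift_join[OF l(1,3)] l(5)])
  also have "\<dots> = cls (f +++ ((u \<circ> g) +++ (u \<circ> v \<circ> h)))"
  proof (rule cls_eqI[OF lift_join[OF lift_join[OF l(1,3)] l(5)]], rule homotopic_paths_sym, rule homotopic_paths_assoc)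
    show "path (u \<circ> v \<circ> h)" "path_image (u \<circ> v \<circ> h) \<subseteq> S" "path (u \<circ> g)" "path_image (u \<circ> g) \<subseteq> S"
      by (intro path_W path_image_W comp_W f' g' h')+
  qed (use f' g' h' in \<open>simp_all add: pathstart_compose pathfinish_compose\<close>)
  also have "(u \<circ> g) +++ (u \<circ> v \<circ> h) = u \<circ> (g +++ (v \<circ> h))"
    by (simp add: path_compose_join comp_assoc)
  also have "cls (f +++ (u \<circ> (g +++ (v \<circ> h)))) = a \<otimes>\<^bsub>B\<^esub> (b \<otimes>\<^bsub>B\<^esub> c)"
    unfolding l(2,4,6) cls_mult[OF l(3,5)] by (rule cls_mult[OF l(1) lift_join[OF l(3,5)], symmetric])
  finally show "a \<otimes>\<^bsub>B\<^esub> b \<otimes>\<^bsub>B\<^esub> c = a \<otimes>\<^bsub>B\<^esub> (b \<otimes>\<^bsub>B\<^esub> c)" .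
next
  fix a assume "a \<in> carrier B"
  then obtain v g where l: "lift v g" "a = cls g" unfolding carrier_B by blast
  have "\<one>\<^bsub>B\<^esub> \<otimes>\<^bsub>B\<^esub> a = cls (linepath x0 x0 +++ (id \<circ> g))"
    unfolding one_B l(2) by (rule cls_mult[OF lift_id l(1)])
  also have "\<dots> = a" unfolding l(2)
    by (rule cls_eqI[OF lift_join[OF lift_id l(1)]])
      (use lift_pathD[OF l(1)] in \<open>simp add: homotopic_paths_lid'\<close>)
  finally show "\<one>\<^bsub>B\<^esub> \<otimes>\<^bsub>B\<^esub> a = a" .
  show "\<exists>b\<in>carrier B. b \<otimes>\<^bsub>B\<^esub> a = \<one>\<^bsub>B\<^esub>"
    using cls_inverse_mult[OF l(1)] cls_carrier[OF lift_inverse[OF l(1)]] l(2) by blast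
qed

lemma inv_cls: "lift w g \<Longrightarrow> inv\<^bsub>B\<^esub> (cls g) = cls (finv w \<circ> reversepath g)"
  by (rule group.inv_equality[OF group_B cls_inverse_mult]) (auto intro: cls_carrier lift_inverse)

text \<open>Homotopic projections have homotopic lifts, hence the same endpoint, and freeness at
  \<open>x0\<close> recovers the group element; so the description operator is well defined.\<close>

lemma braid_projection_cls:
  assumes g: "lift w g"
  shows "braid_projection W x0 (cls g) = w"
  unfolding braid_projection_def
proof (rule the_equality)
  note g' = lift_pathD[OF g]
  have "orb \<circ> g \<in> cls g"
    unfolding mem_cls[OF g'(2)] emb_o
    using orb_in_topspace[OF g'(2)] g' path_emb by (auto simp: path_image_compose)
  then show "w \<in> W \<and> (\<exists>h. path h \<and> path_image h \<subseteq> S \<and> pathstart h = x0 \<and> pathfinish h = w x0 \<and> orb \<circ> h \<in> cls g)"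
    using g' by blast
  fix v assume "v \<in> W \<and> (\<exists>h. path h \<and> path_image h \<subseteq> S \<and> pathstart h = x0 \<and> pathfinish h = v x0 \<and> orb \<circ> h \<in> cls g)"
  then obtain h where v: "v \<in> W" and h: "path h" "path_image h \<subseteq> S" "pathstart h = x0" "pathfinish h = v x0" "orb \<circ> h \<in> cls g"
    by blast
  have "homotopic_paths Y (emb \<circ> g) (emb \<circ> h)" using h(5) unfolding mem_cls[OF g'(2)] emb_o by blast
  then have "homotopic_paths S g h" using homotopic_emb_iff g' h by simp
  then have "w x0 = v x0" using homotopic_paths_imp_pathfinish g'(5) h(4) by metis
  then show "v = w" using W_eqI[OF v g'(3) x0] by simp
qed

end

section \<open>Generators of the monodromy\<close>

text \<open>On the complex line through \<open>x\<close> and \<open>y\<close> each form has at most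
  one zero, and the plane minus a finite set is path connected. The set of forms is a parameter
  because points are later also moved within a hyperplane, where its own form is omitted.\<close>

lemma complex_line_avoiding_path:
  fixes x y :: "'v::complex_fd_space"
  assumes F: "finite F" "\<And>l. l \<in> F \<Longrightarrow> clinear_form l \<and> l x \<noteq> 0 \<and> l y \<noteq> 0"
  shows "\<exists>z. path z \<and> z 0 = 0 \<and> z 1 = (1::complex) \<and> (\<forall>t\<in>{0..1}. \<forall>l\<in>F. l (x + z t *\<^sub>C (y - x)) \<noteq> 0)"
proof -
  define Z where "Z = (\<Union>l\<in>F. {z. l (x + z *\<^sub>C (y - x)) = 0})"
  have eq: "l (x + z *\<^sub>C (y - x)) = l x + z * (l y - l x)" if "l \<in> F" for l z
  proof -
    have "l (a + b) = l a + l b" "l (c *\<^sub>C a) = c * l a" for a b c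
      using F(2)[OF that] by (auto simp: clinear_form_def)
    moreover from this(1)[of "y - x" x] have "l (y - x) = l y - l x" by simp
    ultimately show ?thesis by simp
  qed
  have "finite {z. l (x + z *\<^sub>C (y - x)) = 0}" if l: "l \<in> F" for l
  proof (rule finite_subset)
    show "{z. l (x + z *\<^sub>C (y - x)) = 0} \<subseteq> {- l x / (l y - l x)}"
    proof
      fix z assume "z \<in> {z. l (x + z *\<^sub>C (y - x)) = 0}"
      then have 0: "l x + z * (l y - l x) = 0" by (simp add: eq[OF l])
      have ne: "l y - l x \<noteq> 0" using 0 F(2)[OF l] by auto
      have "z * (l y - l x) = - l x"
        by (rule eq_neg_iff_add_eq_0[THEN iffD2]) (use 0 in \<open>simp only: add.commute\<close>)
      then have "z = - l x / (l y - l x)" using ne by (metis nonzero_mult_div_cancel_right)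
      then show "z \<in> {- l x / (l y - l x)}" by simp
    qed
  qed simp
  then have "finite Z" using F(1) by (simp add: Z_def)
  then have "path_connected (- Z)"
    by (intro path_connected_complement_countable countable_finite) simp
  moreover have "0 \<in> - Z" "1 \<in> - Z" using F(2) by (auto simp: Z_def)
  ultimately obtain z where z: "path z" "path_image z \<subseteq> - Z" "pathstart z = 0" "pathfinish z = 1"
    unfolding path_connected_def by blast
  have "l (x + z t *\<^sub>C (y - x)) \<noteq> 0" if "t \<in> {0..1}" "l \<in> F" for t l
  proof -
    have "z t \<in> - Z" using z(2) that(1) unfolding path_image_def by blast
    then show ?thesis using that(2) by (auto simp: Z_def)
  qed
  then show ?thesis using z by (intro exI[of _ z]) (auto simp: pathstart_def pathfinish_def)
qed

context braid_setting
begin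

sublocale B: group B by (rule group_B)

lemma B_cancel:
  "a \<in> carrier B \<Longrightarrow> b \<in> carrier B \<Longrightarrow> inv\<^bsub>B\<^esub> a \<otimes>\<^bsub>B\<^esub> (a \<otimes>\<^bsub>B\<^esub> b) = b"
  "a \<in> carrier B \<Longrightarrow> b \<in> carrier B \<Longrightarrow> a \<otimes>\<^bsub>B\<^esub> (inv\<^bsub>B\<^esub> a \<otimes>\<^bsub>B\<^esub> b) = b"
  by (simp_all add: B.m_assoc[symmetric])

lemma S_path_connected:
  assumes "x \<in> S" "y \<in> S"
  shows "\<exists>p. path p \<and> path_image p \<subseteq> S \<and> pathstart p = x \<and> pathfinish p = y"
proof -
  have F: "finite (lf ` hyps)" "\<And>l. l \<in> lf ` hyps \<Longrightarrow> clinear_form l \<and> l x \<noteq> 0 \<and> l y \<noteq> 0"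
    using finite_hyps assms lf_linear by (auto simp: regular_part_iff)
  obtain z where z: "path z" "z 0 = 0" "z 1 = 1" "\<forall>t\<in>{0..1}. \<forall>l\<in>lf ` hyps. l (x + z t *\<^sub>C (y - x)) \<noteq> 0"
    using complex_line_avoiding_path[OF F] by blast
  have "path (\<lambda>t. x + z t *\<^sub>C (y - x))" using z(1) unfolding path_def by (intro continuous_intros)
  moreover have "path_image (\<lambda>t. x + z t *\<^sub>C (y - x)) \<subseteq> S"
    using z(4) unfolding path_image_def by (auto simp: regular_part_iff)
  ultimately show ?thesis
    using z(2,3) by (intro exI[of _ "\<lambda>t. x + z t *\<^sub>C (y - x)"]) (simp add: pathstart_def pathfinish_def)
qed

abbreviation pth :: "(real \<Rightarrow> 'v) \<Rightarrow> bool" where "pth p \<equiv> path p \<and> path_image p \<subseteq> S"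

lemma pth_join: "pth p \<Longrightarrow> pth q \<Longrightarrow> pathfinish p = pathstart q \<Longrightarrow> pth (p +++ q)"
  by (simp add: path_image_join)

lemma pth_rev: "pth p \<Longrightarrow> pth (reversepath p)" by simp

lemma pth_W: "w \<in> W \<Longrightarrow> pth p \<Longrightarrow> pth (w \<circ> p)"
  using path_W path_image_W by blast

lemma pth_start: "pth p \<Longrightarrow> pathstart p \<in> S" and pth_finish: "pth p \<Longrightarrow> pathfinish p \<in> S"
  by auto

definition bp :: "'v \<Rightarrow> real \<Rightarrow> 'v"
  where "bp y = (SOME p. pth p \<and> pathstart p = x0 \<and> pathfinish p = y)"

lemma bp: assumes "y \<in> S" shows "pth (bp y)" "pathstart (bp y) = x0" "pathfinish (bp y) = y"
proof -
  have "\<exists>p. pth p \<and> pathstart p = x0 \<and> pathfinish p = y" using S_path_connected[OF x0 assms] by blast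
  from someI_ex[OF this] show "pth (bp y)" "pathstart (bp y) = x0" "pathfinish (bp y) = y"
    by (auto simp: bp_def)
qed

text \<open>Fixed base paths extend \<open>cls\<close> to a representation of the fundamental groupoid of \<open>S\<close>.\<close>

definition \<Phi> :: "(real \<Rightarrow> 'v) \<Rightarrow> (real \<Rightarrow> 'v set) set"
  where "\<Phi> p = cls (bp (pathstart p) +++ (p +++ reversepath (bp (pathfinish p))))"

lemma homotopic_cancel:
  assumes p: "pth p" and r: "pth r" and z: "pth z" and e: "pathfinish p = pathfinish r" "pathstart r = pathstart p'"
    and z': "pathstart z = pathfinish r"
  shows "homotopic_paths S ((p +++ reversepath r) +++ (r +++ z)) (p +++ z)"
proof -
  note c = p r z e z'
  have "homotopic_paths S ((p +++ reversepath r) +++ (r +++ z)) (p +++ (reversepath r +++ (r +++ z)))"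
    by (rule homotopic_paths_sym[OF homotopic_paths_assoc]) (use c in \<open>simp_all add: path_image_join\<close>)
  also have "homotopic_paths S (p +++ (reversepath r +++ (r +++ z))) (p +++ ((reversepath r +++ r) +++ z))"
    by (rule homotopic_paths_join[OF _ homotopic_paths_assoc]) (use c in simp_all)
  also have "homotopic_paths S (p +++ ((reversepath r +++ r) +++ z)) (p +++ (linepath (pathfinish r) (pathfinish r) +++ z))"
    by (intro homotopic_paths_join homotopic_paths_linv) (use c in simp_all)
  also have "homotopic_paths S (p +++ (linepath (pathfinish r) (pathfinish r) +++ z)) (p +++ z)"
    by (intro homotopic_paths_join homotopic_paths_lid') (use c in simp_all)
  finally show ?thesis .
qed

lemma \<Phi>_lift: "pth p \<Longrightarrow> lift id (bp (pathstart p) +++ (p +++ reversepath (bp (pathfinish p))))"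
  using bp[OF pth_start] bp[OF pth_finish] id_W by (simp add: lift_def path_image_join)

lemma \<Phi>_closed: "pth p \<Longrightarrow> \<Phi> p \<in> carrier B"
  unfolding \<Phi>_def by (rule cls_carrier[OF \<Phi>_lift])

lemma \<Phi>_hom: assumes "homotopic_paths S p q" shows "\<Phi> p = \<Phi> q"
proof -
  have p: "pth p" "pth q" using homotopic_paths_imp_path[OF assms] homotopic_paths_imp_subset[OF assms] by auto
  have e: "pathstart p = pathstart q" "pathfinish p = pathfinish q"
    using homotopic_paths_imp_pathstart[OF assms] homotopic_paths_imp_pathfinish[OF assms] by auto
  show ?thesis unfolding \<Phi>_def
    by (rule cls_eqI[OF \<Phi>_lift[OF p(1)]], unfold e[symmetric])
      (intro homotopic_paths_join assms homotopic_paths_refl[THEN iffD2];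
        use bp[OF pth_start[OF p(1)]] bp[OF pth_finish[OF p(1)]] in simp)
qed

lemma \<Phi>_join:
  assumes p: "pth p" and q: "pth q" and pq: "pathfinish p = pathstart q"
  shows "\<Phi> (p +++ q) = \<Phi> p \<otimes>\<^bsub>B\<^esub> \<Phi> q"
proof -
  let ?a = "bp (pathstart p)" and ?b = "bp (pathstart q)" and ?c = "bp (pathfinish q)"
  note a = bp[OF pth_start[OF p]] and b = bp[OF pth_start[OF q]] and c = bp[OF pth_finish[OF q]]
  have "\<Phi> p \<otimes>\<^bsub>B\<^esub> \<Phi> q = cls ((?a +++ (p +++ reversepath ?b)) +++ (?b +++ (q +++ reversepath ?c)))"
    unfolding \<Phi>_def using cls_mult[OF \<Phi>_lift[OF p] \<Phi>_lift[OF q]] by (simp add: pq)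
  also have "\<dots> = cls (?a +++ ((p +++ q) +++ reversepath ?c))"
  proof (rule cls_eqI)
    show "lift id ((?a +++ (p +++ reversepath ?b)) +++ (?b +++ (q +++ reversepath ?c)))"
      using lift_join[OF \<Phi>_lift[OF p] \<Phi>_lift[OF q]] by (simp add: pq)
    have "homotopic_paths S ((?a +++ (p +++ reversepath ?b)) +++ (?b +++ (q +++ reversepath ?c)))
        (((?a +++ p) +++ reversepath ?b) +++ (?b +++ (q +++ reversepath ?c)))"
      by (intro homotopic_paths_join homotopic_paths_assoc homotopic_paths_refl[THEN iffD2])
        (use a b c p q pq in \<open>simp_all add: path_image_join\<close>)
    also have "homotopic_paths S (((?a +++ p) +++ reversepath ?b) +++ (?b +++ (q +++ reversepath ?c)))
        ((?a +++ p) +++ (q +++ reversepath ?c))"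
      by (rule homotopic_cancel[where p' = ?b]) (use a b c p q pq in \<open>simp_all add: path_image_join\<close>)
    also have "homotopic_paths S ((?a +++ p) +++ (q +++ reversepath ?c)) (?a +++ (p +++ (q +++ reversepath ?c)))"
      by (rule homotopic_paths_sym[OF homotopic_paths_assoc]) (use a b c p q pq in \<open>simp_all add: path_image_join\<close>)
    also have "homotopic_paths S (?a +++ (p +++ (q +++ reversepath ?c))) (?a +++ ((p +++ q) +++ reversepath ?c))"
      by (intro homotopic_paths_join homotopic_paths_assoc homotopic_paths_refl[THEN iffD2])
        (use a b c p q pq in \<open>simp_all add: path_image_join\<close>)
    finally show "homotopic_paths S ((?a +++ (p +++ reversepath ?b)) +++ (?b +++ (q +++ reversepath ?c)))
      (?a +++ ((p +++ q) +++ reversepath ?c))" .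
  qed
  finally show ?thesis by (simp add: \<Phi>_def pq)
qed

lemma \<Phi>_const: assumes "y \<in> S" shows "\<Phi> (linepath y y) = \<one>\<^bsub>B\<^esub>"
proof -
  have l: "pth (linepath y y)" using assms by simp
  have "\<Phi> (linepath y y +++ linepath y y) = \<Phi> (linepath y y)"
    by (rule \<Phi>_hom, rule homotopic_paths_rid') (use assms in auto)
  then have "\<Phi> (linepath y y) \<otimes>\<^bsub>B\<^esub> \<Phi> (linepath y y) = \<Phi> (linepath y y)"
    using \<Phi>_join[OF l l] by simp
  then show ?thesis using B.r_cancel_one[OF \<Phi>_closed[OF l] \<Phi>_closed[OF l]] by blast
qed

lemma \<Phi>_rev: assumes p: "pth p" shows "\<Phi> (reversepath p) = inv\<^bsub>B\<^esub> (\<Phi> p)"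
proof -
  have "\<Phi> (reversepath p +++ p) = \<Phi> (linepath (pathfinish p) (pathfinish p))"
    by (rule \<Phi>_hom[OF homotopic_paths_linv]) (use p in auto)
  then have "\<Phi> (reversepath p) \<otimes>\<^bsub>B\<^esub> \<Phi> p = \<one>\<^bsub>B\<^esub>"
    using \<Phi>_join[OF pth_rev[OF p] p] \<Phi>_const[OF pth_finish[OF p]] by simp
  then show ?thesis using B.inv_equality \<Phi>_closed[OF p] \<Phi>_closed[OF pth_rev[OF p]] by metis
qed

text \<open>Composing the associated loop with the base paths recovers the path up to homotopy.
  Equalities of classes can therefore be computed in the group \<open>B\<close>, where inner tails
  cancel algebraically instead of by explicit homotopies.\<close>

lemma \<Phi>_inj:
  assumes p: "pth p" and q: "pth q" and e: "pathstart p = pathstart q" "pathfinish p = pathfinish q"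
    and eq: "\<Phi> p = \<Phi> q"
  shows "homotopic_paths S p q"
proof -
  let ?a = "bp (pathstart p)" and ?b = "bp (pathfinish p)"
  note a = bp[OF pth_start[OF p]] and b = bp[OF pth_finish[OF p]]
  have undo: "homotopic_paths S (reversepath ?a +++ ((?a +++ (r +++ reversepath ?b)) +++ ?b)) r"
    if r: "pth r" "pathstart r = pathstart p" "pathfinish r = pathfinish p" for r
  proof -
    have "homotopic_paths S (reversepath ?a +++ ((?a +++ (r +++ reversepath ?b)) +++ ?b))
        ((reversepath ?a +++ (?a +++ (r +++ reversepath ?b))) +++ ?b)"
      by (rule homotopic_paths_assoc) (use a b r in \<open>simp_all add: path_image_join\<close>)
    also have "homotopic_paths S \<dots> (((reversepath ?a +++ ?a) +++ (r +++ reversepath ?b)) +++ ?b)"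
      by (intro homotopic_paths_join homotopic_paths_assoc homotopic_paths_refl[THEN iffD2])
        (use a b r in \<open>simp_all add: path_image_join\<close>)
    also have "homotopic_paths S \<dots> ((linepath (pathstart r) (pathstart r) +++ (r +++ reversepath ?b)) +++ ?b)"
      using homotopic_paths_linv[of ?a S] a r(2)
      by (intro homotopic_paths_join homotopic_paths_refl[THEN iffD2])
        (use a b r in \<open>simp_all add: path_image_join\<close>)
    also have "homotopic_paths S \<dots> ((r +++ reversepath ?b) +++ ?b)"
      by (intro homotopic_paths_join homotopic_paths_lid' homotopic_paths_refl[THEN iffD2])
        (use a b r in \<open>simp_all add: path_image_join\<close>)
    also have "homotopic_paths S \<dots> (r +++ (reversepath ?b +++ ?b))"
      by (rule homotopic_paths_sym[OF homotopic_paths_assoc]) (use a b r in \<open>simp_all add: path_image_join\<close>)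
    also have "homotopic_paths S \<dots> (r +++ linepath (pathfinish r) (pathfinish r))"
      using homotopic_paths_linv[of ?b S] b r
      by (intro homotopic_paths_join homotopic_paths_refl[THEN iffD2])
        (use a b r in \<open>simp_all add: path_image_join\<close>)
    also have "homotopic_paths S \<dots> r"
      by (rule homotopic_paths_rid) (use r in auto)
    finally show ?thesis .
  qed
  have lp: "lift id (?a +++ (p +++ reversepath ?b))" "lift id (?a +++ (q +++ reversepath ?b))"
    using \<Phi>_lift[OF p] \<Phi>_lift[OF q] e by simp_all
  have "cls (?a +++ (p +++ reversepath ?b)) = cls (?a +++ (q +++ reversepath ?b))"
    using eq unfolding \<Phi>_def e by simp
  then have h: "homotopic_paths S (?a +++ (p +++ reversepath ?b)) (?a +++ (q +++ reversepath ?b))"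
    using cls_eq_iff lift_pathD[OF lp(1)] lift_pathD[OF lp(2)] by simp
  have "homotopic_paths S p (reversepath ?a +++ ((?a +++ (p +++ reversepath ?b)) +++ ?b))"
    by (rule homotopic_paths_sym[OF undo]) (use p in auto)
  also have "homotopic_paths S \<dots> (reversepath ?a +++ ((?a +++ (q +++ reversepath ?b)) +++ ?b))"
    by (intro homotopic_paths_join h homotopic_paths_refl[THEN iffD2])
      (use a b p in \<open>simp_all add: path_image_join\<close>)
  also have "homotopic_paths S \<dots> q" by (rule undo) (use q e in auto)
  finally show ?thesis .
qed

section \<open>Monodromy paths: powers, conjugates and deformations\<close>

text \<open>The parameter is measured in units of the rotation by the distinguished reflection: 1
  corresponds to \<open>sr H\<close> and \<open>ord H\<close> to a full turn.\<close>

definition rot :: "'v set \<Rightarrow> real \<Rightarrow> complex" where "rot H x = cis (2 * pi * x / real (ord H))"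

lemma rot_exp: "exp (2 * \<i> * complex_of_real (pi * x) / of_nat (fixator_order W H)) = rot H x"
  by (simp add: rot_def cis_conv_exp ord_def algebra_simps)

lemma rot_add: "rot H (x + y) = rot H x * rot H y"
  by (simp add: rot_def cis_mult add_divide_distrib distrib_left)

lemma rot_simps [simp]: "rot H 0 = 1" "cmod (rot H x) = 1" "rot H x \<noteq> 0"
  by (simp_all add: rot_def)

lemma rot_1: "rot H 1 = rho H"
  unfolding rot_exp[symmetric] by (simp add: rho_def ord_def)

lemma rot_pow: "rot H (real k) = rho H ^ k"
proof (induction k)
  case (Suc k)
  have "rot H (real (Suc k)) = rot H (real k + 1)" by (simp add: add.commute)
  then show ?case using Suc by (simp add: rot_add rot_1 mult.commute)
qed simp

lemma continuous_rot: "continuous_on A f \<Longrightarrow> continuous_on A (\<lambda>x. rot H (f x))"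
  unfolding rot_def by (intro continuous_intros) (use ord_pos[of H] in auto)

text \<open>These are the conditions on \<open>h\<close> and \<open>d\<close> in
  \<open>monodromy_generators\<close> together with membership of \<open>H\<close>;
  \<open>tail\<close> collects those on the path.\<close>

definition adm :: "'v set \<Rightarrow> 'v \<Rightarrow> 'v \<Rightarrow> bool"
  where "adm H h d \<longleftrightarrow> H \<in> hyps \<and> h \<in> H \<and> (\<forall>H'\<in>hyps. H' \<noteq> H \<longrightarrow> h \<notin> H') \<and> d \<noteq> 0 \<and>
    (\<forall>x\<in>H. herm x d = 0) \<and>
    (\<forall>z. cmod z \<le> 1 \<longrightarrow> (\<forall>H'\<in>hyps. H' \<noteq> H \<longrightarrow> h + z *\<^sub>C d \<notin> H'))"

lemma admD:
  assumes "adm H h d"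
  shows "H \<in> hyps" "h \<in> H" "d \<noteq> 0" "\<And>x. x \<in> H \<Longrightarrow> herm x d = 0" "lf H h = 0" "lf H d \<noteq> 0"
    "d = lf H d *\<^sub>C nrm H" "\<And>z H'. cmod z \<le> 1 \<Longrightarrow> H' \<in> hyps \<Longrightarrow> H' \<noteq> H \<Longrightarrow> lf H' (h + z *\<^sub>C d) \<noteq> 0"
proof -
  show 1: "H \<in> hyps" "h \<in> H" "d \<noteq> 0" "\<And>x. x \<in> H \<Longrightarrow> herm x d = 0"
    using assms unfolding adm_def by blast+
  show "lf H h = 0" using lf_eq_0_iff[OF 1(1)] 1(2) by blast
  show d: "d = lf H d *\<^sub>C nrm H" by (rule orthogonal_nrm[OF 1(1,4)])
  show "lf H d \<noteq> 0" using d 1(3) by (metis cvec.scale_zero_left)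
  show "lf H' (h + z *\<^sub>C d) \<noteq> 0" if "cmod z \<le> 1" "H' \<in> hyps" "H' \<noteq> H" for z H'
    using assms that lf_eq_0_iff[OF that(2)] unfolding adm_def by blast
qed

definition spin :: "'v set \<Rightarrow> 'v \<Rightarrow> 'v \<Rightarrow> real \<Rightarrow> 'v" where "spin H h d x = h + rot H x *\<^sub>C d"

definition arc :: "'v set \<Rightarrow> 'v \<Rightarrow> 'v \<Rightarrow> real \<Rightarrow> real \<Rightarrow> real \<Rightarrow> 'v"
  where "arc H h d a b = spin H h d \<circ> linepath a b"

lemma spin_S: assumes "adm H h d" shows "spin H h d x \<in> S"
  unfolding regular_part_iff
proof
  fix H' assume H': "H' \<in> hyps"
  show "lf H' (spin H h d x) \<noteq> 0"
    using admD[OF assms] admD(8)[OF assms _ H'] by (cases "H' = H") (auto simp: spin_def lf_add lf_scale)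
qed

lemma continuous_spin: "continuous_on A (spin H h d)"
  unfolding spin_def by (intro continuous_intros continuous_rot)

lemma arc_pth: "adm H h d \<Longrightarrow> pth (arc H h d a b)"
  unfolding arc_def
    using spin_S by (auto intro!: path_continuous_image continuous_spin simp: path_image_compose)

lemma arc_ends: "pathstart (arc H h d a b) = spin H h d a" "pathfinish (arc H h d a b) = spin H h d b"
  by (simp_all add: arc_def pathstart_compose pathfinish_compose)

lemma arc_join: assumes "adm H h d"
  shows "\<Phi> (arc H h d a b) \<otimes>\<^bsub>B\<^esub> \<Phi> (arc H h d b c) = \<Phi> (arc H h d a c)"
proof -
  have "\<Phi> (arc H h d a b) \<otimes>\<^bsub>B\<^esub> \<Phi> (arc H h d b c) = \<Phi> (arc H h d a b +++ arc H h d b c)"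
    by (rule \<Phi>_join[OF arc_pth[OF assms] arc_pth[OF assms], symmetric]) (simp add: arc_ends)
  also have "\<dots> = \<Phi> (arc H h d a c)"
    unfolding arc_def path_compose_join[symmetric]
    by (intro \<Phi>_hom homotopic_paths_continuous_image[of UNIV, OF homotopic_paths_linear])
      (use continuous_spin spin_S[OF assms] in auto)
  finally show ?thesis .
qed

lemma sr_pow_W: "H \<in> hyps \<Longrightarrow> sr H ^^ k \<in> W"
  by (rule pow_W[OF sr_W])

lemma sr_spin: assumes "adm H h d" shows "(sr H ^^ k) (spin H h d x) = spin H h d (x + real k)"
proof (induction k)
  case (Suc k)
  have H: "H \<in> hyps" by (rule admD(1)[OF assms])
  have "sr H (spin H h d y) = spin H h d (y + 1)" for y
    using sr_orthogonal[OF H admD(4)[OF assms]] sr_fixes[OF H admD(2)[OF assms]]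
    by (simp add: spin_def W_add[OF sr_W[OF H]] W_scale[OF sr_W[OF H]] scaleC_scaleC rot_add rot_1)
  then show ?case using Suc by (simp add: add_ac)
qed simp

lemma sr_arc: assumes "adm H h d"
  shows "(sr H ^^ k) \<circ> arc H h d a b = arc H h d (a + real k) (b + real k)"
proof
  fix t
  have "linepath a b t + real k = linepath (a + real k) (b + real k) t"
    by (simp add: linepath_def algebra_simps)
  then show "((sr H ^^ k) \<circ> arc H h d a b) t = arc H h d (a + real k) (b + real k) t"
    by (simp add: arc_def sr_spin[OF assms])
qed

definition tail :: "'v \<Rightarrow> (real \<Rightarrow> 'v) \<Rightarrow> bool"
  where "tail y g \<longleftrightarrow> pth g \<and> pathstart g = x0 \<and> pathfinish g = y"

lemma tailD: "tail y g \<Longrightarrow> pth g" "tail y g \<Longrightarrow> pathstart g = x0" "tail y g \<Longrightarrow> pathfinish g = y"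
  by (simp_all add: tail_def)

text \<open>The case \<open>k = 1\<close> is the path of a generator. A general \<open>k\<close>
  rotates by \<open>k\<close> units before returning along the translate of the tail, so that the
  powers with exponents a_H and e_H are given by paths of the same form.\<close>

definition mpath :: "'v set \<Rightarrow> nat \<Rightarrow> (real \<Rightarrow> 'v) \<Rightarrow> 'v \<Rightarrow> 'v \<Rightarrow> real \<Rightarrow> 'v"
  where "mpath H k g h d = g +++ (arc H h d 0 (real k) +++ reversepath ((sr H ^^ k) \<circ> g))"

lemma mpath_1: "mpath H 1 g h d = monodromy_path W H g h d"
proof -
  have "arc H h d 0 1 = (\<lambda>t. h + exp (2 * \<i> * complex_of_real (pi * t) / of_nat (fixator_order W H)) *\<^sub>C d)"
    unfolding rot_exp by (auto simp: arc_def spin_def linepath_def)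
  moreover have "reversepath ((sr H ^^ 1) \<circ> g) = sr H \<circ> reversepath g" by (auto simp: reversepath_def)
  ultimately show ?thesis by (simp add: mpath_def monodromy_path_def)
qed

lemma mpath_facts:
  assumes a: "adm H h d" and g: "tail (h + d) g"
  shows "pth (arc H h d 0 (real k))" "pth ((sr H ^^ k) \<circ> g)" "pathfinish g = pathstart (arc H h d 0 (real k))"
    "pathfinish (arc H h d 0 (real k)) = pathstart (reversepath ((sr H ^^ k) \<circ> g))"
proof -
  have H: "H \<in> hyps" by (rule admD(1)[OF a])
  show "pth (arc H h d 0 (real k))" by (rule arc_pth[OF a])
  show "pth ((sr H ^^ k) \<circ> g)" by (rule pth_W[OF sr_pow_W[OF H] tailD(1)[OF g]])
  show e: "pathfinish g = pathstart (arc H h d 0 (real k))" by (simp add: tailD[OF g] arc_ends spin_def)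
  have "pathfinish g = spin H h d 0" by (simp add: tailD[OF g] spin_def)
  then show "pathfinish (arc H h d 0 (real k)) = pathstart (reversepath ((sr H ^^ k) \<circ> g))"
    by (simp add: arc_ends pathfinish_compose sr_spin[OF a])
qed

lemma lift_mpath:
  assumes a: "adm H h d" and g: "tail (h + d) g"
  shows "lift (sr H ^^ k) (mpath H k g h d)"
  using mpath_facts[OF a g, of k] tailD[OF g] sr_pow_W[OF admD(1)[OF a], of k]
  by (simp add: lift_def mpath_def path_image_join pathstart_compose)

lemma \<Phi>_mpath:
  assumes a: "adm H h d" and g: "tail (h + d) g"
  shows "\<Phi> (mpath H k g h d) = \<Phi> g \<otimes>\<^bsub>B\<^esub> (\<Phi> (arc H h d 0 (real k)) \<otimes>\<^bsub>B\<^esub> inv\<^bsub>B\<^esub> \<Phi> ((sr H ^^ k) \<circ> g))"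
proof -
  note f = mpath_facts[OF a g, of k]
  have "\<Phi> (arc H h d 0 (real k) +++ reversepath ((sr H ^^ k) \<circ> g)) =
      \<Phi> (arc H h d 0 (real k)) \<otimes>\<^bsub>B\<^esub> inv\<^bsub>B\<^esub> \<Phi> ((sr H ^^ k) \<circ> g)"
    using \<Phi>_join[OF f(1) pth_rev[OF f(2)] f(4)] \<Phi>_rev[OF f(2)] by simp
  moreover have "\<Phi> (mpath H k g h d) = \<Phi> g \<otimes>\<^bsub>B\<^esub> \<Phi> (arc H h d 0 (real k) +++ reversepath ((sr H ^^ k) \<circ> g))"
    unfolding mpath_def
    by (rule \<Phi>_join[OF tailD(1)[OF g] pth_join[OF f(1) pth_rev[OF f(2)] f(4)]]) (simp add: f(3))
  ultimately show ?thesis by simp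
qed

lemma cls_eq_\<Phi>I:
  assumes "lift w p" "lift w q" "\<Phi> p = \<Phi> q"
  shows "cls p = cls q"
  by (rule cls_eqI[OF assms(1)], rule \<Phi>_inj) (use assms lift_pathD in auto)

definition mcls :: "'v set \<Rightarrow> nat \<Rightarrow> (real \<Rightarrow> 'v) \<Rightarrow> 'v \<Rightarrow> 'v \<Rightarrow> (real \<Rightarrow> 'v set) set"
  where "mcls H k g h d = cls (mpath H k g h d)"

lemma mcls_closed: "adm H h d \<Longrightarrow> tail (h + d) g \<Longrightarrow> mcls H k g h d \<in> carrier B"
  unfolding mcls_def by (rule cls_carrier[OF lift_mpath])

lemma mcls_projection: "adm H h d \<Longrightarrow> tail (h + d) g \<Longrightarrow> braid_projection W x0 (mcls H k g h d) = sr H ^^ k"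
  unfolding mcls_def by (rule braid_projection_cls[OF lift_mpath])

text \<open>Multiplying by one more generator translates its path by \<open>sr H ^^ k\<close>. The
  returning tail then cancels against the translated outgoing one, and the two arcs fit
  together.\<close>

lemma mcls_pow:
  assumes a: "adm H h d" and g: "tail (h + d) g"
  shows "mcls H 1 g h d [^]\<^bsub>B\<^esub> k = mcls H k g h d"
proof (induction k)
  case 0
  have l: "lift id (mpath H 0 g h d)" using lift_mpath[OF a g, of 0] by simp
  have "arc H h d 0 (real 0) = linepath (h + d) (h + d)"
    by (auto simp: arc_def spin_def linepath_def algebra_simps)
  moreover have "h + d \<in> S" using spin_S[OF a, of 0] by (simp add: spin_def)
  ultimately have "\<Phi> (mpath H 0 g h d) = \<one>\<^bsub>B\<^esub>"
    unfolding \<Phi>_mpath[OF a g] using \<Phi>_const[of "h + d"] \<Phi>_closed[OF tailD(1)[OF g]] by simp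
  then have "cls (linepath x0 x0) = cls (mpath H 0 g h d)"
    using \<Phi>_const[OF x0] by (intro cls_eq_\<Phi>I[OF lift_id l]) simp
  then show ?case by (simp add: one_B mcls_def)
next
  case (Suc k)
  let ?s = "sr H ^^ k"
  have H: "H \<in> hyps" by (rule admD(1)[OF a])
  have l: "lift (?s \<circ> sr H ^^ 1) (mpath H k g h d +++ (?s \<circ> mpath H 1 g h d))"
    by (rule lift_join[OF lift_mpath[OF a g] lift_mpath[OF a g]])
  have s: "?s \<circ> sr H ^^ 1 = sr H ^^ Suc k" by (simp add: funpow_swap1 fun_eq_iff)
  have f: "pth (mpath H k g h d)" "pth (?s \<circ> mpath H 1 g h d)"
    using lift_pathD[OF lift_mpath[OF a g]] pth_W[OF sr_pow_W[OF H], of "mpath H 1 g h d" k] by auto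
  have e: "?s \<circ> mpath H 1 g h d = (?s \<circ> g) +++ (arc H h d (real k) (real (Suc k)) +++ reversepath ((sr H ^^ Suc k) \<circ> g))"
  proof -
    have "?s \<circ> reversepath ((sr H ^^ 1) \<circ> g) = reversepath ((sr H ^^ Suc k) \<circ> g)"
      unfolding s[symmetric] by (auto simp: reversepath_def)
    moreover have "?s \<circ> arc H h d 0 (real 1) = arc H h d (real k) (real (Suc k))"
      using sr_arc[OF a, of k 0 "real 1"] by (simp add: add.commute)
    ultimately show ?thesis unfolding mpath_def path_compose_join by simp
  qed
  have c: "\<Phi> g \<in> carrier B" "\<Phi> (?s \<circ> g) \<in> carrier B" "\<Phi> ((sr H ^^ Suc k) \<circ> g) \<in> carrier B"
    "\<Phi> (arc H h d x y) \<in> carrier B" for x y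
    by (intro \<Phi>_closed tailD(1)[OF g] mpath_facts(2)[OF a g] arc_pth[OF a])+
  have g2: "pth ((sr H ^^ Suc k) \<circ> g)" by (rule mpath_facts(2)[OF a g])
  have g1: "pth (?s \<circ> g)" by (rule mpath_facts(2)[OF a g])
  have fin: "pathfinish g = spin H h d 0" by (simp add: tailD[OF g] spin_def)
  have j1: "pathfinish (arc H h d (real k) (real (Suc k))) = pathstart (reversepath ((sr H ^^ Suc k) \<circ> g))"
    using sr_spin[OF a, of "Suc k" 0] by (simp add: arc_ends pathfinish_compose fin del: funpow.simps)
  have j2: "pathfinish (?s \<circ> g) = pathstart (arc H h d (real k) (real (Suc k)) +++ reversepath ((sr H ^^ Suc k) \<circ> g))"
    using sr_spin[OF a, of k 0] by (simp add: arc_ends pathfinish_compose fin)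
  have 2: "\<Phi> (?s \<circ> mpath H 1 g h d) = \<Phi> (?s \<circ> g) \<otimes>\<^bsub>B\<^esub>
      (\<Phi> (arc H h d (real k) (real (Suc k))) \<otimes>\<^bsub>B\<^esub> inv\<^bsub>B\<^esub> \<Phi> ((sr H ^^ Suc k) \<circ> g))"
    unfolding e \<Phi>_join[OF g1 pth_join[OF arc_pth[OF a] pth_rev[OF g2] j1] j2]
      \<Phi>_join[OF arc_pth[OF a] pth_rev[OF g2] j1] \<Phi>_rev[OF g2] ..
  have "pathfinish (mpath H k g h d) = pathstart (?s \<circ> mpath H 1 g h d)"
    using lift_pathD[OF lift_mpath[OF a g, of k]] lift_pathD[OF lift_mpath[OF a g, of 1]]
    by (simp add: pathstart_compose)
  from \<Phi>_join[OF f this] have "\<Phi> (mpath H k g h d +++ (?s \<circ> mpath H 1 g h d)) = \<Phi> (mpath H (Suc k) g h d)"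
    unfolding 2 \<Phi>_mpath[OF a g] using c arc_join[OF a, of 0 "real k" "real (Suc k)", symmetric]
    by (simp add: B.m_assoc B_cancel del: funpow.simps of_nat_Suc)
  then have "cls (mpath H k g h d +++ (?s \<circ> mpath H 1 g h d)) = cls (mpath H (Suc k) g h d)"
    using l lift_mpath[OF a g, of "Suc k"] unfolding s by (intro cls_eq_\<Phi>I)
  moreover have "mcls H 1 g h d [^]\<^bsub>B\<^esub> Suc k = cls (mpath H k g h d) \<otimes>\<^bsub>B\<^esub> cls (mpath H 1 g h d)"
    using Suc by (simp add: mcls_def)
  ultimately show ?case
    using cls_mult[OF lift_mpath[OF a g, of k] lift_mpath[OF a g, of 1]] by (simp add: mcls_def)
qed

lemma adm_W:
  assumes a: "adm H h d" and w: "w \<in> W"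
  shows "adm (w ` H) (w h) (w d)"
proof -
  have out: "w x \<notin> H'" if "H' \<in> hyps" "H' \<noteq> w ` H" and x: "\<And>H''. H'' \<in> hyps \<Longrightarrow> H'' \<noteq> H \<Longrightarrow> x \<notin> H''" for x H'
  proof
    assume "w x \<in> H'"
    then have "x \<in> finv w ` H'" using W_inv_apply(2)[OF w] by (metis image_eqI)
    moreover have "finv w ` H' \<noteq> H"
    proof
      assume "finv w ` H' = H"
      then have "w ` H = H'" using W_inv_apply(1)[OF w] by (auto simp: image_image)
      then show False using that(2) by simp
    qed
    ultimately show False using x W_hyps[OF inv_W[OF w] that(1)] by blast
  qed
  show ?thesis unfolding adm_def
  proof (intro conjI ballI allI impI)
    show "w ` H \<in> hyps" by (rule W_hyps[OF w admD(1)[OF a]])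
    show "w h \<in> w ` H" using admD(2)[OF a] by blast
    show "w d \<noteq> 0" using admD(3)[OF a] W_inj[OF w, of d 0] W_zero[OF w] by simp
    show "herm x (w d) = 0" if "x \<in> w ` H" for x by (rule orthogonal_image[OF w admD(4)[OF a] that])
    show "w h \<notin> H'" if "H' \<in> hyps" "H' \<noteq> w ` H" for H'
      using a unfolding adm_def by (intro out that) blast
    show "w h + z *\<^sub>C w d \<notin> H'" if "cmod z \<le> 1" "H' \<in> hyps" "H' \<noteq> w ` H" for z H'
    proof -
      have "w h + z *\<^sub>C w d = w (h + z *\<^sub>C d)" by (simp add: W_add[OF w] W_scale[OF w])
      then show ?thesis using a that(1) unfolding adm_def by (simp only:) (intro out that; blast)
    qed
  qed
qed

lemma tail_W:
  assumes "lift w \<delta>" "tail y g"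
  shows "tail (w y) (\<delta> +++ (w \<circ> g))"
  using lift_pathD[OF assms(1)] tailD[OF assms(2)] pth_W[OF lift_pathD(3)[OF assms(1)], of g]
  by (simp add: tail_def path_image_join pathstart_compose pathfinish_compose)

lemma sr_pow_conj:
  assumes w: "w \<in> W" and H: "H \<in> hyps"
  shows "sr (w ` H) ^^ k = w \<circ> (sr H ^^ k) \<circ> finv w"
proof (induction k)
  case 0 then show ?case by (auto simp: W_inv_apply[OF w])
next
  case (Suc k)
  then show ?case by (simp add: sr_conj[OF w H] fun_eq_iff W_inv_apply[OF w])
qed

text \<open>Conjugation by a class lying over \<open>w\<close> transports all the data by
  \<open>w\<close>: the new tail is \<open>\<delta>\<close> followed by \<open>w \<circ> g\<close>,
  and the return path is the translate of \<open>\<delta>\<close> by the conjugated power of the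
  reflection.\<close>

lemma mcls_conj:
  assumes a: "adm H h d" and g: "tail (h + d) g" and \<delta>: "lift w \<delta>"
  shows "cls \<delta> \<otimes>\<^bsub>B\<^esub> mcls H k g h d \<otimes>\<^bsub>B\<^esub> inv\<^bsub>B\<^esub> (cls \<delta>) = mcls (w ` H) k (\<delta> +++ (w \<circ> g)) (w h) (w d)"
proof -
  let ?s = "sr H ^^ k" and ?m = "mpath H k g h d"
  have H: "H \<in> hyps" by (rule admD(1)[OF a])
  note \<delta>' = lift_pathD[OF \<delta>]
  have w: "w \<in> W" by (rule \<delta>'(3))
  have a': "adm (w ` H) (w h) (w d)" by (rule adm_W[OF a w])
  have g': "tail (w h + w d) (\<delta> +++ (w \<circ> g))" using tail_W[OF \<delta> g] by (simp add: W_add[OF w])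
  have lm: "lift ?s ?m" by (rule lift_mpath[OF a g])
  have l1: "lift (w \<circ> ?s) (\<delta> +++ (w \<circ> ?m))" by (rule lift_join[OF \<delta> lm])
  have l2: "lift (w \<circ> ?s \<circ> finv w) ((\<delta> +++ (w \<circ> ?m)) +++ ((w \<circ> ?s) \<circ> (finv w \<circ> reversepath \<delta>)))"
    by (rule lift_join[OF l1 lift_inverse[OF \<delta>]])
  let ?t = "sr (w ` H) ^^ k"
  have t: "?t = w \<circ> ?s \<circ> finv w" by (rule sr_pow_conj[OF w H])
  have arc': "w \<circ> arc H h d 0 (real k) = arc (w ` H) (w h) (w d) 0 (real k)"
    by (auto simp: arc_def spin_def W_add[OF w] W_scale[OF w] rot_def ord_image[OF w])
  have tw: "?t \<circ> w = w \<circ> ?s" unfolding t by (simp add: fun_eq_iff W_inv_apply[OF w])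
  have p: "pth \<delta>" "pth (w \<circ> g)" "pth (?t \<circ> \<delta>)" "pth (?t \<circ> (w \<circ> g))" "pth (w \<circ> ?m)"
    "pth (arc (w ` H) (w h) (w d) 0 (real k))"
    using \<delta>' pth_W[OF w tailD(1)[OF g]] pth_W[OF sr_pow_W[OF W_hyps[OF w H]]] pth_W[OF w] lift_pathD[OF lm] arc_pth[OF a']
    by blast+
  have c: "\<Phi> \<delta> \<in> carrier B" "\<Phi> (w \<circ> g) \<in> carrier B" "\<Phi> (?t \<circ> \<delta>) \<in> carrier B" "\<Phi> (?t \<circ> (w \<circ> g)) \<in> carrier B"
    "\<Phi> (arc (w ` H) (w h) (w d) 0 (real k)) \<in> carrier B"
    using p by (auto intro!: \<Phi>_closed)
  have e1: "w \<circ> ?m = (w \<circ> g) +++ (arc (w ` H) (w h) (w d) 0 (real k) +++ reversepath (?t \<circ> (w \<circ> g)))"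
  proof -
    have "w \<circ> reversepath (?s \<circ> g) = reversepath (?t \<circ> (w \<circ> g))"
      using tw by (auto simp: reversepath_def fun_eq_iff)
    then show ?thesis unfolding mpath_def path_compose_join arc' by simp
  qed
  have fin: "pathfinish (w \<circ> g) = spin (w ` H) (w h) (w d) 0"
    by (simp add: tailD[OF g] pathfinish_compose spin_def W_add[OF w])
  have j1: "pathfinish (arc (w ` H) (w h) (w d) 0 (real k)) = pathstart (reversepath (?t \<circ> (w \<circ> g)))"
  proof -
    have "pathfinish (?t \<circ> (w \<circ> g)) = ?t (spin (w ` H) (w h) (w d) 0)"
      using fin by (simp only: pathfinish_compose[of ?t])
    then show ?thesis using sr_spin[OF a', of k 0] by (simp add: arc_ends)
  qed
  have j2: "pathfinish (w \<circ> g) = pathstart (arc (w ` H) (w h) (w d) 0 (real k) +++ reversepath (?t \<circ> (w \<circ> g)))"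
    using fin by (simp add: arc_ends)
  have 1: "\<Phi> (w \<circ> ?m) = \<Phi> (w \<circ> g) \<otimes>\<^bsub>B\<^esub> (\<Phi> (arc (w ` H) (w h) (w d) 0 (real k)) \<otimes>\<^bsub>B\<^esub> inv\<^bsub>B\<^esub> \<Phi> (?t \<circ> (w \<circ> g)))"
    unfolding e1 \<Phi>_join[OF p(2) pth_join[OF p(6) pth_rev[OF p(4)] j1] j2]
      \<Phi>_join[OF p(6) pth_rev[OF p(4)] j1] \<Phi>_rev[OF p(4)] ..
  have e2: "(w \<circ> ?s) \<circ> (finv w \<circ> reversepath \<delta>) = reversepath (?t \<circ> \<delta>)"
    unfolding t by (auto simp: reversepath_def)
  have j3: "pathfinish \<delta> = pathstart (w \<circ> ?m)" using \<delta>' lift_pathD[OF lm] by (simp add: pathstart_compose)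
  have j4: "pathfinish (\<delta> +++ (w \<circ> ?m)) = pathstart (reversepath (?t \<circ> \<delta>))"
    using lift_pathD(5)[OF l1] \<delta>'(5) tw by (simp add: pathfinish_compose fun_eq_iff)
  have 2: "\<Phi> ((\<delta> +++ (w \<circ> ?m)) +++ reversepath (?t \<circ> \<delta>)) = (\<Phi> \<delta> \<otimes>\<^bsub>B\<^esub> \<Phi> (w \<circ> ?m)) \<otimes>\<^bsub>B\<^esub> inv\<^bsub>B\<^esub> \<Phi> (?t \<circ> \<delta>)"
    unfolding \<Phi>_join[OF pth_join[OF p(1,5) j3] pth_rev[OF p(3)] j4] \<Phi>_join[OF p(1,5) j3] \<Phi>_rev[OF p(3)] ..
  have j5: "pathfinish (?t \<circ> \<delta>) = pathstart (?t \<circ> (w \<circ> g))" "pathfinish \<delta> = pathstart (w \<circ> g)"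
    using \<delta>'(5) tailD[OF g] by (simp_all add: pathfinish_compose pathstart_compose)
  have 3: "\<Phi> (mpath (w ` H) k (\<delta> +++ (w \<circ> g)) (w h) (w d)) = (\<Phi> \<delta> \<otimes>\<^bsub>B\<^esub> \<Phi> (w \<circ> g)) \<otimes>\<^bsub>B\<^esub>
      (\<Phi> (arc (w ` H) (w h) (w d) 0 (real k)) \<otimes>\<^bsub>B\<^esub> inv\<^bsub>B\<^esub> (\<Phi> (?t \<circ> \<delta>) \<otimes>\<^bsub>B\<^esub> \<Phi> (?t \<circ> (w \<circ> g))))"
    unfolding \<Phi>_mpath[OF a' g'] path_compose_join \<Phi>_join[OF p(1,2) j5(2)] \<Phi>_join[OF p(3,4) j5(1)] ..
  have eq: "\<Phi> ((\<delta> +++ (w \<circ> ?m)) +++ reversepath (?t \<circ> \<delta>)) = \<Phi> (mpath (w ` H) k (\<delta> +++ (w \<circ> g)) (w h) (w d))"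
    unfolding 1 2 3 using c by (simp add: B.m_assoc B.inv_mult_group)
  have "cls \<delta> \<otimes>\<^bsub>B\<^esub> mcls H k g h d \<otimes>\<^bsub>B\<^esub> inv\<^bsub>B\<^esub> (cls \<delta>) =
      cls ((\<delta> +++ (w \<circ> ?m)) +++ ((w \<circ> ?s) \<circ> (finv w \<circ> reversepath \<delta>)))"
    unfolding mcls_def inv_cls[OF \<delta>] cls_mult[OF \<delta> lm] by (rule cls_mult[OF l1 lift_inverse[OF \<delta>]])
  also have "\<dots> = mcls (w ` H) k (\<delta> +++ (w \<circ> g)) (w h) (w d)"
    unfolding mcls_def
    by (rule cls_eq_\<Phi>I[OF l2]) (use lift_mpath[OF a' g', of k] t eq e2 in simp_all)
  finally show ?thesis .
qed

text \<open>Rotating the moving centre and direction gives a square. One side is the track of the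
  endpoint of the tail, the opposite one its translate by \<open>sr H ^^ k\<close>; lengthening the
  tail by the track absorbs both.\<close>

lemma mcls_move:
  assumes cont: "continuous_on {0..1} \<eta>" "continuous_on {0..1} \<theta>"
    and adm: "\<And>s. s \<in> {0..1} \<Longrightarrow> adm H (\<eta> s) (\<theta> s)" and g: "tail (\<eta> 0 + \<theta> 0) g"
  shows "tail (\<eta> 1 + \<theta> 1) (g +++ (\<lambda>s. \<eta> s + \<theta> s))"
    "mcls H k g (\<eta> 0) (\<theta> 0) = mcls H k (g +++ (\<lambda>s. \<eta> s + \<theta> s)) (\<eta> 1) (\<theta> 1)"
proof -
  let ?s = "sr H ^^ k" and ?\<tau> = "\<lambda>s. \<eta> s + \<theta> s"
  have a0: "adm H (\<eta> 0) (\<theta> 0)" and a1: "adm H (\<eta> 1) (\<theta> 1)" using adm by simp_all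
  have H: "H \<in> hyps" by (rule admD(1)[OF a0])
  have \<tau>: "pth ?\<tau>"
  proof
    show "path ?\<tau>" unfolding path_def using cont by (intro continuous_intros)
    have "?\<tau> s \<in> S" if "s \<in> {0..1}" for s using spin_S[OF adm[OF that], of 0] by (simp add: spin_def)
    then show "path_image ?\<tau> \<subseteq> S" by (auto simp: path_image_def)
  qed
  have j: "pathfinish g = pathstart ?\<tau>" using tailD(3)[OF g] by (simp add: pathstart_def)
  show t: "tail (\<eta> 1 + \<theta> 1) (g +++ ?\<tau>)"
    using tailD[OF g] \<tau> j pth_join[OF tailD(1)[OF g] \<tau> j] by (simp add: tail_def pathfinish_def[of ?\<tau>])
  define K where "K = (\<lambda>x::real \<times> real. \<eta> (fst x) + rot H (real k * snd x) *\<^sub>C \<theta> (fst x))"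
  have "continuous_on ({0..1} \<times> {0..1}) K"
    unfolding K_def
    by (intro continuous_intros continuous_rot continuous_on_compose2[OF cont(1)] continuous_on_compose2[OF cont(2)]) auto
  moreover have "K ` ({0..1} \<times> {0..1}) \<subseteq> S"
  proof (rule image_subsetI)
    fix x :: "real \<times> real" assume "x \<in> {0..1} \<times> {0..1}"
    then have "fst x \<in> {0..1}" by auto
    from spin_S[OF adm[OF this], of "real k * snd x"] show "K x \<in> S" by (simp add: K_def spin_def)
  qed
  ultimately have sq: "homotopic_paths S ((\<lambda>s. K (s, 0)) +++ (\<lambda>t. K (1, t))) ((\<lambda>t. K (0, t)) +++ (\<lambda>s. K (s, 1)))"
    by (rule homotopic_paths_square)
  have K: "(\<lambda>s. K (s, 0)) = ?\<tau>" "(\<lambda>t. K (a, t)) = arc H (\<eta> a) (\<theta> a) 0 (real k)" for a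
    by (auto simp: K_def arc_def spin_def linepath_def mult.commute)
  have K1: "K (s, 1) = (?s \<circ> ?\<tau>) s" if "s \<in> {0..1}" for s
    using sr_spin[OF adm[OF that], of k 0] by (simp add: K_def spin_def)
  have s\<tau>: "pth (?s \<circ> ?\<tau>)" by (rule pth_W[OF sr_pow_W[OF H] \<tau>])
  have sg: "pth (?s \<circ> g)" by (rule pth_W[OF sr_pow_W[OF H] tailD(1)[OF g]])
  have "homotopic_paths S (\<lambda>s. K (s, 1)) (?s \<circ> ?\<tau>)"
    using s\<tau> K1 by (intro homotopic_paths_sym[OF homotopic_paths_eq]) auto
  then have k1: "pth (\<lambda>s. K (s, 1))" "\<Phi> (\<lambda>s. K (s, 1)) = \<Phi> (?s \<circ> ?\<tau>)"
    using \<Phi>_hom homotopic_paths_imp_path homotopic_paths_imp_subset by blast+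
  have c: "\<Phi> g \<in> carrier B" "\<Phi> ?\<tau> \<in> carrier B" "\<Phi> (?s \<circ> ?\<tau>) \<in> carrier B" "\<Phi> (?s \<circ> g) \<in> carrier B"
    "\<Phi> (arc H (\<eta> 0) (\<theta> 0) 0 (real k)) \<in> carrier B" "\<Phi> (arc H (\<eta> 1) (\<theta> 1) 0 (real k)) \<in> carrier B"
    by (intro \<Phi>_closed tailD(1)[OF g] \<tau> s\<tau> sg arc_pth[OF a0] arc_pth[OF a1])+
  have "\<Phi> ?\<tau> \<otimes>\<^bsub>B\<^esub> \<Phi> (arc H (\<eta> 1) (\<theta> 1) 0 (real k)) = \<Phi> (?\<tau> +++ arc H (\<eta> 1) (\<theta> 1) 0 (real k))"
    by (rule \<Phi>_join[OF \<tau> arc_pth[OF a1], symmetric]) (simp add: arc_ends spin_def pathfinish_def)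
  also have "\<dots> = \<Phi> (arc H (\<eta> 0) (\<theta> 0) 0 (real k) +++ (\<lambda>s. K (s, 1)))"
    using \<Phi>_hom[OF sq] by (simp only: K)
  also have "\<dots> = \<Phi> (arc H (\<eta> 0) (\<theta> 0) 0 (real k)) \<otimes>\<^bsub>B\<^esub> \<Phi> (?s \<circ> ?\<tau>)"
    unfolding k1(2)[symmetric]
    by (rule \<Phi>_join[OF arc_pth[OF a0] k1(1)]) (simp add: arc_ends spin_def pathstart_def K_def)
  finally have sqB: "\<Phi> ?\<tau> \<otimes>\<^bsub>B\<^esub> \<Phi> (arc H (\<eta> 1) (\<theta> 1) 0 (real k)) =
    \<Phi> (arc H (\<eta> 0) (\<theta> 0) 0 (real k)) \<otimes>\<^bsub>B\<^esub> \<Phi> (?s \<circ> ?\<tau>)" .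
  have j': "pathfinish (?s \<circ> g) = pathstart (?s \<circ> ?\<tau>)"
    using j by (simp only: pathfinish_compose pathstart_compose)
  have "\<Phi> (mpath H k (g +++ ?\<tau>) (\<eta> 1) (\<theta> 1)) = (\<Phi> g \<otimes>\<^bsub>B\<^esub> \<Phi> ?\<tau>) \<otimes>\<^bsub>B\<^esub>
      (\<Phi> (arc H (\<eta> 1) (\<theta> 1) 0 (real k)) \<otimes>\<^bsub>B\<^esub> inv\<^bsub>B\<^esub> (\<Phi> (?s \<circ> g) \<otimes>\<^bsub>B\<^esub> \<Phi> (?s \<circ> ?\<tau>)))"
    unfolding \<Phi>_mpath[OF a1 t] path_compose_join \<Phi>_join[OF tailD(1)[OF g] \<tau> j] \<Phi>_join[OF sg s\<tau> j'] ..
  also have "\<dots> = \<Phi> g \<otimes>\<^bsub>B\<^esub> ((\<Phi> ?\<tau> \<otimes>\<^bsub>B\<^esub> \<Phi> (arc H (\<eta> 1) (\<theta> 1) 0 (real k))) \<otimes>\<^bsub>B\<^esub>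
      (inv\<^bsub>B\<^esub> \<Phi> (?s \<circ> ?\<tau>) \<otimes>\<^bsub>B\<^esub> inv\<^bsub>B\<^esub> \<Phi> (?s \<circ> g)))"
    using c by (simp add: B.m_assoc B.inv_mult_group)
  also have "\<dots> = \<Phi> (mpath H k g (\<eta> 0) (\<theta> 0))"
    unfolding sqB \<Phi>_mpath[OF a0 g] using c by (simp add: B.m_assoc B_cancel)
  finally show "mcls H k g (\<eta> 0) (\<theta> 0) = mcls H k (g +++ ?\<tau>) (\<eta> 1) (\<theta> 1)"
    unfolding mcls_def by (intro cls_eq_\<Phi>I[OF lift_mpath[OF a0 g] lift_mpath[OF a1 t]]) simp
qed

lemma adm_scale:
  assumes a: "adm H h d" and t: "t \<noteq> 0" "cmod t \<le> 1"
  shows "adm H h (t *\<^sub>C d)"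
  unfolding adm_def
proof (intro conjI ballI allI impI)
  show "H \<in> hyps" "h \<in> H" using admD[OF a] by auto
  show "h \<notin> H'" if "H' \<in> hyps" "H' \<noteq> H" for H' using a that unfolding adm_def by blast
  show "t *\<^sub>C d \<noteq> 0" using t(1) admD(3)[OF a] by simp
  show "herm x (t *\<^sub>C d) = 0" if "x \<in> H" for x using admD(4)[OF a that] by (simp add: herm_scale_right)
  show "h + z *\<^sub>C t *\<^sub>C d \<notin> H'" if z: "cmod z \<le> 1" and H': "H' \<in> hyps" "H' \<noteq> H" for z H'
  proof -
    have "cmod (z * t) \<le> 1" using z t(2) by (simp add: norm_mult mult_le_one)
    then show ?thesis using admD(8)[OF a _ H'] lf_eq_0_iff[OF H'(1)] by (simp add: scaleC_scaleC)
  qed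
qed

lemma admI:
  assumes H: "H \<in> hyps" and h: "h \<in> H" and d: "d \<noteq> 0" "\<And>x. x \<in> H \<Longrightarrow> herm x d = 0"
    and small: "\<And>H'. H' \<in> hyps - {H} \<Longrightarrow> cmod (lf H' d) < cmod (lf H' h)"
  shows "adm H h d"
  unfolding adm_def
proof (intro conjI ballI allI impI H h d)
  have "h + z *\<^sub>C d \<notin> H'" if z: "cmod z \<le> 1" and H': "H' \<in> hyps" "H' \<noteq> H" for z H'
  proof
    assume "h + z *\<^sub>C d \<in> H'"
    then have "lf H' h + z * lf H' d = 0"
      using lf_eq_0_iff[OF H'(1), of "h + z *\<^sub>C d"] by (simp add: lf_add lf_scale)
    then have "lf H' h = - (z * lf H' d)" by (rule eq_neg_iff_add_eq_0[THEN iffD2])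
    then have "cmod (lf H' h) \<le> 1 * cmod (lf H' d)"
      using z mult_right_mono[of "cmod z" 1 "cmod (lf H' d)"] by (simp add: norm_mult)
    then show False using small[of H'] H' by simp
  qed
  then show "h + z *\<^sub>C d \<notin> H'" if "cmod z \<le> 1" "H' \<in> hyps" "H' \<noteq> H" for z H' using that by blast
  from this[of 0] show "h \<notin> H'" if "H' \<in> hyps" "H' \<noteq> H" for H' using that by simp
qed

lemma distinct_hyps:
  assumes "H \<in> hyps" "H' \<in> hyps" "H \<noteq> H'"
  shows "\<exists>x. lf H x = 0 \<and> lf H' x = 1"
proof -
  have "\<not> H \<subseteq> H'" using hyperplane_subset_eq hyps_hyperplane assms by blast
  then obtain x where x: "x \<in> H" "x \<notin> H'" by blast
  then have "lf H x = 0" "lf H' x \<noteq> 0" using lf_eq_0_iff assms(1,2) by blast+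
  then show ?thesis by (intro exI[of _ "inverse (lf H' x) *\<^sub>C x"]) (simp add: lf_scale)
qed

text \<open>No other hyperplane of the arrangement contains \<open>H\<close>, so the projection of a
  generic vector to \<open>H\<close> avoids them all. \<open>nrm H\<close> is then scaled below the
  smallest value of the other forms at that point.\<close>

lemma adm_exists:
  assumes H: "H \<in> hyps"
  shows "\<exists>h d. adm H h d"
proof -
  define pr where "pr = (\<lambda>x. x - lf H x *\<^sub>C nrm H)"
  have "\<exists>v. \<forall>U\<in>(\<lambda>H'. {x. lf H' (pr x) = 0}) ` (hyps - {H}). v \<notin> U"
  proof (rule finite_union_proper_subspaces)
    fix U assume "U \<in> (\<lambda>H'. {x. lf H' (pr x) = 0}) ` (hyps - {H})"
    then obtain H' where H': "H' \<in> hyps" "H' \<noteq> H" "U = {x. lf H' (pr x) = 0}" by blast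
    have lf0: "lf K 0 = 0" for K using lf_diff[of K 0 0] by simp
    have sub: "subspace U"
      unfolding subspace_def H'(3)
      by (auto simp: lf0 pr_def lf_add lf_diff lf_scale scaleR_scaleC algebra_simps)
    obtain x where x: "lf H x = 0" "lf H' x = 1" using distinct_hyps[OF H H'(1)] H'(2) by auto
    then have "x \<notin> U" by (simp add: H'(3) pr_def)
    then show "subspace U \<and> U \<noteq> UNIV" using sub by blast
  qed (simp add: finite_hyps)
  then obtain v where v: "\<And>H'. H' \<in> hyps - {H} \<Longrightarrow> lf H' (pr v) \<noteq> 0" by auto
  obtain \<mu> where \<mu>: "\<mu> > 0" "\<forall>H'\<in>hyps - {H}. \<mu> \<le> cmod (lf H' (pr v))"
    using finite_positive_lower_bound[of "hyps - {H}" "\<lambda>H'. cmod (lf H' (pr v))"] v finite_hyps by auto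
  define N where "N = (\<Sum>H'\<in>hyps. cmod (lf H' (nrm H)))"
  have N: "0 \<le> N" "\<And>H'. H' \<in> hyps \<Longrightarrow> cmod (lf H' (nrm H)) \<le> N"
    unfolding N_def using finite_hyps by (auto intro: sum_nonneg member_le_sum)
  define \<epsilon> where "\<epsilon> = \<mu> / (N + 1)"
  have \<epsilon>: "0 < \<epsilon>" "\<epsilon> * N < \<mu>" using \<mu>(1) N(1) by (auto simp: \<epsilon>_def field_simps)
  have "adm H (pr v) (of_real \<epsilon> *\<^sub>C nrm H)"
  proof (rule admI[OF H])
    show "pr v \<in> H" unfolding pr_def by (rule lf_decomp[OF H])
    show "of_real \<epsilon> *\<^sub>C nrm H \<noteq> 0" using \<epsilon>(1) nrm(1)[OF H] by simp
    show "herm x (of_real \<epsilon> *\<^sub>C nrm H) = 0" if "x \<in> H" for x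
      using nrm(2)[OF H that] by (simp add: herm_scale_right)
    fix H' assume H': "H' \<in> hyps - {H}"
    have "cmod (lf H' (of_real \<epsilon> *\<^sub>C nrm H)) \<le> \<epsilon> * N"
      using \<epsilon>(1) N(2)[of H'] H' by (simp add: lf_scale norm_mult)
    also have "\<dots> < \<mu>" by (rule \<epsilon>(2))
    also have "\<mu> \<le> cmod (lf H' (pr v))" using \<mu>(2) H' by blast
    finally show "cmod (lf H' (of_real \<epsilon> *\<^sub>C nrm H)) < cmod (lf H' (pr v))" .
  qed
  then show ?thesis by blast
qed

lemma tail_exists: "adm H h d \<Longrightarrow> \<exists>g. tail (h + d) g"
proof -
  assume "adm H h d"
  then have "h + d \<in> S" using spin_S[of H h d 0] by (simp add: spin_def)
  from bp[OF this] show ?thesis by (auto simp: tail_def)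
qed

text \<open>The new tail is required to work for all exponents \<open>k\<close> at once and the old
  tail is arbitrary, so that moves compose.\<close>

definition moves_to :: "'v set \<Rightarrow> 'v \<Rightarrow> 'v \<Rightarrow> 'v \<Rightarrow> 'v \<Rightarrow> bool"
  where "moves_to H h d h' d' \<longleftrightarrow>
    (\<forall>g. tail (h + d) g \<longrightarrow> (\<exists>g'. tail (h' + d') g' \<and> (\<forall>k. mcls H k g h d = mcls H k g' h' d')))"

lemma moves_to_trans: "moves_to H h d h' d' \<Longrightarrow> moves_to H h' d' h'' d'' \<Longrightarrow> moves_to H h d h'' d''"
  unfolding moves_to_def by (metis (no_types))

lemma moves_toI:
  fixes \<eta> \<theta> :: "real \<Rightarrow> 'v"
  assumes "continuous_on {0..1} \<eta>" "continuous_on {0..1} \<theta>" "\<And>s. s \<in> {0..1} \<Longrightarrow> adm H (\<eta> s) (\<theta> s)"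
    "\<eta> 0 = h" "\<theta> 0 = d" "\<eta> 1 = h'" "\<theta> 1 = d'"
  shows "moves_to H h d h' d'"
  unfolding moves_to_def
proof (intro allI impI)
  fix g assume "tail (h + d) g"
  then have g: "tail (\<eta> 0 + \<theta> 0) g" using assms by simp
  show "\<exists>g'. tail (h' + d') g' \<and> (\<forall>k. mcls H k g h d = mcls H k g' h' d')"
    using mcls_move[of \<eta> \<theta> H g, OF assms(1,2,3) g] assms(4-7) by (intro exI[of _ "g +++ (\<lambda>s. \<eta> s + \<theta> s)"]) simp
qed

text \<open>Both directions lie on the orthogonal line, so they differ by a factor \<open>c\<close>.
  The direction is shrunk, the centre is moved inside \<open>H\<close> avoiding the other
  hyperplanes, the short direction is multiplied by \<open>c\<close> along the exponentials of
  multiples of \<open>Ln c\<close>, and finally it is enlarged.\<close>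

lemma adm_moves_to:
  assumes a: "adm H h d" and a': "adm H h' d'"
  shows "moves_to H h d h' d'"
proof -
  have H: "H \<in> hyps" by (rule admD(1)[OF a])
  define c where "c = lf H d' / lf H d"
  have c: "c \<noteq> 0" using admD(6)[OF a] admD(6)[OF a'] by (simp add: c_def)
  have d': "d' = c *\<^sub>C d"
  proof -
    have "c *\<^sub>C d = (c * lf H d) *\<^sub>C nrm H" using admD(7)[OF a] by (metis scaleC_scaleC)
    also have "\<dots> = lf H d' *\<^sub>C nrm H" using admD(6)[OF a] by (simp add: c_def)
    finally show ?thesis using admD(7)[OF a'] by simp
  qed
  have F: "finite (lf ` (hyps - {H}))"
    "\<And>l. l \<in> lf ` (hyps - {H}) \<Longrightarrow> clinear_form l \<and> l h \<noteq> 0 \<and> l h' \<noteq> 0"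
    using finite_hyps lf_linear admD(8)[OF a, of 0] admD(8)[OF a', of 0] by auto
  obtain z where z: "path z" "z 0 = 0" "z 1 = 1"
    "\<forall>t\<in>{0..1}. \<forall>l\<in>lf ` (hyps - {H}). l (h + z t *\<^sub>C (h' - h)) \<noteq> 0"
    using complex_line_avoiding_path[OF F] by blast
  define \<eta> where "\<eta> = (\<lambda>t. h + z t *\<^sub>C (h' - h))"
  have \<eta>c: "continuous_on {0..1} \<eta>" using z(1) unfolding path_def \<eta>_def by (intro continuous_intros)
  have \<eta>01: "\<eta> 0 = h" "\<eta> 1 = h'" using z(2,3) by (simp_all add: \<eta>_def)
  have \<eta>H: "\<eta> t \<in> H" for t
    using admD(5)[OF a] admD(5)[OF a'] lf_eq_0_iff[OF H, of "\<eta> t"] by (simp add: \<eta>_def lf_add lf_scale lf_diff)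
  have \<eta>n: "lf H' (\<eta> t) \<noteq> 0" if "t \<in> {0..1}" "H' \<in> hyps - {H}" for t H'
    using z(4) that by (auto simp: \<eta>_def)
  have "\<exists>M>0. \<forall>H'\<in>hyps - {H}. \<forall>t\<in>{0..1}. 1 / cmod (lf H' (\<eta> t)) \<le> M"
  proof (rule finite_continuous_upper_bound)
    show "continuous_on {0..1} (\<lambda>t. 1 / cmod (lf H' (\<eta> t)))" if "H' \<in> hyps - {H}" for H'
      using \<eta>n[OF _ that] by (intro continuous_intros \<eta>c) simp
  qed (simp add: finite_hyps)
  then obtain M where M: "M > 0" "\<And>H' t. H' \<in> hyps - {H} \<Longrightarrow> t \<in> {0..1} \<Longrightarrow> 1 / cmod (lf H' (\<eta> t)) \<le> M"
    by blast
  define N where "N = (\<Sum>H'\<in>hyps. cmod (lf H' d))"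
  have N: "0 \<le> N" "\<And>H'. H' \<in> hyps \<Longrightarrow> cmod (lf H' d) \<le> N"
    unfolding N_def using finite_hyps by (auto intro: sum_nonneg member_le_sum)
  define C where "C = max 1 (cmod c)"
  have C: "1 \<le> C" "cmod c \<le> C" by (auto simp: C_def)
  \<comment> \<open>\<open>M\<close> bounds the reciprocals of the other forms along the path of
    centres, \<open>N\<close> their values on \<open>d\<close>, and \<open>C\<close> the factors
    occurring between 1 and \<open>c\<close>. The summand 1 in \<open>N + 1\<close> gives the strict
    inequality required by \<open>admI\<close>.\<close>
  define \<epsilon> where "\<epsilon> = min 1 (1 / (M * (C * (N + 1))))"
  have pos: "0 < M * (C * (N + 1))" using M(1) C(1) N(1) by (intro mult_pos_pos) auto
  have \<epsilon>: "0 < \<epsilon>" "\<epsilon> \<le> 1" "M * (C * (N + 1)) * \<epsilon> \<le> 1"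
  proof -
    show "0 < \<epsilon>" "\<epsilon> \<le> 1" using pos by (auto simp: \<epsilon>_def)
    have "q * min 1 (1 / q) \<le> 1" if "0 < q" for q :: real using that by (auto simp: min_def field_simps)
    from this[OF pos] show "M * (C * (N + 1)) * \<epsilon> \<le> 1" by (simp only: \<epsilon>_def)
  qed
  have A: "adm H (\<eta> t) (e *\<^sub>C of_real \<epsilon> *\<^sub>C d)" if t: "t \<in> {0..1}" and e: "e \<noteq> 0" "cmod e \<le> C" for t e
  proof (rule admI[OF H \<eta>H])
    show "e *\<^sub>C of_real \<epsilon> *\<^sub>C d \<noteq> 0" using e \<epsilon>(1) admD(3)[OF a] by simp
    show "herm x (e *\<^sub>C of_real \<epsilon> *\<^sub>C d) = 0" if "x \<in> H" for x
      using admD(4)[OF a that] by (simp add: herm_scale_right)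
    fix H' assume H': "H' \<in> hyps - {H}"
    have p: "0 < cmod (lf H' (\<eta> t))" using \<eta>n[OF t H'] by simp
    have "cmod (lf H' (e *\<^sub>C of_real \<epsilon> *\<^sub>C d)) = cmod e * (\<epsilon> * cmod (lf H' d))"
      using \<epsilon>(1) by (simp add: lf_scale norm_mult)
    also have "\<dots> \<le> C * (\<epsilon> * N)"
      using e(2) \<epsilon>(1) N(2)[of H'] H' C(1) by (intro mult_mono mult_left_mono) auto
    finally have 1: "cmod (lf H' (e *\<^sub>C of_real \<epsilon> *\<^sub>C d)) \<le> C * (\<epsilon> * N)" .
    have "M * (C * (\<epsilon> * N)) < M * (C * (N + 1)) * \<epsilon>"
    proof -
      have "M * (C * (N + 1)) * \<epsilon> - M * (C * (\<epsilon> * N)) = M * C * \<epsilon>" by (simp add: algebra_simps)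
      moreover have "0 < M * C * \<epsilon>" using M(1) C(1) \<epsilon>(1) by simp
      ultimately show ?thesis by linarith
    qed
    then have 2: "M * (C * (\<epsilon> * N)) < 1" using \<epsilon>(3) by linarith
    have "1 \<le> M * cmod (lf H' (\<eta> t))" using M(2)[OF H' t] p by (simp add: field_simps)
    then have "M * (C * (\<epsilon> * N)) < M * cmod (lf H' (\<eta> t))" using 2 by linarith
    then have "C * (\<epsilon> * N) < cmod (lf H' (\<eta> t))" using M(1) by simp
    then show "cmod (lf H' (e *\<^sub>C of_real \<epsilon> *\<^sub>C d)) < cmod (lf H' (\<eta> t))" using 1 by linarith
  qed
  have small: "adm H h1 (of_real ((1 - s) * u + s * v) *\<^sub>C d1)"
    if "adm H h1 d1" "s \<in> {0..1}" "0 < u" "u \<le> 1" "0 < v" "v \<le> 1" for h1 d1 s u v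
  proof (rule adm_scale[OF that(1)])
    have "0 < (1 - s) * u + s * v"
      using that by (cases "s = 0") (auto intro!: add_nonneg_pos mult_nonneg_nonneg mult_pos_pos)
    moreover have "(1 - s) * u + s * v \<le> (1 - s) * 1 + s * 1"
      using that by (intro add_mono mult_left_mono) auto
    ultimately show "complex_of_real ((1 - s) * u + s * v) \<noteq> 0" "cmod (of_real ((1 - s) * u + s * v)) \<le> 1"
      by (simp_all del: of_real_add of_real_mult of_real_diff)
  qed
  have 1: "moves_to H h d h (of_real \<epsilon> *\<^sub>C d)"
    by (rule moves_toI[of "\<lambda>_. h" "\<lambda>s. of_real ((1 - s) * 1 + s * \<epsilon>) *\<^sub>C d"])
      (use small[OF a _ _ _ \<epsilon>(1,2), of _ 1] in \<open>auto intro!: continuous_intros\<close>)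
  have 2: "moves_to H h (of_real \<epsilon> *\<^sub>C d) h' (of_real \<epsilon> *\<^sub>C d)"
    by (rule moves_toI[of \<eta> "\<lambda>_. of_real \<epsilon> *\<^sub>C d"]) (use A[of _ 1] C(1) \<eta>c \<eta>01 in auto)
  have 3: "moves_to H h' (of_real \<epsilon> *\<^sub>C d) h' (of_real \<epsilon> *\<^sub>C d')"
  proof (rule moves_toI[of "\<lambda>_. h'" "\<lambda>s. exp (of_real s * Ln c) *\<^sub>C of_real \<epsilon> *\<^sub>C d"])
    fix s :: real assume s: "s \<in> {0..1}"
    have "cmod (exp (of_real s * Ln c)) = exp (s * ln (cmod c))" using c by simp
    also have "\<dots> \<le> C"
    proof (cases "ln (cmod c) \<le> 0")
      case True
      then have "exp (s * ln (cmod c)) \<le> 1" using s by (simp add: mult_nonneg_nonpos)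
      then show ?thesis using C(1) by linarith
    next
      case False
      then have "s * ln (cmod c) \<le> 1 * ln (cmod c)" using s by (intro mult_right_mono) auto
      then have "exp (s * ln (cmod c)) \<le> exp (ln (cmod c))" by simp
      also have "\<dots> = cmod c" using c by simp
      finally show ?thesis using C(2) by linarith
    qed
    finally show "adm H h' (exp (of_real s * Ln c) *\<^sub>C of_real \<epsilon> *\<^sub>C d)"
      using A[of 1 "exp (of_real s * Ln c)"] \<eta>01 by simp
  qed (use c d' in \<open>auto intro!: continuous_intros simp: scaleC_scaleC mult.commute\<close>)
  have 4: "moves_to H h' (of_real \<epsilon> *\<^sub>C d') h' d'"
    by (rule moves_toI[of "\<lambda>_. h'" "\<lambda>s. of_real ((1 - s) * \<epsilon> + s * 1) *\<^sub>C d'"])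
      (use small[OF a' _ \<epsilon>(1,2), of _ 1] in \<open>auto intro!: continuous_intros\<close>)
  show ?thesis by (rule moves_to_trans[OF 1 moves_to_trans[OF 2 moves_to_trans[OF 3 4]]])
qed

lemma mcls_tail_cong:
  assumes a: "adm H h d" and g: "tail (h + d) g" "tail (h + d) g'" and hom: "homotopic_paths S g g'"
  shows "mcls H k g h d = mcls H k g' h d"
proof -
  have "homotopic_paths S ((sr H ^^ k) \<circ> g) ((sr H ^^ k) \<circ> g')"
    by (rule homotopic_W[OF sr_pow_W[OF admD(1)[OF a]] hom])
  then have "\<Phi> (mpath H k g h d) = \<Phi> (mpath H k g' h d)"
    unfolding \<Phi>_mpath[OF a g(1)] \<Phi>_mpath[OF a g(2)] using \<Phi>_hom[OF hom] \<Phi>_hom by metis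
  then show ?thesis unfolding mcls_def by (rule cls_eq_\<Phi>I[OF lift_mpath[OF a g(1)] lift_mpath[OF a g(2)]])
qed

text \<open>After moving one disc onto the other only the tails differ, by a loop in the regular
  part; the conjugating element is the class of this loop, hence pure and independent of
  \<open>k\<close>.\<close>

lemma mcls_conjugate:
  assumes a: "adm H h d" and g: "tail (h + d) g" and a': "adm H h' d'" and g': "tail (h' + d') g'"
  shows "\<exists>\<delta>. lift id \<delta> \<and> (\<forall>k. mcls H k g h d = cls \<delta> \<otimes>\<^bsub>B\<^esub> mcls H k g' h' d' \<otimes>\<^bsub>B\<^esub> inv\<^bsub>B\<^esub> (cls \<delta>))"
proof -
  obtain f where f: "tail (h' + d') f" "\<And>k. mcls H k g h d = mcls H k f h' d'"
    using adm_moves_to[OF a a'] g unfolding moves_to_def by blast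
  define \<delta> where "\<delta> = f +++ reversepath g'"
  have \<delta>: "lift id \<delta>"
    using tailD[OF f(1)] tailD[OF g'] id_W by (simp add: lift_def \<delta>_def path_image_join)
  have t: "tail (h' + d') (\<delta> +++ g')" using tail_W[OF \<delta> g'] by simp
  have p: "pth f" "pth (reversepath g')" "pth g'" "pathfinish f = pathstart (reversepath g')"
    "pathfinish (f +++ reversepath g') = pathstart g'"
    using tailD[OF f(1)] tailD[OF g'] by simp_all
  have "\<Phi> (\<delta> +++ g') = \<Phi> f"
    unfolding \<delta>_def \<Phi>_join[OF pth_join[OF p(1,2,4)] p(3,5)] \<Phi>_join[OF p(1,2,4)] \<Phi>_rev[OF p(3)]
    using \<Phi>_closed[OF p(1)] \<Phi>_closed[OF p(3)] by (simp add: B.m_assoc)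
  then have "homotopic_paths S (\<delta> +++ g') f"
    using tailD[OF t] tailD[OF f(1)] by (intro \<Phi>_inj) auto
  then have "mcls H k (\<delta> +++ g') h' d' = mcls H k f h' d'" for k
    by (rule mcls_tail_cong[OF a' t f(1)])
  moreover have "cls \<delta> \<otimes>\<^bsub>B\<^esub> mcls H k g' h' d' \<otimes>\<^bsub>B\<^esub> inv\<^bsub>B\<^esub> (cls \<delta>) = mcls H k (\<delta> +++ g') h' d'" for k
    using mcls_conj[OF a' g' \<delta>, of k] by simp
  ultimately show ?thesis using \<delta> f(2) by metis
qed

section \<open>The kernel of the projection is generated by full turns\<close>

definition pure_generators :: "(real \<Rightarrow> 'v set) set set"
  where "pure_generators = {mcls H (ord H) g h d |H g h d. adm H h d \<and> tail (h + d) g}"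

text \<open>Conjugation permutes the full turns by \<open>mcls_conj\<close>, since the order of the
  fixator is the same for \<open>H\<close> and its image.\<close>

lemma pure_generators_normal: "generate B pure_generators \<lhd> B"
proof (rule B.normal_generateI)
  show "pure_generators \<subseteq> carrier B" using mcls_closed by (auto simp: pure_generators_def)
  fix n b assume n: "n \<in> pure_generators" and b: "b \<in> carrier B"
  obtain H g h d where 1: "adm H h d" "tail (h + d) g" "n = mcls H (ord H) g h d"
    using n by (auto simp: pure_generators_def)
  obtain w \<delta> where 2: "lift w \<delta>" "b = cls \<delta>" using b unfolding carrier_B by blast
  have w: "w \<in> W" by (rule lift_pathD(3)[OF 2(1)])
  have "b \<otimes>\<^bsub>B\<^esub> n \<otimes>\<^bsub>B\<^esub> inv\<^bsub>B\<^esub> b = mcls (w ` H) (ord (w ` H)) (\<delta> +++ (w \<circ> g)) (w h) (w d)"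
    unfolding 1(3) 2(2) ord_image[OF w] by (rule mcls_conj[OF 1(1,2) 2(1)])
  moreover have "tail (w h + w d) (\<delta> +++ (w \<circ> g))" using tail_W[OF 2(1) 1(2)] by (simp add: W_add[OF w])
  ultimately show "b \<otimes>\<^bsub>B\<^esub> n \<otimes>\<^bsub>B\<^esub> inv\<^bsub>B\<^esub> b \<in> pure_generators"
    using adm_W[OF 1(1) w] unfolding pure_generators_def by blast
qed

sublocale arr: arrangement hyps lf nrm
  by unfold_locales (use finite_hyps lf_linear lf_nrm distinct_hyps in auto)

lemma arr_compl: "arr.compl = S"
  unfolding arr.compl_def using regular_part_iff by blast

text \<open>The groupoid representation followed by the quotient by \<open>N\<close> kills small
  meridians, so \<open>loop_trivial\<close> applies to it: every closed regular path has its value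
  in \<open>N\<close>.\<close>

lemma pure_subset: assumes g: "lift id g" shows "cls g \<in> generate B pure_generators"
proof -
  define N where "N = generate B pure_generators"
  interpret N: normal N B unfolding N_def by (rule pure_generators_normal)
  have arcN: "\<Phi> (arc H h d 0 (real (ord H))) \<in> N" if a: "adm H h d" for H h d
  proof -
    have H: "H \<in> hyps" by (rule admD(1)[OF a])
    have y: "h + d \<in> S" using spin_S[OF a, of 0] by (simp add: spin_def)
    have t: "tail (h + d) (bp (h + d))" using bp[OF y] by (simp add: tail_def)
    have r: "rot H (real (ord H)) = 1" by (simp add: rot_pow rho_pow_ord)
    \<comment> \<open>With the fixed base path as tail this is literally a full turn:
      \<open>sr H ^^ ord H\<close> is the identity, so the path returns along the same tail.\<close>
    have "\<Phi> (arc H h d 0 (real (ord H))) = mcls H (ord H) (bp (h + d)) h d"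
      unfolding mcls_def mpath_def \<Phi>_def sr_pow_ord[OF H] by (simp add: arc_ends spin_def r)
    then have "\<Phi> (arc H h d 0 (real (ord H))) \<in> pure_generators"
      using a t unfolding pure_generators_def by blast
    then show ?thesis unfolding N_def by (rule generate.incl)
  qed
  interpret F: arrangement_functor hyps lf nrm "B Mod N" "\<lambda>p. N #>\<^bsub>B\<^esub> \<Phi> p"
  proof (rule arrangement_functor.intro[OF arr.arrangement_axioms N.factorgroup_is_group], unfold_locales, unfold arr_compl)
    show "N #>\<^bsub>B\<^esub> \<Phi> p \<in> carrier (B Mod N)" if "path p" "path_image p \<subseteq> S" for p
      using \<Phi>_closed[of p] that by (auto simp: FactGroup_def RCOSETS_def)
    show "N #>\<^bsub>B\<^esub> \<Phi> (p +++ q) = (N #>\<^bsub>B\<^esub> \<Phi> p) \<otimes>\<^bsub>B Mod N\<^esub> (N #>\<^bsub>B\<^esub> \<Phi> q)"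
      if "path p" "path_image p \<subseteq> S" "path q" "path_image q \<subseteq> S" "pathfinish p = pathstart q" for p q
      using that \<Phi>_join[of p q] N.rcos_sum[of "\<Phi> p" "\<Phi> q"] \<Phi>_closed[of p] \<Phi>_closed[of q]
        by (simp add: FactGroup_def)
    show "N #>\<^bsub>B\<^esub> \<Phi> p = N #>\<^bsub>B\<^esub> \<Phi> q" if "homotopic_paths S p q" for p q
      using \<Phi>_hom[OF that] by simp
    fix H h c
    assume H: "H \<in> hyps" and h: "lf H h = 0" and c: "c \<noteq> 0"
      and out: "\<And>z H'. cmod z \<le> 1 \<Longrightarrow> H' \<in> hyps \<Longrightarrow> H' \<noteq> H \<Longrightarrow> lf H' (h + z *\<^sub>C c *\<^sub>C nrm H) \<noteq> 0"
    have a: "adm H h (c *\<^sub>C nrm H)"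
      unfolding adm_def
    proof (intro conjI ballI allI impI)
      show "h \<in> H" using h lf_eq_0_iff[OF H] by blast
      show "c *\<^sub>C nrm H \<noteq> 0" using c nrm(1)[OF H] by simp
      show "herm x (c *\<^sub>C nrm H) = 0" if "x \<in> H" for x using nrm(2)[OF H that] by (simp add: herm_scale_right)
      show o: "h + z *\<^sub>C c *\<^sub>C nrm H \<notin> H'" if "cmod z \<le> 1" "H' \<in> hyps" "H' \<noteq> H" for z H'
        using out[OF that] lf_eq_0_iff[OF that(2)] by blast
      show "h \<notin> H'" if "H' \<in> hyps" "H' \<noteq> H" for H' using o[of 0 H'] that by simp
    qed (rule H)
    have "(\<lambda>t. h + exp (2 * \<i> * complex_of_real (pi * t)) *\<^sub>C c *\<^sub>C nrm H) = arc H h (c *\<^sub>C nrm H) 0 (real (ord H))"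
    proof
      fix t
      have "rot H (t * real (ord H)) = cis (2 * pi * t)" using ord_pos[of H] by (simp add: rot_def mult.assoc)
      also have "\<dots> = exp (2 * \<i> * complex_of_real (pi * t))" by (simp add: cis_conv_exp mult_ac)
      finally show "h + exp (2 * \<i> * complex_of_real (pi * t)) *\<^sub>C c *\<^sub>C nrm H = arc H h (c *\<^sub>C nrm H) 0 (real (ord H)) t"
        by (simp add: arc_def spin_def linepath_def)
    qed
    then show "N #>\<^bsub>B\<^esub> \<Phi> (\<lambda>t. h + exp (2 * \<i> * complex_of_real (pi * t)) *\<^sub>C c *\<^sub>C nrm H) = \<one>\<^bsub>B Mod N\<^esub>"
      using N.rcos_const[OF group_B arcN[OF a]] by (simp add: FactGroup_def)
  qed
  note g' = lift_pathD[OF g]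
  have pg: "pth g" using g' by blast
  have "N #>\<^bsub>B\<^esub> \<Phi> g = \<one>\<^bsub>B Mod N\<^esub>"
    by (rule F.loop_trivial) (use g' in \<open>simp_all add: arr_compl\<close>)
  then have "N #>\<^bsub>B\<^esub> \<Phi> g = N" by (simp add: FactGroup_def)
  then have \<Phi>N: "\<Phi> g \<in> N" using B.coset_join1 \<Phi>_closed[OF pg] N.subset N.is_subgroup by metis
  let ?a = "bp x0"
  note a = bp[OF x0]
  have la: "lift id ?a" using a id_W by (simp add: lift_def)
  have lb: "lift id (reversepath ?a)" using a id_W by (simp add: lift_def)
  have lag: "lift id (?a +++ g)" using lift_join[OF la g] by simp
  have "cls ?a \<otimes>\<^bsub>B\<^esub> cls g \<otimes>\<^bsub>B\<^esub> inv\<^bsub>B\<^esub> (cls ?a) = cls ((?a +++ g) +++ reversepath ?a)"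
    using cls_mult[OF la g] inv_cls[OF la] cls_mult[OF lag lb] by simp
  also have "\<dots> = \<Phi> g"
  proof -
    have "\<Phi> g = cls (?a +++ (g +++ reversepath ?a))" using g' by (simp add: \<Phi>_def)
    moreover have "homotopic_paths S ((?a +++ g) +++ reversepath ?a) (?a +++ (g +++ reversepath ?a))"
      by (rule homotopic_paths_sym[OF homotopic_paths_assoc]) (use g' a in simp_all)
    moreover have "lift id ((?a +++ g) +++ reversepath ?a)" using lift_join[OF lag lb] by simp
    ultimately show ?thesis using cls_eqI by simp
  qed
  finally have eq: "\<Phi> g = cls ?a \<otimes>\<^bsub>B\<^esub> cls g \<otimes>\<^bsub>B\<^esub> inv\<^bsub>B\<^esub> (cls ?a)" ..
  \<comment> \<open>The fixed base path at \<open>x0\<close> is itself a loop, possibly nontrivial;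
    its conjugation is undone using normality of \<open>N\<close>.\<close>
  have "cls g = inv\<^bsub>B\<^esub> (cls ?a) \<otimes>\<^bsub>B\<^esub> \<Phi> g \<otimes>\<^bsub>B\<^esub> cls ?a"
    unfolding eq using cls_carrier[OF la] cls_carrier[OF g] by (simp add: B.m_assoc B_cancel)
  then show ?thesis using N.inv_op_closed1[OF cls_carrier[OF la] \<Phi>N] by (simp add: N_def)
qed

end

section \<open>The abelianization\<close>

text \<open>Elements of one family \<open>X K\<close> are conjugate, so each family has one image
  \<open>v K\<close> in the abelianization, and these images generate it. The homomorphisms
  \<open>\<phi> K\<close> factor through the abelianization and are dual to the \<open>v K\<close>,
  so there is no relation between them.\<close>

lemma free_abelianization:
  fixes G :: "('a, 'b) monoid_scheme"
  assumes grp: "group G" and gen: "carrier G = generate G (\<Union>K\<in>I. X K)"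
    and sub: "\<And>K. K \<in> I \<Longrightarrow> X K \<subseteq> carrier G" and ne: "\<And>K. K \<in> I \<Longrightarrow> X K \<noteq> {}"
    and conj: "\<And>K x y. K \<in> I \<Longrightarrow> x \<in> X K \<Longrightarrow> y \<in> X K \<Longrightarrow>
      \<exists>g\<in>carrier G. x = g \<otimes>\<^bsub>G\<^esub> y \<otimes>\<^bsub>G\<^esub> inv\<^bsub>G\<^esub> g"
    and \<phi>: "\<And>K. K \<in> I \<Longrightarrow> \<phi> K \<in> hom G integer_group"
    and val: "\<And>K K' x. K \<in> I \<Longrightarrow> K' \<in> I \<Longrightarrow> x \<in> X K' \<Longrightarrow> \<phi> K x = (if K = K' then 1 else 0)"
  shows "\<exists>v f. (\<forall>K\<in>I. ab_class G ` X K = {v K}) \<and> f \<in> iso (abelianization G) (free_Abelian_group I) \<and>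
    (\<forall>K\<in>I. f (v K) = frag_of K) \<and> carrier (abelianization G) = generate (abelianization G) (v ` I) \<and>
    (\<forall>K\<in>I. \<exists>\<psi>\<in>hom (abelianization G) integer_group.
      (\<forall>b\<in>carrier G. \<psi> (ab_class G b) = \<phi> K b) \<and> (\<forall>K'\<in>I. \<psi> (v K') = (if K = K' then 1 else 0)))"
proof -
  interpret group G by (rule grp)
  let ?D = "derived G (carrier G)" and ?A = "abelianization G" and ?F = "free_Abelian_group I"
  interpret D: normal ?D G by (rule derived_self_is_normal)
  interpret A: comm_group ?A unfolding abelianization_def by (rule derived_quot_is_comm_group)
  interpret Z: group integer_group by simp
  have ab: "ab_class G \<in> hom G ?A"
    unfolding abelianization_def ab_class_def by (rule D.r_coset_hom_Mod)
  interpret ab: group_hom G ?A "ab_class G" by unfold_locales (rule ab)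
  have onto: "carrier ?A = ab_class G ` carrier G"
    by (simp add: abelianization_def ab_class_def carrier_FactGroup)
  have cls: "ab_class G x = ab_class G y" if K: "K \<in> I" and xy: "x \<in> X K" "y \<in> X K" for K x y
  proof -
    obtain g where g: "g \<in> carrier G" "x = g \<otimes>\<^bsub>G\<^esub> y \<otimes>\<^bsub>G\<^esub> inv\<^bsub>G\<^esub> g" using conj[OF K xy] by blast
    have y: "y \<in> carrier G" using sub[OF K] xy by blast
    have "ab_class G x = ab_class G g \<otimes>\<^bsub>?A\<^esub> ab_class G y \<otimes>\<^bsub>?A\<^esub> inv\<^bsub>?A\<^esub> ab_class G g"
      using g y by simp
    also have "\<dots> = ab_class G y"
      using A.m_comm[OF ab.hom_closed[OF g(1)] ab.hom_closed[OF y]] ab.hom_closed[OF g(1)] ab.hom_closed[OF y]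
      by (simp add: A.m_assoc)
    finally show ?thesis .
  qed
  have "\<forall>K\<in>I. \<exists>u. ab_class G ` X K = {u}"
  proof
    fix K assume K: "K \<in> I"
    obtain x where x: "x \<in> X K" using ne[OF K] by blast
    have "ab_class G ` X K = {ab_class G x}" using cls[OF K _ x] x by blast
    then show "\<exists>u. ab_class G ` X K = {u}" by blast
  qed
  then obtain v where v: "\<And>K. K \<in> I \<Longrightarrow> ab_class G ` X K = {v K}" by metis
  have vx: "ab_class G x = v K" if "K \<in> I" "x \<in> X K" for K x using v[OF that(1)] that(2) by blast
  have vI: "v ` I \<subseteq> carrier ?A"
  proof
    fix u assume "u \<in> v ` I"
    then obtain K where K: "K \<in> I" "u = v K" by blast
    obtain x where x: "x \<in> X K" using ne[OF K(1)] by blast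
    have "x \<in> carrier G" using sub[OF K(1)] x by (rule subsetD)
    then show "u \<in> carrier ?A" using vx[OF K(1) x] K(2) ab.hom_closed[of x] by simp
  qed
  have 1: "ab_class G ` (\<Union>K\<in>I. X K) = v ` I" unfolding image_UN using v by auto
  have 2: "(\<Union>K\<in>I. X K) \<subseteq> carrier G" using sub by (rule UN_least)
  have "carrier ?A = ab_class G ` generate G (\<Union>K\<in>I. X K)"
    using onto arg_cong[OF gen, of "(`) (ab_class G)"] by (rule trans)
  then have genA: "carrier ?A = generate ?A (v ` I)" using ab.generate_img[OF 2] 1 by simp
  have "\<forall>K\<in>I. \<exists>\<psi>. \<psi> \<in> hom ?A integer_group \<and> (\<forall>b\<in>carrier G. \<psi> (ab_class G b) = \<phi> K b)"
  proof
    fix K assume K: "K \<in> I"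
    interpret \<phi>: group_hom G integer_group "\<phi> K" by unfold_locales (rule \<phi>[OF K])
    have "derived_set G (carrier G) \<subseteq> kernel G integer_group (\<phi> K)"
      by (auto simp: kernel_def)
    then have ker: "?D \<subseteq> kernel G integer_group (\<phi> K)"
      unfolding derived_def by (rule generate_subgroup_incl[OF _ \<phi>.subgroup_kernel])
    have "\<phi> K x = \<phi> K y" if x: "x \<in> carrier G" and y: "y \<in> carrier G" and e: "?D #>\<^bsub>G\<^esub> x = ?D #>\<^bsub>G\<^esub> y" for x y
    proof -
      have "x \<in> ?D #>\<^bsub>G\<^esub> y" using rcos_self[OF x D.subgroup_axioms] e by simp
      then obtain z where z: "z \<in> ?D" "x = z \<otimes>\<^bsub>G\<^esub> y" unfolding r_coset_def by blast
      have "z \<in> carrier G" "\<phi> K z = 0" using z(1) ker by (auto simp: kernel_def)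
      then show ?thesis using y z(2) by simp
    qed
    from FactGroup_universal[OF \<phi>[OF K] D.normal_axioms this]
    obtain \<psi> where "\<psi> \<in> hom (G Mod ?D) integer_group" "\<And>x. x \<in> carrier G \<Longrightarrow> \<psi> (?D #>\<^bsub>G\<^esub> x) = \<phi> K x" by blast
    then show "\<exists>\<psi>. \<psi> \<in> hom ?A integer_group \<and> (\<forall>b\<in>carrier G. \<psi> (ab_class G b) = \<phi> K b)"
      by (auto simp: abelianization_def ab_class_def)
  qed
  then obtain \<psi> where \<psi>: "\<And>K. K \<in> I \<Longrightarrow> \<psi> K \<in> hom ?A integer_group"
    "\<And>K b. K \<in> I \<Longrightarrow> b \<in> carrier G \<Longrightarrow> \<psi> K (ab_class G b) = \<phi> K b" by metis
  have \<psi>v: "\<psi> K (v K') = (if K = K' then 1 else 0)" if K: "K \<in> I" "K' \<in> I" for K K'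
  proof -
    obtain x where x: "x \<in> X K'" using ne[OF K(2)] by blast
    then have "x \<in> carrier G" using sub[OF K(2)] by blast
    from \<psi>(2)[OF K(1) this] show ?thesis unfolding vx[OF K(2) x] val[OF K x] .
  qed
  obtain \<Gamma> where \<Gamma>: "\<Gamma> \<in> hom ?F ?A" "\<And>K. K \<in> I \<Longrightarrow> \<Gamma> (frag_of K) = v K"
    using A.free_Abelian_group_universal[OF vI] by blast
  interpret F: group ?F by simp
  interpret \<Gamma>: group_hom ?F ?A \<Gamma> by unfold_locales (rule \<Gamma>(1))
  \<comment> \<open>The dual homomorphism reads off the coefficient at \<open>K\<close>, which gives
    injectivity of the map from the free abelian group.\<close>
  have look: "\<psi> K (\<Gamma> x) = Poly_Mapping.lookup x K" if K: "K \<in> I" and x: "Poly_Mapping.keys x \<subseteq> I" for K x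
  proof (rule free_Abelian_group_induct[OF x])
    interpret c: group_hom ?F integer_group "\<psi> K \<circ> \<Gamma>"
      by unfold_locales (rule Group.hom_compose[OF \<Gamma>(1) \<psi>(1)[OF K]])
    show "\<psi> K (\<Gamma> 0) = Poly_Mapping.lookup 0 K" using c.hom_one by simp
    show "\<psi> K (\<Gamma> (y - z)) = Poly_Mapping.lookup (y - z) K"
      if yz: "Poly_Mapping.keys y \<subseteq> I" "Poly_Mapping.keys z \<subseteq> I"
        and e: "\<psi> K (\<Gamma> y) = Poly_Mapping.lookup y K" "\<psi> K (\<Gamma> z) = Poly_Mapping.lookup z K" for y z
    proof -
      have "y - z = y \<otimes>\<^bsub>?F\<^esub> inv\<^bsub>?F\<^esub> z" using yz by simp
      then have "(\<psi> K \<circ> \<Gamma>) (y - z) = (\<psi> K \<circ> \<Gamma>) y - (\<psi> K \<circ> \<Gamma>) z"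
        using c.hom_mult[of y "inv\<^bsub>?F\<^esub> z"] c.hom_inv[of z] yz F.inv_closed[of z]
        by (simp del: inv_free_Abelian_group mult_free_Abelian_group)
      then show ?thesis using e by (simp add: lookup_minus)
    qed
    show "\<psi> K (\<Gamma> (frag_of a)) = Poly_Mapping.lookup (frag_of a) K" if "a \<in> I" for a
      using \<Gamma>(2)[OF that] \<psi>v[OF K that] by (simp add: lookup_single when_def)
  qed
  have "inj_on \<Gamma> (carrier ?F)"
  proof (rule inj_onI)
    fix x y assume xy: "x \<in> carrier ?F" "y \<in> carrier ?F" "\<Gamma> x = \<Gamma> y"
    have "Poly_Mapping.lookup x K = Poly_Mapping.lookup y K" for K
    proof (cases "K \<in> I")
      case True then show ?thesis using look[OF True, of x] look[OF True, of y] xy by simp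
    next
      case False
      then have "K \<notin> Poly_Mapping.keys x" "K \<notin> Poly_Mapping.keys y" using xy by auto
      then show ?thesis by (simp add: in_keys_iff)
    qed
    then show "x = y" by (rule poly_mapping_eqI)
  qed
  moreover have "\<Gamma> ` carrier ?F = carrier ?A"
  proof
    have "v ` I \<subseteq> \<Gamma> ` carrier ?F"
    proof
      fix u assume "u \<in> v ` I"
      then obtain K where "K \<in> I" "u = v K" by blast
      then show "u \<in> \<Gamma> ` carrier ?F" using \<Gamma>(2)[of K] by (intro image_eqI[of _ _ "frag_of K"]) simp_all
    qed
    then show "carrier ?A \<subseteq> \<Gamma> ` carrier ?F"
      by (subst genA, rule A.generate_subgroup_incl[OF _ \<Gamma>.img_is_subgroup])
  qed (use \<Gamma>.hom_closed in blast)
  ultimately have iso: "\<Gamma> \<in> iso ?F ?A" using \<Gamma>(1) by (simp add: iso_iff)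
  define f where "f = inv_into (carrier ?F) \<Gamma>"
  show ?thesis
  proof (intro exI[of _ v] exI[of _ f] conjI ballI)
    show "ab_class G ` X K = {v K}" if "K \<in> I" for K by (rule v[OF that])
    show "f \<in> iso ?A ?F" unfolding f_def by (rule F.iso_set_sym[OF iso])
    show "f (v K) = frag_of K" if "K \<in> I" for K
      unfolding f_def \<Gamma>(2)[OF that, symmetric]
      using iso that by (intro inv_into_f_f) (simp_all add: iso_iff)
    show "carrier ?A = generate ?A (v ` I)" by (rule genA)
    show "\<exists>\<psi>\<in>hom ?A integer_group. (\<forall>b\<in>carrier G. \<psi> (ab_class G b) = \<phi> K b) \<and>
      (\<forall>K'\<in>I. \<psi> (v K') = (if K = K' then 1 else 0))" if "K \<in> I" for K
      by (rule bexI[OF _ \<psi>(1)[OF that]], intro conjI ballI \<psi>(2)[OF that] \<psi>v[OF that])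
  qed
qed

section \<open>Winding numbers of lifted paths\<close>

text \<open>Multiplication shifts a continuous logarithm by the constant \<open>Ln c\<close>,
  leaving the difference of its end values unchanged; the path need not be closed.\<close>

lemma winding_number_mult_const:
  assumes p: "path p" "0 \<notin> path_image p" and c: "c \<noteq> 0"
  shows "winding_number (\<lambda>t. c * p t) 0 = winding_number p 0"
proof -
  obtain q where q: "path q" "\<And>t. t \<in> {0..1} \<Longrightarrow> p t = 0 + exp (q t)"
    using winding_number_as_continuous_log[OF p] by metis
  have "winding_number (\<lambda>t. c * p t) 0 = winding_number (\<lambda>t. exp (Ln c + q t)) 0"
    by (rule winding_number_cong) (simp add: q(2) exp_add c)
  also have "\<dots> = winding_number (\<lambda>t. exp (q t)) 0"
    using q(1) by (simp add: winding_number_exp path_def continuous_on_add)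
  also have "\<dots> = winding_number p 0"
    by (rule winding_number_cong) (simp add: q(2))
  finally show ?thesis .
qed

context braid_setting
begin

definition turn :: "'v set \<Rightarrow> (real \<Rightarrow> 'v) \<Rightarrow> complex"
  where "turn H p = winding_number (lf H \<circ> p) 0"

lemma lf_path:
  assumes "H \<in> hyps" "pth p"
  shows "path (lf H \<circ> p)" "0 \<notin> path_image (lf H \<circ> p)"
proof -
  show "path (lf H \<circ> p)" using assms(2) by (intro path_continuous_image continuous_lf continuous_on_id) simp
  show "0 \<notin> path_image (lf H \<circ> p)" using assms regular_part_iff unfolding path_image_compose by fastforce
qed

lemma turn_join:
  assumes "H \<in> hyps" "pth p" "pth q" "pathfinish p = pathstart q"
  shows "turn H (p +++ q) = turn H p + turn H q"
  unfolding turn_def path_compose_join using lf_path[OF assms(1,2)] lf_path[OF assms(1,3)] assms(4)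
  by (intro winding_number_join) (simp_all add: pathstart_compose pathfinish_compose)

lemma turn_rev: "H \<in> hyps \<Longrightarrow> pth p \<Longrightarrow> turn H (reversepath p) = - turn H p"
  unfolding turn_def path_compose_reversepath using lf_path by (intro winding_number_reversepath)

lemma turn_hom:
  assumes "H \<in> hyps" "homotopic_paths S p q"
  shows "turn H p = turn H q"
  unfolding turn_def
proof (intro winding_number_homotopic_paths homotopic_paths_continuous_image[OF assms(2)])
  show "continuous_on S (lf H)" by (intro continuous_lf continuous_on_id)
  show "lf H \<in> S \<rightarrow> - {0}" using assms(1) by (auto simp: regular_part_iff)
qed

text \<open>Pulling the form of the image hyperplane back along \<open>w\<close> gives a form with
  kernel \<open>H\<close>, hence a nonzero constant multiple of \<open>lf H\<close>.\<close>

lemma turn_W: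
  assumes H: "H \<in> hyps" and w: "w \<in> W" and p: "pth p"
  shows "turn (w ` H) (w \<circ> p) = turn H p"
proof -
  have wH: "w ` H \<in> hyps" by (rule W_hyps[OF w H])
  define c where "c = lf (w ` H) (w (nrm H))"
  have e: "lf (w ` H) (w x) = c * lf H x" for x
  proof -
    have "w (x - lf H x *\<^sub>C nrm H) \<in> w ` H" using lf_decomp[OF H] by blast
    then have "lf (w ` H) (w (x - lf H x *\<^sub>C nrm H)) = 0" using lf_eq_0_iff[OF wH] by blast
    then show ?thesis by (simp add: W_diff[OF w] W_scale[OF w] lf_diff lf_scale c_def mult.commute)
  qed
  have "c \<noteq> 0"
  proof
    assume "c = 0"
    then have "w (nrm H) \<in> w ` H" using lf_eq_0_iff[OF wH] by (simp add: c_def)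
    then have "nrm H \<in> H" using W_inj[OF w] by auto
    then show False using lf_eq_0_iff[OF H, of "nrm H"] lf_nrm[OF H] by simp
  qed
  from winding_number_mult_const[OF lf_path[OF H p] this] show ?thesis
    unfolding turn_def comp_def e .
qed

lemma turn_arc:
  assumes a: "adm H h d"
  shows "turn H (arc H h d 0 (real (ord H))) = 1"
proof -
  have c: "lf H d \<noteq> 0" by (rule admD(6)[OF a])
  let ?q = "\<lambda>t. Ln (lf H d) + of_real t * (2 * of_real pi * \<i>)"
  have "lf H (arc H h d 0 (real (ord H)) t) = exp (?q t)" for t
  proof -
    have "rot H (t * real (ord H)) = exp (of_real t * (2 * of_real pi * \<i>))"
      using ord_pos[of H] by (simp add: rot_def cis_conv_exp mult_ac)
    then show ?thesis
      using c admD(5)[OF a] by (simp add: arc_def spin_def linepath_def lf_add lf_scale exp_add)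
  qed
  moreover have "path ?q" unfolding path_def by (intro continuous_intros)
  ultimately show ?thesis unfolding turn_def comp_def by (simp add: winding_number_exp)
qed

text \<open>The values of \<open>lf H'\<close> along the arc lie in the image of the closed unit
  disc, which is convex and omits 0 by admissibility.\<close>

lemma turn_arc_other:
  assumes a: "adm H h d" and H': "H' \<in> hyps" "H' \<noteq> H"
  shows "turn H' (arc H h d 0 (real (ord H))) = 0"
  unfolding turn_def
proof (rule winding_number_zero_outside)
  let ?p = "arc H h d 0 (real (ord H))" and ?D = "(\<lambda>z. lf H' (h + z *\<^sub>C d)) ` cball 0 1"
  show "path (lf H' \<circ> ?p)" by (rule lf_path[OF H'(1) arc_pth[OF a]])
  show "convex ?D"
  proof -
    have "?D = (+) (lf H' h) ` ((\<lambda>z. z * lf H' d) ` cball 0 1)"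
      by (simp add: image_image lf_add lf_scale)
    moreover have "linear (\<lambda>z. z * lf H' d)" by (intro bounded_linear.linear bounded_linear_mult_left)
    ultimately show ?thesis by (simp only:) (intro convex_translation convex_linear_image convex_cball)
  qed
  show "pathfinish (lf H' \<circ> ?p) = pathstart (lf H' \<circ> ?p)"
    by (simp add: pathfinish_compose pathstart_compose arc_ends spin_def rot_pow rho_pow_ord)
  show "0 \<notin> ?D" using admD(8)[OF a _ H'] by fastforce
  show "path_image (lf H' \<circ> ?p) \<subseteq> ?D"
    by (auto simp: path_image_def arc_def spin_def)
qed

text \<open>Only full turns are evaluated, because there the tails cancel for each hyperplane separately; the
  values on their roots then follow by division.\<close>

lemma turn_mpath:
  assumes a: "adm H h d" and g: "tail (h + d) g" and H': "H' \<in> hyps"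
  shows "turn H' (mpath H (ord H) g h d) = (if H' = H then 1 else 0)"
proof -
  note f = mpath_facts[OF a g, of "ord H"] and t = tailD[OF g]
  have "turn H' (mpath H (ord H) g h d) = turn H' g +
      (turn H' (arc H h d 0 (real (ord H))) - turn H' ((sr H ^^ ord H) \<circ> g))"
    unfolding mpath_def turn_join[OF H' t(1) pth_join[OF f(1) pth_rev[OF f(2)] f(4)] trans[OF f(3) pathstart_join[symmetric]]]
      turn_join[OF H' f(1) pth_rev[OF f(2)] f(4)] turn_rev[OF H' f(2)] by simp
  also have "\<dots> = turn H' (arc H h d 0 (real (ord H)))"
    by (simp add: sr_pow_ord[OF admD(1)[OF a]])
  finally show ?thesis using turn_arc[OF a] turn_arc_other[OF a H'] by simp
qed

text \<open>A chosen lift of the class; lifts from \<open>x0\<close> of the same class are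
  homotopic, so the turns do not depend on the choice.\<close>

definition rep :: "(real \<Rightarrow> 'v set) set \<Rightarrow> real \<Rightarrow> 'v"
  where "rep b = (SOME g. \<exists>w. lift w g \<and> b = cls g)"

definition total_turn :: "'v set set \<Rightarrow> (real \<Rightarrow> 'v set) set \<Rightarrow> complex"
  where "total_turn K b = (\<Sum>H\<in>K. turn H (rep b))"

lemma total_turn_cls:
  assumes g: "lift w g" and K: "K \<subseteq> hyps"
  shows "total_turn K (cls g) = (\<Sum>H\<in>K. turn H g)"
proof -
  have "\<exists>f. \<exists>v. lift v f \<and> cls g = cls f" using g by blast
  from someI_ex[OF this] obtain v where f: "lift v (rep (cls g))" "cls g = cls (rep (cls g))"
    unfolding rep_def by blast
  note f' = lift_pathD[OF f(1)] and g' = lift_pathD[OF g]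
  have "homotopic_paths S g (rep (cls g))"
    by (rule iffD1[OF cls_eq_iff[OF g'(1,2) f'(1,2)] f(2)]) (simp add: f' g')
  then show ?thesis unfolding total_turn_def using K turn_hom by (intro sum.cong refl) (metis subsetD)
qed

text \<open>Translating the second lift by \<open>w\<close> permutes the hyperplanes along with
  their turns. Additivity therefore holds only after summing over a set stable under
  \<open>w\<close>, which is why whole classes are summed.\<close>

lemma total_turn_mult:
  assumes g: "lift w g" and f: "lift v f" and K: "K \<subseteq> hyps" "(`) w ` K = K"
  shows "total_turn K (cls g \<otimes>\<^bsub>B\<^esub> cls f) = total_turn K (cls g) + total_turn K (cls f)"
proof -
  note g' = lift_pathD[OF g] and f' = lift_pathD[OF f]
  have p: "pth g" "pth f" "pth (w \<circ> f)" using g' f' pth_W[OF g'(3)] by blast+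
  have j: "pathfinish g = pathstart (w \<circ> f)" using g' f' by (simp add: pathstart_compose)
  have "inj_on ((`) w) K"
    by (rule inj_onI) (use W_inj[OF g'(3)] in \<open>metis inj_def inj_image_eq_iff\<close>)
  then have "(\<Sum>H\<in>(`) w ` K. turn H (w \<circ> f)) = (\<Sum>H\<in>K. turn (w ` H) (w \<circ> f))" by (rule sum.reindex_cong) auto
  also have "\<dots> = (\<Sum>H\<in>K. turn H f)"
    using K(1) turn_W[OF _ g'(3) p(2)] by (intro sum.cong refl) blast
  finally have s: "(\<Sum>H\<in>K. turn H (w \<circ> f)) = (\<Sum>H\<in>K. turn H f)" unfolding K(2) .
  have "total_turn K (cls g \<otimes>\<^bsub>B\<^esub> cls f) = (\<Sum>H\<in>K. turn H (g +++ (w \<circ> f)))"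
    unfolding cls_mult[OF g f] by (rule total_turn_cls[OF lift_join[OF g f] K(1)])
  also have "\<dots> = (\<Sum>H\<in>K. turn H g + turn H (w \<circ> f))"
    using K(1) turn_join[OF _ p(1,3) j] by (intro sum.cong refl) blast
  also have "\<dots> = total_turn K (cls g) + total_turn K (cls f)"
    unfolding total_turn_cls[OF g K(1)] total_turn_cls[OF f K(1)] by (simp add: sum.distrib s)
  finally show ?thesis .
qed

lemma total_turn_mcls:
  assumes a: "adm H h d" and g: "tail (h + d) g" and K: "K \<subseteq> hyps"
  shows "total_turn K (mcls H (ord H) g h d) = (if H \<in> K then 1 else 0)"
proof -
  have "finite K" using K finite_hyps by (rule finite_subset)
  moreover have "total_turn K (mcls H (ord H) g h d) = (\<Sum>H'\<in>K. if H' = H then 1 else 0)"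
    unfolding mcls_def total_turn_cls[OF lift_mpath[OF a g] K]
    by (rule sum.cong[OF refl turn_mpath[OF a g]]) (use K in blast)
  ultimately show ?thesis by simp
qed

end

section \<open>The preimage of the reflection subgroup\<close>

locale braid_subgroup = reflection_subgroup herm W C + braid_setting herm W x0
  for herm :: "'v::complex_fd_space \<Rightarrow> 'v \<Rightarrow> complex" and W C and x0 :: 'v
begin

abbreviation hclasses :: "'v set set set" where "hclasses \<equiv> hyperplane_classes W C"

lemma classes_iff: "K \<in> hclasses \<longleftrightarrow> (\<exists>H\<in>hyps. K = (\<lambda>c. c ` H) ` C)"
  by (auto simp: hyperplane_classes_def orbits_def orbit_def)

lemma classes_subset: "K \<in> hclasses \<Longrightarrow> K \<subseteq> hyps"
  unfolding classes_iff using W_hyps C_subset by blast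

lemma mem_own_class: "H \<in> (\<lambda>c. c ` H) ` C"
  using C.id_W by (auto intro!: image_eqI[of _ _ id])

lemma class_exists: "H \<in> hyps \<Longrightarrow> \<exists>K\<in>hclasses. H \<in> K"
  using mem_own_class classes_iff by blast

lemma class_nonempty: "K \<in> hclasses \<Longrightarrow> \<exists>H. H \<in> K"
  unfolding classes_iff using mem_own_class by blast

lemma class_closed: "K \<in> hclasses \<Longrightarrow> c \<in> C \<Longrightarrow> H \<in> K \<Longrightarrow> c ` H \<in> K"
proof -
  assume "K \<in> hclasses" and c: "c \<in> C" and "H \<in> K"
  then obtain L a where 1: "K = (\<lambda>c. c ` L) ` C" "a \<in> C" "H = a ` L" unfolding classes_iff by blast
  have "c ` H = (c \<circ> a) ` L" unfolding 1(3) by (rule image_comp)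
  then show ?thesis unfolding 1(1) using C.comp_W[OF c 1(2)] by (rule image_eqI)
qed

lemma class_transitive:
  assumes "K \<in> hclasses" "H \<in> K" "H' \<in> K"
  shows "\<exists>c\<in>C. H = c ` H'"
proof -
  obtain L a b where 1: "H = a ` L" "H' = b ` L" "a \<in> C" "b \<in> C" using assms unfolding classes_iff by auto
  have "finv b ` H' = L" unfolding 1(2) image_image using C.W_inv_apply(2)[OF 1(4)] by simp
  then have "H = (a \<circ> finv b) ` H'" unfolding image_comp[symmetric] using 1(1) by simp
  then show ?thesis using C.comp_W[OF 1(3) C.inv_W[OF 1(4)]] by blast
qed

lemma class_image:
  assumes "K \<in> hclasses" "c \<in> C"
  shows "(`) c ` K = K"
proof
  show "(`) c ` K \<subseteq> K" using class_closed[OF assms] by blast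
  show "K \<subseteq> (`) c ` K"
  proof
    fix H assume H: "H \<in> K"
    have "H = c ` (finv c ` H)" unfolding image_image using C.W_inv_apply(1)[OF assms(2)] by simp
    then show "H \<in> (`) c ` K" using class_closed[OF assms(1) C.inv_W[OF assms(2)] H] by (rule image_eqI)
  qed
qed

lemma class_unique: "K \<in> hclasses \<Longrightarrow> K' \<in> hclasses \<Longrightarrow> H \<in> K \<Longrightarrow> H \<in> K' \<Longrightarrow> K = K'"
  using class_transitive class_closed by (metis subsetI subset_antisym)

abbreviation proj :: "(real \<Rightarrow> 'v set) set \<Rightarrow> 'v \<Rightarrow> 'v" where "proj \<equiv> braid_projection W x0"
abbreviation G :: "(real \<Rightarrow> 'v set) set monoid" where "G \<equiv> braid_preimage W x0 C"

lemma proj_hom: "proj \<in> hom B GL"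
proof (rule homI)
  fix a b assume "a \<in> carrier B" "b \<in> carrier B"
  then obtain v f w g where 1: "lift v f" "a = cls f" and 2: "lift w g" "b = cls g" unfolding carrier_B by blast
  show "proj (a \<otimes>\<^bsub>B\<^esub> b) = proj a \<otimes>\<^bsub>GL\<^esub> proj b"
    unfolding 1(2) 2(2) cls_mult[OF 1(1) 2(1)] using braid_projection_cls 1(1) 2(1) lift_join by auto
  show "proj a \<in> carrier GL"
    unfolding 1(2) braid_projection_cls[OF 1(1)] by (rule W_carrier[OF lift_pathD(3)[OF 1(1)]])
qed

sublocale proj: group_hom B GL proj
  using group_B group_GL proj_hom by (simp add: group_hom_def group_hom_axioms_def)

lemma carrier_G: "carrier G = {b \<in> carrier B. proj b \<in> C}"
  by (simp add: braid_preimage_def)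

lemma G_simps [simp]: "x \<otimes>\<^bsub>G\<^esub> y = x \<otimes>\<^bsub>B\<^esub> y" "\<one>\<^bsub>G\<^esub> = \<one>\<^bsub>B\<^esub>"
  by (simp_all add: braid_preimage_def)

lemma G_carrier_update: "B\<lparr>carrier := carrier G\<rparr> = G"
  by (simp add: braid_preimage_def)

lemma subgroup_G: "subgroup (carrier G) B"
  unfolding carrier_G
proof (rule B.subgroupI)
  show "{b \<in> carrier B. proj b \<in> C} \<noteq> {}" using proj.hom_one C.id_W by auto
  show "a \<otimes>\<^bsub>B\<^esub> b \<in> {b \<in> carrier B. proj b \<in> C}"
    if "a \<in> {b \<in> carrier B. proj b \<in> C}" "b \<in> {b \<in> carrier B. proj b \<in> C}" for a b
    using that C.comp_W by simp
  show "inv\<^bsub>B\<^esub> a \<in> {b \<in> carrier B. proj b \<in> C}" if "a \<in> {b \<in> carrier B. proj b \<in> C}" for a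
    using that C.inv_W inv_GL[OF C.W_carrier] by simp
qed auto

lemma group_G: "group G"
  using subgroup.subgroup_is_group[OF subgroup_G group_B] unfolding G_carrier_update .

lemma inv_G: "x \<in> carrier G \<Longrightarrow> inv\<^bsub>G\<^esub> x = inv\<^bsub>B\<^esub> x"
  using B.m_inv_consistent[OF subgroup_G] unfolding G_carrier_update by simp

lemma cls_G: "lift w g \<Longrightarrow> w \<in> C \<Longrightarrow> cls g \<in> carrier G"
  using cls_carrier braid_projection_cls by (simp add: carrier_G)

text \<open>The powers with exponent a_H of the generators of the monodromy around the hyperplanes
  of \<open>K\<close>, given directly as classes of paths; they are roots of full turns.\<close>

definition roots :: "'v set set \<Rightarrow> (real \<Rightarrow> 'v set) set set"
  where "roots K = {mcls H (idx H) g h d |H g h d. H \<in> K \<and> adm H h d \<and> tail (h + d) g}"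

lemma sr_idx_C: "H \<in> hyps \<Longrightarrow> sr H ^^ idx H \<in> C"
  using idx_props[of H] by (simp add: fixator_def)

lemma roots_G: "roots K \<subseteq> carrier G"
  using mcls_closed mcls_projection sr_idx_C admD(1) by (auto simp: roots_def carrier_G)

lemma roots_nonempty: "K \<in> hclasses \<Longrightarrow> roots K \<noteq> {}"
proof -
  assume K: "K \<in> hclasses"
  then obtain H where H: "H \<in> K" using class_nonempty by blast
  obtain h d where a: "adm H h d" using adm_exists classes_subset[OF K] H by blast
  obtain g where "tail (h + d) g" using tail_exists[OF a] by blast
  then show ?thesis using a H by (auto simp: roots_def)
qed

lemma monodromy_generators_eq:
  assumes "H \<in> hyps"
  shows "monodromy_generators herm W x0 H = {mcls H 1 g h d |g h d. adm H h d \<and> tail (h + d) g}"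
proof -
  have "(h \<in> H \<and> (\<forall>H'\<in>hyps. H' \<noteq> H \<longrightarrow> h \<notin> H') \<and> d \<noteq> 0 \<and> (\<forall>x\<in>H. herm x d = 0) \<and>
      (\<forall>z. cmod z \<le> 1 \<longrightarrow> (\<forall>H'\<in>hyps. H' \<noteq> H \<longrightarrow> h + z *\<^sub>C d \<notin> H')) \<and>
      path g \<and> path_image g \<subseteq> S \<and> pathstart g = x0 \<and> pathfinish g = h + d) =
    (adm H h d \<and> tail (h + d) g)" for g h d
    unfolding adm_def tail_def by (simp only: assms simp_thms conj_assoc)
  then show ?thesis unfolding monodromy_generators_def mcls_def mpath_1 cls_def by (simp only:)
qed

lemma roots_eq:
  assumes "K \<subseteq> hyps"
  shows "roots K = {s [^]\<^bsub>B\<^esub> idx H |H s. H \<in> K \<and> s \<in> monodromy_generators herm W x0 H}"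
proof (intro equalityI subsetI)
  fix x assume "x \<in> roots K"
  then obtain H g h d where 1: "x = mcls H (idx H) g h d" "H \<in> K" "adm H h d" "tail (h + d) g"
    unfolding roots_def by blast
  have "mcls H 1 g h d \<in> monodromy_generators herm W x0 H"
    unfolding monodromy_generators_eq[OF admD(1)[OF 1(3)]] using 1(3,4) by blast
  moreover have "x = mcls H 1 g h d [^]\<^bsub>B\<^esub> idx H" unfolding 1(1) by (rule mcls_pow[OF 1(3,4), symmetric])
  ultimately show "x \<in> {s [^]\<^bsub>B\<^esub> idx H |H s. H \<in> K \<and> s \<in> monodromy_generators herm W x0 H}"
    using 1(2) by blast
next
  fix x assume "x \<in> {s [^]\<^bsub>B\<^esub> idx H |H s. H \<in> K \<and> s \<in> monodromy_generators herm W x0 H}"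
  then obtain H s where 1: "x = s [^]\<^bsub>B\<^esub> idx H" "H \<in> K" "s \<in> monodromy_generators herm W x0 H" by blast
  have "H \<in> hyps" using 1(2) assms by blast
  from 1(3)[unfolded monodromy_generators_eq[OF this]]
  obtain g h d where 2: "s = mcls H 1 g h d" "adm H h d" "tail (h + d) g" by blast
  have "x = mcls H (idx H) g h d" unfolding 1(1) 2(1) by (rule mcls_pow[OF 2(2,3)])
  then show "x \<in> roots K" unfolding roots_def using 1(2) 2(2,3) by blast
qed

text \<open>An element \<open>c\<close> of \<open>C\<close> carries one hyperplane to the other, and
  any lift \<open>\<delta>\<close> of it conjugates accordingly, with the same index. The remaining
  difference of discs and tails is a conjugation by a pure element \<open>\<epsilon>\<close>. Both
  conjugating elements lie over \<open>C\<close>.\<close>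

lemma roots_conjugate:
  assumes K: "K \<in> hclasses" and x: "x \<in> roots K" and y: "y \<in> roots K"
  shows "\<exists>g\<in>carrier G. x = g \<otimes>\<^bsub>G\<^esub> y \<otimes>\<^bsub>G\<^esub> inv\<^bsub>G\<^esub> g"
proof -
  obtain H g h d where 1: "x = mcls H (idx H) g h d" "H \<in> K" "adm H h d" "tail (h + d) g"
    using x unfolding roots_def by blast
  obtain H' g' h' d' where 2: "y = mcls H' (idx H') g' h' d'" "H' \<in> K" "adm H' h' d'" "tail (h' + d') g'"
    using y unfolding roots_def by blast
  obtain c where c: "c \<in> C" "H = c ` H'" using class_transitive[OF K 1(2) 2(2)] by blast
  have cW: "c \<in> W" using c(1) C_subset by blast
  obtain \<delta> where "path \<delta>" "path_image \<delta> \<subseteq> S" "pathstart \<delta> = x0" "pathfinish \<delta> = c x0"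
    using S_path_connected[OF x0 W_regular[OF cW x0]] by blast
  then have \<delta>: "lift c \<delta>" using cW by (simp add: lift_def)
  have i: "idx H' = idx H" unfolding c(2) using idx_image[OF c(1) admD(1)[OF 2(3)]] by simp
  let ?g = "\<delta> +++ (c \<circ> g')"
  have a: "adm H (c h') (c d')" unfolding c(2) by (rule adm_W[OF 2(3) cW])
  have t: "tail (c h' + c d') ?g" using tail_W[OF \<delta> 2(4)] by (simp add: W_add[OF cW])
  have y': "cls \<delta> \<otimes>\<^bsub>B\<^esub> y \<otimes>\<^bsub>B\<^esub> inv\<^bsub>B\<^esub> (cls \<delta>) = mcls H (idx H) ?g (c h') (c d')"
    unfolding 2(1) i using mcls_conj[OF 2(3,4) \<delta>] c(2) by simp
  obtain \<epsilon> where \<epsilon>: "lift id \<epsilon>"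
    "x = cls \<epsilon> \<otimes>\<^bsub>B\<^esub> (cls \<delta> \<otimes>\<^bsub>B\<^esub> y \<otimes>\<^bsub>B\<^esub> inv\<^bsub>B\<^esub> (cls \<delta>)) \<otimes>\<^bsub>B\<^esub> inv\<^bsub>B\<^esub> (cls \<epsilon>)"
    using mcls_conjugate[OF 1(3,4) a t] unfolding y' 1(1) by blast
  have G: "cls \<epsilon> \<in> carrier G" "cls \<delta> \<in> carrier G" "y \<in> carrier G"
    using cls_G[OF \<epsilon>(1) C.id_W] cls_G[OF \<delta> c(1)] y roots_G by blast+
  then have B: "cls \<epsilon> \<in> carrier B" "cls \<delta> \<in> carrier B" "y \<in> carrier B" by (simp_all add: carrier_G)
  have m: "cls \<epsilon> \<otimes>\<^bsub>B\<^esub> cls \<delta> \<in> carrier G" by (rule subgroup.m_closed[OF subgroup_G G(1,2)])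
  have "x = (cls \<epsilon> \<otimes>\<^bsub>B\<^esub> cls \<delta>) \<otimes>\<^bsub>B\<^esub> y \<otimes>\<^bsub>B\<^esub> inv\<^bsub>B\<^esub> (cls \<epsilon> \<otimes>\<^bsub>B\<^esub> cls \<delta>)"
    unfolding \<epsilon>(2) using B by (simp add: B.m_assoc B.inv_mult_group)
  then show ?thesis using m by (intro bexI[OF _ m]) (simp add: inv_G[OF m])
qed

abbreviation R :: "(real \<Rightarrow> 'v set) set set" where "R \<equiv> roots hyps"

lemma mcls_idx_multiple:
  assumes a: "adm H h d" and g: "tail (h + d) g"
  shows "mcls H (idx H * n) g h d = mcls H (idx H) g h d [^]\<^bsub>B\<^esub> n"
  using B.nat_pow_pow[OF mcls_closed[OF a g, of 1], of "idx H" n] by (simp only: mcls_pow[OF a g])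

lemma R_generate_pow: "x \<in> generate B R \<Longrightarrow> x [^]\<^bsub>B\<^esub> (n::nat) \<in> generate B R"
  by (induction n) (auto intro: generate.one generate.eng)

lemma R_mcls: "adm H h d \<Longrightarrow> tail (h + d) g \<Longrightarrow> mcls H (idx H * n) g h d \<in> generate B R"
proof -
  assume a: "adm H h d" and g: "tail (h + d) g"
  have "mcls H (idx H) g h d \<in> R" using a g admD(1)[OF a] unfolding roots_def by blast
  then show ?thesis unfolding mcls_idx_multiple[OF a g] by (intro R_generate_pow generate.incl)
qed

lemma generate_R: "carrier G = generate B R"
proof
  show "generate B R \<subseteq> carrier G" by (rule B.generate_subgroup_incl[OF roots_G subgroup_G])
  have RB: "R \<subseteq> carrier B" using roots_G by (auto simp: carrier_G)
  have sub: "subgroup (generate B R) B" by (rule B.generate_is_subgroup[OF RB])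
  have "pure_generators \<subseteq> generate B R"
  proof
    fix x assume "x \<in> pure_generators"
    then obtain H g h d where 1: "x = mcls H (ord H) g h d" "adm H h d" "tail (h + d) g"
      unfolding pure_generators_def by blast
    have "ord H = idx H * card (fixator C H)" using idx_props[OF admD(1)[OF 1(2)]] by simp
    then show "x \<in> generate B R" unfolding 1(1) using R_mcls[OF 1(2,3)] by simp
  qed
  then have pure: "generate B pure_generators \<subseteq> generate B R" by (rule B.generate_subgroup_incl[OF _ sub])
  \<comment> \<open>A reflection of \<open>C\<close> with hyperplane \<open>H\<close> is a power of
    \<open>sr H ^^ idx H\<close>, which is the image of a root.\<close>
  have "{r \<in> C. \<exists>H. reflection_on r H} \<subseteq> proj ` generate B R"
  proof
    fix r assume "r \<in> {r \<in> C. \<exists>H. reflection_on r H}"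
    then obtain H where r: "r \<in> C" "reflection_on r H" by blast
    then have H: "H \<in> hyps" and rf: "r \<in> fixator C H"
      using C_subset by (auto simp: reflection_hyperplanes_def fixator_def reflection_on_def)
    obtain k where k: "r = (sr H ^^ idx H) ^^ k" using idx_props[OF H] rf by blast
    obtain h d where a: "adm H h d" using adm_exists[OF H] by blast
    obtain g where g: "tail (h + d) g" using tail_exists[OF a] by blast
    have "proj (mcls H (idx H * k) g h d) = r"
      unfolding k mcls_projection[OF a g] by (simp add: funpow_mult mult.commute)
    then show "r \<in> proj ` generate B R" using R_mcls[OF a g, of k] by blast
  qed
  then have CM: "C \<subseteq> proj ` generate B R"
    using group.generate_subgroup_incl[OF group_GL _ proj.subgroup_img_is_subgroup[OF sub]] C.refl_group
    unfolding reflection_group_def by blast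
  show "carrier G \<subseteq> generate B R"
  proof
    fix b assume b: "b \<in> carrier G"
    then have bB: "b \<in> carrier B" and bC: "proj b \<in> C" by (simp_all add: carrier_G)
    have "proj b \<in> proj ` generate B R" using CM bC by (rule subsetD)
    \<comment> \<open>\<open>m\<close> is generated by the roots and has the same image as
      \<open>b\<close>, so the quotient of the two is pure.\<close>
    then obtain m where m: "proj b = proj m" "m \<in> generate B R" by (rule imageE)
    have mB: "m \<in> carrier B" using m(2) subgroup.subset[OF sub] by blast
    have "proj (b \<otimes>\<^bsub>B\<^esub> inv\<^bsub>B\<^esub> m) = id"
      using bB mB m(1) group.r_inv[OF group_GL proj.hom_closed[OF bB]] by simp
    moreover obtain w g where g: "lift w g" "b \<otimes>\<^bsub>B\<^esub> inv\<^bsub>B\<^esub> m = cls g"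
      using B.m_closed[OF bB B.inv_closed[OF mB]] unfolding carrier_B by blast
    ultimately have "lift id g" using braid_projection_cls[OF g(1)] by simp
    then have "b \<otimes>\<^bsub>B\<^esub> inv\<^bsub>B\<^esub> m \<in> generate B R" using pure_subset pure g(2) by auto
    then have "b \<otimes>\<^bsub>B\<^esub> inv\<^bsub>B\<^esub> m \<otimes>\<^bsub>B\<^esub> m \<in> generate B R" using m(2) by (rule generate.eng)
    then show "b \<in> generate B R" using bB mB by (simp add: B.m_assoc)
  qed
qed

lemma R_classes: "(\<Union>K\<in>hclasses. roots K) = R"
proof
  show "(\<Union>K\<in>hclasses. roots K) \<subseteq> R"
    unfolding roots_def using classes_subset by blast
  show "R \<subseteq> (\<Union>K\<in>hclasses. roots K)"
  proof
    fix x assume "x \<in> R"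
    then obtain H g h d where 1: "x = mcls H (idx H) g h d" "H \<in> hyps" "adm H h d" "tail (h + d) g"
      unfolding roots_def by blast
    obtain K where "K \<in> hclasses" "H \<in> K" using class_exists[OF 1(2)] by blast
    then show "x \<in> (\<Union>K\<in>hclasses. roots K)" unfolding roots_def using 1 by blast
  qed
qed

lemma generate_roots: "carrier G = generate G (\<Union>K\<in>hclasses. roots K)"
  unfolding R_classes
  using B.generate_consistent[OF roots_G subgroup_G, of hyps] generate_R unfolding G_carrier_update by simp

text \<open>The quotient e_H / a_H, constant on the class: the power of a root that is a full
  turn.\<close>

definition mult_class :: "'v set set \<Rightarrow> nat"
  where "mult_class K = card (fixator C (SOME H. H \<in> K))"

lemma mult_class:
  assumes K: "K \<in> hclasses" and H: "H \<in> K"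
  shows "mult_class K = card (fixator C H)"
proof -
  have "(SOME H. H \<in> K) \<in> K" using H by (rule someI)
  from class_transitive[OF K this H] obtain c where "c \<in> C" "(SOME H. H \<in> K) = c ` H" by blast
  then show ?thesis unfolding mult_class_def by (simp add: C.card_fixator_image)
qed

lemma total_turn_hom:
  assumes K: "K \<in> hclasses" and a: "a \<in> carrier G" and b: "b \<in> carrier G"
  shows "total_turn K (a \<otimes>\<^bsub>B\<^esub> b) = total_turn K a + total_turn K b"
proof -
  obtain w g v f where 1: "lift w g" "a = cls g" "lift v f" "b = cls f"
    using a b by (auto simp: carrier_G carrier_B)
  have "w \<in> C" using a braid_projection_cls[OF 1(1)] by (simp add: carrier_G 1(2))
  then show ?thesis unfolding 1(2,4)
    by (intro total_turn_mult[OF 1(1,3) classes_subset[OF K]] class_image[OF K])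
qed

lemma total_turn_pow:
  assumes K: "K \<in> hclasses" and a: "a \<in> carrier G"
  shows "total_turn K (a [^]\<^bsub>B\<^esub> (n::nat)) = of_nat n * total_turn K a"
proof (induction n)
  case 0
  have 1: "\<one>\<^bsub>B\<^esub> \<in> carrier G" by (rule subgroup.one_closed[OF subgroup_G])
  show ?case using total_turn_hom[OF K 1 1] by simp
next
  case (Suc n)
  have "a [^]\<^bsub>B\<^esub> n \<in> carrier G"
    using monoid.nat_pow_closed[OF group.is_monoid[OF group_G] a, of n]
      by (simp add: braid_preimage_def nat_pow_def)
  from total_turn_hom[OF K this a] show ?case using Suc by (simp add: algebra_simps)
qed

text \<open>The power of \<open>x\<close> with exponent \<open>card (fixator C H)\<close> is a full
  turn around \<open>H\<close>, whose total turn is 1 or 0 according to whether \<open>H\<close>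
  lies in \<open>K\<close>; additivity allows division by the exponent.\<close>

lemma total_turn_roots:
  assumes K: "K \<in> hclasses" "K' \<in> hclasses" and x: "x \<in> roots K'"
  shows "of_nat (mult_class K) * total_turn K x = (if K = K' then 1 else 0)"
proof -
  obtain H g h d where 1: "x = mcls H (idx H) g h d" "H \<in> K'" "adm H h d" "tail (h + d) g"
    using x unfolding roots_def by blast
  let ?n = "card (fixator C H)"
  have "ord H = idx H * ?n" using idx_props[OF admD(1)[OF 1(3)]] by simp
  then have "x [^]\<^bsub>B\<^esub> ?n = mcls H (ord H) g h d"
    unfolding 1(1) using mcls_idx_multiple[OF 1(3,4), of ?n] by simp
  moreover have xG: "x \<in> carrier G" using x roots_G by blast
  ultimately have t: "of_nat ?n * total_turn K x = (if H \<in> K then 1 else 0)"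
    using total_turn_pow[OF K(1) xG, of ?n] total_turn_mcls[OF 1(3,4) classes_subset[OF K(1)]] by simp
  have n: "?n \<noteq> 0" using C.id_fixator C.finite_fixator by (metis card_eq_0_iff empty_iff)
  show ?thesis
  proof (cases "K = K'")
    case True
    then show ?thesis using t 1(2) mult_class[OF K(1)] by simp
  next
    case False
    then have "H \<notin> K" using class_unique[OF K _ 1(2)] by blast
    then show ?thesis using t n False by simp
  qed
qed

text \<open>The elements with integral value form a subgroup, and it contains the
  generators.\<close>

lemma total_turn_integer:
  assumes K: "K \<in> hclasses" and b: "b \<in> carrier G"
  shows "of_nat (mult_class K) * total_turn K b \<in> \<int>"
proof -
  have "subgroup {b \<in> carrier G. of_nat (mult_class K) * total_turn K b \<in> \<int>} G" (is "subgroup ?Z G")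
  proof (rule group.subgroupI[OF group_G])
    have 1: "\<one>\<^bsub>B\<^esub> \<in> carrier G" by (rule subgroup.one_closed[OF subgroup_G])
    have t1: "total_turn K \<one>\<^bsub>B\<^esub> = 0" using total_turn_hom[OF K 1 1] by simp
    then show "?Z \<noteq> {}" using 1 by force
    show "x \<otimes>\<^bsub>G\<^esub> y \<in> ?Z" if "x \<in> ?Z" "y \<in> ?Z" for x y
      using that total_turn_hom[OF K, of x y] subgroup.m_closed[OF subgroup_G, of x y]
        by (simp add: distrib_left)
    show "inv\<^bsub>G\<^esub> x \<in> ?Z" if x: "x \<in> ?Z" for x
    proof -
      have xG: "x \<in> carrier G" "inv\<^bsub>B\<^esub> x \<in> carrier G" using x subgroup.m_inv_closed[OF subgroup_G] by auto
      have "x \<in> carrier B" using xG by (simp add: carrier_G)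
      then have "total_turn K x + total_turn K (inv\<^bsub>B\<^esub> x) = 0" using total_turn_hom[OF K xG] t1 by simp
      then have "total_turn K (inv\<^bsub>B\<^esub> x) = - total_turn K x" by (rule minus_unique[symmetric])
      then show ?thesis using xG x by (simp add: inv_G)
    qed
  qed auto
  moreover have "(\<Union>K\<in>hclasses. roots K) \<subseteq> ?Z" using total_turn_roots[OF K] roots_G by auto
  ultimately have "generate G (\<Union>K\<in>hclasses. roots K) \<subseteq> ?Z" by (intro group.generate_subgroup_incl[OF group_G])
  then show ?thesis using b generate_roots by blast
qed

text \<open>The value is already an integer on \<open>carrier G\<close>; real part and floor only
  change its type.\<close>

definition deg :: "'v set set \<Rightarrow> (real \<Rightarrow> 'v set) set \<Rightarrow> int"
  where "deg K b = \<lfloor>Re (of_nat (mult_class K) * total_turn K b)\<rfloor>"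

lemma of_int_deg:
  assumes "K \<in> hclasses" "b \<in> carrier G"
  shows "of_int (deg K b) = of_nat (mult_class K) * total_turn K b"
  using total_turn_integer[OF assms] unfolding deg_def by (elim Ints_cases) simp

lemma deg_hom: "K \<in> hclasses \<Longrightarrow> deg K \<in> hom G integer_group"
proof (rule homI)
  fix a b assume K: "K \<in> hclasses" and ab: "a \<in> carrier G" "b \<in> carrier G"
  have "complex_of_int (deg K (a \<otimes>\<^bsub>B\<^esub> b)) = of_int (deg K a + deg K b)"
    using of_int_deg[OF K] ab subgroup.m_closed[OF subgroup_G ab] total_turn_hom[OF K ab]
    by (simp add: distrib_left)
  then show "deg K (a \<otimes>\<^bsub>G\<^esub> b) = deg K a \<otimes>\<^bsub>integer_group\<^esub> deg K b" by (simp only: of_int_eq_iff) simp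
qed simp

lemma deg_roots:
  assumes "K \<in> hclasses" "K' \<in> hclasses" "x \<in> roots K'"
  shows "deg K x = (if K = K' then 1 else 0)"
proof -
  have "x \<in> carrier G" using assms(3) roots_G by blast
  then have "complex_of_int (deg K x) = of_int (if K = K' then 1 else 0)"
    using of_int_deg[OF assms(1)] total_turn_roots[OF assms] by simp
  then show ?thesis by (simp only: of_int_eq_iff)
qed

lemma classes_eq: "K \<in> hclasses \<Longrightarrow> monodromy_power_classes herm W x0 C K = ab_class G ` roots K"
  unfolding roots_eq[OF classes_subset] monodromy_power_classes_def by blast

end

theorem proposition10:
  fixes W C :: "('v::complex_fd_space \<Rightarrow> 'v) set"
    and herm :: "'v \<Rightarrow> 'v \<Rightarrow> complex"
    and x0 :: 'v
  assumes "reflection_group W"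
    and "C \<subseteq> W" and "reflection_group C"
    and "hermitian_product herm" and "invariant_form W herm"
    and "x0 \<in> regular_part W"
  shows
    "(\<exists>f \<in> iso (abelianization (braid_preimage W x0 C))
               (free_Abelian_group (hyperplane_classes W C)).
        \<forall>K \<in> hyperplane_classes W C. f (common_class herm W x0 C K) = frag_of K) \<and>
     carrier (braid_preimage W x0 C) =
       generate (braid_group W x0)
         {s [^]\<^bsub>braid_group W x0\<^esub> fixator_index W C H |H s.
            H \<in> reflection_hyperplanes W \<and> s \<in> monodromy_generators herm W x0 H} \<and>
     (\<forall>K \<in> hyperplane_classes W C.
        monodromy_power_classes herm W x0 C K = {common_class herm W x0 C K}) \<and>
     carrier (abelianization (braid_preimage W x0 C)) =
       generate (abelianization (braid_preimage W x0 C))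
         (common_class herm W x0 C ` hyperplane_classes W C) \<and>
     (\<forall>K \<in> hyperplane_classes W C.
        \<exists>\<phi> \<in> hom (braid_preimage W x0 C) integer_group.
        \<exists>\<psi> \<in> hom (abelianization (braid_preimage W x0 C)) integer_group.
          (\<forall>b \<in> carrier (braid_preimage W x0 C).
             \<psi> (ab_class (braid_preimage W x0 C) b) = \<phi> b) \<and>
          \<psi> (common_class herm W x0 C K) = 1 \<and>
          (\<forall>K' \<in> hyperplane_classes W C. K' \<noteq> K \<longrightarrow> \<psi> (common_class herm W x0 C K') = 0))"
proof -
  interpret braid_subgroup herm W C x0
    using assms by unfold_locales (auto simp: invariant_form_def)
  have "\<exists>v f. (\<forall>K\<in>hclasses. ab_class G ` roots K = {v K}) \<and>
    f \<in> iso (abelianization G) (free_Abelian_group hclasses) \<and> (\<forall>K\<in>hclasses. f (v K) = frag_of K) \<and>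
    carrier (abelianization G) = generate (abelianization G) (v ` hclasses) \<and>
    (\<forall>K\<in>hclasses. \<exists>\<psi>\<in>hom (abelianization G) integer_group.
      (\<forall>b\<in>carrier G. \<psi> (ab_class G b) = deg K b) \<and> (\<forall>K'\<in>hclasses. \<psi> (v K') = (if K = K' then 1 else 0)))"
    by (rule free_abelianization[OF group_G generate_roots roots_G roots_nonempty roots_conjugate deg_hom deg_roots])
  then obtain v f where v: "\<forall>K\<in>hclasses. ab_class G ` roots K = {v K}"
    and f: "f \<in> iso (abelianization G) (free_Abelian_group hclasses)" "\<forall>K\<in>hclasses. f (v K) = frag_of K"
    and gen: "carrier (abelianization G) = generate (abelianization G) (v ` hclasses)"
    and \<psi>: "\<forall>K\<in>hclasses. \<exists>\<psi>\<in>hom (abelianization G) integer_group.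
      (\<forall>b\<in>carrier G. \<psi> (ab_class G b) = deg K b) \<and> (\<forall>K'\<in>hclasses. \<psi> (v K') = (if K = K' then 1 else 0))"
    by (elim exE conjE) (rule that)
  \<comment> \<open>Once the set of classes is known to be the singleton of \<open>v K\<close>, the
    description in \<open>common_class\<close> selects \<open>v K\<close>.\<close>
  have cc: "monodromy_power_classes herm W x0 C K = {v K}" "common_class herm W x0 C K = v K" if "K \<in> hclasses" for K
  proof -
    show "monodromy_power_classes herm W x0 C K = {v K}" unfolding classes_eq[OF that] using v that by blast
    then show "common_class herm W x0 C K = v K" unfolding common_class_def by simp
  qed
  show ?thesis
  proof (intro conjI ballI)
    show "\<exists>f\<in>iso (abelianization G) (free_Abelian_group hclasses). \<forall>K\<in>hclasses. f (common_class herm W x0 C K) = frag_of K"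
      using f cc(2) by (intro bexI[of _ f]) simp_all
    show "carrier G = generate B {s [^]\<^bsub>B\<^esub> idx H |H s. H \<in> hyps \<and> s \<in> monodromy_generators herm W x0 H}"
      unfolding roots_eq[OF subset_refl, symmetric] by (rule generate_R)
    show "monodromy_power_classes herm W x0 C K = {common_class herm W x0 C K}" if "K \<in> hclasses" for K
      using cc[OF that] by simp
    have "common_class herm W x0 C ` hclasses = v ` hclasses" using cc(2) by (rule image_cong[OF refl])
    then show "carrier (abelianization G) = generate (abelianization G) (common_class herm W x0 C ` hclasses)"
      using gen by simp
    fix K assume K: "K \<in> hclasses"
    obtain p where p: "p \<in> hom (abelianization G) integer_group" "\<forall>b\<in>carrier G. p (ab_class G b) = deg K b"
      "\<forall>K'\<in>hclasses. p (v K') = (if K = K' then 1 else 0)" using bspec[OF \<psi> K] by blast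
    show "\<exists>\<phi>\<in>hom G integer_group. \<exists>\<psi>\<in>hom (abelianization G) integer_group.
      (\<forall>b\<in>carrier G. \<psi> (ab_class G b) = \<phi> b) \<and> \<psi> (common_class herm W x0 C K) = 1 \<and>
      (\<forall>K'\<in>hclasses. K' \<noteq> K \<longrightarrow> \<psi> (common_class herm W x0 C K') = 0)"
    proof (rule bexI[OF _ deg_hom[OF K]], rule bexI[OF _ p(1)], intro conjI ballI impI)
      show "p (ab_class G b) = deg K b" if "b \<in> carrier G" for b using p(2) that by blast
      show "p (common_class herm W x0 C K) = 1" using p(3) K cc(2)[OF K] by simp
      show "p (common_class herm W x0 C K') = 0" if "K' \<in> hclasses" "K' \<noteq> K" for K'
        using p(3) that cc(2)[OF that(1)] by simp
    qed
  qed
qed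

end
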